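(* Let $(\eta)=\{\eta_n\}_{n=0}^\infty$ be a sequence of complex numbers. (i) If $\alpha>-1$, $1\le p<\infty$, and $F_{(\eta)}\in\Lambda^p_{1/p}$, then $\mathcal R_{(\eta)}\in\mathcal B(A^p_\alpha)$. (ii) If $\alpha>-1$, $1<p<\infty$, and $F_{(\eta)}\in\lambda^p_{1/p}$, then $\mathcal R_{(\eta)}\in\mathcal K(A^p_\alpha)$. (iii) If $1<p<\infty$, $-1<\alpha<2p-2$, and $\mathcal R_{(\eta)}\in\mathcal B(A^p_\alpha)$, then $$M_p(r,F_{(\eta)}')=O\left(\frac{\log\frac{1}{1-r}}{(1-r)^{1-\frac1p}}\right),\quad\text{as } r\to 1.$$ (iv) If $1<p<\infty$, $-1<\alpha<2p-2$, and $\mathcal R_{(\eta)}\in\mathcal K(A^p_\alpha)$, then $$M_p(r,F_{(\eta)}')=o\left(\frac{\log\frac{1}{1-r}}{(1-r)^{1-\frac1p}}\right),\quad\text{as } r\to 1.$$ (v) If $\alpha>-1$, then $\mathcal R_{(\eta)}\in\mathcal B(A^2_\alpha)$ if and only if $F_{(\eta)}\in\Lambda^2_{1/2}$. (vi) If $\alpha>-1$, then $\mathcal R_{(\eta)}\in\mathcal K(A^2_\alpha)$ if and only if $F_{(\eta)}\in\lambda^2_{1/2}$.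
   Context: $\mathbb D$ is the open unit disc in $\mathbb C$, and $\mathrm{Hol}(\mathbb D)$ is the space of analytic functions in $\mathbb D$. For $f\in \mathrm{Hol}(\mathbb D)$, $0<r<1$, $0<p<\infty$, $M_p(r,f)=\left(\frac1{2\pi}\int_0^{2\pi}|f(re^{it})|^p\,dt\right)^{1/p}$. The Hardy space $H^p$ consists of those $f\in\mathrm{Hol}(\mathbb D)$ with $\|f\|_{H^p}=\sup_{0<r<1}M_p(r,f)<\infty$. Bergman spaces: $dA=\frac1\pi\,dx\,dy$ is normalized area measure on $\mathbb D$; for $0<p<\infty$, $\alpha>-1$, $dA_\alpha(z)=(\alpha+1)(1-|z|^2)^\alpha dA(z)$, and $A^p_\alpha$ is the space of $f\in\mathrm{Hol}(\mathbb D)$ with $\|f\|_{A^p_\alpha}=\left(\int_{\mathbb D}|f|^p\,dA_\alpha\right)^{1/p}<\infty$. Rhaly operator: for a complex sequence $(\eta)=\{\eta_n\}_{n=0}^\infty$ and $f(z)=\sum_{n=0}^\infty a_nz^n\in\mathrm{Hol}(\mathbb D)$, formally $\mathcal R_{(\eta)}(f)(z)=\sum_{n=0}^\infty\eta_n\left(\sum_{k=0}^na_k\right)z^n$, whenever the right-hand side defines an analytic function in $\mathbb D$. If the power series $\sum\eta_nz^n$ defines an analytic function in $\mathbb D$, set $F_{(\eta)}(z)=\sum_{n=0}^\infty\eta_nz^n$. (On a subspace of $\mathrm{Hol}(\mathbb D)$ containing the constants, $\mathcal R_{(\eta)}$ is well defined into $\mathrm{Hol}(\mathbb D)$ if and only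 if this power series defines an analytic function in $\mathbb D$; a hypothesis such as $F_{(\eta)}\in X$ includes that it does.) For a Banach space $X$, $\mathcal B(X)$ (resp. $\mathcal K(X)$) denotes the continuous (resp. compact) linear operators from $X$ into $X$; $\mathcal R_{(\eta)}\in\mathcal B(X)$ (resp. $\mathcal K(X)$) means that $\mathcal R_{(\eta)}$ is well defined on $X$, maps $X$ into $X$, and is bounded (resp. compact). Mean Lipschitz spaces: for $1\le p<\infty$ and $f$ with boundary values $f(e^{i\theta})$ a.e., $\omega_p(\delta,f)=\sup_{0<|t|\le\delta}\left(\frac1{2\pi}\int_{-\pi}^{\pi}|f(e^{i(\theta+t)})-f(e^{i\theta})|^p\,d\theta\right)^{1/p}$. For $0<\alpha\le1$, $\Lambda^p_\alpha$ (resp. $\lambda^p_\alpha$) is the space of $f\in H^p$ with $\omega_p(\delta,f)=O(\delta^\alpha)$ (resp. $o(\delta^\alpha)$) as $\delta\to0$; equivalently, $f\in\mathrm{Hol}(\mathbb D)$ with $M_p(r,f')=O((1-r)^{\alpha-1})$ (resp. $o((1-r)^{\alpha-1})$) as $r\to1$. *)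

theory Defs
  imports "HOL-Complex_Analysis.Complex_Analysis" "HOL-Library.Landau_Symbols"
begin

text \<open>
  A function on the open unit disc is represented by a total function on the complex numbers;
  nothing below depends on its values outside the disc.
\<close>

abbreviation unit_disc :: "complex set" where
  "unit_disc \<equiv> ball 0 1"

definition integral_mean :: "real \<Rightarrow> real \<Rightarrow> (complex \<Rightarrow> complex) \<Rightarrow> real" where
  "integral_mean p r f =
     (1 / (2 * pi) * (LINT t:{0..2 * pi}|lebesgue. norm (f (of_real r * cis t)) powr p)) powr (1 / p)"

definition Hardy :: "real \<Rightarrow> (complex \<Rightarrow> complex) set" where
  "Hardy p = {f. f holomorphic_on unit_disc \<and> bdd_above ((\<lambda>r. integral_mean p r f) ` {0<..<1})}"

subsection \<open>Mean Lipschitz spaces\<close>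

text \<open>Boundary values are radial limits.\<close>

definition has_radial_limit :: "(complex \<Rightarrow> complex) \<Rightarrow> complex \<Rightarrow> bool" where
  "has_radial_limit f w \<longleftrightarrow> (\<exists>l. ((\<lambda>r. f (of_real r * w)) \<longlongrightarrow> l) (at_left (1::real)))"

definition boundary_value :: "(complex \<Rightarrow> complex) \<Rightarrow> complex \<Rightarrow> complex" where
  "boundary_value f w = Lim (at_left (1::real)) (\<lambda>r. f (of_real r * w))"

text \<open>
  The supremum and the integrals in the next definition are only meaningful when the boundary
  function is in \<open>L\<^sup>p\<close>; they are used below for functions in the Hardy space \<open>H\<^sup>p\<close> only.
\<close>

definition mean_modulus :: "real \<Rightarrow> real \<Rightarrow> (complex \<Rightarrow> complex) \<Rightarrow> real" where
  "mean_modulus p \<delta> f =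
     (SUP t\<in>{t. 0 < \<bar>t\<bar> \<and> \<bar>t\<bar> \<le> \<delta>}.
        (1 / (2 * pi) * (LINT \<theta>:{-pi..pi}|lebesgue.
           norm (boundary_value f (cis (\<theta> + t)) - boundary_value f (cis \<theta>)) powr p)) powr (1 / p))"

text \<open>
  By Fatou's theorem the almost-everywhere clause is automatic for functions in \<open>H\<^sup>p\<close>; it makes
  explicit that \<^const>\<open>boundary_value\<close> is a genuine limit.
\<close>

definition mean_Lipschitz :: "real \<Rightarrow> real \<Rightarrow> (complex \<Rightarrow> complex) set" where
  "mean_Lipschitz p \<alpha> =
     {f \<in> Hardy p. (AE \<theta> in lebesgue. has_radial_limit f (cis \<theta>)) \<and>
        (\<lambda>\<delta>. mean_modulus p \<delta> f) \<in> O[at_right 0](\<lambda>\<delta>. \<delta> powr \<alpha>)}"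

definition little_mean_Lipschitz :: "real \<Rightarrow> real \<Rightarrow> (complex \<Rightarrow> complex) set" where
  "little_mean_Lipschitz p \<alpha> =
     {f \<in> Hardy p. (AE \<theta> in lebesgue. has_radial_limit f (cis \<theta>)) \<and>
        (\<lambda>\<delta>. mean_modulus p \<delta> f) \<in> o[at_right 0](\<lambda>\<delta>. \<delta> powr \<alpha>)}"

subsection \<open>Weighted Bergman spaces\<close>

text \<open>The factor \<open>1 / pi\<close> normalizes the area of the disc.\<close>

definition area_measure :: "real \<Rightarrow> complex measure" where
  "area_measure \<alpha> =
     density (lebesgue_on unit_disc) (\<lambda>z. ennreal ((\<alpha> + 1) / pi * (1 - (norm z)\<^sup>2) powr \<alpha>))"

definition Bergman :: "real \<Rightarrow> real \<Rightarrow> (complex \<Rightarrow> complex) set" where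
  "Bergman p \<alpha> =
     {f. f holomorphic_on unit_disc \<and> integrable (area_measure \<alpha>) (\<lambda>z. norm (f z) powr p)}"

definition Bergman_norm :: "real \<Rightarrow> real \<Rightarrow> (complex \<Rightarrow> complex) \<Rightarrow> real" where
  "Bergman_norm p \<alpha> f = (LINT z|area_measure \<alpha>. norm (f z) powr p) powr (1 / p)"

subsection \<open>Bounded and compact operators on a space of functions on the disc\<close>

text \<open>Functions are identified when they agree on the disc, so linearity is required there only.\<close>

definition linear_operator_on ::
    "(complex \<Rightarrow> complex) set \<Rightarrow> ((complex \<Rightarrow> complex) \<Rightarrow> complex \<Rightarrow> complex) \<Rightarrow> bool" where
  "linear_operator_on X T \<longleftrightarrow>
     (\<forall>f\<in>X. T f \<in> X) \<and>
     (\<forall>f\<in>X. \<forall>g\<in>X. \<forall>a b. \<forall>z\<in>unit_disc. T (\<lambda>w. a * f w + b * g w) z = a * T f z + b * T g z)"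

definition bounded_operator_on ::
    "(complex \<Rightarrow> complex) set \<Rightarrow> ((complex \<Rightarrow> complex) \<Rightarrow> real) \<Rightarrow>
     ((complex \<Rightarrow> complex) \<Rightarrow> complex \<Rightarrow> complex) \<Rightarrow> bool" where
  "bounded_operator_on X N T \<longleftrightarrow>
     linear_operator_on X T \<and> (\<exists>C. \<forall>f\<in>X. N (T f) \<le> C * N f)"

definition compact_operator_on ::
    "(complex \<Rightarrow> complex) set \<Rightarrow> ((complex \<Rightarrow> complex) \<Rightarrow> real) \<Rightarrow>
     ((complex \<Rightarrow> complex) \<Rightarrow> complex \<Rightarrow> complex) \<Rightarrow> bool" where
  "compact_operator_on X N T \<longleftrightarrow>
     linear_operator_on X T \<and>
     (\<forall>f :: nat \<Rightarrow> complex \<Rightarrow> complex. (\<forall>n. f n \<in> X) \<and> bdd_above (range (\<lambda>n. N (f n))) \<longrightarrow>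
        (\<exists>s g. strict_mono s \<and> g \<in> X \<and> (\<lambda>n. N (\<lambda>z. T (f (s n)) z - g z)) \<longlonglongrightarrow> 0))"

subsection \<open>Rhaly operators\<close>

definition Rhaly_fps :: "(nat \<Rightarrow> complex) \<Rightarrow> (complex \<Rightarrow> complex) \<Rightarrow> complex fps" where
  "Rhaly_fps \<eta> f = Abs_fps (\<lambda>n. \<eta> n * (\<Sum>k\<le>n. fps_nth (fps_expansion f 0) k))"

definition Rhaly :: "(nat \<Rightarrow> complex) \<Rightarrow> (complex \<Rightarrow> complex) \<Rightarrow> complex \<Rightarrow> complex" where
  "Rhaly \<eta> f = eval_fps (Rhaly_fps \<eta> f)"

definition Rhaly_well_defined_on :: "(nat \<Rightarrow> complex) \<Rightarrow> (complex \<Rightarrow> complex) set \<Rightarrow> bool" where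
  "Rhaly_well_defined_on \<eta> X \<longleftrightarrow> (\<forall>f\<in>X. fps_conv_radius (Rhaly_fps \<eta> f) \<ge> 1)"

definition Rhaly_bounded_Bergman :: "(nat \<Rightarrow> complex) \<Rightarrow> real \<Rightarrow> real \<Rightarrow> bool" where
  "Rhaly_bounded_Bergman \<eta> p \<alpha> \<longleftrightarrow>
     Rhaly_well_defined_on \<eta> (Bergman p \<alpha>) \<and>
     bounded_operator_on (Bergman p \<alpha>) (Bergman_norm p \<alpha>) (Rhaly \<eta>)"

definition Rhaly_compact_Bergman :: "(nat \<Rightarrow> complex) \<Rightarrow> real \<Rightarrow> real \<Rightarrow> bool" where
  "Rhaly_compact_Bergman \<eta> p \<alpha> \<longleftrightarrow>
     Rhaly_well_defined_on \<eta> (Bergman p \<alpha>) \<and>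
     compact_operator_on (Bergman p \<alpha>) (Bergman_norm p \<alpha>) (Rhaly \<eta>)"

definition symbol_fun :: "(nat \<Rightarrow> complex) \<Rightarrow> complex \<Rightarrow> complex" where
  "symbol_fun \<eta> = eval_fps (Abs_fps \<eta>)"

text \<open>Convergence is required because \<^const>\<open>symbol_fun\<close> is a total function even when the power series diverges.\<close>

definition symbol_in :: "(nat \<Rightarrow> complex) \<Rightarrow> (complex \<Rightarrow> complex) set \<Rightarrow> bool" where
  "symbol_in \<eta> X \<longleftrightarrow> fps_conv_radius (Abs_fps \<eta>) \<ge> 1 \<and> symbol_fun \<eta> \<in> X"

end

theory Submission
  imports Defs
begin

text \<open>
  Since \<open>\<R>(f)\<close> is the Hadamard product of \<open>F\<close> and \<open>f(z) / (1 - z)\<close>, the function \<open>(z \<R>(f))'\<close> is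
  the convolution of \<open>(z F)'\<close> and \<open>f(z) / (1 - z)\<close> on circles. By Young's and Hoelder's inequalities,
  \<open>M\<^sub>p(r, (zF)') = O((1 - r)\<^bsup>1/p-1\<^esup>)\<close> makes the operator bounded, and the little-\<open>o\<close> condition makes it compact.
  The boundary modulus of continuity controls this growth, because \<open>|G|\<^bsup>1/2\<^esup>\<close> is dominated by
  the Poisson integral of its boundary values. Conversely, the operator maps the test function
  \<open>(1 - z) / (1 - a z)\<^bsup>j+1\<^esup>\<close> to the \<open>j\<close>-th derivative of \<open>z\<^sup>j F / j!\<close> at \<open>a z\<close>. For large \<open>j\<close> the norm of the
  test function is a power of \<open>1 - a\<close>, and integrating the resulting estimate down to \<open>F'\<close> loses no logarithm.
\<close>

text \<open>Three obstacles shape the proof. The Lipschitz conditions speak of boundary values,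
  while all estimates live on circles inside the disc, and the passage must include p = 1, where
  bounded means alone do not control boundary values. Dividing out zeros leaves a holomorphic square
  root, and Jensen with exponent 2p > 1 supplies the missing uniform integrability. Next, big-O and
  little-o are treated at once through bounds \<epsilon> (1 - r)^(-\<beta>) + K: the factor that
  multiplies \<epsilon> is always independent of \<epsilon>, and K may change freely. Finally, the
  kernel that recovers zF' from differences of F has, for p = 1, logarithmically growing mass, so
  that case uses difference quotients instead. In the converse the descent from order j to order 1
  meets only exponents above 1, which is why each integration trades one derivative for one power of
  1 - r. Integrals are taken in [0, infinity] (\<open>mean_pow\<close>, \<open>bergman_int\<close>,
  \<open>modulus_int\<close>), so that Tonelli and Fatou apply without integrability; the
  real-valued definitions enter only through a few translation lemmas.\<close>

section \<open>Integral inequalities\<close>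

text \<open>The convex function v^p lies above its tangent at each c > 0; integrating the tangent
  bound against w and optimising over c gives Jensen for a weight of mass at most A. Everything is
  in [0, infinity], and only an upper bound for the mass enters.\<close>

lemma nn_integral_weighted_Jensen:
  fixes u w :: "'a \<Rightarrow> real"
  assumes [measurable]: "u \<in> borel_measurable M" "w \<in> borel_measurable M"
    and u: "\<And>x. u x \<ge> 0" and w: "\<And>x. w x \<ge> 0" and p: "p \<ge> 1" and A: "A > 0" and h: "h \<ge> 0"
    and wA: "(\<integral>\<^sup>+x. ennreal (w x) \<partial>M) \<le> ennreal A"
    and hle: "ennreal h \<le> (\<integral>\<^sup>+x. ennreal (u x * w x) \<partial>M)"
  shows "ennreal (h powr p) \<le> ennreal (A powr (p - 1)) * (\<integral>\<^sup>+x. ennreal (u x powr p * w x) \<partial>M)"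
proof (cases "(\<integral>\<^sup>+x. ennreal (u x powr p * w x) \<partial>M) = \<infinity>")
  case True
  then show ?thesis using A by (simp add: ennreal_mult_top)
next
  case False
  then obtain b where b: "b \<ge> 0" "(\<integral>\<^sup>+x. ennreal (u x powr p * w x) \<partial>M) = ennreal b"
    by (metis ennreal_cases infinity_ennreal_def)
  \<comment> \<open>Young's inequality with exponents 1/p and 1 - 1/p; equality holds at v =
    c.\<close>
  have tangent: "v \<le> (1/p) * c powr (1-p) * v powr p + (1 - 1/p) * c" if "c > 0" "v \<ge> 0" for v c :: real
  proof (cases "v = 0")
    case True
    then show ?thesis using that p by simp
  next
    case False
    then have "v > 0" using that by simp
    have "(c powr (1-p) * v powr p) powr (1/p) * c powr (1 - 1/p)
        \<le> (1/p) * (c powr (1-p) * v powr p) + (1-1/p) * c"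
      using that p \<open>v > 0\<close> by (intro Youngs_inequality_0) auto
    moreover have "(c powr (1-p) * v powr p) powr (1/p) * c powr (1 - 1/p) = v"
    proof -
      have "(c powr (1-p) * v powr p) powr (1/p) = c powr ((1-p)/p) * v"
        using \<open>v > 0\<close> that p by (simp add: powr_mult powr_powr)
      moreover have "c powr ((1-p)/p) * c powr (1 - 1/p) = 1"
        using that p by (simp add: powr_add [symmetric] diff_divide_distrib)
      ultimately show ?thesis by (simp add: mult.commute mult.left_commute)
    qed
    ultimately show ?thesis by (simp add: mult.assoc)
  qed
  have key: "h \<le> (1/p) * c powr (1-p) * b + (1 - 1/p) * c * A" if c: "c > 0" for c
  proof -
    have "ennreal h \<le> (\<integral>\<^sup>+x. ennreal ((1/p) * c powr (1-p)) * ennreal (u x powr p * w x)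
            + ennreal ((1 - 1/p) * c) * ennreal (w x) \<partial>M)"
    proof (rule order.trans[OF hle], rule nn_integral_mono)
      fix x
      have "u x * w x \<le> ((1/p) * c powr (1-p) * u x powr p + (1 - 1/p) * c) * w x"
        by (rule mult_right_mono[OF tangent[OF c u] w])
      then have "u x * w x \<le> (1/p) * c powr (1-p) * (u x powr p * w x) + (1 - 1/p) * c * w x"
        by (simp only: distrib_right mult.assoc)
      then have "ennreal (u x * w x) \<le> ennreal ((1/p) * c powr (1-p) * (u x powr p * w x) + (1 - 1/p) * c * w x)"
        by (rule ennreal_leI)
      also have "\<dots> = ennreal ((1/p) * c powr (1-p)) * ennreal (u x powr p * w x)
            + ennreal ((1 - 1/p) * c) * ennreal (w x)"
        using p c u[of x] w[of x] by (subst ennreal_plus) (simp_all add: ennreal_mult[symmetric] mult.assoc)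
      finally show "ennreal (u x * w x) \<le> ennreal ((1/p) * c powr (1-p)) * ennreal (u x powr p * w x)
            + ennreal ((1 - 1/p) * c) * ennreal (w x)" .
    qed
    also have "\<dots> = ennreal ((1/p) * c powr (1-p)) * ennreal b
        + ennreal ((1 - 1/p) * c) * (\<integral>\<^sup>+x. ennreal (w x) \<partial>M)"
      by (simp add: nn_integral_add nn_integral_cmult b)
    also have "\<dots> \<le> ennreal ((1/p) * c powr (1-p)) * ennreal b + ennreal ((1 - 1/p) * c) * ennreal A"
      by (intro add_left_mono mult_left_mono wA) auto
    also have "\<dots> = ennreal ((1/p) * c powr (1-p) * b + (1 - 1/p) * c * A)"
      using p c b A by (simp add: ennreal_mult [symmetric] ennreal_plus [symmetric] del: ennreal_plus)
    finally show ?thesis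
      using p c b A by (subst (asm) ennreal_le_iff) auto
  qed
  have "h powr p \<le> A powr (p-1) * b"
  proof (cases "b = 0")
    case True
    \<comment> \<open>The optimal c would be 0 here, so c = e/A with arbitrarily small e replaces
      it.\<close>
    have "h \<le> 0"
    proof (rule field_le_epsilon)
      fix e :: real assume "e > 0"
      have "h \<le> (1 - 1/p) * (e / A) * A"
        using key[of "e/A"] True A \<open>e > 0\<close> by simp
      also have "\<dots> \<le> 0 + e"
        using p A \<open>e > 0\<close> by (simp add: field_simps)
      finally show "h \<le> 0 + e" .
    qed
    with h True show ?thesis by simp
  next
    case False
    then have "b > 0" using b by simp
    \<comment> \<open>The minimiser of the bound \<open>key\<close>: with c^p = b/A both terms
      become multiples of c * A.\<close>
    define c where "c = (b/A) powr (1/p)"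
    have c: "c > 0" using \<open>b > 0\<close> A by (simp add: c_def)
    have cp: "c powr p = b / A" using \<open>b > 0\<close> A p by (simp add: c_def powr_powr)
    have "c powr (1-p) * b = c * A"
      using c cp A \<open>b > 0\<close> by (simp add: powr_diff)
    then have "h \<le> (1/p) * (c * A) + (1-1/p) * (c * A)"
      using key[OF c] by (simp add: mult.assoc)
    then have "h \<le> c * A" using p by (simp add: field_simps)
    then have "h powr p \<le> (c * A) powr p" using h p by (intro powr_mono2) auto
    also have "\<dots> = b / A * A powr p" using c A by (simp add: powr_mult cp)
    also have "\<dots> = A powr (p-1) * b" using A by (simp add: powr_diff)
    finally show ?thesis .
  qed
  then show ?thesis using b by (simp add: ennreal_mult [symmetric])
qed

text \<open>The quotient \<open>\<phi> x y / m y\<close> has p-norm at most 1 in x for each y, so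
  Jensen with weight m followed by an exchange of the integrals finishes the proof. A majorant m
  instead of the exact p-norm lets the caller choose an explicit measurable function;
  \<open>\<phi>0\<close> makes the division by m harmless.\<close>

theorem Minkowski_integral_inequality:
  fixes \<phi> :: "'a \<Rightarrow> 'b \<Rightarrow> real"
  assumes "sigma_finite_measure M" "sigma_finite_measure N"
    and meas[measurable]: "(\<lambda>(x,y). \<phi> x y) \<in> borel_measurable (M \<Otimes>\<^sub>M N)"
    and [measurable]: "m \<in> borel_measurable N"
    and \<phi>: "\<And>x y. \<phi> x y \<ge> 0" and m: "\<And>y. m y \<ge> 0" and p: "p \<ge> 1"
    and \<phi>0: "\<And>x y. m y = 0 \<Longrightarrow> \<phi> x y = 0"
    and mI: "(\<integral>\<^sup>+y. ennreal (m y) \<partial>N) \<le> ennreal I" and I: "I \<ge> 0"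
    and bound: "\<And>y. (\<integral>\<^sup>+x. ennreal (\<phi> x y powr p) \<partial>M) \<le> ennreal (m y powr p)"
    and h: "\<And>x. h x \<ge> 0"
    and hle: "AE x in M. ennreal (h x) \<le> (\<integral>\<^sup>+y. ennreal (\<phi> x y) \<partial>N)"
  shows "(\<integral>\<^sup>+x. ennreal (h x powr p) \<partial>M) \<le> ennreal (I powr p)"
proof (cases "I = 0")
  case True
  \<comment> \<open>Jensen needs a positive bound for the mass. With I = 0 the majorant, and with it
    \<open>\<phi>\<close>, vanishes almost everywhere.\<close>
  then have "AE y in N. ennreal (m y) = 0"
    using mI by (subst (asm) True) (simp add: nn_integral_0_iff_AE)
  then have "AE y in N. m y = 0" by (rule AE_mp) (use m in \<open>auto intro!: AE_I2 simp: ennreal_eq_0_iff intro: antisym\<close>)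
  then have z: "(\<integral>\<^sup>+y. ennreal (\<phi> x y) \<partial>N) = 0" for x
  proof -
    have "AE y in N. ennreal (\<phi> x y) = 0"
      using \<open>AE y in N. m y = 0\<close> by eventually_elim (simp add: \<phi>0)
    then have "(\<integral>\<^sup>+y. ennreal (\<phi> x y) \<partial>N) = (\<integral>\<^sup>+y. 0 \<partial>N)" by (rule nn_integral_cong_AE)
    then show ?thesis by simp
  qed
  have "(\<integral>\<^sup>+x. ennreal (h x powr p) \<partial>M) \<le> (\<integral>\<^sup>+x. 0 \<partial>M)"
  proof (rule nn_integral_mono_AE)
    show "AE x in M. ennreal (h x powr p) \<le> 0"
      using hle by eventually_elim (use z h in \<open>auto simp: ennreal_eq_0_iff intro: antisym\<close>)
  qed
  then show ?thesis by simp
next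
  case False
  then have I: "I > 0" using I by simp
  interpret M: sigma_finite_measure M by fact
  interpret N: sigma_finite_measure N by fact
  interpret pair_sigma_finite M N ..
  have [measurable]: "\<And>x. x \<in> space M \<Longrightarrow> (\<lambda>y. \<phi> x y) \<in> borel_measurable N"
    by measurable
  have "(\<integral>\<^sup>+x. ennreal (h x powr p) \<partial>M)
      \<le> (\<integral>\<^sup>+x. ennreal (I powr (p-1)) * (\<integral>\<^sup>+y. ennreal ((\<phi> x y / m y) powr p * m y) \<partial>N) \<partial>M)"
  proof (rule nn_integral_mono_AE)
    have step: "ennreal (h x powr p) \<le> ennreal (I powr (p-1)) * (\<integral>\<^sup>+y. ennreal ((\<phi> x y / m y) powr p * m y) \<partial>N)"
      if "x \<in> space M" "ennreal (h x) \<le> (\<integral>\<^sup>+y. ennreal (\<phi> x y) \<partial>N)" for x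
    proof (rule nn_integral_weighted_Jensen)
      have "\<phi> x y / m y * m y = \<phi> x y" for y
        using \<phi>0[of y x] by (cases "m y = 0") auto
      then show "ennreal (h x) \<le> (\<integral>\<^sup>+y. ennreal (\<phi> x y / m y * m y) \<partial>N)"
        using that by simp
    qed (use that \<phi> m p I h mI in auto)
    show "AE x in M. ennreal (h x powr p)
        \<le> ennreal (I powr (p-1)) * (\<integral>\<^sup>+y. ennreal ((\<phi> x y / m y) powr p * m y) \<partial>N)"
      using hle AE_space by eventually_elim (use step in auto)
  qed
  also have "\<dots> = ennreal (I powr (p-1)) * (\<integral>\<^sup>+x. (\<integral>\<^sup>+y. ennreal ((\<phi> x y / m y) powr p * m y) \<partial>N) \<partial>M)"
    by (rule nn_integral_cmult) measurable
  also have "(\<integral>\<^sup>+x. (\<integral>\<^sup>+y. ennreal ((\<phi> x y / m y) powr p * m y) \<partial>N) \<partial>M)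
      = (\<integral>\<^sup>+y. (\<integral>\<^sup>+x. ennreal ((\<phi> x y / m y) powr p * m y) \<partial>M) \<partial>N)"
    by (rule Fubini'[symmetric]) measurable
  also have "\<dots> \<le> (\<integral>\<^sup>+y. ennreal (m y) \<partial>N)"
  proof (rule nn_integral_mono)
    fix y assume y: "y \<in> space N"
    then have [measurable]: "(\<lambda>x. \<phi> x y) \<in> borel_measurable M" by measurable
    show "(\<integral>\<^sup>+x. ennreal ((\<phi> x y / m y) powr p * m y) \<partial>M) \<le> ennreal (m y)"
    proof (cases "m y = 0")
      case False
      then have my: "m y > 0" using m[of y] by simp
      have "(\<integral>\<^sup>+x. ennreal ((\<phi> x y / m y) powr p * m y) \<partial>M)
          = (\<integral>\<^sup>+x. ennreal (m y / m y powr p) * ennreal (\<phi> x y powr p) \<partial>M)"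
        using my \<phi> by (intro nn_integral_cong) (simp add: ennreal_mult [symmetric] powr_divide)
      also have "\<dots> = ennreal (m y / m y powr p) * (\<integral>\<^sup>+x. ennreal (\<phi> x y powr p) \<partial>M)"
        by (rule nn_integral_cmult) measurable
      also have "\<dots> \<le> ennreal (m y / m y powr p) * ennreal (m y powr p)"
        by (intro mult_left_mono bound) auto
      also have "\<dots> = ennreal (m y)"
        using my by (simp add: ennreal_mult [symmetric])
      finally show ?thesis .
    qed simp
  qed
  also have "\<dots> \<le> ennreal I" by (rule mI)
  also have "ennreal (I powr (p-1)) * ennreal I = ennreal (I powr p)"
    using I by (simp add: ennreal_mult [symmetric] powr_diff)
  finally show ?thesis by (simp add: mult_left_mono)
qed

section \<open>Normalized arc length and polar coordinates\<close>

text \<open>A probability measure on the Borel line instead of the circle: periodic integrands can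
  still be shifted and reflected, and the tools for \<open>lborel\<close> stay available. The
  interval is half-open so that its translates by multiples of 2 * pi form a partition.\<close>

definition circ :: "real measure" where
  "circ = density lborel (\<lambda>t. ennreal (indicator {0..<2*pi} t / (2*pi)))"

lemma sets_circ [measurable_cong, simp]: "sets circ = sets borel"
  by (simp add: circ_def)

lemma space_circ [simp]: "space circ = UNIV"
  by (simp add: circ_def)

lemma nn_integral_circ:
  assumes [measurable]: "f \<in> borel_measurable borel"
  shows "(\<integral>\<^sup>+t. f t \<partial>circ) = ennreal (1 / (2*pi)) * (\<integral>\<^sup>+t. f t * indicator {0..<2*pi} t \<partial>lborel)"
proof -
  have "(\<integral>\<^sup>+t. f t \<partial>circ) = (\<integral>\<^sup>+t. ennreal (indicator {0..<2*pi} t / (2*pi)) * f t \<partial>lborel)"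
    unfolding circ_def by (rule nn_integral_density) auto
  also have "\<dots> = (\<integral>\<^sup>+t. ennreal (1 / (2*pi)) * (f t * indicator {0..<2*pi} t) \<partial>lborel)"
    by (intro nn_integral_cong) (auto simp: indicator_def)
  also have "\<dots> = ennreal (1 / (2*pi)) * (\<integral>\<^sup>+t. f t * indicator {0..<2*pi} t \<partial>lborel)"
    by (rule nn_integral_cmult) auto
  finally show ?thesis .
qed

lemma emeasure_circ_space: "emeasure circ (space circ) = 1"
proof -
  have "emeasure circ (space circ) = (\<integral>\<^sup>+t. 1 \<partial>circ)" by simp
  also have "\<dots> = ennreal (1 / (2*pi)) * ennreal (2*pi)"
    by (subst nn_integral_circ) auto
  also have "\<dots> = 1" by (simp add: ennreal_mult [symmetric] del: ennreal_1 flip: ennreal_1)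
  finally show ?thesis .
qed

lemma finite_measure_circ: "finite_measure circ"
  by standard (simp only: emeasure_circ_space, simp)

lemma sigma_finite_circ: "sigma_finite_measure circ"
  using finite_measure_circ by (simp add: finite_measure_def)

lemma nn_integral_circ_const: "(\<integral>\<^sup>+t. c \<partial>circ) = c"
  using emeasure_circ_space by simp

section \<open>Invariance of arc length for periodic integrands\<close>

lemma nn_integral_lborel_shift:
  fixes f :: "'a::euclidean_space \<Rightarrow> ennreal"
  assumes [measurable]: "f \<in> borel_measurable borel"
  shows "(\<integral>\<^sup>+t. f (c + t) \<partial>lborel) = (\<integral>\<^sup>+t. f t \<partial>lborel)"
proof -
  have "(\<integral>\<^sup>+t. f t \<partial>lborel) = (\<integral>\<^sup>+t. f t \<partial>distr lborel borel ((+) c))"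
    by (simp add: lborel_distr_plus)
  also have "\<dots> = (\<integral>\<^sup>+t. f (c + t) \<partial>lborel)"
    by (rule nn_integral_distr) auto
  finally show ?thesis ..
qed

lemma periodic_nat:
  fixes f :: "real \<Rightarrow> 'a"
  assumes per: "\<And>t. f (t + 2*pi) = f t"
  shows "f (t + 2*pi * of_nat k) = f t"
  using per[of "t + 2*pi * of_nat k" for k] by (induction k) (auto simp: algebra_simps)

lemma periodic_int:
  fixes f :: "real \<Rightarrow> 'a"
  assumes per: "\<And>t. f (t + 2*pi) = f t"
  shows "f (t + 2*pi * of_int k) = f t"
proof (cases "k \<ge> 0")
  case True
  then show ?thesis using periodic_nat[of f t "nat k", OF per] by simp
next
  case False
  then show ?thesis using periodic_nat[of f "t + 2*pi * of_int k" "nat (-k)", OF per] by simp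
qed

text \<open>Translation by whole periods reduces the interval to a start c in [0, 2 pi); the piece
  that then sticks out beyond 2 pi is moved back by one period.\<close>

lemma nn_integral_periodic_interval:
  fixes f :: "real \<Rightarrow> ennreal"
  assumes [measurable]: "f \<in> borel_measurable borel" and per: "\<And>t. f (t + 2*pi) = f t"
  shows "(\<integral>\<^sup>+t. f t * indicator {a..<a+2*pi} t \<partial>lborel) = (\<integral>\<^sup>+t. f t * indicator {0..<2*pi} t \<partial>lborel)"
proof -
  define k where "k = \<lfloor>a / (2*pi)\<rfloor>"
  define c where "c = a - 2*pi * of_int k"
  have "of_int k \<le> a / (2*pi)" "a / (2*pi) < of_int k + 1"
    unfolding k_def by linarith+
  then have "0 \<le> c" "c < 2*pi"
    by (auto simp: c_def field_simps)
  have "(\<integral>\<^sup>+t. f t * indicator {a..<a+2*pi} t \<partial>lborel)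
      = (\<integral>\<^sup>+t. f (2*pi * of_int k + t) * indicator {a..<a+2*pi} (2*pi * of_int k + t) \<partial>lborel)"
    by (rule nn_integral_lborel_shift[symmetric]) auto
  also have "\<dots> = (\<integral>\<^sup>+t. f t * indicator {c..<c+2*pi} t \<partial>lborel)"
    using periodic_int[of f, OF per]
    by (intro nn_integral_cong) (auto simp: indicator_def c_def add.commute)
  also have "\<dots> = (\<integral>\<^sup>+t. f t * indicator {c..<2*pi} t + f t * indicator {2*pi..<c+2*pi} t \<partial>lborel)"
    using \<open>0 \<le> c\<close> \<open>c < 2*pi\<close> by (intro nn_integral_cong) (auto simp: indicator_def)
  also have "\<dots> = (\<integral>\<^sup>+t. f t * indicator {c..<2*pi} t \<partial>lborel) + (\<integral>\<^sup>+t. f t * indicator {2*pi..<c+2*pi} t \<partial>lborel)"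
    by (rule nn_integral_add) auto
  also have "(\<integral>\<^sup>+t. f t * indicator {2*pi..<c+2*pi} t \<partial>lborel)
      = (\<integral>\<^sup>+t. f (2*pi + t) * indicator {2*pi..<c+2*pi} (2*pi + t) \<partial>lborel)"
    by (rule nn_integral_lborel_shift[symmetric]) auto
  also have "\<dots> = (\<integral>\<^sup>+t. f t * indicator {0..<c} t \<partial>lborel)"
    using per by (intro nn_integral_cong) (auto simp: indicator_def add.commute)
  also have "(\<integral>\<^sup>+t. f t * indicator {c..<2*pi} t \<partial>lborel) + \<dots>
      = (\<integral>\<^sup>+t. f t * indicator {c..<2*pi} t + f t * indicator {0..<c} t \<partial>lborel)"
    by (rule nn_integral_add[symmetric]) auto
  also have "\<dots> = (\<integral>\<^sup>+t. f t * indicator {0..<2*pi} t \<partial>lborel)"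
    using \<open>0 \<le> c\<close> \<open>c < 2*pi\<close> by (intro nn_integral_cong) (auto simp: indicator_def)
  finally show ?thesis .
qed

lemma nn_integral_circ_interval:
  fixes f :: "real \<Rightarrow> ennreal"
  assumes [measurable]: "f \<in> borel_measurable borel" and per: "\<And>t. f (t + 2*pi) = f t"
  shows "(\<integral>\<^sup>+t. f t \<partial>circ) = ennreal (1 / (2*pi)) * (\<integral>\<^sup>+t. f t * indicator {a..<a+2*pi} t \<partial>lborel)"
  using nn_integral_periodic_interval[of f, OF _ per, of a] by (simp add: nn_integral_circ)

lemma nn_integral_circ_shift:
  fixes f :: "real \<Rightarrow> ennreal"
  assumes [measurable]: "f \<in> borel_measurable borel" and per: "\<And>t. f (t + 2*pi) = f t"
  shows "(\<integral>\<^sup>+t. f (c + t) \<partial>circ) = (\<integral>\<^sup>+t. f t \<partial>circ)"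
proof -
  have "(\<integral>\<^sup>+t. f (c + t) \<partial>circ) = ennreal (1 / (2*pi)) * (\<integral>\<^sup>+t. f (c + t) * indicator {0..<2*pi} t \<partial>lborel)"
    by (rule nn_integral_circ) auto
  also have "(\<integral>\<^sup>+t. f (c + t) * indicator {0..<2*pi} t \<partial>lborel)
      = (\<integral>\<^sup>+t. f (c + t) * indicator {c..<c+2*pi} (c + t) \<partial>lborel)"
    by (intro nn_integral_cong) (auto simp: indicator_def)
  also have "\<dots> = (\<integral>\<^sup>+t. f t * indicator {c..<c+2*pi} t \<partial>lborel)"
    by (rule nn_integral_lborel_shift) auto
  finally show ?thesis
    using nn_integral_circ_interval[of f, OF _ per, of c] by simp
qed

lemma nn_integral_circ_reflect:
  fixes f :: "real \<Rightarrow> ennreal"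
  assumes [measurable]: "f \<in> borel_measurable borel" and per: "\<And>t. f (t + 2*pi) = f t"
  shows "(\<integral>\<^sup>+t. f (c - t) \<partial>circ) = (\<integral>\<^sup>+t. f t \<partial>circ)"
proof -
  define g where "g = (\<lambda>t. f (- t))"
  have [measurable]: "g \<in> borel_measurable borel" unfolding g_def by measurable
  have gper: "g (t + 2*pi) = g t" for t
    using per[of "-t - 2*pi"] by (simp add: g_def)
  have "(\<integral>\<^sup>+t. f (c - t) \<partial>circ) = (\<integral>\<^sup>+t. g (-c + t) \<partial>circ)"
    by (simp add: g_def)
  also have "\<dots> = (\<integral>\<^sup>+t. g t \<partial>circ)"
    by (rule nn_integral_circ_shift) (use gper in auto)
  also have "\<dots> = ennreal (1 / (2*pi)) * (\<integral>\<^sup>+t. g t * indicator {-2*pi..<-2*pi+2*pi} t \<partial>lborel)"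
    by (rule nn_integral_circ_interval) (use gper in auto)
  also have "(\<integral>\<^sup>+t. g t * indicator {-2*pi..<-2*pi+2*pi} t \<partial>lborel)
      = (\<integral>\<^sup>+t. g t * indicator {-2*pi..<-2*pi+2*pi} t \<partial>distr lborel borel uminus)"
    by (simp add: lborel_distr_uminus)
  also have "\<dots> = (\<integral>\<^sup>+t. f t * indicator {-2*pi..<-2*pi+2*pi} (- t) \<partial>lborel)"
    by (subst nn_integral_distr) (auto simp: g_def)
  also have "\<dots> = (\<integral>\<^sup>+t. f t * indicator {0..<2*pi} t \<partial>lborel)"
  proof (rule nn_integral_cong_AE)
    \<comment> \<open>Reflection makes the interval half-open at the other end, so the integrands
      agree only off the end points.\<close>
    have "AE t in lborel. t \<noteq> (0::real) \<and> t \<noteq> 2*pi"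
      by (intro AE_conjI AE_lborel_singleton)
    then show "AE t in lborel. f t * indicator {-2*pi..<-2*pi+2*pi} (- t) = f t * indicator {0..<2*pi} t"
      by eventually_elim (auto simp: indicator_def)
  qed
  finally show ?thesis by (simp add: nn_integral_circ)
qed

text \<open>The argument for the uniqueness of Haar measure: after multiplication by the mass V of
  the unit disc, translations alone move the factor c from u to the indicator B, which is invariant
  under it. V is positive and finite and can be cancelled.\<close>

lemma nn_integral_rotate:
  fixes u :: "complex \<Rightarrow> ennreal"
  assumes [measurable]: "u \<in> borel_measurable borel" and c: "norm c = 1"
  shows "(\<integral>\<^sup>+z. u (c * z) \<partial>lborel) = (\<integral>\<^sup>+z. u z \<partial>lborel)"
proof -
  have cc: "cnj c * c = 1" using c by (metis complex_norm_square mult.commute of_real_1 power_one)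
  define B where "B = (\<lambda>z::complex. indicator (ball 0 1) z :: ennreal)"
  have [measurable]: "unit_disc \<in> sets borel" by simp
  have [measurable]: "B \<in> borel_measurable borel" unfolding B_def by measurable
  have Brot: "B (c * z) = B z" for z using c by (simp add: B_def indicator_def norm_mult)
  define V where "V = (\<integral>\<^sup>+z. B z \<partial>lborel)"
  have V: "V = ennreal (measure lborel (ball 0 1 :: complex set))" unfolding V_def B_def
    using emeasure_lborel_ball_finite[of "0::complex" 1] by (simp add: emeasure_eq_ennreal_measure less_top)
  have V0: "V \<noteq> 0" "V \<noteq> \<infinity>" unfolding V by (auto simp: ennreal_eq_0_iff not_le)
  have "(\<integral>\<^sup>+x. u (c * x) \<partial>lborel) * V = (\<integral>\<^sup>+x. u (c * x) * V \<partial>lborel)"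
    by (rule nn_integral_multc[symmetric]) auto
  also have "\<dots> = (\<integral>\<^sup>+x. \<integral>\<^sup>+y. u (c * x) * B y \<partial>lborel \<partial>lborel)"
    unfolding V_def by (simp add: nn_integral_cmult)
  also have "\<dots> = (\<integral>\<^sup>+y. \<integral>\<^sup>+x. u (c * x) * B y \<partial>lborel \<partial>lborel)"
    by (rule lborel_pair.Fubini'[symmetric]) measurable
  also have "\<dots> = (\<integral>\<^sup>+y. \<integral>\<^sup>+x. u (y + c * x) * B y \<partial>lborel \<partial>lborel)"
  proof (rule nn_integral_cong)
    fix y :: complex
    have "(\<integral>\<^sup>+x. u (c * (cnj c * y + x)) * B y \<partial>lborel) = (\<integral>\<^sup>+x. u (c * x) * B y \<partial>lborel)"
      by (rule nn_integral_lborel_shift) measurable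
    moreover have "c * (cnj c * y + x) = y + c * x" for x
    proof -
      have "c * (cnj c * y + x) = (cnj c * c) * y + c * x" by (simp only: algebra_simps)
      then show ?thesis by (simp only: cc mult_1)
    qed
    ultimately show "(\<integral>\<^sup>+x. u (c * x) * B y \<partial>lborel) = (\<integral>\<^sup>+x. u (y + c * x) * B y \<partial>lborel)"
      by simp
  qed
  also have "\<dots> = (\<integral>\<^sup>+x. \<integral>\<^sup>+y. u (y + c * x) * B y \<partial>lborel \<partial>lborel)"
    by (rule lborel_pair.Fubini') measurable
  also have "\<dots> = (\<integral>\<^sup>+x. \<integral>\<^sup>+y. u y * B (y - c * x) \<partial>lborel \<partial>lborel)"
  proof (rule nn_integral_cong)
    fix x :: complex
    have "(\<integral>\<^sup>+y. u (c * x + y) * B (c * x + y - c * x) \<partial>lborel) = (\<integral>\<^sup>+y. u y * B (y - c * x) \<partial>lborel)"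
      by (rule nn_integral_lborel_shift) measurable
    then show "(\<integral>\<^sup>+y. u (y + c * x) * B y \<partial>lborel) = (\<integral>\<^sup>+y. u y * B (y - c * x) \<partial>lborel)"
      by (simp add: add.commute)
  qed
  also have "\<dots> = (\<integral>\<^sup>+y. \<integral>\<^sup>+x. u y * B (y - c * x) \<partial>lborel \<partial>lborel)"
    by (rule lborel_pair.Fubini'[symmetric]) measurable
  also have "\<dots> = (\<integral>\<^sup>+y. u y * V \<partial>lborel)"
  proof (rule nn_integral_cong)
    fix y :: complex
    have "B (y - c * x) = B (- (cnj c * y) + x)" for x
    proof -
      have "- (c * (- (cnj c * y) + x)) = (cnj c * c) * y - c * x" by (simp add: algebra_simps)
      then have "y - c * x = - (c * (- (cnj c * y) + x))" by (simp only: cc mult_1)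
      then have "B (y - c * x) = B (c * (- (cnj c * y) + x))"
        by (simp add: B_def indicator_def norm_minus_commute)
      then show ?thesis by (simp only: Brot)
    qed
    then have "(\<integral>\<^sup>+x. B (y - c * x) \<partial>lborel) = (\<integral>\<^sup>+x. B (- (cnj c * y) + x) \<partial>lborel)" by simp
    also have "\<dots> = V" unfolding V_def by (rule nn_integral_lborel_shift) measurable
    finally show "(\<integral>\<^sup>+x. u y * B (y - c * x) \<partial>lborel) = u y * V"
      by (simp add: nn_integral_cmult)
  qed
  also have "\<dots> = (\<integral>\<^sup>+y. u y \<partial>lborel) * V"
    by (rule nn_integral_multc) auto
  finally show ?thesis
    using V0 ennreal_mult_le_mult_iff[of V] by (metis infinity_ennreal_def mult.commute order_antisym order_refl)
qed

text \<open>The disc |z|^2 <= s has area pi * s, so area measure is carried by |z|^2 to pi times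
  Lebesgue measure on [0, 1); it suffices to compare the measures of half-lines. The squared radius
  as variable absorbs the Jacobian r dr.\<close>

lemma nn_integral_disc_radial:
  fixes g :: "real \<Rightarrow> ennreal"
  assumes [measurable]: "g \<in> borel_measurable borel"
  shows "(\<integral>\<^sup>+z. g ((norm z)\<^sup>2) * indicator unit_disc z \<partial>lborel)
       = ennreal pi * (\<integral>\<^sup>+s. g s * indicator {0..<1} s \<partial>lborel)"
proof -
  define M where "M = distr (density lborel (indicator unit_disc)) borel (\<lambda>z::complex. (norm z)\<^sup>2)"
  define N where "N = density lborel (\<lambda>s::real. ennreal pi * indicator {0..<1} s)"
  have [measurable]: "unit_disc \<in> sets borel" by simp
  have Mat: "emeasure M {s<..} = ennreal pi * emeasure lborel ({0..<1} \<inter> {s<..})" for s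
  proof -
    have "emeasure M {s<..} = emeasure (density lborel (indicator unit_disc)) ((\<lambda>z::complex. (norm z)\<^sup>2) -` {s<..})"
      unfolding M_def by (subst emeasure_distr) auto
    also have "\<dots> = emeasure lborel (unit_disc \<inter> (\<lambda>z::complex. (norm z)\<^sup>2) -` {s<..})"
      by (subst emeasure_restricted) (auto intro!: measurable_sets_borel[of _ borel])
    also have "\<dots> = ennreal pi * emeasure lborel ({0..<1} \<inter> {s<..})"
    proof -
      consider "s < 0" | "0 \<le> s" "s < 1" | "s \<ge> 1" by linarith
      then show ?thesis
      proof cases
        case 1
        then have "unit_disc \<inter> (\<lambda>z::complex. (norm z)\<^sup>2) -` {s<..} = unit_disc"
          by (auto intro: less_le_trans[OF _ zero_le_power2])
        moreover have "{0..<1} \<inter> {s<..} = {0..<1}" using 1 by auto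
        moreover have "emeasure lborel unit_disc = ennreal pi"
          using emeasure_lborel_ball_finite[of "0::complex" 1]
          by (simp add: emeasure_eq_ennreal_measure less_top content_ball unit_ball_vol_2)
        ultimately show ?thesis by simp
      next
        case 2
        have sq: "s < (norm z)\<^sup>2 \<longleftrightarrow> sqrt s < norm z" for z :: complex
          by (metis real_sqrt_less_iff real_sqrt_abs abs_norm_cancel)
        have "unit_disc \<inter> (\<lambda>z::complex. (norm z)\<^sup>2) -` {s<..} = unit_disc - cball 0 (sqrt s)"
          by (auto simp: not_le sq)
        moreover have "sqrt s < 1" using 2 by simp
        moreover have "emeasure lborel (unit_disc - cball 0 (sqrt s) :: complex set) = ennreal (pi - pi * s)"
        proof -
          have "emeasure lborel (unit_disc - cball 0 (sqrt s) :: complex set)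
              = emeasure lborel (unit_disc :: complex set) - emeasure lborel (cball 0 (sqrt s) :: complex set)"
            using 2 \<open>sqrt s < 1\<close> emeasure_lborel_cball_finite[of "0::complex" "sqrt s"]
            by (intro emeasure_Diff) (auto simp: less_top cball_subset_ball_iff)
          then show ?thesis
            using 2 emeasure_lborel_ball_finite[of "0::complex" 1] emeasure_lborel_cball_finite[of "0::complex" "sqrt s"]
            by (simp add: emeasure_eq_ennreal_measure less_top content_ball content_cball unit_ball_vol_2 ennreal_minus)
        qed
        moreover have "{0..<1} \<inter> {s<..} = {s<..<1}" using 2 by auto
        ultimately show ?thesis using 2 by (simp add: ennreal_mult[symmetric] algebra_simps)
      next
        case 3
        then have "(norm z)\<^sup>2 \<le> s" if "norm z < 1" for z :: complex
          using that by (smt (verit) norm_ge_zero power_le_one)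
        then have e1: "unit_disc \<inter> (\<lambda>z::complex. (norm z)\<^sup>2) -` {s<..} = {}"
          by (force simp: not_less)
        have e2: "{0..<1} \<inter> {s<..} = {}" using 3 by auto
        show ?thesis unfolding e1 e2 by simp
      qed
    qed
    finally show ?thesis .
  qed
  have "M = N"
  proof (rule measure_eqI_lessThan)
    show "sets M = sets borel" "sets N = sets borel" by (auto simp: M_def N_def)
    show "emeasure M {s<..} < \<infinity>" for s
    proof -
      have "emeasure lborel ({0..<1} \<inter> {s<..}) \<le> emeasure lborel {0..<1::real}"
        by (rule emeasure_mono) auto
      then have "emeasure lborel ({0..<1} \<inter> {s<..}) < top" by (auto intro: le_less_trans)
      then show ?thesis unfolding Mat by (simp add: ennreal_mult_less_top)
    qed
    show "emeasure M {s<..} = emeasure N {s<..}" for s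
      unfolding Mat N_def
      by (subst emeasure_density) (auto simp: nn_integral_cmult mult.assoc simp flip: indicator_inter_arith)
  qed
  have "(\<integral>\<^sup>+z. g ((norm z)\<^sup>2) * indicator unit_disc z \<partial>lborel) = (\<integral>\<^sup>+s. g s \<partial>M)"
    unfolding M_def by (simp add: nn_integral_distr nn_integral_density mult.commute)
  also have "\<dots> = ennreal pi * (\<integral>\<^sup>+s. g s * indicator {0..<1} s \<partial>lborel)"
    unfolding \<open>M = N\<close> N_def
    by (subst nn_integral_density) (auto simp: nn_integral_cmult[symmetric] mult_ac)
  finally show ?thesis .
qed

text \<open>Averaging over all rotations does not change the area integral; after Tonelli the
  integral over the angle depends on |z| only, so the radial formula applies.\<close>

lemma nn_integral_polar:
  fixes u :: "complex \<Rightarrow> ennreal"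
  assumes [measurable]: "u \<in> borel_measurable borel"
  shows "(\<integral>\<^sup>+z. u z * indicator unit_disc z \<partial>lborel)
       = ennreal pi * (\<integral>\<^sup>+s. (\<integral>\<^sup>+t. u (of_real (sqrt s) * cis t) \<partial>circ) * indicator {0..<1} s \<partial>lborel)"
proof -
  interpret C: sigma_finite_measure circ by (rule sigma_finite_circ)
  interpret pair_sigma_finite "lborel :: complex measure" circ ..
  have [measurable]: "cis \<in> borel_measurable borel"
    by (intro borel_measurable_continuous_onI continuous_intros)
  have [measurable]: "unit_disc \<in> sets borel" by simp
  have rot: "(\<integral>\<^sup>+t. u (z * cis t) \<partial>circ) = (\<integral>\<^sup>+t. u (of_real (norm z) * cis t) \<partial>circ)" for z
  proof -
    have z: "z = of_real (norm z) * cis (Arg z)"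
      by (metis rcis_cmod_Arg rcis_def)
    have "(\<integral>\<^sup>+t. u (z * cis t) \<partial>circ) = (\<integral>\<^sup>+t. u (of_real (norm z) * cis (Arg z + t)) \<partial>circ)"
      by (subst z) (simp only: cis_mult[symmetric] mult.assoc)
    also have "\<dots> = (\<integral>\<^sup>+t. u (of_real (norm z) * cis t) \<partial>circ)"
      by (rule nn_integral_circ_shift) (auto simp: cis_mult[symmetric])
    finally show ?thesis .
  qed
  have "(\<integral>\<^sup>+z. u z * indicator unit_disc z \<partial>lborel)
      = (\<integral>\<^sup>+t. (\<integral>\<^sup>+z. u z * indicator unit_disc z \<partial>lborel) \<partial>circ)"
    by (rule nn_integral_circ_const[symmetric])
  also have "\<dots> = (\<integral>\<^sup>+t. (\<integral>\<^sup>+z. u (cis t * z) * indicator unit_disc (cis t * z) \<partial>lborel) \<partial>circ)"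
    by (intro nn_integral_cong nn_integral_rotate[symmetric]) (auto simp: norm_mult)
  also have "\<dots> = (\<integral>\<^sup>+t. (\<integral>\<^sup>+z. u (z * cis t) * indicator unit_disc z \<partial>lborel) \<partial>circ)"
    by (intro nn_integral_cong) (auto simp: norm_mult indicator_def mult.commute)
  also have "\<dots> = (\<integral>\<^sup>+z. (\<integral>\<^sup>+t. u (z * cis t) * indicator unit_disc z \<partial>circ) \<partial>lborel)"
    by (rule Fubini') measurable
  also have "\<dots> = (\<integral>\<^sup>+z. (\<integral>\<^sup>+t. u (of_real (sqrt ((norm z)\<^sup>2)) * cis t) \<partial>circ) * indicator unit_disc z \<partial>lborel)"
  proof (rule nn_integral_cong)
    fix z :: complex
    have "(\<integral>\<^sup>+t. u (z * cis t) * indicator unit_disc z \<partial>circ) = (\<integral>\<^sup>+t. u (z * cis t) \<partial>circ) * indicator unit_disc z"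
      by (rule nn_integral_multc) measurable
    then show "(\<integral>\<^sup>+t. u (z * cis t) * indicator unit_disc z \<partial>circ)
        = (\<integral>\<^sup>+t. u (of_real (sqrt ((norm z)\<^sup>2)) * cis t) \<partial>circ) * indicator unit_disc z"
      by (simp only: rot[of z]) simp
  qed
  also have "\<dots> = ennreal pi * (\<integral>\<^sup>+s. (\<integral>\<^sup>+t. u (of_real (sqrt s) * cis t) \<partial>circ) * indicator {0..<1} s \<partial>lborel)"
    by (rule nn_integral_disc_radial) measurable
  finally show ?thesis .
qed

section \<open>Poisson integrals\<close>

lemma cis_measurable [measurable]: "cis \<in> borel_measurable borel"
  by (intro borel_measurable_continuous_onI continuous_intros)

lemma cnj_measurable [measurable]: "cnj \<in> borel_measurable borel"
  by (intro borel_measurable_continuous_onI continuous_intros)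

lemma integrable_circ_bounded:
  fixes f :: "real \<Rightarrow> 'a::{banach, second_countable_topology}"
  assumes [measurable]: "f \<in> borel_measurable borel" and "\<And>t. norm (f t) \<le> K"
  shows "integrable circ f"
proof -
  interpret finite_measure circ by (rule finite_measure_circ)
  show ?thesis by (rule integrable_const_bound[where B = K]) (use assms in auto)
qed

lemma integral_circ_cis:
  "(LINT t|circ. cis (of_int k * t)) = (if k = 0 then 1 else 0)"
proof (cases "k = 0")
  case True
  then show ?thesis
    using emeasure_circ_space by (simp add: measure_def)
next
  case False
  have "(LINT t|circ. cis (of_int k * t)) = (LINT t|lborel. (indicator {0..<2*pi} t / (2*pi)) *\<^sub>R cis (of_int k * t))"
    unfolding circ_def by (rule integral_density) auto
  also have "\<dots> = (LINT t|lborel. indicator {0..2*pi} t *\<^sub>R (cis (of_int k * t) / (2*pi)))"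
  proof (rule integral_cong_AE)
    have "AE t in lborel. t \<noteq> 2*pi" by (rule AE_lborel_singleton)
    then show "AE t in lborel. (indicator {0..<2*pi} t / (2*pi)) *\<^sub>R cis (of_int k * t)
        = indicator {0..2*pi} t *\<^sub>R (cis (of_int k * t) / (2*pi))"
      by eventually_elim (auto simp: indicator_def scaleR_conv_of_real)
  qed auto
  also have "\<dots> = cis (of_int k * (2*pi)) / (2 * pi * \<i> * of_int k) - cis (of_int k * 0) / (2 * pi * \<i> * of_int k)"
  proof (rule integral_FTC_Icc)
    have ce: "cis x = exp (\<i> * of_real x)" for x by (simp add: cis_conv_exp)
    show "((\<lambda>t. cis (of_int k * t) / (2 * pi * \<i> * of_int k)) has_vector_derivative cis (of_int k * x) / (2*pi)) (at x within {0..2*pi})" for x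
    proof -
      have "((\<lambda>t. exp (\<i> * (of_int k * t)) / (2 * pi * \<i> * of_int k)) has_field_derivative exp (\<i> * (of_int k * of_real x)) / (2*pi)) (at (of_real x))"
        using False by (auto intro!: derivative_eq_intros)
      then have "((\<lambda>t. exp (\<i> * (of_int k * of_real t)) / (2 * pi * \<i> * of_int k)) has_vector_derivative exp (\<i> * (of_int k * of_real x)) / (2*pi)) (at x within {0..2*pi})"
        by (rule has_vector_derivative_real_field)
      then show "((\<lambda>t. cis (of_int k * t) / (2 * pi * \<i> * of_int k)) has_vector_derivative cis (of_int k * x) / (2*pi)) (at x within {0..2*pi})"
        by (simp add: ce)
    qed
    show "continuous_on {0..2*pi} (\<lambda>t. cis (of_int k * t) / (2*pi))"
      by (intro continuous_intros) auto
  qed auto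
  also have "cis (of_int k * (2*pi)) = 1"
    by (metis cis_multiple_2pi Ints_of_int mult.commute)
  finally show ?thesis using False by simp
qed

lemma integral_circ_suminf:
  fixes c :: "nat \<Rightarrow> complex" and e :: "nat \<Rightarrow> real \<Rightarrow> complex"
  assumes c: "summable (\<lambda>n. norm (c n))" and [measurable]: "\<And>n. e n \<in> borel_measurable borel"
    and e: "\<And>n t. norm (e n t) \<le> K"
  shows "(LINT t|circ. (\<Sum>n. c n * e n t)) = (\<Sum>n. c n * (LINT t|circ. e n t))"
proof -
  have K: "K \<ge> 0" using norm_ge_zero order_trans[OF _ e] by blast
  have int: "integrable circ (\<lambda>t. c n * e n t)" for n
    by (rule integrable_circ_bounded[where K = "norm (c n) * K"]) (auto simp: norm_mult intro!: mult_left_mono e)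
  have le: "norm (c n * e n t) \<le> norm (c n) * K" for n t
    by (auto simp: norm_mult intro!: mult_left_mono e)
  have sK: "summable (\<lambda>n. norm (c n) * K)" using c by (rule summable_mult2)
  have "(LINT t|circ. (\<Sum>n. c n * e n t)) = (\<Sum>n. LINT t|circ. c n * e n t)"
  proof (rule integral_suminf[OF int])
    show "AE t in circ. summable (\<lambda>n. norm (c n * e n t))"
      by (intro AE_I2 summable_comparison_test'[OF sK, of 0]) (use le in auto)
    show "summable (\<lambda>n. LINT t|circ. norm (c n * e n t))"
    proof (rule summable_comparison_test'[OF sK, of 0])
      fix n
      interpret prob: finite_measure circ by (rule finite_measure_circ)
      have "(LINT t|circ. norm (c n * e n t)) \<le> (LINT t|circ. norm (c n) * K)"
        by (rule integral_mono) (use int le in auto)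
      also have "\<dots> = norm (c n) * K" using emeasure_circ_space by (simp add: measure_def)
      finally show "norm (LINT t|circ. norm (c n * e n t)) \<le> norm (c n) * K" by simp
    qed
  qed
  also have "\<dots> = (\<Sum>n. c n * (LINT t|circ. e n t))"
    by simp
  finally show ?thesis .
qed

text \<open>A power series on a circle, with the powers of the radius absorbed into the
  coefficients. Convolution on the circle then multiplies coefficients.\<close>

definition fourier :: "(nat \<Rightarrow> complex) \<Rightarrow> real \<Rightarrow> complex" where
  "fourier a t = (\<Sum>n. a n * cis (of_nat n * t))"

lemma fourier_measurable [measurable]: "fourier a \<in> borel_measurable borel"
  unfolding fourier_def by measurable

lemma norm_fourier_le:
  assumes "summable (\<lambda>n. norm (a n))"
  shows "norm (fourier a t) \<le> (\<Sum>n. norm (a n))"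
  unfolding fourier_def using summable_norm[of "\<lambda>n. a n * cis (of_nat n * t)"] assms
  by (simp add: norm_mult)

lemma integral_fourier_convolution:
  assumes a: "summable (\<lambda>n. norm (a n))" and b: "summable (\<lambda>n. norm (b n))"
  shows "(LINT t|circ. fourier a t * fourier b (\<theta> - t)) = fourier (\<lambda>n. a n * b n) \<theta>"
proof -
  have inner: "(LINT t|circ. cis (of_nat n * t) * fourier b (\<theta> - t)) = b n * cis (of_nat n * \<theta>)" for n
  proof -
    have "(LINT t|circ. cis (of_nat n * t) * fourier b (\<theta> - t))
        = (LINT t|circ. (\<Sum>m. (b m * cis (of_nat m * \<theta>)) * cis (of_int (int n - int m) * t)))"
    proof (rule Bochner_Integration.integral_cong[OF refl])
      fix t
      have "(\<lambda>m. b m * cis (of_nat m * (\<theta> - t))) sums fourier b (\<theta> - t)"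
        unfolding fourier_def using b by (intro summable_sums summable_norm_cancel[of "\<lambda>n. b n * _ n"]) (simp add: norm_mult)
      then have "(\<lambda>m. cis (of_nat n * t) * (b m * cis (of_nat m * (\<theta> - t)))) sums (cis (of_nat n * t) * fourier b (\<theta> - t))"
        by (rule sums_mult)
      moreover have "cis (of_nat n * t) * (b m * cis (of_nat m * (\<theta> - t)))
          = (b m * cis (of_nat m * \<theta>)) * cis (of_int (int n - int m) * t)" for m
      proof -
        have "cis (of_nat n * t) * cis (of_nat m * (\<theta> - t)) = cis (of_nat m * \<theta>) * cis (of_int (int n - int m) * t)"
          by (simp add: cis_mult algebra_simps)
        then show ?thesis by (simp add: mult_ac)
      qed
      ultimately show "cis (of_nat n * t) * fourier b (\<theta> - t)
          = (\<Sum>m. (b m * cis (of_nat m * \<theta>)) * cis (of_int (int n - int m) * t))"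
        by (simp add: sums_iff)
    qed
    also have "\<dots> = (\<Sum>m. (b m * cis (of_nat m * \<theta>)) * (LINT t|circ. cis (of_int (int n - int m) * t)))"
      by (rule integral_circ_suminf[where K = 1]) (use b in \<open>auto simp: norm_mult\<close>)
    also have "\<dots> = (\<Sum>m. if m = n then b m * cis (of_nat m * \<theta>) else 0)"
      unfolding integral_circ_cis by (intro suminf_cong) auto
    also have "\<dots> = b n * cis (of_nat n * \<theta>)"
      using sums_single[of n "\<lambda>m. b m * cis (of_nat m * \<theta>)"] by (simp add: sums_iff)
    finally show ?thesis .
  qed
  have "(LINT t|circ. fourier a t * fourier b (\<theta> - t))
      = (LINT t|circ. (\<Sum>n. a n * (cis (of_nat n * t) * fourier b (\<theta> - t))))"
  proof (rule Bochner_Integration.integral_cong[OF refl])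
    fix t
    have "(\<lambda>m. a m * cis (of_nat m * t)) sums fourier a t"
      unfolding fourier_def using a by (intro summable_sums summable_norm_cancel[of "\<lambda>n. a n * _ n"]) (simp add: norm_mult)
    then have "(\<lambda>m. a m * cis (of_nat m * t) * fourier b (\<theta> - t)) sums (fourier a t * fourier b (\<theta> - t))"
      by (rule sums_mult2)
    then show "fourier a t * fourier b (\<theta> - t) = (\<Sum>n. a n * (cis (of_nat n * t) * fourier b (\<theta> - t)))"
      by (simp add: sums_iff mult.assoc)
  qed
  also have "\<dots> = (\<Sum>n. a n * (LINT t|circ. cis (of_nat n * t) * fourier b (\<theta> - t)))"
    by (rule integral_circ_suminf[where K = "\<Sum>n. norm (b n)"]) (use a b in \<open>auto simp: norm_mult norm_fourier_le\<close>)
  also have "\<dots> = fourier (\<lambda>n. a n * b n) \<theta>"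
    by (simp only: inner) (simp add: fourier_def mult.assoc)
  finally show ?thesis .
qed

text \<open>The frequencies n of the first factor and m of the conjugate add up to n + m, so only n
  = m = 0 survives the integration.\<close>

lemma integral_fourier_cnj_convolution:
  assumes a: "summable (\<lambda>n. norm (a n))" and b: "summable (\<lambda>n. norm (b n))"
  shows "(LINT t|circ. fourier a t * cnj (fourier b (\<theta> - t))) = a 0 * cnj (b 0)"
proof -
  have inner: "(LINT t|circ. cis (of_nat n * t) * cnj (fourier b (\<theta> - t))) = (if n = 0 then cnj (b 0) else 0)" for n
  proof -
    have "(LINT t|circ. cis (of_nat n * t) * cnj (fourier b (\<theta> - t)))
        = (LINT t|circ. (\<Sum>m. (cnj (b m) * cis (- (of_nat m * \<theta>))) * cis (of_int (int n + int m) * t)))"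
    proof (rule Bochner_Integration.integral_cong[OF refl])
      fix t
      have "(\<lambda>m. b m * cis (of_nat m * (\<theta> - t))) sums fourier b (\<theta> - t)"
        unfolding fourier_def using b by (intro summable_sums summable_norm_cancel[of "\<lambda>n. b n * _ n"]) (simp add: norm_mult)
      then have "(\<lambda>m. cnj (b m * cis (of_nat m * (\<theta> - t)))) sums cnj (fourier b (\<theta> - t))"
        by (simp only: sums_cnj)
      then have "(\<lambda>m. cis (of_nat n * t) * cnj (b m * cis (of_nat m * (\<theta> - t)))) sums (cis (of_nat n * t) * cnj (fourier b (\<theta> - t)))"
        by (rule sums_mult)
      moreover have "cis (of_nat n * t) * cnj (b m * cis (of_nat m * (\<theta> - t)))
          = (cnj (b m) * cis (- (of_nat m * \<theta>))) * cis (of_int (int n + int m) * t)" for m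
      proof -
        have "cis (of_nat n * t) * cis (- (of_nat m * (\<theta> - t))) = cis (- (of_nat m * \<theta>)) * cis (of_int (int n + int m) * t)"
          by (simp add: cis_mult algebra_simps)
        then have "cnj (b m) * (cis (of_nat n * t) * cis (- (of_nat m * (\<theta> - t)))) = cnj (b m) * (cis (- (of_nat m * \<theta>)) * cis (of_int (int n + int m) * t))"
          by simp
        then show ?thesis by (simp only: mult_ac cis_cnj complex_cnj_mult)
      qed
      ultimately have "(\<lambda>m. (cnj (b m) * cis (- (of_nat m * \<theta>))) * cis (of_int (int n + int m) * t))
          sums (cis (of_nat n * t) * cnj (fourier b (\<theta> - t)))"
        by (simp only:)
      then show "cis (of_nat n * t) * cnj (fourier b (\<theta> - t))
          = (\<Sum>m. (cnj (b m) * cis (- (of_nat m * \<theta>))) * cis (of_int (int n + int m) * t))"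
        by (rule sums_unique)
    qed
    also have "\<dots> = (\<Sum>m. (cnj (b m) * cis (- (of_nat m * \<theta>))) * (LINT t|circ. cis (of_int (int n + int m) * t)))"
      by (rule integral_circ_suminf[where K = 1]) (use b in \<open>auto simp: norm_mult\<close>)
    also have "\<dots> = (\<Sum>m. if m = 0 then (if n = 0 then cnj (b 0) else 0) else 0)"
      unfolding integral_circ_cis by (intro suminf_cong) auto
    also have "\<dots> = (if n = 0 then cnj (b 0) else 0)"
      using sums_single[of 0 "\<lambda>m. (if n = 0 then cnj (b 0) else 0)"] by (simp add: sums_iff)
    finally show ?thesis .
  qed
  have "(LINT t|circ. fourier a t * cnj (fourier b (\<theta> - t)))
      = (LINT t|circ. (\<Sum>n. a n * (cis (of_nat n * t) * cnj (fourier b (\<theta> - t)))))"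
  proof (rule Bochner_Integration.integral_cong[OF refl])
    fix t
    have "(\<lambda>m. a m * cis (of_nat m * t)) sums fourier a t"
      unfolding fourier_def using a by (intro summable_sums summable_norm_cancel[of "\<lambda>n. a n * _ n"]) (simp add: norm_mult)
    then have "(\<lambda>m. a m * cis (of_nat m * t) * cnj (fourier b (\<theta> - t))) sums (fourier a t * cnj (fourier b (\<theta> - t)))"
      by (rule sums_mult2)
    then show "fourier a t * cnj (fourier b (\<theta> - t)) = (\<Sum>n. a n * (cis (of_nat n * t) * cnj (fourier b (\<theta> - t))))"
      by (simp add: sums_iff mult.assoc)
  qed
  also have "\<dots> = (\<Sum>n. a n * (LINT t|circ. cis (of_nat n * t) * cnj (fourier b (\<theta> - t))))"
    by (rule integral_circ_suminf[where K = "\<Sum>n. norm (b n)"]) (use a b in \<open>auto simp: norm_mult norm_fourier_le\<close>)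
  also have "\<dots> = (\<Sum>n. if n = 0 then a 0 * cnj (b 0) else 0)"
    unfolding inner by (intro suminf_cong) auto
  also have "\<dots> = a 0 * cnj (b 0)"
    using sums_single[of 0 "\<lambda>m. a 0 * cnj (b 0)"] by (simp add: sums_iff)
  finally show ?thesis .
qed

definition poisson :: "real \<Rightarrow> real \<Rightarrow> real" where
  "poisson r x = (1 - r\<^sup>2) / (norm (1 - of_real r * cis x))\<^sup>2"

lemma poisson_measurable [measurable]: "poisson r \<in> borel_measurable borel"
  unfolding poisson_def by measurable

lemma poisson_nonneg: "0 \<le> r \<Longrightarrow> r < 1 \<Longrightarrow> poisson r x \<ge> 0"
  by (auto simp: poisson_def power_le_one intro!: divide_nonneg_nonneg)

lemma norm_one_minus_cis_ge: "0 \<le> r \<Longrightarrow> 1 - r \<le> norm (1 - of_real r * cis x)"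
  using norm_triangle_ineq2[of 1 "of_real r * cis x"] by (simp add: norm_mult)

lemma poisson_le:
  assumes "0 \<le> r" "r \<le> q" "q < 1"
  shows "poisson r x \<le> 2 / (1 - q)"
proof -
  have "poisson r x \<le> (1 - r\<^sup>2) / (1 - r)\<^sup>2"
    unfolding poisson_def using assms norm_one_minus_cis_ge[of r x]
    by (intro divide_left_mono power_mono mult_pos_pos) (auto simp: power_le_one)
  also have "\<dots> = (1 + r) / (1 - r)"
    using assms by (simp add: power2_eq_square divide_simps) (simp add: algebra_simps)
  also have "\<dots> \<le> 2 / (1 - q)"
    using assms by (intro frac_le) auto
  finally show ?thesis .
qed

lemma summable_geometric_norm: "0 \<le> r \<Longrightarrow> r < 1 \<Longrightarrow> summable (\<lambda>n. norm (of_real r ^ n :: complex))"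
  by (simp add: norm_power)

lemma fourier_geometric:
  assumes "0 \<le> r" "r < 1"
  shows "fourier (\<lambda>n. of_real r ^ n) x = 1 / (1 - of_real r * cis x)"
proof -
  have "(\<lambda>n. (of_real r * cis x) ^ n) sums (1 / (1 - of_real r * cis x))"
    by (rule geometric_sums) (use assms in \<open>simp add: norm_mult\<close>)
  then show ?thesis unfolding fourier_def
    by (simp add: power_mult_distrib Complex.DeMoivre sums_iff)
qed

lemma poisson_eq:
  assumes "0 \<le> r" "r < 1"
  shows "of_real (poisson r x) = 1 / (1 - of_real r * cis x) + cnj (1 / (1 - of_real r * cis x)) - 1"
proof -
  define w where "w = of_real r * cis x"
  have nw: "norm w = r" using assms by (simp add: w_def norm_mult)
  then have ne: "1 - w \<noteq> 0" using assms by auto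
  have "w * cnj w = of_real (r\<^sup>2)" using nw by (simp add: complex_norm_square[symmetric])
  then have "1 / (1 - w) + cnj (1 / (1 - w)) - 1 = (1 - of_real (r\<^sup>2)) / ((1 - w) * cnj (1 - w))"
    using ne by (simp add: divide_simps) (simp add: algebra_simps)
  also have "\<dots> = of_real (poisson r x)"
    by (simp add: poisson_def w_def complex_norm_square[symmetric] del: complex_cnj_diff)
  finally show ?thesis by (simp add: w_def)
qed

text \<open>By \<open>poisson_eq\<close> the kernel is a geometric series plus its conjugate minus
  1. Convolution with the series multiplies the coefficients by r^n, the conjugate contributes only
  the constant coefficient, and the term -1 cancels exactly that.\<close>

lemma poisson_representation:
  assumes a: "summable (\<lambda>n. norm (a n))" and r: "0 \<le> r" "r < 1"
  shows "fourier (\<lambda>n. a n * of_real r ^ n) \<theta> = (LINT t|circ. fourier a t * of_real (poisson r (\<theta> - t)))"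
proof -
  define b where "b = (\<lambda>n. of_real r ^ n :: complex)"
  \<comment> \<open>The coefficients of the constant function 1, so that the convolution lemmas also
    cover the last term of \<open>poisson_eq\<close>.\<close>
  define e where "e = (\<lambda>n::nat. if n = 0 then 1 else 0 :: complex)"
  have b: "summable (\<lambda>n. norm (b n))" using summable_geometric_norm r by (simp add: b_def)
  have e: "summable (\<lambda>n. norm (e n))" unfolding e_def by (rule summable_finite[of "{0}"]) auto
  have fe: "fourier e x = 1" for x
    unfolding fourier_def e_def using suminf_finite[of "{0}" "\<lambda>n. (if n = 0 then 1 else 0) * cis (real n * x)"] by simp
  have int: "integrable circ (\<lambda>t. fourier a t * g t)" if [measurable]: "g \<in> borel_measurable borel"
      and "\<And>t. norm (g t) \<le> K" for g and K :: real
  proof (rule integrable_circ_bounded[where K = "(\<Sum>n. norm (a n)) * K"])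
    show "norm (fourier a t * g t) \<le> (\<Sum>n. norm (a n)) * K" for t
      unfolding norm_mult using norm_fourier_le[OF a, of t] that(2)[of t] by (intro mult_mono) (auto intro: suminf_nonneg a)
  qed auto
  have "(LINT t|circ. fourier a t * of_real (poisson r (\<theta> - t)))
      = (LINT t|circ. fourier a t * fourier b (\<theta> - t) + (fourier a t * cnj (fourier b (\<theta> - t)) - fourier a t * cnj (fourier e (\<theta> - t))))"
    unfolding poisson_eq[OF r] fe b_def fourier_geometric[OF r] by (simp add: algebra_simps)
  also have "\<dots> = (LINT t|circ. fourier a t * fourier b (\<theta> - t))
      + ((LINT t|circ. fourier a t * cnj (fourier b (\<theta> - t))) - (LINT t|circ. fourier a t * cnj (fourier e (\<theta> - t))))"
  proof -
    have "integrable circ (\<lambda>t. fourier a t * fourier b (\<theta> - t))"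
      by (rule int[where K = "\<Sum>n. norm (b n)"]) (simp_all add: norm_fourier_le[OF b])
    moreover have "integrable circ (\<lambda>t. fourier a t * cnj (fourier b (\<theta> - t)))"
      by (rule int[where K = "\<Sum>n. norm (b n)"]) (simp_all add: norm_fourier_le[OF b])
    moreover have "integrable circ (\<lambda>t. fourier a t * cnj (fourier e (\<theta> - t)))"
      by (rule int[where K = 1]) (simp_all add: fe)
    ultimately show ?thesis by simp
  qed
  also have "\<dots> = fourier (\<lambda>n. a n * b n) \<theta>"
    unfolding integral_fourier_convolution[OF a b] integral_fourier_cnj_convolution[OF a b]
        integral_fourier_cnj_convolution[OF a e] by (simp add: b_def e_def)
  finally show ?thesis by (simp add: b_def)
qed

text \<open>The representation formula applied to the constant 1. Both orientations occur later,
  since the kernel is integrated in either of its variables.\<close>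

lemma nn_integral_poisson:
  assumes r: "0 \<le> r" "r < 1"
  shows "(\<integral>\<^sup>+t. ennreal (poisson r (\<theta> - t)) \<partial>circ) = 1" "(\<integral>\<^sup>+t. ennreal (poisson r (t - \<theta>)) \<partial>circ) = 1"
proof -
  define e where "e = (\<lambda>n::nat. if n = 0 then 1 else 0 :: complex)"
  have e: "summable (\<lambda>n. norm (e n))" unfolding e_def by (rule summable_finite[of "{0}"]) auto
  have fe: "fourier e x = 1" for x
    unfolding fourier_def e_def using suminf_finite[of "{0}" "\<lambda>n. (if n = 0 then 1 else 0) * cis (real n * x)"] by simp
  have ee: "(\<lambda>n. e n * of_real r ^ n) = e" by (auto simp: e_def)
  have "(LINT t|circ. complex_of_real (poisson r (\<theta> - t))) = 1" for \<theta>
    using poisson_representation[OF e r, of \<theta>] by (simp add: ee fe)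
  then have I: "(LINT t|circ. poisson r (\<theta> - t)) = 1" for \<theta>
    by (metis integral_complex_of_real of_real_eq_1_iff)
  have int: "integrable circ (\<lambda>t. poisson r (\<theta> - t))" for \<theta>
    by (rule integrable_circ_bounded[where K = "2 / (1 - r)"]) (use r poisson_nonneg[OF r] poisson_le[of r r] in auto)
  have 1: "(\<integral>\<^sup>+t. ennreal (poisson r (\<theta> - t)) \<partial>circ) = 1" for \<theta>
    by (subst nn_integral_eq_integral[OF int]) (use I poisson_nonneg[OF r] in auto)
  show "(\<integral>\<^sup>+t. ennreal (poisson r (\<theta> - t)) \<partial>circ) = 1" by (rule 1)
  have per: "poisson r (t + 2*pi) = poisson r t" for t
    by (simp add: poisson_def cis_mult[symmetric])
  have "(\<integral>\<^sup>+t. ennreal (poisson r (t - \<theta>)) \<partial>circ) = (\<integral>\<^sup>+t. ennreal (poisson r (-\<theta> + t)) \<partial>circ)" by simp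
  also have "\<dots> = (\<integral>\<^sup>+t. ennreal (poisson r t) \<partial>circ)"
    by (rule nn_integral_circ_shift) (auto simp: per)
  also have "\<dots> = (\<integral>\<^sup>+t. ennreal (poisson r (0 - t)) \<partial>circ)"
    by (rule nn_integral_circ_reflect[symmetric]) (auto simp: per)
  also have "\<dots> = 1" by (rule 1)
  finally show "(\<integral>\<^sup>+t. ennreal (poisson r (t - \<theta>)) \<partial>circ) = 1" .
qed

text \<open>Jensen at each point with the Poisson kernel as a weight of mass 1, then Tonelli and
  mass 1 in the other variable. A pointwise domination suffices as hypothesis, so that it applies to
  powers of |G|.\<close>

lemma poisson_contraction:
  assumes [measurable]: "u \<in> borel_measurable borel" and u: "\<And>t. u t \<ge> 0" and p: "p \<ge> 1" and r: "0 \<le> r" "r < 1"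
    and v: "\<And>\<theta>. v \<theta> \<ge> 0"
    and le: "\<And>\<theta>. ennreal (v \<theta>) \<le> (\<integral>\<^sup>+t. ennreal (u t * poisson r (\<theta> - t)) \<partial>circ)"
  shows "ennreal (v \<theta> powr p) \<le> (\<integral>\<^sup>+t. ennreal (u t powr p * poisson r (\<theta> - t)) \<partial>circ)"
    and "(\<integral>\<^sup>+\<theta>. ennreal (v \<theta> powr p) \<partial>circ) \<le> (\<integral>\<^sup>+t. ennreal (u t powr p) \<partial>circ)"
proof -
  interpret C: sigma_finite_measure circ by (rule sigma_finite_circ)
  interpret pair_sigma_finite circ circ ..
  have 1: "ennreal (v \<theta> powr p) \<le> (\<integral>\<^sup>+t. ennreal (u t powr p * poisson r (\<theta> - t)) \<partial>circ)" for \<theta>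
    using nn_integral_weighted_Jensen[of u circ "\<lambda>t. poisson r (\<theta> - t)" p 1 "v \<theta>"] u v p le poisson_nonneg[OF r] nn_integral_poisson[OF r]
    by simp
  then show "ennreal (v \<theta> powr p) \<le> (\<integral>\<^sup>+t. ennreal (u t powr p * poisson r (\<theta> - t)) \<partial>circ)" .
  have "(\<integral>\<^sup>+\<theta>. ennreal (v \<theta> powr p) \<partial>circ) \<le> (\<integral>\<^sup>+\<theta>. (\<integral>\<^sup>+t. ennreal (u t powr p * poisson r (\<theta> - t)) \<partial>circ) \<partial>circ)"
    by (rule nn_integral_mono) (rule 1)
  also have "\<dots> = (\<integral>\<^sup>+t. (\<integral>\<^sup>+\<theta>. ennreal (u t powr p * poisson r (\<theta> - t)) \<partial>circ) \<partial>circ)"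
    by (rule Fubini') measurable
  also have "\<dots> = (\<integral>\<^sup>+t. ennreal (u t powr p) \<partial>circ)"
    using u poisson_nonneg[OF r]
    by (intro nn_integral_cong) (simp add: ennreal_mult nn_integral_cmult nn_integral_poisson[OF r])
  finally show "(\<integral>\<^sup>+\<theta>. ennreal (v \<theta> powr p) \<partial>circ) \<le> (\<integral>\<^sup>+t. ennreal (u t powr p) \<partial>circ)" .
qed

lemma holomorphic_power_series_fourier:
  assumes f: "f holomorphic_on ball 0 R" and r: "0 \<le> r" "r < R"
  shows "f (of_real r * cis t) = fourier (\<lambda>n. fps_nth (fps_expansion f 0) n * of_real r ^ n) t"
    and "summable (\<lambda>n. norm (fps_nth (fps_expansion f 0) n * of_real r ^ n))"
proof -
  have f': "f holomorphic_on eball 0 (ereal R)" using f by simp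
  have "fps_conv_radius (fps_expansion f 0) \<ge> ereal R" by (rule conv_radius_fps_expansion[OF f'])
  then have rad: "norm (of_real r * cis t :: complex) < fps_conv_radius (fps_expansion f 0)" for t
    using r by (auto simp: norm_mult intro: less_le_trans[of _ "ereal R"])
  have "eval_fps (fps_expansion f 0) (of_real r * cis t) = f (0 + of_real r * cis t)"
    by (rule eval_fps_expansion'[OF f']) (use r in \<open>simp add: norm_mult\<close>)
  moreover have "eval_fps (fps_expansion f 0) (of_real r * cis t) = fourier (\<lambda>n. fps_nth (fps_expansion f 0) n * of_real r ^ n) t"
    unfolding eval_fps_def fourier_def by (simp only: power_mult_distrib Complex.DeMoivre mult.assoc)
  ultimately show "f (of_real r * cis t) = fourier (\<lambda>n. fps_nth (fps_expansion f 0) n * of_real r ^ n) t" by simp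
  show "summable (\<lambda>n. norm (fps_nth (fps_expansion f 0) n * of_real r ^ n))"
    using abs_summable_in_conv_radius[of "of_real r" "fps_nth (fps_expansion f 0)"] rad[of 0]
    by (simp add: fps_conv_radius_def)
qed

lemma emeasure_circ_UNIV [simp]: "emeasure circ UNIV = 1"
  using emeasure_circ_space by simp

section \<open>Integral means of holomorphic functions\<close>

text \<open>The p-th power of the integral mean with values in [0, infinity]; the root and the
  question of finiteness are dealt with once, in \<open>mean_pow_integral_mean\<close>.\<close>

definition mean_pow :: "real \<Rightarrow> real \<Rightarrow> (complex \<Rightarrow> complex) \<Rightarrow> ennreal" where
  "mean_pow p r f = (\<integral>\<^sup>+t. ennreal (norm (f (of_real r * cis t)) powr p) \<partial>circ)"

lemma holomorphic_circle_measurable: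
  assumes f: "f holomorphic_on ball 0 R" and r: "0 \<le> r" "r < R"
  shows "(\<lambda>t. f (of_real r * cis t)) \<in> borel_measurable borel"
proof (rule borel_measurable_continuous_onI)
  have "continuous_on (ball 0 R) f" using f by (rule holomorphic_on_imp_continuous_on)
  then show "continuous_on UNIV (\<lambda>t. f (of_real r * cis t))"
    by (rule continuous_on_compose2) (use r in \<open>auto intro!: continuous_intros simp: norm_mult\<close>)
qed

lemma holomorphic_circle_bounded:
  assumes f: "f holomorphic_on ball 0 R" and \<rho>: "\<rho> < R"
  obtains K where "K \<ge> 0" "\<And>z. norm z \<le> \<rho> \<Longrightarrow> norm (f z) \<le> K"
proof -
  have "compact (f ` cball 0 \<rho>)"
    using f \<rho> by (intro compact_continuous_image holomorphic_on_imp_continuous_on holomorphic_on_subset[OF f]) auto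
  then have "bounded (f ` cball 0 \<rho>)" by (rule compact_imp_bounded)
  then obtain K where "K > 0" "\<forall>x\<in>f ` cball 0 \<rho>. norm x \<le> K" by (auto simp: bounded_pos)
  then show ?thesis by (intro that[of K]) auto
qed

lemma poisson_representation_holomorphic:
  assumes f: "f holomorphic_on ball 0 R" and R: "R > 1" and r: "0 \<le> r" "r < 1"
  shows "f (of_real r * cis \<theta>) = (LINT t|circ. f (cis t) * of_real (poisson r (\<theta> - t)))"
proof -
  let ?a = "\<lambda>n. fps_nth (fps_expansion f 0) n"
  have "summable (\<lambda>n. norm (?a n))"
    using holomorphic_power_series_fourier(2)[OF f, of 1] R by simp
  from poisson_representation[OF this r]
  show ?thesis
    using holomorphic_power_series_fourier(1)[OF f, of 1] holomorphic_power_series_fourier(1)[OF f, of r] R r by simp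
qed

lemma norm_le_poisson:
  assumes f: "f holomorphic_on ball 0 R" and R: "R > 1" and r: "0 \<le> r" "r < 1"
  shows "ennreal (norm (f (of_real r * cis \<theta>))) \<le> (\<integral>\<^sup>+t. ennreal (norm (f (cis t)) * poisson r (\<theta> - t)) \<partial>circ)"
proof -
  obtain K where K: "K \<ge> 0" "\<And>z. norm z \<le> 1 \<Longrightarrow> norm (f z) \<le> K"
    using holomorphic_circle_bounded[OF f R] by blast
  have [measurable]: "(\<lambda>t. f (cis t)) \<in> borel_measurable borel"
    using holomorphic_circle_measurable[OF f, of 1] R by simp
  have "integrable circ (\<lambda>t. f (cis t) * of_real (poisson r (\<theta> - t)))"
  proof (rule integrable_circ_bounded[where K = "K * (2 / (1 - r))"])
    show "norm (f (cis t) * of_real (poisson r (\<theta> - t))) \<le> K * (2 / (1 - r))" for t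
      unfolding norm_mult using K poisson_le[of r r "\<theta> - t"] poisson_nonneg[OF r, of "\<theta> - t"] r
      by (intro mult_mono) auto
  qed measurable
  then have "ennreal (norm (LINT t|circ. f (cis t) * of_real (poisson r (\<theta> - t))))
      \<le> (\<integral>\<^sup>+t. ennreal (norm (f (cis t) * of_real (poisson r (\<theta> - t)))) \<partial>circ)"
    by (rule integral_norm_bound_ennreal)
  then show ?thesis
    using poisson_representation_holomorphic[OF f R r, of \<theta>] poisson_nonneg[OF r] by (simp add: norm_mult)
qed

section \<open>Removal of zeros and domination by Poisson integrals\<close>

lemma holomorphic_divide_zero:
  assumes f: "f holomorphic_on S" "open S" "connected S" "a \<in> S" "f a = 0" "\<not> f constant_on S"
  obtains h m where "h holomorphic_on S" "h a \<noteq> 0" "\<And>w. w \<in> S \<Longrightarrow> f w = (w - a) ^ m * h w" "m > 0"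
proof -
  obtain g r n where g: "0 < n"  "0 < r"  "ball a r \<subseteq> S" "g holomorphic_on ball a r"
      "\<And>w. w \<in> ball a r \<Longrightarrow> f w = (w - a)^n * g w" "\<And>w. w \<in> ball a r \<Longrightarrow> g w \<noteq> 0"
    using holomorphic_factor_zero_nonconstant[OF assms] by metis
  define h where "h = (\<lambda>w. if w = a then g a else f w / (w - a) ^ n)"
  have hg: "h w = g w" if "w \<in> ball a r" for w
    using g(5)[OF that] by (auto simp: h_def)
  \<comment> \<open>Off a the quotient is holomorphic, and near a it coincides with the local factor
    g, so the singularity is removable.\<close>
  have "h holomorphic_on S"
  proof (rule no_isolated_singularity)
    have hol: "h holomorphic_on (S - {a})"
      by (rule holomorphic_transform[of "\<lambda>w. f w / (w - a) ^ n"])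
         (auto simp: h_def intro!: holomorphic_intros holomorphic_on_subset[OF f(1)])
    then show "h holomorphic_on (S - {a})" .
    have "h holomorphic_on ball a r"
      by (rule holomorphic_transform[OF g(4)]) (simp add: hg)
    then have "continuous_on (ball a r \<union> (S - {a})) h"
      using hol f(2) by (intro continuous_on_open_Un holomorphic_on_imp_continuous_on) auto
    then show "continuous_on S h" by (rule continuous_on_subset) (use g(2) in auto)
  qed (use f in auto)
  moreover have "h a \<noteq> 0" using g(2,6) by (auto simp: h_def)
  moreover have "f w = (w - a) ^ n * h w" if "w \<in> S" for w
    using f(5) g(1) by (auto simp: h_def)
  ultimately show ?thesis using that g(1) by blast
qed

lemma blaschke_norm_sq:
  "(norm (1 - cnj a * w))\<^sup>2 - (norm (w - a))\<^sup>2 = (1 - (norm a)\<^sup>2) * (1 - (norm w)\<^sup>2)"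
  by (simp add: cmod_power2) (simp add: algebra_simps power2_eq_square)

lemma blaschke_norm_le:
  assumes "norm a < 1" "norm w \<le> 1"
  shows "norm (w - a) \<le> norm (1 - cnj a * w)"
proof -
  have "0 \<le> (1 - (norm a)\<^sup>2) * (1 - (norm w)\<^sup>2)"
    using assms by (intro mult_nonneg_nonneg) (auto simp: power_le_one)
  then have "(norm (w - a))\<^sup>2 \<le> (norm (1 - cnj a * w))\<^sup>2" using blaschke_norm_sq[of a w] by linarith
  then show ?thesis by (rule power2_le_imp_le) simp
qed

lemma blaschke_norm_eq:
  assumes "norm w = 1"
  shows "norm (w - a) = norm (1 - cnj a * w)"
  using blaschke_norm_sq[of a w] assms by (simp add: power2_eq_iff_nonneg)

text \<open>Replacing a factor \<open>z - a\<close> by \<open>1 - cnj a * z\<close> keeps the modulus on the circle and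
  increases it inside; once no zeros are left, \<open>f\<close> has a holomorphic square root.\<close>

lemma sqrt_norm_le_poisson_finite:
  assumes "finite Z" and R: "R > 1" and r: "0 \<le> r" "r < 1"
    and "f holomorphic_on ball 0 R" "{z \<in> cball 0 1. f z = 0} = Z" "Z \<subseteq> ball 0 1"
  shows "ennreal (norm (f (of_real r * cis \<theta>)) powr (1/2))
    \<le> (\<integral>\<^sup>+t. ennreal (norm (f (cis t)) powr (1/2) * poisson r (\<theta> - t)) \<partial>circ)"
  using assms(1,5-)
proof (induction Z arbitrary: f rule: finite_induct)
  case empty
  define R1 where "R1 = (1 + R) / 2"
  have R1: "1 < R1" "R1 < R" using R by (auto simp: R1_def)
  define A where "A = {z \<in> cball 0 R1. f z = 0}"
  have cf: "continuous_on (cball 0 R1) f"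
    using empty(1) R1 by (intro holomorphic_on_imp_continuous_on holomorphic_on_subset[OF empty(1)]) auto
  \<comment> \<open>The closed unit disc contains no zero, so a zero of least modulus in the compact
    set A lies outside it and bounds a larger zero-free disc. The room beyond radius 1 is what
    \<open>norm_le_poisson\<close> asks of the square root.\<close>
  have "\<exists>R'. 1 < R' \<and> R' \<le> R1 \<and> (\<forall>z\<in>ball (0::complex) R'. f z \<noteq> 0)"
  proof (cases "A = {}")
    case True
    then show ?thesis using R1 by (intro exI[of _ R1]) (auto simp: A_def)
  next
    case False
    have "closed A" unfolding A_def
      using continuous_closed_preimage[OF cf, of "{0}"] by (simp add: vimage_def Int_def)
    then have "compact A"
      by (metis A_def compact_Int_closed compact_cball inf.absorb_iff2 Collect_subset)
    then obtain z0 where z0: "z0 \<in> A" "\<And>z. z \<in> A \<Longrightarrow> norm z0 \<le> norm z"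
      using continuous_attains_inf[of A norm] False by (auto intro: continuous_intros)
    show ?thesis
    proof (intro exI[of _ "norm z0"] conjI ballI)
      have "z0 \<notin> cball 0 1" using z0(1) empty(2) by (auto simp: A_def)
      then show "1 < norm z0" by simp
      show "norm z0 \<le> R1" using z0(1) by (simp add: A_def)
      fix z :: complex assume "z \<in> ball 0 (norm z0)"
      then show "f z \<noteq> 0" using z0(2)[of z] \<open>norm z0 \<le> R1\<close> by (force simp: A_def)
    qed
  qed
  then obtain R' where R': "1 < R'" "R' \<le> R1" "\<forall>z\<in>ball 0 R'. f z \<noteq> 0" by blast
  have "f holomorphic_on ball 0 R'" using R' R1 by (intro holomorphic_on_subset[OF empty(1)]) auto
  then obtain g where g: "g holomorphic_on ball 0 R'" "\<And>z. z \<in> ball 0 R' \<Longrightarrow> f z = g z ^ 2"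
    using contractible_imp_holomorphic_sqrt[of f "ball 0 R'"] R'(3) by (metis convex_ball convex_imp_contractible)
  have sq: "norm (f z) powr (1/2) = norm (g z)" if "norm z \<le> 1" for z
    using g(2)[of z] that R' by (simp add: norm_power powr_half_sqrt)
  show ?case
    using norm_le_poisson[OF g(1) R'(1) r, of \<theta>] sq r by (simp add: norm_mult)
next
  case (insert a Z)
  have a: "norm a < 1" "f a = 0" "a \<in> ball 0 R" using insert.prems R by auto
  have "f 1 \<noteq> 0"
  proof
    assume "f 1 = 0"
    then have "1 \<in> insert a Z" using insert.prems(2) by auto
    then show False using insert.prems(3) by auto
  qed
  then have "\<not> f constant_on ball 0 R"
    using a R unfolding constant_on_def by (metis dist_0_norm mem_ball norm_one)
  then obtain h m where h: "h holomorphic_on ball 0 R" "h a \<noteq> 0"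
      "\<And>w. w \<in> ball 0 R \<Longrightarrow> f w = (w - a) ^ m * h w" "m > 0"
    using holomorphic_divide_zero[OF insert.prems(1) _ _ a(3) a(2)] by auto
  \<comment> \<open>All m factors at a are exchanged at once, so that the zero set loses exactly the
    point a.\<close>
  define f1 where "f1 = (\<lambda>w. (1 - cnj a * w) ^ m * h w)"
  have nz: "1 - cnj a * w \<noteq> 0" if "norm w \<le> 1" for w
  proof
    assume "1 - cnj a * w = 0"
    then have "norm (cnj a * w) = 1" by (metis eq_iff_diff_eq_0 norm_one)
    moreover have "norm (cnj a * w) \<le> norm a * 1" unfolding norm_mult using that by (intro mult_mono) auto
    ultimately show False using a by simp
  qed
  have "ennreal (norm (f1 (of_real r * cis \<theta>)) powr (1/2))
    \<le> (\<integral>\<^sup>+t. ennreal (norm (f1 (cis t)) powr (1/2) * poisson r (\<theta> - t)) \<partial>circ)"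
  proof (rule insert.IH)
    show "f1 holomorphic_on ball 0 R" unfolding f1_def by (intro holomorphic_intros h(1))
    have "f1 w = 0 \<longleftrightarrow> f w = 0 \<and> w \<noteq> a" if "norm w \<le> 1" for w
      using that nz[OF that] h(2) h(3)[of w] h(4) R by (auto simp: f1_def)
    then have "{z \<in> cball 0 1. f1 z = 0} = {z \<in> cball 0 1. f z = 0} - {a}" by auto
    then show "{z \<in> cball 0 1. f1 z = 0} = Z" using insert.hyps insert.prems(2) by auto
    show "Z \<subseteq> ball 0 1" using insert.prems(3) by auto
  qed
  moreover have "ennreal (norm (f (of_real r * cis \<theta>)) powr (1/2)) \<le> ennreal (norm (f1 (of_real r * cis \<theta>)) powr (1/2))"
  proof (intro ennreal_leI powr_mono2)
    show "norm (f (of_real r * cis \<theta>)) \<le> norm (f1 (of_real r * cis \<theta>))"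
      using r R a by (subst h(3)) (auto simp: f1_def norm_mult norm_power intro!: mult_right_mono power_mono blaschke_norm_le)
  qed auto
  moreover have "norm (f1 (cis t)) = norm (f (cis t))" for t
    using R blaschke_norm_eq[of "cis t" a] by (simp add: f1_def h(3) norm_mult norm_power)
  ultimately show ?case
    by (simp only:)
qed

text \<open>Dilation by s carries the unit circle to the circle of radius s, where the finite case
  applies as soon as no zero has modulus s. Constants are treated directly, since the finiteness of
  the zeros in a compact disc is a statement about non-constant functions.\<close>

lemma sqrt_norm_le_poisson:
  assumes G: "G holomorphic_on unit_disc" and r: "0 \<le> r" "r < \<rho>" and \<rho>: "\<rho> < 1"
  shows "ennreal (norm (G (of_real r * cis \<theta>)) powr (1/2))
    \<le> (\<integral>\<^sup>+t. ennreal (norm (G (of_real \<rho> * cis t)) powr (1/2) * poisson (r/\<rho>) (\<theta> - t)) \<partial>circ)"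
proof (cases "G constant_on unit_disc")
  case True
  then obtain c where c: "\<And>z. norm z < 1 \<Longrightarrow> G z = c" by (auto simp: constant_on_def)
  have q: "0 \<le> r/\<rho>" "r/\<rho> < 1" using r by auto
  have "(\<integral>\<^sup>+t. ennreal (norm (G (of_real \<rho> * cis t)) powr (1/2) * poisson (r/\<rho>) (\<theta> - t)) \<partial>circ)
      = (\<integral>\<^sup>+t. ennreal (norm c powr (1/2)) * ennreal (poisson (r/\<rho>) (\<theta> - t)) \<partial>circ)"
    using r \<rho> poisson_nonneg[OF q] by (intro nn_integral_cong) (simp add: c norm_mult ennreal_mult)
  also have "\<dots> = ennreal (norm c powr (1/2))"
    by (simp add: nn_integral_cmult nn_integral_poisson[OF q])
  finally show ?thesis using r \<rho> by (simp add: c norm_mult)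
next
  case False
  have q: "0 \<le> r/\<rho>" "r/\<rho> < 1" using r by auto
  \<comment> \<open>A slightly larger closed disc: it contains finitely many zeros and leaves room
    for radii above \<rho>.\<close>
  define \<rho>1 where "\<rho>1 = (1 + \<rho>) / 2"
  have \<rho>1: "\<rho> < \<rho>1" "\<rho>1 < 1" using \<rho> by (auto simp: \<rho>1_def)
  define Z where "Z = {z \<in> cball 0 \<rho>1. G z = 0}"
  have "finite Z" unfolding Z_def
    by (rule holomorphic_compact_finite_zeros[OF G _ _ _ _ False]) (use \<rho>1 in auto)
  then have finN: "finite (norm ` Z)" by simp
  have good: "ennreal (norm (G (of_real r * cis \<theta>)) powr (1/2))
    \<le> (\<integral>\<^sup>+t. ennreal (norm (G (of_real s * cis t)) powr (1/2) * poisson (r/s) (\<theta> - t)) \<partial>circ)"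
    if s: "r < s" "s < \<rho>1" "s \<notin> norm ` Z" for s
  proof -
    have s0: "s > 0" using s r by simp
    let ?f = "\<lambda>z. G (of_real s * z)"
    have "ennreal (norm (?f (of_real (r/s) * cis \<theta>)) powr (1/2))
        \<le> (\<integral>\<^sup>+t. ennreal (norm (?f (cis t)) powr (1/2) * poisson (r/s) (\<theta> - t)) \<partial>circ)"
    proof (rule sqrt_norm_le_poisson_finite[OF _ _ _ _ _ refl])
      show "1 < \<rho>1 / s" using s s0 by simp
      show "?f holomorphic_on ball 0 (\<rho>1 / s)"
        using s0 \<rho>1 by (intro holomorphic_on_compose_gen[OF _ G, unfolded o_def] holomorphic_intros)
          (auto simp: norm_mult field_simps intro: less_trans)
      have "{z \<in> cball 0 1. ?f z = 0} \<subseteq> (\<lambda>z. z / of_real s) ` Z"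
      proof
        fix z assume z: "z \<in> {z \<in> cball 0 1. ?f z = 0}"
        then have "norm (of_real s * z) \<le> s * 1" unfolding norm_mult using s0 by (intro mult_mono) auto
        then have "of_real s * z \<in> Z" using z s by (auto simp: Z_def)
        then show "z \<in> (\<lambda>z. z / of_real s) ` Z" using s0 by (intro image_eqI[of _ _ "of_real s * z"]) auto
      qed
      then show "finite {z \<in> cball 0 1. ?f z = 0}" using \<open>finite Z\<close> finite_surj by blast
      show "{z \<in> cball 0 1. ?f z = 0} \<subseteq> ball 0 1"
      proof
        fix z assume z: "z \<in> {z \<in> cball 0 1. ?f z = 0}"
        have "norm z \<noteq> 1"
        proof
          assume "norm z = 1"
          then have "norm (of_real s * z) = s" using s0 by (simp add: norm_mult)
          moreover from this have "of_real s * z \<in> Z" using z s by (auto simp: Z_def)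
          ultimately show False using s(3) by force
        qed
        then show "z \<in> ball 0 1" using z by auto
      qed
    qed (use s s0 r in auto)
    then show ?thesis using s0 by simp
  qed
  text \<open>The zeros lie on finitely many circles, so \<open>\<rho>\<close> is a limit of radii without zeros.\<close>
  define s where "s = (\<lambda>n. \<rho> + (\<rho>1 - \<rho>) / real (n + 2))"
  have s_lt: "r < s n" "s n < \<rho>1" "\<rho> < s n" for n
  proof -
    have "(\<rho>1 - \<rho>) / real (n + 2) > 0" using \<rho>1 by simp
    moreover have "(\<rho>1 - \<rho>) / real (n + 2) < (\<rho>1 - \<rho>) / 1" using \<rho>1 by (intro divide_strict_left_mono) auto
    ultimately show "r < s n" "s n < \<rho>1" "\<rho> < s n" using r by (auto simp: s_def)
  qed
  have s_lim: "s \<longlonglongrightarrow> \<rho>"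
    unfolding s_def by real_asymp
  have "inj s"
    unfolding s_def using \<rho>1 by (auto simp: inj_def)
  then have "finite (s -` (norm ` Z))" using finN by (intro finite_vimageI)
  then have ev: "eventually (\<lambda>n. s n \<notin> norm ` Z) sequentially"
    unfolding cofinite_eq_sequentially[symmetric] eventually_cofinite by (simp add: vimage_def)
  obtain K where K: "K \<ge> 0" "\<And>z. norm z \<le> \<rho>1 \<Longrightarrow> norm (G z) \<le> K"
    using holomorphic_circle_bounded[OF G \<rho>1(2)] by blast
  have \<rho>0: "\<rho> > 0" using r by simp
  have sr: "r / s n \<le> r / \<rho>" "0 \<le> r / s n" "r / s n < 1" for n
    using s_lt[of n] r \<rho>0 by (auto intro!: divide_left_mono mult_pos_pos intro: less_trans)
  have "(\<lambda>n. \<integral>\<^sup>+t. ennreal (norm (G (of_real (s n) * cis t)) powr (1/2) * poisson (r/s n) (\<theta> - t)) \<partial>circ)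
      \<longlonglongrightarrow> (\<integral>\<^sup>+t. ennreal (norm (G (of_real \<rho> * cis t)) powr (1/2) * poisson (r/\<rho>) (\<theta> - t)) \<partial>circ)"
  proof (rule nn_integral_dominated_convergence[where w = "\<lambda>t. ennreal (K powr (1/2) * (2 / (1 - r/\<rho>)))"])
    have [measurable]: "(\<lambda>t. G (of_real (s n) * cis t)) \<in> borel_measurable borel" for n
      by (rule holomorphic_circle_measurable[OF G]) (use s_lt[of n] r \<rho>1 in auto)
    have [measurable]: "(\<lambda>t. G (of_real \<rho> * cis t)) \<in> borel_measurable borel"
      by (rule holomorphic_circle_measurable[OF G]) (use \<rho> \<rho>0 in auto)
    show "(\<lambda>t. ennreal (norm (G (of_real (s n) * cis t)) powr (1/2) * poisson (r/s n) (\<theta> - t))) \<in> borel_measurable circ" for n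
      by measurable
    show "(\<lambda>t. ennreal (norm (G (of_real \<rho> * cis t)) powr (1/2) * poisson (r/\<rho>) (\<theta> - t))) \<in> borel_measurable circ"
      by measurable
    show "AE t in circ. ennreal (norm (G (of_real (s n) * cis t)) powr (1/2) * poisson (r/s n) (\<theta> - t))
        \<le> ennreal (K powr (1/2) * (2 / (1 - r/\<rho>)))" for n
    proof (intro AE_I2 ennreal_leI mult_mono)
      fix t
      show "norm (G (of_real (s n) * cis t)) powr (1/2) \<le> K powr (1/2)"
        using K s_lt[of n] r by (intro powr_mono2) (auto simp: norm_mult)
      show "poisson (r / s n) (\<theta> - t) \<le> 2 / (1 - r / \<rho>)"
        using sr q by (intro poisson_le) auto
      show "0 \<le> poisson (r / s n) (\<theta> - t)" using sr by (intro poisson_nonneg)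
    qed (use K in auto)
    show "AE t in circ. (\<lambda>n. ennreal (norm (G (of_real (s n) * cis t)) powr (1/2) * poisson (r/s n) (\<theta> - t)))
        \<longlonglongrightarrow> ennreal (norm (G (of_real \<rho> * cis t)) powr (1/2) * poisson (r/\<rho>) (\<theta> - t))"
    proof (intro AE_I2 tendsto_ennrealI tendsto_mult)
      fix t
      have "isCont G (of_real \<rho> * cis t)"
        using holomorphic_on_imp_continuous_on[OF G] \<rho> \<rho>0
        by (intro continuous_on_interior[of unit_disc]) (auto simp: norm_mult)
      then have "(\<lambda>n. G (of_real (s n) * cis t)) \<longlonglongrightarrow> G (of_real \<rho> * cis t)"
        by (rule isCont_tendsto_compose) (intro tendsto_intros s_lim)
      then show "(\<lambda>n. norm (G (of_real (s n) * cis t)) powr (1/2)) \<longlonglongrightarrow> norm (G (of_real \<rho> * cis t)) powr (1/2)"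
        by (intro tendsto_powr2 tendsto_norm tendsto_const) auto
      have "1 - of_real (r / \<rho>) * cis (\<theta> - t) \<noteq> 0"
        using norm_one_minus_cis_ge[OF q(1), of "\<theta> - t"] q(2) by (metis diff_gt_0_iff_gt norm_zero not_le)
      then show "(\<lambda>n. poisson (r / s n) (\<theta> - t)) \<longlonglongrightarrow> poisson (r / \<rho>) (\<theta> - t)"
        unfolding poisson_def using \<rho>0 by (intro tendsto_intros s_lim) auto
    qed
  qed (simp_all add: ennreal_mult_less_top)
  then show ?thesis
    by (rule tendsto_lowerbound) (use ev good s_lt in \<open>auto elim!: eventually_mono\<close>)
qed

lemma powr_sqrt_double: "x \<ge> 0 \<Longrightarrow> (x powr (1/2)) powr (2 * p) = x powr p" for x :: real
  by (simp add: powr_powr)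

text \<open>Jensen with exponent 2p applied to |G|^(1/2). This yields the sub-mean-value property of
  |G|^p and, by integration, the monotonicity of the means in the radius.\<close>

lemma norm_powr_le_poisson:
  assumes G: "G holomorphic_on unit_disc" and r: "0 \<le> r" "r < \<rho>" and \<rho>: "\<rho> < 1" and p: "p \<ge> 1"
  shows "ennreal (norm (G (of_real r * cis \<theta>)) powr p)
      \<le> (\<integral>\<^sup>+t. ennreal (norm (G (of_real \<rho> * cis t)) powr p * poisson (r/\<rho>) (\<theta> - t)) \<partial>circ)"
    and "mean_pow p r G \<le> mean_pow p \<rho> G"
proof -
  have q: "0 \<le> r/\<rho>" "r/\<rho> < 1" using r by auto
  have [measurable]: "(\<lambda>t. G (of_real \<rho> * cis t)) \<in> borel_measurable borel"
    by (rule holomorphic_circle_measurable[OF G]) (use r \<rho> in auto)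
  note * = poisson_contraction[of "\<lambda>t. norm (G (of_real \<rho> * cis t)) powr (1/2)" "2 * p" "r/\<rho>"
      "\<lambda>\<theta>. norm (G (of_real r * cis \<theta>)) powr (1/2)", OF _ _ _ q _ sqrt_norm_le_poisson[OF G r \<rho>]]
  show "ennreal (norm (G (of_real r * cis \<theta>)) powr p)
      \<le> (\<integral>\<^sup>+t. ennreal (norm (G (of_real \<rho> * cis t)) powr p * poisson (r/\<rho>) (\<theta> - t)) \<partial>circ)"
    using *(1)[of \<theta>] p by (simp add: powr_sqrt_double)
  show "mean_pow p r G \<le> mean_pow p \<rho> G"
    using *(2) p by (simp add: powr_sqrt_double mean_pow_def)
qed

lemma mean_pow_mono:
  assumes "G holomorphic_on unit_disc" "0 \<le> r" "r \<le> \<rho>" "\<rho> < 1" "p \<ge> 1"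
  shows "mean_pow p r G \<le> mean_pow p \<rho> G"
  using norm_powr_le_poisson(2)[OF assms(1,2), of \<rho> p] assms by (cases "r = \<rho>") auto

lemma norm_powr_le_mean_pow:
  assumes G: "G holomorphic_on unit_disc" and z: "norm z \<le> r" "r < \<rho>" and \<rho>: "\<rho> < 1" and p: "p \<ge> 1"
  shows "ennreal (norm (G z) powr p) \<le> ennreal (2 / (1 - r/\<rho>)) * mean_pow p \<rho> G"
proof -
  have r: "0 \<le> norm z" "norm z < \<rho>" using z by auto
  have \<rho>0: "\<rho> > 0" using r by linarith
  have q: "0 \<le> norm z/\<rho>" "norm z/\<rho> \<le> r/\<rho>" "r / \<rho> < 1" using r z \<rho>0 by (auto intro: divide_right_mono)
  have [measurable]: "(\<lambda>t. G (of_real \<rho> * cis t)) \<in> borel_measurable borel"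
    by (rule holomorphic_circle_measurable[OF G]) (use \<rho>0 \<rho> in auto)
  have "z = of_real (norm z) * cis (Arg z)" by (metis rcis_cmod_Arg rcis_def)
  then have "ennreal (norm (G z) powr p)
      \<le> (\<integral>\<^sup>+t. ennreal (norm (G (of_real \<rho> * cis t)) powr p * poisson (norm z/\<rho>) (Arg z - t)) \<partial>circ)"
    using norm_powr_le_poisson(1)[OF G r \<rho> p, of "Arg z"] by simp
  also have "\<dots> \<le> (\<integral>\<^sup>+t. ennreal (2 / (1 - r/\<rho>)) * ennreal (norm (G (of_real \<rho> * cis t)) powr p) \<partial>circ)"
  proof (rule nn_integral_mono)
    fix t
    have "norm (G (of_real \<rho> * cis t)) powr p * poisson (norm z/\<rho>) (Arg z - t)
        \<le> norm (G (of_real \<rho> * cis t)) powr p * (2 / (1 - r/\<rho>))"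
      by (intro mult_left_mono poisson_le q) auto
    then show "ennreal (norm (G (of_real \<rho> * cis t)) powr p * poisson (norm z/\<rho>) (Arg z - t))
        \<le> ennreal (2 / (1 - r/\<rho>)) * ennreal (norm (G (of_real \<rho> * cis t)) powr p)"
      using q by (subst ennreal_mult[symmetric]) (auto intro!: ennreal_leI simp: mult.commute)
  qed
  also have "\<dots> = ennreal (2 / (1 - r/\<rho>)) * mean_pow p \<rho> G"
    unfolding mean_pow_def by (rule nn_integral_cmult) measurable
  finally show ?thesis .
qed

text \<open>Passage to the boundary. Cutting \<open>|G|\<^sup>1\<^sup>/\<^sup>2\<close> at height \<open>k\<close> costs at most \<open>k\<^bsup>1-2p\<^esup> |G|\<^sup>p\<close>, so that
  boundedness of the means replaces uniform integrability; this uses that \<open>G\<close> is holomorphic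
  (for \<open>p = 1\<close> the corresponding statement fails for harmonic functions).\<close>

theorem mean_pow_le_boundary:
  assumes G: "G holomorphic_on unit_disc" and p: "p \<ge> 1"
    and B: "\<And>r. 0 < r \<Longrightarrow> r < 1 \<Longrightarrow> mean_pow p r G \<le> ennreal B" "B \<ge> 0"
    and s: "\<And>n. 0 < s n" "\<And>n. s n < 1" "s \<longlonglongrightarrow> 1"
    and [measurable]: "g \<in> borel_measurable borel" and g: "\<And>t. g t \<ge> 0"
    and lim: "AE t in circ. (\<lambda>n. norm (G (of_real (s n) * cis t))) \<longlonglongrightarrow> g t"
    and r: "0 \<le> r" "r < 1"
  shows "mean_pow p r G \<le> (\<integral>\<^sup>+t. ennreal (g t powr p) \<partial>circ)"
proof -
  have meas[measurable]: "(\<lambda>t. G (of_real (s n) * cis t)) \<in> borel_measurable borel" for n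
    by (rule holomorphic_circle_measurable[OF G]) (use s(1)[of n] s(2)[of n] in auto)
  \<comment> \<open>The value of \<open>r / s n\<close> at \<open>s n = (1 + r) / 2\<close>: from
    there on it bounds the ratio, and K bounds the Poisson kernel.\<close>
  define q0 where "q0 = 2 * r / (1 + r)"
  have q0: "q0 < 1" "0 \<le> q0" using r by (auto simp: q0_def field_simps)
  define K where "K = 2 / (1 - q0)"
  have K: "K > 0" using q0 by (simp add: K_def)
  have ev: "eventually (\<lambda>n. (1 + r) / 2 < s n) sequentially"
    using s(3) r by (intro order_tendstoD(1)) auto
  have qs: "r / s n \<le> q0" "0 \<le> r / s n" "r / s n < 1" "r < s n" if "(1 + r) / 2 < s n" for n
  proof -
    have "r / s n \<le> r / ((1 + r)/2)" using that r by (intro divide_left_mono) auto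
    then show "r / s n \<le> q0" by (simp add: q0_def mult.commute)
    then show "r / s n < 1" using q0 by simp
    show "0 \<le> r / s n" using s(1)[of n] r by simp
    show "r < s n" using that r by (simp add: field_simps)
  qed
  have main: "ennreal (norm (G (of_real r * cis \<theta>)) powr (1/2))
      \<le> (\<integral>\<^sup>+t. ennreal (g t powr (1/2) * poisson r (\<theta> - t)) \<partial>circ)" for \<theta>
  proof -
    have cut: "ennreal (norm (G (of_real r * cis \<theta>)) powr (1/2))
      \<le> (\<integral>\<^sup>+t. ennreal (g t powr (1/2) * poisson r (\<theta> - t)) \<partial>circ) + ennreal (k powr (1 - 2*p) * K * B)"
      if k: "k > 0" for k :: real
    proof -
      \<comment> \<open>Both factors are cut so that the constant k * K dominates for every n. The
        cut at K is inactive once (1 + r)/2 < s n; the cut at k is paid for by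
        \<open>split\<close>.\<close>
      have "(\<lambda>n. (\<integral>\<^sup>+t. ennreal (min k (norm (G (of_real (s n) * cis t)) powr (1/2)) * min K (poisson (r/s n) (\<theta> - t))) \<partial>circ))
          \<longlonglongrightarrow> (\<integral>\<^sup>+t. ennreal (min k (g t powr (1/2)) * min K (poisson r (\<theta> - t))) \<partial>circ)"
      proof (rule nn_integral_dominated_convergence[where w = "\<lambda>t. ennreal (k * K)"])
        show "AE t in circ. ennreal (min k (norm (G (of_real (s n) * cis t)) powr (1/2)) * min K (poisson (r/s n) (\<theta> - t))) \<le> ennreal (k * K)" for n
        proof (intro AE_I2 ennreal_leI)
          fix t
          have "min k (norm (G (of_real (s n) * cis t)) powr (1/2)) * min K (poisson (r/s n) (\<theta> - t)) \<le> min k (norm (G (of_real (s n) * cis t)) powr (1/2)) * K"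
            using k by (intro mult_left_mono) auto
          also have "\<dots> \<le> k * K" using K by (intro mult_right_mono) auto
          finally show "min k (norm (G (of_real (s n) * cis t)) powr (1/2)) * min K (poisson (r/s n) (\<theta> - t)) \<le> k * K" .
        qed
        show "AE t in circ. (\<lambda>n. ennreal (min k (norm (G (of_real (s n) * cis t)) powr (1/2)) * min K (poisson (r/s n) (\<theta> - t))))
            \<longlonglongrightarrow> ennreal (min k (g t powr (1/2)) * min K (poisson r (\<theta> - t)))"
          using lim
        proof eventually_elim
          case (elim t)
          have "(\<lambda>n. norm (G (of_real (s n) * cis t)) powr (1/2)) \<longlonglongrightarrow> g t powr (1/2)"
            using elim by (intro tendsto_powr2 tendsto_const) auto
          moreover have "1 - of_real r * cis (\<theta> - t) \<noteq> 0"
            using norm_one_minus_cis_ge[OF r(1), of "\<theta> - t"] r(2) by (metis diff_gt_0_iff_gt norm_zero not_le)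
          then have "(\<lambda>n. poisson (r / s n) (\<theta> - t)) \<longlonglongrightarrow> poisson (r / 1) (\<theta> - t)"
            unfolding poisson_def by (intro tendsto_intros s) auto
          ultimately show ?case
            by (intro tendsto_ennrealI tendsto_mult tendsto_min tendsto_const) auto
        qed
      qed (simp_all add: ennreal_mult_less_top)
      then have lim': "(\<lambda>n. (\<integral>\<^sup>+t. ennreal (min k (norm (G (of_real (s n) * cis t)) powr (1/2)) * min K (poisson (r/s n) (\<theta> - t))) \<partial>circ) + ennreal (k powr (1 - 2*p) * K * B))
          \<longlonglongrightarrow> (\<integral>\<^sup>+t. ennreal (min k (g t powr (1/2)) * min K (poisson r (\<theta> - t))) \<partial>circ) + ennreal (k powr (1 - 2*p) * K * B)"
        by (rule tendsto_add[OF _ tendsto_const])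
      have step: "ennreal (norm (G (of_real r * cis \<theta>)) powr (1/2))
          \<le> (\<integral>\<^sup>+t. ennreal (min k (norm (G (of_real (s n) * cis t)) powr (1/2)) * min K (poisson (r/s n) (\<theta> - t))) \<partial>circ) + ennreal (k powr (1 - 2*p) * K * B)"
        if n: "(1 + r) / 2 < s n" for n
      proof -
        note Q = qs[OF n]
        define f where "f = (\<lambda>t. norm (G (of_real (s n) * cis t)))"
        have [measurable]: "f \<in> borel_measurable borel" unfolding f_def by measurable
        have f0: "f t \<ge> 0" for t by (simp add: f_def)
        have P: "poisson (r/s n) x \<le> K" "poisson (r/s n) x \<ge> 0" for x
          using poisson_le[OF Q(2) Q(1) q0(1)] poisson_nonneg[OF Q(2,3)] by (auto simp: K_def)
        \<comment> \<open>Where x^(1/2) > k, write x^(1/2) = x^p * x^(1/2 - p) and bound the last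
          factor by k^(1 - 2p).\<close>
        have split: "x powr (1/2) \<le> min k (x powr (1/2)) + k powr (1 - 2*p) * x powr p" if x: "x \<ge> 0" for x :: real
        proof (cases "x powr (1/2) \<le> k")
          case False
          then have "k powr (2*p-1) \<le> (x powr (1/2)) powr (2*p-1)" using k p by (intro powr_mono2) auto
          also have "\<dots> = x powr (p - 1/2)" by (simp add: powr_powr algebra_simps)
          finally have "k powr (1 - 2*p) * k powr (2*p-1) * x powr (1/2) \<le> k powr (1 - 2*p) * x powr (p - 1/2) * x powr (1/2)"
            by (intro mult_right_mono mult_left_mono) auto
          also have "k powr (1 - 2*p) * k powr (2*p-1) = 1" using k by (simp add: powr_add[symmetric])
          also have "k powr (1 - 2*p) * x powr (p - 1/2) * x powr (1/2) = k powr (1 - 2*p) * x powr p"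
            using x by (simp add: mult.assoc powr_add[symmetric])
          finally show ?thesis using k by (auto simp: min_def)
        qed (use k in auto)
        have "ennreal (norm (G (of_real r * cis \<theta>)) powr (1/2))
            \<le> (\<integral>\<^sup>+t. ennreal (f t powr (1/2) * poisson (r/s n) (\<theta> - t)) \<partial>circ)"
          unfolding f_def by (rule sqrt_norm_le_poisson[OF G r(1) Q(4) s(2)])
        also have "\<dots> \<le> (\<integral>\<^sup>+t. ennreal (min k (f t powr (1/2)) * min K (poisson (r/s n) (\<theta> - t)))
            + ennreal (k powr (1 - 2*p) * K) * ennreal (f t powr p) \<partial>circ)"
        proof (rule nn_integral_mono)
          fix t
          have "f t powr (1/2) * poisson (r/s n) (\<theta> - t) \<le> (min k (f t powr (1/2)) + k powr (1 - 2*p) * f t powr p) * poisson (r/s n) (\<theta> - t)"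
            by (intro mult_right_mono split f0 P)
          also have "\<dots> \<le> min k (f t powr (1/2)) * min K (poisson (r/s n) (\<theta> - t)) + (k powr (1 - 2*p) * f t powr p) * K"
            using P[of "\<theta> - t"] f0[of t] by (auto simp: distrib_right min_absorb2 intro!: mult_left_mono)
          finally have "ennreal (f t powr (1/2) * poisson (r/s n) (\<theta> - t))
              \<le> ennreal (min k (f t powr (1/2)) * min K (poisson (r/s n) (\<theta> - t)) + (k powr (1 - 2*p) * f t powr p) * K)"
            by (rule ennreal_leI)
          also have "\<dots> = ennreal (min k (f t powr (1/2)) * min K (poisson (r/s n) (\<theta> - t)))
              + ennreal (k powr (1 - 2*p) * K) * ennreal (f t powr p)"
            using P[of "\<theta> - t"] k K by (subst ennreal_plus) (auto simp: ennreal_mult[symmetric] mult_ac)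
          finally show "ennreal (f t powr (1/2) * poisson (r/s n) (\<theta> - t))
            \<le> ennreal (min k (f t powr (1/2)) * min K (poisson (r/s n) (\<theta> - t)))
              + ennreal (k powr (1 - 2*p) * K) * ennreal (f t powr p)" .
        qed
        also have "\<dots> = (\<integral>\<^sup>+t. ennreal (min k (f t powr (1/2)) * min K (poisson (r/s n) (\<theta> - t))) \<partial>circ)
            + ennreal (k powr (1 - 2*p) * K) * mean_pow p (s n) G"
          unfolding mean_pow_def f_def by (subst nn_integral_add) (auto simp: nn_integral_cmult)
        also have "\<dots> \<le> (\<integral>\<^sup>+t. ennreal (min k (f t powr (1/2)) * min K (poisson (r/s n) (\<theta> - t))) \<partial>circ)
            + ennreal (k powr (1 - 2*p) * K) * ennreal B"
          by (intro add_left_mono mult_left_mono B s) auto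
        finally show ?thesis using K B(2) by (simp add: f_def ennreal_mult)
      qed
      have "ennreal (norm (G (of_real r * cis \<theta>)) powr (1/2))
        \<le> (\<integral>\<^sup>+t. ennreal (min k (g t powr (1/2)) * min K (poisson r (\<theta> - t))) \<partial>circ) + ennreal (k powr (1 - 2*p) * K * B)"
        by (rule tendsto_lowerbound[OF lim']) (use ev step in \<open>auto elim!: eventually_mono\<close>)
      also have "\<dots> \<le> (\<integral>\<^sup>+t. ennreal (g t powr (1/2) * poisson r (\<theta> - t)) \<partial>circ) + ennreal (k powr (1 - 2*p) * K * B)"
        using k K poisson_nonneg[OF r] by (intro add_right_mono nn_integral_mono ennreal_leI mult_mono) auto
      finally show ?thesis .
    qed
    \<comment> \<open>The exponent 1 - 2p is negative, so the price of the cut vanishes as k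
      grows.\<close>
    have "((\<lambda>k::real. k powr (1 - 2*p)) \<longlongrightarrow> 0) at_top"
      using p by (intro tendsto_neg_powr filterlim_ident) auto
    then have "((\<lambda>k. (\<integral>\<^sup>+t. ennreal (g t powr (1/2) * poisson r (\<theta> - t)) \<partial>circ) + ennreal (k powr (1 - 2*p) * K * B))
        \<longlongrightarrow> (\<integral>\<^sup>+t. ennreal (g t powr (1/2) * poisson r (\<theta> - t)) \<partial>circ) + ennreal (0 * K * B)) at_top"
      by (intro tendsto_intros tendsto_ennrealI)
    from tendsto_lowerbound[OF this, of "ennreal (norm (G (of_real r * cis \<theta>)) powr (1/2))"] show ?thesis
      using cut by (auto intro: eventually_mono[OF eventually_gt_at_top[of 0]])
  qed
  have "(\<integral>\<^sup>+\<theta>. ennreal ((norm (G (of_real r * cis \<theta>)) powr (1/2)) powr (2*p)) \<partial>circ)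
      \<le> (\<integral>\<^sup>+t. ennreal ((g t powr (1/2)) powr (2*p)) \<partial>circ)"
    by (rule poisson_contraction(2)[OF _ _ _ r _ main]) (use p in auto)
  then show ?thesis using g by (simp add: mean_pow_def powr_sqrt_double)
qed

section \<open>Kernel estimates\<close>

text \<open>Cut at y = d. Below, the maximum is d and a > -1 gives convergence; above, the integrand
  is y^(a - b) and b > a + 1 does. Both parts scale like d^(a + 1 - b).\<close>

lemma nn_integral_max_powr:
  fixes a b d :: real
  assumes a: "a > -1" and b: "b > a + 1" and d: "d > 0"
  shows "(\<integral>\<^sup>+y. ennreal (y powr a * max d y powr (-b)) * indicator {0..} y \<partial>lborel)
      \<le> ennreal ((1 / (a+1) + 1 / (b-a-1)) * d powr (a+1-b))"
proof -
  have "(\<integral>\<^sup>+y. ennreal (y powr a * max d y powr (-b)) * indicator {0..} y \<partial>lborel)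
      \<le> (\<integral>\<^sup>+y. ennreal (d powr (-b)) * (ennreal (y powr a) * indicator {0..d} y) + ennreal (y powr (a-b)) * indicator {d..} y \<partial>lborel)"
  proof (rule nn_integral_mono)
    fix y :: real
    show "ennreal (y powr a * max d y powr (-b)) * indicator {0..} y
        \<le> ennreal (d powr (-b)) * (ennreal (y powr a) * indicator {0..d} y) + ennreal (y powr (a-b)) * indicator {d..} y"
    proof (cases "y < d")
      case True
      then show ?thesis by (auto simp: indicator_def ennreal_mult max_def mult.commute)
    next
      case False
      then have "y powr a * max d y powr (-b) = y powr (a - b)"
        using d by (simp add: powr_diff powr_minus field_simps max_def)
      then show ?thesis using False d by (auto simp: indicator_def)
    qed
  qed
  also have "\<dots> = ennreal (d powr (-b)) * (\<integral>\<^sup>+y. ennreal (y powr a) * indicator {0..d} y \<partial>lborel)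
      + (\<integral>\<^sup>+y. ennreal (y powr (a-b)) * indicator {d..} y \<partial>lborel)"
    by (subst nn_integral_add) (auto simp: nn_integral_cmult)
  also have "(\<integral>\<^sup>+y. ennreal (y powr a) * indicator {0..d} y \<partial>lborel) = ennreal (d powr (a+1) / (a+1))"
    by (rule nn_integral_has_integral_lebesgue'[OF _ has_integral_powr_from_0[OF a]]) (use d in auto)
  also have "(\<integral>\<^sup>+y. ennreal (y powr (a-b)) * indicator {d..} y \<partial>lborel) = ennreal (- (d powr (a-b+1)) / (a-b+1))"
    by (rule nn_integral_has_integral_lebesgue'[OF _ has_integral_powr_to_inf]) (use b d in auto)
  also have "ennreal (d powr (-b)) * ennreal (d powr (a+1) / (a+1)) + ennreal (- (d powr (a-b+1)) / (a-b+1))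
      = ennreal (d powr (-b) * (d powr (a+1) / (a+1)) + - (d powr (a-b+1)) / (a-b+1))"
    using a b by (subst ennreal_plus) (auto simp: ennreal_mult[symmetric] divide_nonneg_neg)
  also have "d powr (-b) * (d powr (a+1) / (a+1)) + - (d powr (a-b+1)) / (a-b+1) = (1 / (a+1) + 1 / (b-a-1)) * d powr (a+1-b)"
  proof -
    have "d powr (-b) * (d powr (a+1) / (a+1)) = d powr (a+1-b) / (a+1)"
      by (simp add: powr_add[symmetric] algebra_simps)
    moreover have "- (d powr (a-b+1)) / (a-b+1) = d powr (a+1-b) / (b-a-1)"
      by (simp add: minus_divide_left[symmetric] minus_divide_right algebra_simps)
    ultimately show ?thesis by (simp add: algebra_simps)
  qed
  finally show ?thesis .
qed

lemma sin_ge_linear: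
  assumes "0 \<le> x" "x \<le> pi/2"
  shows "sin x \<ge> 2 * x / pi"
proof -
  have "convex_on {0..pi/2} (\<lambda>x. - sin x)"
    by (rule f''_ge0_imp_convex[where f' = "\<lambda>x. - cos x" and f'' = sin])
       (auto intro!: derivative_eq_intros sin_ge_zero)
  from convex_onD_Icc'[OF this, of x] assms show ?thesis by simp
qed

text \<open>For q > 1/4, use |1 - q e^(it)|^2 = (1 - q)^2 + 4 q sin^2(t/2) and the chord bound for
  the sine. For q <= 1/4 the modulus is at least 3/4, while |t| <= pi < 15/4. The constant 5 serves
  both cases.\<close>

lemma norm_one_minus_cis_lower:
  assumes q: "0 \<le> q" "q < 1" and t: "\<bar>t\<bar> \<le> pi"
  shows "norm (1 - of_real q * cis t) \<ge> max (1 - q) \<bar>t\<bar> / 5"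
proof -
  have 1: "norm (1 - of_real q * cis t) \<ge> 1 - q" by (rule norm_one_minus_cis_ge[OF q(1)])
  have "norm (1 - of_real q * cis t) \<ge> \<bar>t\<bar> / 5"
  proof (cases "q \<le> 1/4")
    case True
    have "\<bar>t\<bar> \<le> 15/4" using t pi_approx by simp
    then show ?thesis using 1 True by linarith
  next
    case False
    have "(norm (1 - of_real q * cis t))\<^sup>2 = (1 - q)\<^sup>2 + 4 * q * (sin (\<bar>t\<bar>/2))\<^sup>2"
    proof -
      have c: "cos t = 1 - 2 * (sin (\<bar>t\<bar>/2))\<^sup>2"
        using cos_double_sin[of "\<bar>t\<bar>/2"] by simp
      have "(norm (1 - of_real q * cis t))\<^sup>2 = (1 - q * cos t)\<^sup>2 + (q * sin t)\<^sup>2"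
        by (simp add: cmod_power2)
      also have "\<dots> = 1 - 2 * q * cos t + q\<^sup>2 * ((sin t)\<^sup>2 + (cos t)\<^sup>2)"
        by algebra
      also have "(sin t)\<^sup>2 + (cos t)\<^sup>2 = 1" by simp
      also have "1 - 2 * q * cos t + q\<^sup>2 * 1 = (1 - q)\<^sup>2 + 4 * q * (sin (\<bar>t\<bar>/2))\<^sup>2"
        by (simp add: c power2_eq_square algebra_simps)
      finally show ?thesis .
    qed
    moreover have "4 * q * (sin (\<bar>t\<bar>/2))\<^sup>2 \<ge> 1 * (\<bar>t\<bar>/pi)\<^sup>2"
    proof (intro mult_mono power_mono)
      show "\<bar>t\<bar>/pi \<le> sin (\<bar>t\<bar>/2)" using sin_ge_linear[of "\<bar>t\<bar>/2"] t by simp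
    qed (use False in auto)
    moreover have "(\<bar>t\<bar>/5)\<^sup>2 \<le> (\<bar>t\<bar>/pi)\<^sup>2"
      using pi_approx by (intro power_mono divide_left_mono) auto
    ultimately have "(\<bar>t\<bar>/5)\<^sup>2 \<le> (norm (1 - of_real q * cis t))\<^sup>2"
      using zero_le_power2[of "1 - q"] by linarith
    then show ?thesis by (rule power2_le_imp_le) simp
  qed
  moreover have "norm (1 - of_real q * cis t) \<ge> (1 - q) / 5" using 1 q by simp
  ultimately show ?thesis by (simp add: max_def)
qed

text \<open>The factor 2 counts the two signs of t, 5^b stems from
  \<open>norm_one_minus_cis_lower\<close>, and the bracket is the constant of
  \<open>nn_integral_max_powr\<close>.\<close>

definition kernel_const :: "real \<Rightarrow> real \<Rightarrow> real" where
  "kernel_const a b = 2 * 5 powr b * (1 / (a+1) + 1 / (b-a-1))"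

lemma kernel_const_pos: "a > -1 \<Longrightarrow> b > a + 1 \<Longrightarrow> kernel_const a b > 0"
  by (simp add: kernel_const_def add_pos_pos)

text \<open>Up to the factor 5^b the kernel is dominated by max(1 - q, |t|)^(-b). The case a = 0
  serves Hoelder's inequality and the test functions, the case a = 1/p, b = 2 the kernel of the
  derivative.\<close>

lemma nn_integral_kernel:
  assumes a: "a > -1" and b: "b > a + 1" "b \<ge> 0" and q: "0 \<le> q" "q < 1"
  shows "(\<integral>\<^sup>+t. ennreal (\<bar>t\<bar> powr a * norm (1 - of_real q * cis t) powr (-b)) * indicator {-pi..<pi} t \<partial>lborel)
      \<le> ennreal (kernel_const a b * (1 - q) powr (a+1-b))"
proof -
  let ?f = "\<lambda>y::real. ennreal (y powr a * max (1-q) y powr (-b)) * indicator {0..} y"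
  have "(\<integral>\<^sup>+t. ennreal (\<bar>t\<bar> powr a * norm (1 - of_real q * cis t) powr (-b)) * indicator {-pi..<pi} t \<partial>lborel)
      \<le> (\<integral>\<^sup>+t. ennreal (5 powr b) * (?f t + ?f (- t)) \<partial>lborel)"
  proof (rule nn_integral_mono)
    fix t :: real
    show "ennreal (\<bar>t\<bar> powr a * norm (1 - of_real q * cis t) powr (-b)) * indicator {-pi..<pi} t
        \<le> ennreal (5 powr b) * (?f t + ?f (- t))"
    proof (cases "t \<in> {-pi..<pi}")
      case True
      then have "\<bar>t\<bar> \<le> pi" by auto
      from norm_one_minus_cis_lower[OF q this]
      have "norm (1 - of_real q * cis t) powr (-b) \<le> (max (1 - q) \<bar>t\<bar> / 5) powr (-b)"
        using b q by (intro powr_mono2') auto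
      also have "\<dots> = 5 powr b * max (1 - q) \<bar>t\<bar> powr (-b)"
        using q by (simp add: powr_divide powr_minus field_simps)
      finally have "\<bar>t\<bar> powr a * norm (1 - of_real q * cis t) powr (-b) \<le> 5 powr b * (\<bar>t\<bar> powr a * max (1 - q) \<bar>t\<bar> powr (-b))"
        by (simp add: mult_left_mono mult.left_commute)
      then have "ennreal (\<bar>t\<bar> powr a * norm (1 - of_real q * cis t) powr (-b))
          \<le> ennreal (5 powr b) * ennreal (\<bar>t\<bar> powr a * max (1 - q) \<bar>t\<bar> powr (-b))"
        by (subst ennreal_mult[symmetric]) (auto intro: ennreal_leI)
      also have "ennreal (\<bar>t\<bar> powr a * max (1 - q) \<bar>t\<bar> powr (-b)) \<le> ?f t + ?f (- t)"
        by (cases "t \<ge> 0") (auto simp: indicator_def)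
      finally show ?thesis using True by (simp add: mult_left_mono)
    qed simp
  qed
  also have "\<dots> = ennreal (5 powr b) * ((\<integral>\<^sup>+t. ?f t \<partial>lborel) + (\<integral>\<^sup>+t. ?f (-t) \<partial>lborel))"
    by (simp add: nn_integral_cmult nn_integral_add)
  also have "(\<integral>\<^sup>+t. ?f (-t) \<partial>lborel) = (\<integral>\<^sup>+t. ?f t \<partial>lborel)"
  proof -
    have "(\<integral>\<^sup>+t. ?f t \<partial>lborel) = (\<integral>\<^sup>+t. ?f t \<partial>distr lborel borel uminus)"
      by (simp add: lborel_distr_uminus)
    also have "\<dots> = (\<integral>\<^sup>+t. ?f (-t) \<partial>lborel)" by (rule nn_integral_distr) auto
    finally show ?thesis ..
  qed
  also have "ennreal (5 powr b) * ((\<integral>\<^sup>+t. ?f t \<partial>lborel) + (\<integral>\<^sup>+t. ?f t \<partial>lborel))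
      \<le> ennreal (5 powr b) * (ennreal ((1 / (a+1) + 1 / (b-a-1)) * (1-q) powr (a+1-b)) + ennreal ((1 / (a+1) + 1 / (b-a-1)) * (1-q) powr (a+1-b)))"
    using q by (intro mult_left_mono add_mono nn_integral_max_powr a b) auto
  also have "\<dots> = ennreal (5 powr b * ((1 / (a+1) + 1 / (b-a-1)) * (1-q) powr (a+1-b) + (1 / (a+1) + 1 / (b-a-1)) * (1-q) powr (a+1-b)))"
    using a b by (simp add: ennreal_plus[symmetric] ennreal_mult[symmetric] del: ennreal_plus)
  also have "\<dots> = ennreal (kernel_const a b * (1 - q) powr (a+1-b))"
    by (simp add: kernel_const_def algebra_simps)
  finally show ?thesis .
qed

lemma nn_integral_circ_kernel:
  assumes b: "b > 1" and q: "0 \<le> q" "q < 1"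
  shows "(\<integral>\<^sup>+t. ennreal (norm (1 - of_real q * cis t) powr (-b)) \<partial>circ)
      \<le> ennreal (kernel_const 0 b * (1 - q) powr (1-b))"
proof -
  have "(\<integral>\<^sup>+t. ennreal (norm (1 - of_real q * cis t) powr (-b)) \<partial>circ)
      = ennreal (1 / (2*pi)) * (\<integral>\<^sup>+t. ennreal (norm (1 - of_real q * cis t) powr (-b)) * indicator {-pi..<-pi+2*pi} t \<partial>lborel)"
    by (rule nn_integral_circ_interval) (auto simp: cis_mult[symmetric])
  also have "\<dots> \<le> 1 * (\<integral>\<^sup>+t. ennreal (norm (1 - of_real q * cis t) powr (-b)) * indicator {-pi..<pi} t \<partial>lborel)"
    using pi_gt3 by (intro mult_mono) (auto simp: field_simps simp flip: ennreal_1 intro!: ennreal_leI)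
  also have "\<dots> = (\<integral>\<^sup>+t. ennreal (\<bar>t\<bar> powr 0 * norm (1 - of_real q * cis t) powr (-b)) * indicator {-pi..<pi} t \<partial>lborel)"
    unfolding mult_1
  proof (rule nn_integral_cong_AE)
    \<comment> \<open>In HOL \<open>0 powr 0\<close> is 0, so the two integrands differ at t =
      0.\<close>
    have "AE t in lborel. t \<noteq> (0::real)" by (rule AE_lborel_singleton)
    then show "AE t in lborel. ennreal (norm (1 - of_real q * cis t) powr (-b)) * indicator {-pi..<pi} t
       = ennreal (\<bar>t\<bar> powr 0 * norm (1 - of_real q * cis t) powr (-b)) * indicator {-pi..<pi} t"
      by eventually_elim auto
  qed
  also have "\<dots> \<le> ennreal (kernel_const 0 b * (1 - q) powr (0+1-b))"
    by (rule nn_integral_kernel) (use b q in auto)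
  finally show ?thesis by simp
qed

section \<open>Circle means as real integrals\<close>

text \<open>Links the Bochner integrals over closed intervals in the definitions with
  \<open>circ\<close>: a = 0 serves the integral means, a = -pi the modulus of continuity. If the
  integral is infinite, both sides are 0 by convention, so finiteness need not be assumed.\<close>

lemma set_integral_circ:
  fixes g :: "real \<Rightarrow> real"
  assumes [measurable]: "g \<in> borel_measurable borel" and g: "\<And>t. g t \<ge> 0" and per: "\<And>t. g (t + 2*pi) = g t"
  shows "1 / (2*pi) * (LINT t:{a..a+2*pi}|lebesgue. g t) = enn2real (\<integral>\<^sup>+t. ennreal (g t) \<partial>circ)"
proof -
  have "(LINT t:{a..a+2*pi}|lebesgue. g t) = (LINT t|lborel. indicator {a..a+2*pi} t * g t)"
    unfolding set_lebesgue_integral_def by (subst integral_completion) auto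
  also have "\<dots> = enn2real (\<integral>\<^sup>+t. ennreal (indicator {a..a+2*pi} t * g t) \<partial>lborel)"
    by (rule integral_eq_nn_integral) (use g in auto)
  also have "(\<integral>\<^sup>+t. ennreal (indicator {a..a+2*pi} t * g t) \<partial>lborel) = (\<integral>\<^sup>+t. ennreal (g t) * indicator {a..<a+2*pi} t \<partial>lborel)"
  proof (rule nn_integral_cong_AE)
    have "AE t in lborel. t \<noteq> a+2*pi" by (rule AE_lborel_singleton)
    then show "AE t in lborel. ennreal (indicator {a..a+2*pi} t * g t) = ennreal (g t) * indicator {a..<a+2*pi} t"
      by eventually_elim (auto simp: indicator_def)
  qed
  finally show ?thesis
    by (simp add: nn_integral_circ_interval[of "\<lambda>t. ennreal (g t)" a] per enn2real_mult)
qed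

lemma mean_pow_finite:
  assumes f: "f holomorphic_on unit_disc" and r: "0 \<le> r" "r < 1" and p: "p > 0"
  shows "mean_pow p r f < \<infinity>"
proof -
  obtain K where K: "K \<ge> 0" "\<And>z. norm z \<le> r \<Longrightarrow> norm (f z) \<le> K"
    using holomorphic_circle_bounded[OF f r(2)] by blast
  have "mean_pow p r f \<le> (\<integral>\<^sup>+t. ennreal (K powr p) \<partial>circ)"
    unfolding mean_pow_def using K r p by (intro nn_integral_mono ennreal_leI powr_mono2) (auto simp: norm_mult)
  then show ?thesis by (auto intro: le_less_trans)
qed

lemma mean_pow_integral_mean:
  assumes f: "f holomorphic_on unit_disc" and r: "0 \<le> r" "r < 1" and p: "p > 0"
  shows "mean_pow p r f = ennreal (integral_mean p r f powr p)"
proof -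
  have [measurable]: "(\<lambda>t. f (of_real r * cis t)) \<in> borel_measurable borel"
    by (rule holomorphic_circle_measurable[OF f r])
  have "integral_mean p r f = enn2real (mean_pow p r f) powr (1/p)"
    unfolding integral_mean_def mean_pow_def
    using set_integral_circ[of "\<lambda>t. norm (f (of_real r * cis t)) powr p" 0] by (simp add: cis_mult[symmetric])
  then show ?thesis
    using mean_pow_finite[OF f r p] p by (simp add: powr_powr)
qed

lemma integral_mean_nonneg: "integral_mean p r f \<ge> 0"
  by (simp add: integral_mean_def)

lemma integral_mean_le_iff:
  assumes f: "f holomorphic_on unit_disc" and r: "0 \<le> r" "r < 1" and p: "p > 0" and A: "A \<ge> 0"
  shows "integral_mean p r f \<le> A \<longleftrightarrow> mean_pow p r f \<le> ennreal (A powr p)"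
  unfolding mean_pow_integral_mean[OF f r p] using A p integral_mean_nonneg[of p r f]
  by (auto simp: powr_mono2 intro: powr_mono2 dest: powr_less_mono2 simp: not_le[symmetric])
     (metis A integral_mean_nonneg not_le p powr_less_mono2)

text \<open>From u + v <= 2 max(u, v), where the p-th power of the maximum is at most the sum of the
  p-th powers. The constant 4 is crude, but later bounds only matter up to constants, and no p-th
  roots of integrals have to be taken.\<close>

lemma nn_integral_powr_triangle:
  assumes [measurable]: "u \<in> borel_measurable M" "v \<in> borel_measurable M"
    and u: "\<And>x. u x \<ge> (0::real)" and v: "\<And>x. v x \<ge> 0" and w: "\<And>x. w x \<ge> 0" and p: "p \<ge> 1"
    and wle: "\<And>x. w x \<le> u x + v x" and A: "A \<ge> 0" "B \<ge> 0"
    and uA: "(\<integral>\<^sup>+x. ennreal (u x powr p) \<partial>M) \<le> ennreal (A powr p)"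
    and vB: "(\<integral>\<^sup>+x. ennreal (v x powr p) \<partial>M) \<le> ennreal (B powr p)"
  shows "(\<integral>\<^sup>+x. ennreal (w x powr p) \<partial>M) \<le> ennreal ((4 * (A + B)) powr p)"
proof -
  have "(\<integral>\<^sup>+x. ennreal (w x powr p) \<partial>M) \<le> (\<integral>\<^sup>+x. ennreal (2 powr p) * (ennreal (u x powr p) + ennreal (v x powr p)) \<partial>M)"
  proof (rule nn_integral_mono)
    fix x
    have "w x powr p \<le> (2 * max (u x) (v x)) powr p"
      using w wle[of x] u[of x] v[of x] p by (intro powr_mono2) auto
    also have "\<dots> = 2 powr p * max (u x) (v x) powr p" using u[of x] by (simp add: powr_mult)
    also have "\<dots> \<le> 2 powr p * (u x powr p + v x powr p)" by (auto simp: max_def)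
    finally have "ennreal (w x powr p) \<le> ennreal (2 powr p * (u x powr p + v x powr p))" by (rule ennreal_leI)
    then show "ennreal (w x powr p) \<le> ennreal (2 powr p) * (ennreal (u x powr p) + ennreal (v x powr p))"
      by (simp add: ennreal_mult)
  qed
  also have "\<dots> = ennreal (2 powr p) * ((\<integral>\<^sup>+x. ennreal (u x powr p) \<partial>M) + (\<integral>\<^sup>+x. ennreal (v x powr p) \<partial>M))"
    by (simp add: nn_integral_cmult nn_integral_add)
  also have "\<dots> \<le> ennreal (2 powr p) * (ennreal (A powr p) + ennreal (B powr p))"
    by (intro mult_left_mono add_mono uA vB) auto
  also have "\<dots> = ennreal (2 powr p * (A powr p + B powr p))"
    by (simp add: ennreal_mult)
  also have "\<dots> \<le> ennreal ((4 * (A + B)) powr p)"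
  proof (rule ennreal_leI)
    have "A powr p \<le> (A + B) powr p" "B powr p \<le> (A + B) powr p" using A p by (auto intro!: powr_mono2)
    moreover have "2 * (A + B) powr p \<le> 2 powr p * (A + B) powr p"
      using powr_mono[of 1 p 2] p by (intro mult_right_mono) auto
    ultimately have "2 powr p * (A powr p + B powr p) \<le> 2 powr p * (2 powr p * (A + B) powr p)"
      by (intro mult_left_mono) auto
    also have "\<dots> = (4 * (A + B)) powr p"
      using A by (simp add: powr_mult[symmetric])
    finally show "2 powr p * (A powr p + B powr p) \<le> (4 * (A + B)) powr p" .
  qed
  finally show ?thesis .
qed

lemma norm_diff_le_nn_integral:
  fixes \<phi> :: "real \<Rightarrow> complex"
  assumes "a \<le> b" and der: "\<And>s. a \<le> s \<Longrightarrow> s \<le> b \<Longrightarrow> (\<phi> has_vector_derivative \<phi>' s) (at s within {a..b})"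
    and cont: "continuous_on {a..b} \<phi>'"
  shows "ennreal (norm (\<phi> b - \<phi> a)) \<le> (\<integral>\<^sup>+s. ennreal (norm (\<phi>' s) * indicator {a..b} s) \<partial>lborel)"
proof -
  have i: "integrable lborel (\<lambda>s. indicator {a..b} s *\<^sub>R \<phi>' s)"
    using borel_integrable_compact[OF _ cont] by simp
  have "(LINT s|lborel. indicator {a..b} s *\<^sub>R \<phi>' s) = \<phi> b - \<phi> a"
    by (rule integral_FTC_Icc[OF assms(1) der cont])
  then show ?thesis
    using integral_norm_bound_ennreal[OF i] by (simp add: mult.commute abs_mult)
qed

lemma radial_has_vector_derivative:
  assumes G: "G holomorphic_on unit_disc" and "0 \<le> s" "s < 1"
  shows "((\<lambda>s. G (of_real s * cis \<theta>)) has_vector_derivative cis \<theta> * deriv G (of_real s * cis \<theta>)) (at s within S)"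
proof -
  have "(G has_field_derivative deriv G (of_real s * cis \<theta>)) (at (of_real s * cis \<theta>))"
    using assms by (intro holomorphic_derivI[OF G]) (auto simp: norm_mult)
  moreover have "((\<lambda>s. of_real s * cis \<theta>) has_vector_derivative cis \<theta>) (at s within S)"
    by (auto intro!: derivative_eq_intros)
  ultimately show ?thesis
    using field_vector_diff_chain_within[of "\<lambda>s. of_real s * cis \<theta>" "cis \<theta>" s S G "deriv G (of_real s * cis \<theta>)"]
    by (simp add: o_def has_field_derivative_at_within)
qed

lemma norm_radial_diff_le:
  assumes G: "G holomorphic_on unit_disc" and r: "0 \<le> r0" "r0 \<le> r" "r < 1"
  shows "ennreal (norm (G (of_real r * cis \<theta>) - G (of_real r0 * cis \<theta>)))
      \<le> (\<integral>\<^sup>+s. ennreal (norm (deriv G (of_real s * cis \<theta>)) * indicator {r0..r} s) \<partial>lborel)"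
proof -
  have "continuous_on unit_disc (deriv G)"
    using holomorphic_deriv[OF G] by (auto intro: holomorphic_on_imp_continuous_on)
  then have "continuous_on {r0..r} (\<lambda>s. deriv G (of_real s * cis \<theta>))"
    by (rule continuous_on_compose2) (use r in \<open>auto intro!: continuous_intros simp: norm_mult\<close>)
  then have "continuous_on {r0..r} (\<lambda>s. cis \<theta> * deriv G (of_real s * cis \<theta>))" by (intro continuous_intros)
  from norm_diff_le_nn_integral[OF r(2) radial_has_vector_derivative[OF G] this] r
  show ?thesis by (simp add: norm_mult)
qed

lemma norm_angular_diff_le:
  assumes G: "G holomorphic_on unit_disc" and r: "0 \<le> r" "r < 1" and ab: "a \<le> b"
  shows "ennreal (norm (G (of_real r * cis b) - G (of_real r * cis a)))
      \<le> (\<integral>\<^sup>+s. ennreal (norm (deriv G (of_real r * cis s)) * indicator {a..b} s) \<partial>lborel)"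
proof -
  have der: "((\<lambda>s. G (of_real r * cis s)) has_vector_derivative (of_real r * (\<i> * cis s)) * deriv G (of_real r * cis s)) (at s within {a..b})" for s
  proof -
    have "(G has_field_derivative deriv G (of_real r * cis s)) (at (of_real r * cis s))"
      using r by (intro holomorphic_derivI[OF G]) (auto simp: norm_mult)
    moreover have "((\<lambda>s. of_real r * cis s) has_vector_derivative of_real r * (\<i> * cis s)) (at s within {a..b})"
    proof -
      have "((\<lambda>s. of_real r * exp (\<i> * s)) has_field_derivative of_real r * (\<i> * exp (\<i> * of_real s))) (at (of_real s))"
        by (auto intro!: derivative_eq_intros)
      then have "((\<lambda>s. of_real r * exp (\<i> * of_real s)) has_vector_derivative of_real r * (\<i> * exp (\<i> * of_real s))) (at s within {a..b})"
        by (rule has_vector_derivative_real_field)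
      then show ?thesis by (simp add: cis_conv_exp)
    qed
    ultimately show ?thesis
      using field_vector_diff_chain_within[of "\<lambda>s. of_real r * cis s" "of_real r * (\<i> * cis s)" s "{a..b}" G "deriv G (of_real r * cis s)"]
      by (simp add: o_def has_field_derivative_at_within)
  qed
  have "continuous_on unit_disc (deriv G)"
    using holomorphic_deriv[OF G] by (auto intro: holomorphic_on_imp_continuous_on)
  then have c1: "continuous_on {a..b} (\<lambda>s. deriv G (of_real r * cis s))"
    by (rule continuous_on_compose2) (use r in \<open>auto intro!: continuous_intros simp: norm_mult\<close>)
  then have "continuous_on {a..b} (\<lambda>s. (of_real r * (\<i> * cis s)) * deriv G (of_real r * cis s))" by (intro continuous_intros)
  from norm_diff_le_nn_integral[OF ab der this]
  have "ennreal (norm (G (of_real r * cis b) - G (of_real r * cis a)))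
      \<le> (\<integral>\<^sup>+s. ennreal (norm ((of_real r * (\<i> * cis s)) * deriv G (of_real r * cis s)) * indicator {a..b} s) \<partial>lborel)" .
  also have "\<dots> \<le> (\<integral>\<^sup>+s. ennreal (norm (deriv G (of_real r * cis s)) * indicator {a..b} s) \<partial>lborel)"
    using r by (intro nn_integral_mono ennreal_leI mult_right_mono) (auto simp: norm_mult intro!: mult_left_le_one_le)
  finally show ?thesis .
qed

section \<open>Coefficient multipliers\<close>

text \<open>The \<open>n\<close>-th coefficient of \<open>f\<close> is multiplied by \<open>n + j\<close> choose \<open>j\<close>; equivalently, this is the
  \<open>j\<close>-th derivative of \<open>z\<^sup>j f / j!\<close>.\<close>

primrec binom_deriv :: "(complex \<Rightarrow> complex) \<Rightarrow> nat \<Rightarrow> complex \<Rightarrow> complex" where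
  "binom_deriv f 0 = f"
| "binom_deriv f (Suc j) = (\<lambda>z. binom_deriv f j z + z * deriv (binom_deriv f j) z / of_nat (Suc j))"

lemma holomorphic_binom_deriv:
  "f holomorphic_on unit_disc \<Longrightarrow> binom_deriv f j holomorphic_on unit_disc"
  by (induction j) (auto intro!: holomorphic_intros simp del: of_nat_Suc)

lemma fps_expansion_disc:
  "f holomorphic_on unit_disc \<Longrightarrow> f has_fps_expansion fps_expansion f 0"
  by (rule has_fps_expansion_fps_expansion[of unit_disc]) auto

text \<open>One step of the recursion multiplies the n-th coefficient by (n + j + 1)/(j + 1), the
  quotient of consecutive binomial coefficients.\<close>

lemma fps_nth_binom_deriv:
  assumes f: "f holomorphic_on unit_disc"
  shows "fps_nth (fps_expansion (binom_deriv f j) 0) n = fps_nth (fps_expansion f 0) n * of_nat ((n + j) choose j)"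
proof (induction j arbitrary: n)
  case (Suc j)
  let ?G = "fps_expansion (binom_deriv f j) 0"
  have G: "binom_deriv f j has_fps_expansion ?G"
    by (rule fps_expansion_disc[OF holomorphic_binom_deriv[OF f]])
  have "(\<lambda>z. binom_deriv f j z + z * deriv (binom_deriv f j) z / of_nat (Suc j))
      has_fps_expansion (?G + fps_X * fps_deriv ?G * fps_const (1 / of_nat (Suc j)))"
    unfolding divide_inverse by (intro fps_expansion_intros G has_fps_expansion_mult has_fps_expansion_cmult_right[of _ _ "inverse (of_nat (Suc j))", simplified mult.commute]) auto
  then have "fps_expansion (binom_deriv f (Suc j)) 0 = ?G + fps_X * fps_deriv ?G * fps_const (1 / of_nat (Suc j))"
    using fps_expansion_eqI by simp
  then have "fps_nth (fps_expansion (binom_deriv f (Suc j)) 0) n = fps_nth ?G n + of_nat n * fps_nth ?G n / of_nat (Suc j)"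
    by (cases n) (simp_all del: of_nat_Suc)
  also have "\<dots> = fps_nth ?G n * of_nat (Suc (n + j)) / of_nat (Suc j)"
  proof -
    have e: "complex_of_nat (Suc (n + j)) = of_nat n + of_nat (Suc j)" by simp
    have "complex_of_nat (Suc j) \<noteq> 0" by (simp del: of_nat_Suc)
    then show ?thesis unfolding e by (simp add: field_simps del: of_nat_Suc)
  qed
  also have "\<dots> = fps_nth (fps_expansion f 0) n * (of_nat (Suc (n + j) * ((n + j) choose j)) / of_nat (Suc j))"
    by (simp only: Suc of_nat_mult times_divide_eq_right mult.assoc mult.commute mult.left_commute)
  also have "of_nat (Suc (n + j) * ((n + j) choose j)) / of_nat (Suc j) = (of_nat ((n + Suc j) choose Suc j) :: complex)"
    using of_nat_neq_0[of j, where 'a = complex]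
    by (simp only: Suc_times_binomial_eq add_Suc_right of_nat_mult nonzero_mult_div_cancel_right not_False_eq_True)
  finally show ?case .
qed auto

text \<open>Lets order j be recovered from order j + 1 by integration along radii; the factor z^(j +
  1) vanishes at 0, so there is no constant of integration.\<close>

lemma binom_deriv_has_derivative:
  assumes f: "f holomorphic_on unit_disc" and z: "norm z < 1"
  shows "((\<lambda>z. z ^ Suc j * binom_deriv f j z) has_field_derivative of_nat (Suc j) * z ^ j * binom_deriv f (Suc j) z) (at z)"
proof -
  have "(binom_deriv f j has_field_derivative deriv (binom_deriv f j) z) (at z)"
    using z by (intro holomorphic_derivI[OF holomorphic_binom_deriv[OF f]]) auto
  then have "((\<lambda>z. z ^ Suc j * binom_deriv f j z) has_field_derivative
      of_nat (Suc j) * z ^ j * binom_deriv f j z + z ^ Suc j * deriv (binom_deriv f j) z) (at z)"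
  proof -
    assume b: "(binom_deriv f j has_field_derivative deriv (binom_deriv f j) z) (at z)"
    have a: "((\<lambda>z. z ^ Suc j) has_field_derivative of_nat (Suc j) * z ^ j) (at z)"
      by (auto intro!: derivative_eq_intros simp del: of_nat_Suc power_Suc)
    show ?thesis using DERIV_mult[OF a b] by (simp only: mult_ac)
  qed
  moreover have "of_nat (Suc j) * z ^ j * binom_deriv f j z + z ^ Suc j * deriv (binom_deriv f j) z
      = of_nat (Suc j) * z ^ j * binom_deriv f (Suc j) z"
    by (simp add: distrib_left del: of_nat_Suc)
  ultimately show ?thesis by simp
qed

lemma eval_fps_expansion_disc:
  assumes "f holomorphic_on unit_disc" "norm z < 1"
  shows "eval_fps (fps_expansion f 0) z = f z"
  using has_fps_expansion_imp_eval_fps_eq[OF fps_expansion_disc[OF assms(1)] assms(2,1)] .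

lemma fps_conv_radius_disc:
  "f holomorphic_on unit_disc \<Longrightarrow> fps_conv_radius (fps_expansion f 0) \<ge> 1"
  using conv_radius_fps_expansion[of f 0 1] by (simp add: one_ereal_def)

lemma less_conv_radius:
  "R \<ge> 1 \<Longrightarrow> norm z < 1 \<Longrightarrow> ereal (norm z) < R"
  using less_le_trans[of "ereal (norm z)" "ereal 1" R] by (simp add: one_ereal_def)

lemma holomorphic_eval_fps_disc:
  "fps_conv_radius F \<ge> 1 \<Longrightarrow> eval_fps F holomorphic_on unit_disc"
  by (rule holomorphic_on_eval_fps) (auto simp: in_eball_iff intro: less_conv_radius)

lemma fps_expansion_eval_fps:
  fixes F :: "complex fps"
  assumes "fps_conv_radius F \<ge> 1"
  shows "fps_expansion (eval_fps F) 0 = F"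
  by (rule fps_expansion_eqI[OF eval_fps_has_fps_expansion])
     (use assms in \<open>auto intro: less_le_trans[of _ 1]\<close>)

section \<open>Rhaly operators as Hadamard products\<close>

lemma holomorphic_div_one_minus:
  "f holomorphic_on unit_disc \<Longrightarrow> (\<lambda>z. f z / (1 - z)) holomorphic_on unit_disc"
  by (intro holomorphic_intros) auto

text \<open>Multiplication by 1 - z turns coefficients into differences, whose sums telescope. This
  is how the partial sums in the Rhaly operator become the factor 1/(1 - z).\<close>

lemma partial_sum_fps_nth:
  assumes f: "f holomorphic_on unit_disc"
  shows "(\<Sum>k\<le>n. fps_nth (fps_expansion f 0) k) = fps_nth (fps_expansion (\<lambda>z. f z / (1 - z)) 0) n"
proof -
  define G where "G = fps_expansion (\<lambda>z. f z / (1 - z)) 0"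
  have G: "(\<lambda>z. f z / (1 - z)) has_fps_expansion G"
    unfolding G_def by (rule fps_expansion_disc[OF holomorphic_div_one_minus[OF f]])
  have "(\<lambda>z. (1 - z) * (f z / (1 - z))) has_fps_expansion ((1 - fps_X) * G)"
    by (intro fps_expansion_intros G)
  moreover have "eventually (\<lambda>z. z \<in> unit_disc) (nhds (0::complex))"
    by (intro eventually_nhds_in_open) auto
  then have "eventually (\<lambda>z. (1 - z) * (f z / (1 - z)) = f z) (nhds 0)"
    by eventually_elim auto
  ultimately have "f has_fps_expansion ((1 - fps_X) * G)"
    by (subst (asm) has_fps_expansion_cong[OF _ refl])
  then have e: "fps_expansion f 0 = G - fps_X * G"
    by (simp add: fps_expansion_eqI left_diff_distrib)
  have "(\<Sum>k\<le>n. fps_nth (G - fps_X * G) k) = fps_nth G n"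
    by (induction n) auto
  then show ?thesis unfolding e G_def by simp
qed

lemma summable_norm_product:
  fixes a b :: "nat \<Rightarrow> complex"
  assumes a: "summable (\<lambda>n. norm (a n))" and b: "summable (\<lambda>n. norm (b n))"
  shows "summable (\<lambda>n. norm (a n * b n))"
proof (rule summable_comparison_test')
  show "summable (\<lambda>n. norm (a n) * (\<Sum>n. norm (b n)))" by (rule summable_mult2[OF a])
  show "norm (norm (a n * b n)) \<le> norm (a n) * (\<Sum>n. norm (b n))" if "n \<ge> 0" for n
    unfolding norm_mult using sum_le_suminf[OF b, of "{n}"] by (auto intro!: mult_left_mono)
qed

text \<open>With q = sqrt r the power r^n splits as q^n * q^n, one factor for each of two series
  that converge absolutely at the radius q < 1.\<close>

lemma fps_conv_radius_Rhaly:
  assumes \<eta>: "fps_conv_radius (Abs_fps \<eta>) \<ge> 1" and f: "f holomorphic_on unit_disc"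
  shows "fps_conv_radius (Rhaly_fps \<eta> f) \<ge> 1"
proof -
  let ?G = "fps_expansion (\<lambda>z. f z / (1 - z)) 0"
  have G: "fps_conv_radius ?G \<ge> 1" by (rule fps_conv_radius_disc[OF holomorphic_div_one_minus[OF f]])
  have "conv_radius (\<lambda>n. \<eta> n * fps_nth ?G n) \<ge> 1"
  proof (rule conv_radius_geI_ex)
    fix r :: real assume r: "0 < r" "ereal r < 1"
    define q where "q = sqrt r"
    have q: "0 < q" "q < 1" using r by (auto simp: q_def)
    have "summable (\<lambda>n. norm (\<eta> n * of_real q ^ n))"
      using abs_summable_in_conv_radius[of "of_real q" \<eta>] \<eta> q less_le_trans[of "ereal q" 1]
      by (simp add: fps_conv_radius_def)
    moreover have "summable (\<lambda>n. norm (fps_nth ?G n * of_real q ^ n))"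
      using abs_summable_in_conv_radius[of "of_real q" "fps_nth ?G"] G q less_le_trans[of "ereal q" 1]
      by (simp add: fps_conv_radius_def)
    ultimately have "summable (\<lambda>n. norm ((\<eta> n * of_real q ^ n) * (fps_nth ?G n * of_real q ^ n)))"
      by (rule summable_norm_product)
    then have "summable (\<lambda>n. (\<eta> n * of_real q ^ n) * (fps_nth ?G n * of_real q ^ n))"
      by (rule summable_norm_cancel)
    moreover have "(\<eta> n * of_real q ^ n) * (fps_nth ?G n * of_real q ^ n) = \<eta> n * fps_nth ?G n * of_real r ^ n" for n
    proof -
      have "of_real q ^ n * of_real q ^ n = (of_real r ^ n :: complex)"
        using r by (simp add: power_mult_distrib[symmetric] q_def of_real_mult[symmetric] del: of_real_mult)
      then show ?thesis by (simp add: mult_ac)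
    qed
    ultimately show "\<exists>z. norm z = r \<and> summable (\<lambda>n. \<eta> n * fps_nth ?G n * z ^ n)"
      using r by (intro exI[of _ "of_real r"]) simp
  qed
  then show ?thesis
    by (simp add: Rhaly_fps_def fps_conv_radius_def partial_sum_fps_nth[OF f])
qed

lemma holomorphic_Rhaly:
  assumes "fps_conv_radius (Abs_fps \<eta>) \<ge> 1" "f holomorphic_on unit_disc"
  shows "Rhaly \<eta> f holomorphic_on unit_disc"
  unfolding Rhaly_def by (rule holomorphic_eval_fps_disc[OF fps_conv_radius_Rhaly[OF assms]])

lemma Rhaly_linear:
  assumes \<eta>: "fps_conv_radius (Abs_fps \<eta>) \<ge> 1" and f: "f holomorphic_on unit_disc" and g: "g holomorphic_on unit_disc"
    and z: "norm z < 1"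
  shows "Rhaly \<eta> (\<lambda>w. a * f w + b * g w) z = a * Rhaly \<eta> f z + b * Rhaly \<eta> g z"
proof -
  have "(\<lambda>w. a * f w + b * g w) has_fps_expansion (fps_const a * fps_expansion f 0 + fps_const b * fps_expansion g 0)"
    by (intro fps_expansion_intros fps_expansion_disc f g)
  then have e: "fps_expansion (\<lambda>w. a * f w + b * g w) 0 = fps_const a * fps_expansion f 0 + fps_const b * fps_expansion g 0"
    by (rule fps_expansion_eqI)
  have "Rhaly_fps \<eta> (\<lambda>w. a * f w + b * g w) = fps_const a * Rhaly_fps \<eta> f + fps_const b * Rhaly_fps \<eta> g"
    unfolding Rhaly_fps_def e by (rule fps_ext) (simp add: sum.distrib sum_distrib_left algebra_simps)
  moreover have r: "ereal (norm z) < fps_conv_radius (Rhaly_fps \<eta> f)" "ereal (norm z) < fps_conv_radius (Rhaly_fps \<eta> g)"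
    using fps_conv_radius_Rhaly[OF \<eta> f] fps_conv_radius_Rhaly[OF \<eta> g] z by (auto elim!: less_le_trans[rotated])
  moreover have "ereal (norm z) < fps_conv_radius (fps_const c * F)" if "ereal (norm z) < fps_conv_radius F" for c and F :: "complex fps"
    using that by (cases "c = 0") (auto simp: fps_conv_radius_cmult_left)
  ultimately show ?thesis
    by (simp add: Rhaly_def eval_fps_add eval_fps_mult)
qed

lemma symbol_fun_expansion:
  assumes "fps_conv_radius (Abs_fps \<eta>) \<ge> 1"
  shows "symbol_fun \<eta> holomorphic_on unit_disc" "fps_nth (fps_expansion (symbol_fun \<eta>) 0) n = \<eta> n"
  using holomorphic_eval_fps_disc[OF assms] fps_expansion_eval_fps[OF assms] by (auto simp: symbol_fun_def)

text \<open>Convolution multiplies coefficients, and the multiplier n + 1 is attached to the symbol.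
  Both factors are taken on the circle of radius r, so the powers r^n * r^n place the result on
  radius r^2.\<close>

lemma binom_deriv_Rhaly_convolution:
  assumes \<eta>: "fps_conv_radius (Abs_fps \<eta>) \<ge> 1" and f: "f holomorphic_on unit_disc" and r: "0 \<le> r" "r < 1"
  shows "binom_deriv (Rhaly \<eta> f) 1 (of_real (r\<^sup>2) * cis \<theta>)
    = (LINT t|circ. binom_deriv (symbol_fun \<eta>) 1 (of_real r * cis t) * (f (of_real r * cis (\<theta> - t)) / (1 - of_real r * cis (\<theta> - t))))"
proof -
  let ?g = "\<lambda>z. f z / (1 - z)" and ?F1 = "binom_deriv (symbol_fun \<eta>) 1" and ?H = "binom_deriv (Rhaly \<eta> f) 1"
  have g: "?g holomorphic_on ball 0 1" by (rule holomorphic_div_one_minus[OF f])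
  have F1: "?F1 holomorphic_on ball 0 1"
    by (rule holomorphic_binom_deriv[OF symbol_fun_expansion(1)[OF \<eta>]])
  have h: "Rhaly \<eta> f holomorphic_on unit_disc" by (rule holomorphic_Rhaly[OF \<eta> f])
  then have H: "?H holomorphic_on ball 0 1" by (rule holomorphic_binom_deriv)
  have r2: "0 \<le> r\<^sup>2" "r\<^sup>2 < 1" using r by (auto simp: abs_square_less_1)
  have "fps_nth (fps_expansion (Rhaly \<eta> f) 0) n = \<eta> n * fps_nth (fps_expansion ?g 0) n" for n
    unfolding Rhaly_def fps_expansion_eval_fps[OF fps_conv_radius_Rhaly[OF \<eta> f]]
    by (simp add: Rhaly_fps_def partial_sum_fps_nth[OF f])
  then have "fps_nth (fps_expansion ?H 0) n * of_real (r\<^sup>2) ^ n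
      = (fps_nth (fps_expansion ?F1 0) n * of_real r ^ n) * (fps_nth (fps_expansion ?g 0) n * of_real r ^ n)" for n
    unfolding fps_nth_binom_deriv[OF h] fps_nth_binom_deriv[OF symbol_fun_expansion(1)[OF \<eta>]] symbol_fun_expansion(2)[OF \<eta>]
    by (simp add: power2_eq_square power_mult_distrib mult_ac)
  then show ?thesis
    unfolding holomorphic_power_series_fourier(1)[OF H r2]
      holomorphic_power_series_fourier(1)[OF F1 r] holomorphic_power_series_fourier(1)[OF g r]
    by (simp only: integral_fourier_convolution[OF holomorphic_power_series_fourier(2)[OF F1 r] holomorphic_power_series_fourier(2)[OF g r]])
qed

section \<open>Weighted Bergman spaces\<close>

text \<open>Values off the disc are arbitrary, so f need not be Borel measurable on the plane; its
  extension by 0 is.\<close>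

definition disc_restrict :: "(complex \<Rightarrow> complex) \<Rightarrow> complex \<Rightarrow> complex" where
  "disc_restrict f = (\<lambda>z. indicator unit_disc z *\<^sub>R f z)"

lemma disc_restrict_measurable:
  assumes f: "f holomorphic_on unit_disc"
  shows "disc_restrict f \<in> borel_measurable borel"
  unfolding disc_restrict_def
  by (rule borel_measurable_continuous_on_indicator) (use holomorphic_on_imp_continuous_on[OF f] in auto)

lemma disc_restrict_eq: "norm z < 1 \<Longrightarrow> disc_restrict f z = f z"
  by (simp add: disc_restrict_def)

lemma mean_pow_disc_restrict:
  "0 \<le> r \<Longrightarrow> r < 1 \<Longrightarrow> mean_pow p r (disc_restrict f) = mean_pow p r f"
  by (simp add: mean_pow_def disc_restrict_eq norm_mult)

lemma mean_pow_measurable [measurable]: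
  assumes [measurable]: "f \<in> borel_measurable borel"
  shows "(\<lambda>r. mean_pow p r f) \<in> borel_measurable borel"
proof -
  interpret sigma_finite_measure circ by (rule sigma_finite_circ)
  show ?thesis unfolding mean_pow_def by measurable
qed

lemma mean_pow_cong:
  assumes "0 \<le> r" "r < 1" "\<And>z. norm z < 1 \<Longrightarrow> f z = g z"
  shows "mean_pow p r f = mean_pow p r g"
  using assms by (simp add: mean_pow_def norm_mult)

lemma nn_integral_powr_upto_1:
  fixes \<gamma> y :: real
  assumes \<gamma>: "\<gamma> > -1" and y: "y \<le> 1"
  shows "(\<integral>\<^sup>+s. ennreal ((1 - s) powr \<gamma>) * indicator {y..<1} s \<partial>lborel) = ennreal ((1 - y) powr (\<gamma>+1) / (\<gamma>+1))"
proof -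
  have "(\<integral>\<^sup>+s. ennreal ((1 - s) powr \<gamma>) * indicator {y..<1} s \<partial>lborel)
      = (\<integral>\<^sup>+s. ennreal ((1 - (1 + (-1) * s)) powr \<gamma>) * indicator {y..<1} (1 + (-1) * s) \<partial>lborel)"
    by (subst nn_integral_real_affine[where c = "-1" and t = 1]) auto
  also have "\<dots> = (\<integral>\<^sup>+s. ennreal (s powr \<gamma>) * indicator {0..1-y} s \<partial>lborel)"
  proof (rule nn_integral_cong_AE)
    have "AE s in lborel. s \<noteq> (0::real)" by (rule AE_lborel_singleton)
    then show "AE s in lborel. ennreal ((1 - (1 + (-1) * s)) powr \<gamma>) * indicator {y..<1} (1 + (-1) * s)
        = ennreal (s powr \<gamma>) * indicator {0..1-y} s"
      by eventually_elim (auto simp: indicator_def)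
  qed
  also have "\<dots> = ennreal ((1 - y) powr (\<gamma>+1) / (\<gamma>+1))"
    by (rule nn_integral_has_integral_lebesgue'[OF _ has_integral_powr_from_0[OF \<gamma>]]) (use y in auto)
  finally show ?thesis .
qed

text \<open>The variable of integration is \<open>s = |z|\<^sup>2\<close>.\<close>

definition bergman_int :: "real \<Rightarrow> real \<Rightarrow> (complex \<Rightarrow> complex) \<Rightarrow> ennreal" where
  "bergman_int p \<alpha> f = (\<integral>\<^sup>+s. ennreal ((\<alpha>+1) * (1 - s) powr \<alpha>) * mean_pow p (sqrt s) f * indicator {0..<1} s \<partial>lborel)"

lemma bergman_int_cong:
  assumes "\<And>z. norm z < 1 \<Longrightarrow> f z = g z"
  shows "bergman_int p \<alpha> f = bergman_int p \<alpha> g"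
  unfolding bergman_int_def
  by (intro nn_integral_cong) (auto simp: indicator_def intro!: mean_pow_cong arg_cong[where f = "\<lambda>x. _ * x"] assms)

lemma bergman_int_disc_restrict: "bergman_int p \<alpha> (disc_restrict f) = bergman_int p \<alpha> f"
  by (rule bergman_int_cong) (simp add: disc_restrict_eq)

text \<open>In polar coordinates with s = |z|^2 the weight is (1 - s)^\<alpha>, and the factor pi
  from the area cancels the normalisation.\<close>

lemma nn_integral_area_measure:
  assumes f: "f holomorphic_on unit_disc" and \<alpha>: "\<alpha> > -1"
  shows "(\<integral>\<^sup>+z. ennreal (norm (f z) powr p) \<partial>area_measure \<alpha>) = bergman_int p \<alpha> f"
    and "(\<lambda>z. norm (f z) powr p) \<in> borel_measurable (area_measure \<alpha>)"
proof -
  let ?w = "\<lambda>z::complex. ennreal ((\<alpha> + 1) / pi * (1 - (norm z)\<^sup>2) powr \<alpha>)"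
  let ?f = "disc_restrict f"
  note [measurable] = disc_restrict_measurable[OF f]
  have [measurable]: "unit_disc \<in> sets borel" "unit_disc \<in> sets lebesgue" by auto
  have fm: "f \<in> borel_measurable (lebesgue_on unit_disc)"
    by (rule continuous_imp_measurable_on_sets_lebesgue) (use holomorphic_on_imp_continuous_on[OF f] in auto)
  then have fm': "(\<lambda>z. norm (f z) powr p) \<in> borel_measurable (lebesgue_on unit_disc)"
    by measurable
  then show "(\<lambda>z. norm (f z) powr p) \<in> borel_measurable (area_measure \<alpha>)"
    by (simp add: area_measure_def)
  have wm: "?w \<in> borel_measurable (lebesgue_on unit_disc)"
  proof -
    have "?w \<in> borel_measurable lborel" by measurable
    then have "?w \<in> borel_measurable lebesgue" by (rule measurable_completion)
    then show ?thesis by (rule measurable_restrict_space1)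
  qed
  have "(\<integral>\<^sup>+z. ennreal (norm (f z) powr p) \<partial>area_measure \<alpha>) = (\<integral>\<^sup>+z. ?w z * ennreal (norm (f z) powr p) \<partial>lebesgue_on unit_disc)"
    unfolding area_measure_def by (rule nn_integral_density[OF wm]) (use fm' in measurable)
  also have "\<dots> = (\<integral>\<^sup>+z. ?w z * ennreal (norm (f z) powr p) * indicator unit_disc z \<partial>lebesgue)"
    by (subst nn_integral_restrict_space) auto
  also have "\<dots> = (\<integral>\<^sup>+z. (?w z * ennreal (norm (?f z) powr p)) * indicator unit_disc z \<partial>lebesgue)"
    by (intro nn_integral_cong) (auto simp: indicator_def disc_restrict_def)
  also have "\<dots> = (\<integral>\<^sup>+z. (?w z * ennreal (norm (?f z) powr p)) * indicator unit_disc z \<partial>lborel)"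
    by (rule nn_integral_completion)
  also have "\<dots> = ennreal pi * (\<integral>\<^sup>+s. (\<integral>\<^sup>+t. ?w (of_real (sqrt s) * cis t) * ennreal (norm (?f (of_real (sqrt s) * cis t)) powr p) \<partial>circ) * indicator {0..<1} s \<partial>lborel)"
    by (rule nn_integral_polar) measurable
  also have "\<dots> = (\<integral>\<^sup>+s. ennreal pi * ((\<integral>\<^sup>+t. ?w (of_real (sqrt s) * cis t) * ennreal (norm (?f (of_real (sqrt s) * cis t)) powr p) \<partial>circ) * indicator {0..<1} s) \<partial>lborel)"
  proof (rule nn_integral_cmult[symmetric])
    interpret sigma_finite_measure circ by (rule sigma_finite_circ)
    show "(\<lambda>s. (\<integral>\<^sup>+t. ?w (of_real (sqrt s) * cis t) * ennreal (norm (?f (of_real (sqrt s) * cis t)) powr p) \<partial>circ) * indicator {0..<1} s) \<in> borel_measurable lborel"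
      by measurable
  qed
  also have "\<dots> = bergman_int p \<alpha> ?f"
    unfolding bergman_int_def
  proof (intro nn_integral_cong)
    fix s :: real
    show "ennreal pi * ((\<integral>\<^sup>+t. ?w (of_real (sqrt s) * cis t) * ennreal (norm (?f (of_real (sqrt s) * cis t)) powr p) \<partial>circ) * indicator {0..<1} s)
        = ennreal ((\<alpha>+1) * (1 - s) powr \<alpha>) * mean_pow p (sqrt s) ?f * indicator {0..<1} s"
    proof (cases "s \<in> {0..<1}")
      case True
      have "(\<integral>\<^sup>+t. ?w (of_real (sqrt s) * cis t) * ennreal (norm (?f (of_real (sqrt s) * cis t)) powr p) \<partial>circ)
          = (\<integral>\<^sup>+t. ennreal ((\<alpha> + 1) / pi * (1 - s) powr \<alpha>) * ennreal (norm (?f (of_real (sqrt s) * cis t)) powr p) \<partial>circ)"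
        using True by (intro nn_integral_cong) (simp add: norm_mult)
      also have "\<dots> = ennreal ((\<alpha> + 1) / pi * (1 - s) powr \<alpha>) * mean_pow p (sqrt s) ?f"
        unfolding mean_pow_def by (rule nn_integral_cmult) measurable
      finally have "ennreal pi * (\<integral>\<^sup>+t. ?w (of_real (sqrt s) * cis t) * ennreal (norm (?f (of_real (sqrt s) * cis t)) powr p) \<partial>circ)
          = (ennreal pi * ennreal ((\<alpha> + 1) / pi * (1 - s) powr \<alpha>)) * mean_pow p (sqrt s) ?f"
        by (simp add: mult.assoc)
      also have "ennreal pi * ennreal ((\<alpha> + 1) / pi * (1 - s) powr \<alpha>) = ennreal ((\<alpha>+1) * (1 - s) powr \<alpha>)"
        using \<alpha> by (subst ennreal_mult[symmetric]) auto
      finally show ?thesis using True by simp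
    qed simp
  qed
  finally show "(\<integral>\<^sup>+z. ennreal (norm (f z) powr p) \<partial>area_measure \<alpha>) = bergman_int p \<alpha> f"
    by (simp add: bergman_int_disc_restrict)
qed

lemma Bergman_iff:
  assumes \<alpha>: "\<alpha> > -1"
  shows "f \<in> Bergman p \<alpha> \<longleftrightarrow> f holomorphic_on unit_disc \<and> bergman_int p \<alpha> f < \<infinity>"
  using nn_integral_area_measure[OF _ \<alpha>, of f p]
  by (auto simp: Bergman_def integrable_iff_bounded)

lemma Bergman_norm_eq:
  assumes \<alpha>: "\<alpha> > -1" and f: "f holomorphic_on unit_disc"
  shows "Bergman_norm p \<alpha> f = enn2real (bergman_int p \<alpha> f) powr (1/p)"
  using nn_integral_area_measure[OF f \<alpha>, of p]
  by (simp add: Bergman_norm_def integral_eq_nn_integral)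

lemma bergman_int_eq_norm:
  assumes \<alpha>: "\<alpha> > -1" and f: "f \<in> Bergman p \<alpha>" and p: "p > 0"
  shows "bergman_int p \<alpha> f = ennreal (Bergman_norm p \<alpha> f powr p)"
  using f Bergman_iff[OF \<alpha>, of f p] Bergman_norm_eq[OF \<alpha>, of f p] p
  by (simp add: powr_powr)

lemma Bergman_norm_nonneg: "Bergman_norm p \<alpha> f \<ge> 0"
  by (simp add: Bergman_norm_def)

text \<open>Means increase with the radius, so the part s >= r^2 of the integral is at least the
  mean at r times the mass (1 - r^2)^(\<alpha> + 1) that the weight has there.\<close>

lemma mean_pow_le_bergman_int:
  assumes f: "f holomorphic_on unit_disc" and \<alpha>: "\<alpha> > -1" and p: "p \<ge> 1" and r: "0 \<le> r" "r < 1"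
  shows "ennreal ((1 - r\<^sup>2) powr (\<alpha>+1)) * mean_pow p r f \<le> bergman_int p \<alpha> f"
proof -
  have r2: "r\<^sup>2 < 1" "0 \<le> r\<^sup>2" using r by (auto simp: abs_square_less_1)
  have "ennreal ((1 - r\<^sup>2) powr (\<alpha>+1)) * mean_pow p r f
      = (\<integral>\<^sup>+s. ennreal (\<alpha>+1) * (ennreal ((1 - s) powr \<alpha>) * indicator {r\<^sup>2..<1} s) \<partial>lborel) * mean_pow p r f"
    using nn_integral_powr_upto_1[OF \<alpha>, of "r\<^sup>2"] r2 \<alpha>
    by (simp add: nn_integral_cmult ennreal_mult[symmetric])
  also have "\<dots> = (\<integral>\<^sup>+s. ennreal (\<alpha>+1) * (ennreal ((1 - s) powr \<alpha>) * indicator {r\<^sup>2..<1} s) * mean_pow p r f \<partial>lborel)"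
    by (rule nn_integral_multc[symmetric]) measurable
  also have "\<dots> \<le> bergman_int p \<alpha> f"
    unfolding bergman_int_def
  proof (rule nn_integral_mono)
    fix s
    show "ennreal (\<alpha>+1) * (ennreal ((1 - s) powr \<alpha>) * indicator {r\<^sup>2..<1} s) * mean_pow p r f
        \<le> ennreal ((\<alpha>+1) * (1 - s) powr \<alpha>) * mean_pow p (sqrt s) f * indicator {0..<1} s"
    proof (cases "s \<in> {r\<^sup>2..<1}")
      case True
      then have "r \<le> sqrt s" using r by (simp add: real_le_rsqrt)
      then have "mean_pow p r f \<le> mean_pow p (sqrt s) f"
        using True r p by (intro mean_pow_mono[OF f]) auto
      moreover have "s \<ge> 0" using True order_trans[OF r2(2), of s] by auto
      ultimately show ?thesis using True \<alpha> by (simp add: ennreal_mult mult_left_mono mult.assoc)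
    qed simp
  qed
  finally show ?thesis .
qed

lemma nn_integral_powr_below:
  fixes b r :: real
  assumes b: "b > 1" and r: "r < 1"
  shows "(\<integral>\<^sup>+x. ennreal ((1 - x) powr (-b) * indicator {0..r} x) \<partial>lborel) \<le> ennreal ((1 - r) powr (1 - b) / (b - 1))"
proof -
  have "(\<integral>\<^sup>+x. ennreal ((1 - x) powr (-b) * indicator {0..r} x) \<partial>lborel)
      = (\<integral>\<^sup>+x. ennreal ((1 - (1 + (-1) * x)) powr (-b) * indicator {0..r} (1 + (-1) * x)) \<partial>lborel)"
    by (subst nn_integral_real_affine[where c = "-1" and t = 1]) auto
  also have "\<dots> \<le> (\<integral>\<^sup>+x. ennreal (x powr (-b)) * indicator {1-r..} x \<partial>lborel)"
    by (intro nn_integral_mono) (auto simp: indicator_def)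
  also have "\<dots> = ennreal (- ((1 - r) powr (-b+1)) / (-b+1))"
    by (rule nn_integral_has_integral_lebesgue'[OF _ has_integral_powr_to_inf]) (use b r in auto)
  also have "- ((1 - r) powr (-b+1)) / (-b+1) = (1 - r) powr (1 - b) / (b - 1)"
    using minus_divide_divide[of "(1 - r) powr (-b+1)" "b - 1"] by (simp add: add.commute)
  finally show ?thesis .
qed

text \<open>A derivative estimate of Hardy--Littlewood type, with \<open>(z h)'\<close> in place of \<open>h'\<close> so that no
  constant term appears. The exponent \<open>b\<close> of the auxiliary weight \<open>(1 - x)\<^bsup>-b\<^esup>\<close> must
  satisfy \<open>b > 1\<close> and \<open>(b - 1)(p - 1) < 1 + \<alpha>\<close>.\<close>

lemma bergman_int_le_derivative:
  assumes p: "p \<ge> 1" and \<alpha>: "\<alpha> > -1"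
  obtains C where "C > 0"
    "\<And>h \<Phi>. h holomorphic_on unit_disc \<Longrightarrow> \<Phi> \<in> borel_measurable borel \<Longrightarrow>
      (\<And>x. 0 \<le> x \<Longrightarrow> x < 1 \<Longrightarrow> mean_pow p x (binom_deriv h 1) \<le> ennreal ((1 - x) powr (-p)) * \<Phi> x) \<Longrightarrow>
      bergman_int p \<alpha> h \<le> ennreal C * (\<integral>\<^sup>+x. ennreal ((1 - x) powr \<alpha>) * \<Phi> x * indicator {0..<1} x \<partial>lborel)"
proof -
  \<comment> \<open>With this b, (b - 1) p = (1 + \<alpha>)/2, half of what the second condition on
    b allows.\<close>
  define b where "b = 1 + (1 + \<alpha>) / (2 * p)"
  have b: "b > 1" using p \<alpha> by (simp add: b_def)
  \<comment> \<open>The weight (1 - s)^\<alpha> combined with the constant of Jensen's inequality,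
    which contributes the power (1 - b)(p - 1) of 1 - r.\<close>
  define \<gamma> where "\<gamma> = \<alpha> + (1 - b) * (p - 1)"
  have \<gamma>: "\<gamma> > -1"
  proof -
    have "(b - 1) * (p - 1) \<le> (1 + \<alpha>) / (2 * p) * p" unfolding b_def using p \<alpha> by (intro mult_mono) auto
    also have "\<dots> = (1 + \<alpha>) / 2" using p by simp
    also have "\<dots> < 1 + \<alpha>" using \<alpha> by simp
    finally show ?thesis by (simp add: \<gamma>_def algebra_simps)
  qed
  define C1 where "C1 = 2 powr p * (\<alpha> + 1) * ((1/2) powr (1 - b) / (b - 1)) powr (p - 1)"
  have C1: "C1 > 0" using b \<alpha> by (simp add: C1_def)
  define C2 where "C2 = C1 * (2 powr (\<gamma>+1) / (\<gamma>+1))"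
  have C2: "C2 > 0" using C1 \<gamma> by (simp add: C2_def)
  \<comment> \<open>The mass of the weight on s >= 1/4; through it the range s < 1/4 is bounded by
    the rest.\<close>
  define W where "W = (3/4) powr (\<alpha>+1)"
  have W: "W > 0" by (simp add: W_def)
  have main: "bergman_int p \<alpha> h \<le> ennreal ((1 + 1 / W) * C2) * (\<integral>\<^sup>+x. ennreal ((1 - x) powr \<alpha>) * \<Phi> x * indicator {0..<1} x \<partial>lborel)"
    if h: "h holomorphic_on unit_disc" and \<Phi>m[measurable]: "\<Phi> \<in> borel_measurable borel"
      and \<Phi>: "\<And>x. 0 \<le> x \<Longrightarrow> x < 1 \<Longrightarrow> mean_pow p x (binom_deriv h 1) \<le> ennreal ((1 - x) powr (-p)) * \<Phi> x" for h \<Phi>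
  proof -
    define H where "H = disc_restrict (binom_deriv h 1)"
    have H1: "binom_deriv h 1 holomorphic_on unit_disc" by (rule holomorphic_binom_deriv[OF h])
    have [measurable]: "H \<in> borel_measurable borel" unfolding H_def by (rule disc_restrict_measurable[OF H1])
    have [measurable]: "disc_restrict h \<in> borel_measurable borel" by (rule disc_restrict_measurable[OF h])
    interpret C: sigma_finite_measure circ by (rule sigma_finite_circ)
    interpret pair_sigma_finite circ lborel ..
    have mh: "mean_pow p r h \<le> ennreal (2 powr p * ((1 - r) powr (1 - b) / (b - 1)) powr (p - 1))
        * (\<integral>\<^sup>+x. ennreal ((1 - x) powr (b * (p - 1) - p)) * \<Phi> x * indicator {0..r} x \<partial>lborel)"
      if r: "1/2 \<le> r" "r < 1" for r
    proof -
      define A where "A = (1 - r) powr (1 - b) / (b - 1)"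
      have A: "A > 0" using r b by (simp add: A_def)
      have wA: "(\<integral>\<^sup>+x. ennreal ((1 - x) powr (-b) * indicator {0..r} x) \<partial>lborel) \<le> ennreal A"
        unfolding A_def by (rule nn_integral_powr_below[OF b(1) r(2)])
      have pt: "ennreal ((r * norm (h (of_real r * cis \<theta>))) powr p)
          \<le> ennreal (A powr (p - 1)) * (\<integral>\<^sup>+x. ennreal (norm (H (of_real x * cis \<theta>)) powr p * ((1 - x) powr (b * (p - 1)) * indicator {0..r} x)) \<partial>lborel)" for \<theta>
      proof -
        \<comment> \<open>Jensen along the radius with weight (1 - x)^(-b), of mass at most A up to
          r: the derivative is written as itself times |1 - x|^b times the weight.\<close>
        have "ennreal ((r * norm (h (of_real r * cis \<theta>))) powr p) \<le> ennreal (A powr (p - 1)) *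
            (\<integral>\<^sup>+x. ennreal ((norm (H (of_real x * cis \<theta>)) * \<bar>1 - x\<bar> powr b) powr p * ((1 - x) powr (-b) * indicator {0..r} x)) \<partial>lborel)"
        proof (rule nn_integral_weighted_Jensen[OF _ _ _ _ p A _ wA])
          have zh: "(\<lambda>z. z * h z) holomorphic_on unit_disc" by (intro holomorphic_intros h)
          have der: "deriv (\<lambda>z. z * h z) z = binom_deriv h 1 z" if "norm z < 1" for z
            using binom_deriv_has_derivative[OF h that, of 0] by (intro DERIV_imp_deriv) simp
          have "ennreal (r * norm (h (of_real r * cis \<theta>)))
            \<le> (\<integral>\<^sup>+s. ennreal (norm (deriv (\<lambda>z. z * h z) (of_real s * cis \<theta>)) * indicator {0..r} s) \<partial>lborel)"
            using norm_radial_diff_le[OF zh, of 0 r \<theta>] r by (simp add: norm_mult)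
          also have "\<dots> = (\<integral>\<^sup>+x. ennreal (norm (H (of_real x * cis \<theta>)) * \<bar>1 - x\<bar> powr b * ((1 - x) powr (-b) * indicator {0..r} x)) \<partial>lborel)"
          proof (intro nn_integral_cong arg_cong[where f = ennreal])
            fix s
            show "norm (deriv (\<lambda>z. z * h z) (of_real s * cis \<theta>)) * indicator {0..r} s
              = norm (H (of_real s * cis \<theta>)) * \<bar>1 - s\<bar> powr b * ((1 - s) powr (-b) * indicator {0..r} s)"
            proof (cases "s \<in> {0..r}")
              case True
              then have "norm (of_real s * cis \<theta>) < 1" using r by (simp add: norm_mult)
              moreover have "\<bar>1 - s\<bar> powr b * (1 - s) powr (-b) = 1" using True r by (simp add: powr_add[symmetric])
              ultimately show ?thesis using True by (simp add: der H_def disc_restrict_eq mult.assoc del: binom_deriv.simps)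
            qed simp
          qed
          finally show "ennreal (r * norm (h (of_real r * cis \<theta>)))
              \<le> (\<integral>\<^sup>+x. ennreal (norm (H (of_real x * cis \<theta>)) * \<bar>1 - x\<bar> powr b * ((1 - x) powr (-b) * indicator {0..r} x)) \<partial>lborel)" .
        qed (use r in auto)
        also have "(\<integral>\<^sup>+x. ennreal ((norm (H (of_real x * cis \<theta>)) * \<bar>1 - x\<bar> powr b) powr p * ((1 - x) powr (-b) * indicator {0..r} x)) \<partial>lborel)
            = (\<integral>\<^sup>+x. ennreal (norm (H (of_real x * cis \<theta>)) powr p * ((1 - x) powr (b * (p - 1)) * indicator {0..r} x)) \<partial>lborel)"
        proof (intro nn_integral_cong arg_cong[where f = ennreal])
          fix x
          show "(norm (H (of_real x * cis \<theta>)) * \<bar>1 - x\<bar> powr b) powr p * ((1 - x) powr (-b) * indicator {0..r} x)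
             = norm (H (of_real x * cis \<theta>)) powr p * ((1 - x) powr (b * (p - 1)) * indicator {0..r} x)"
          proof (cases "x \<in> {0..r}")
            case True
            then have "1 - x > 0" using r by auto
            then have "(\<bar>1 - x\<bar> powr b) powr p * (1 - x) powr (-b) = (1 - x) powr (b * (p - 1))"
              by (simp add: powr_powr powr_add[symmetric] algebra_simps)
            then show ?thesis using True by (simp add: powr_mult mult.assoc)
          qed simp
        qed
        finally show ?thesis .
      qed
      have "ennreal (r powr p) * mean_pow p r h = (\<integral>\<^sup>+\<theta>. ennreal ((r * norm (h (of_real r * cis \<theta>))) powr p) \<partial>circ)"
      proof -
        have [measurable]: "(\<lambda>t. h (of_real r * cis t)) \<in> borel_measurable borel"
          by (rule holomorphic_circle_measurable[OF h]) (use r in auto)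
        show ?thesis unfolding mean_pow_def
          using r by (subst nn_integral_cmult[symmetric]) (auto simp: powr_mult ennreal_mult)
      qed
      also have "\<dots> \<le> (\<integral>\<^sup>+\<theta>. ennreal (A powr (p - 1)) * (\<integral>\<^sup>+x. ennreal (norm (H (of_real x * cis \<theta>)) powr p * ((1 - x) powr (b * (p - 1)) * indicator {0..r} x)) \<partial>lborel) \<partial>circ)"
        by (intro nn_integral_mono pt)
      also have "\<dots> = ennreal (A powr (p - 1)) * (\<integral>\<^sup>+\<theta>. (\<integral>\<^sup>+x. ennreal (norm (H (of_real x * cis \<theta>)) powr p * ((1 - x) powr (b * (p - 1)) * indicator {0..r} x)) \<partial>lborel) \<partial>circ)"
        by (rule nn_integral_cmult) measurable
      also have "(\<integral>\<^sup>+\<theta>. (\<integral>\<^sup>+x. ennreal (norm (H (of_real x * cis \<theta>)) powr p * ((1 - x) powr (b * (p - 1)) * indicator {0..r} x)) \<partial>lborel) \<partial>circ)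
          = (\<integral>\<^sup>+x. (\<integral>\<^sup>+\<theta>. ennreal (norm (H (of_real x * cis \<theta>)) powr p * ((1 - x) powr (b * (p - 1)) * indicator {0..r} x)) \<partial>circ) \<partial>lborel)"
        by (rule Fubini'[symmetric]) measurable
      also have "\<dots> = (\<integral>\<^sup>+x. mean_pow p x H * ennreal ((1 - x) powr (b * (p - 1)) * indicator {0..r} x) \<partial>lborel)"
        unfolding mean_pow_def by (intro nn_integral_cong) (simp add: ennreal_mult nn_integral_multc)
      also have "\<dots> \<le> (\<integral>\<^sup>+x. ennreal ((1 - x) powr (b * (p - 1) - p)) * \<Phi> x * indicator {0..r} x \<partial>lborel)"
      proof (rule nn_integral_mono)
        fix x
        show "mean_pow p x H * ennreal ((1 - x) powr (b * (p - 1)) * indicator {0..r} x)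
            \<le> ennreal ((1 - x) powr (b * (p - 1) - p)) * \<Phi> x * indicator {0..r} x"
        proof (cases "x \<in> {0..r}")
          case True
          then have x: "0 \<le> x" "x < 1" using r by auto
          have "mean_pow p x H * ennreal ((1 - x) powr (b * (p - 1))) \<le> (ennreal ((1 - x) powr (-p)) * \<Phi> x) * ennreal ((1 - x) powr (b * (p - 1)))"
            unfolding H_def mean_pow_disc_restrict[OF x] by (intro mult_right_mono \<Phi> x) auto
          also have "\<dots> = ennreal ((1 - x) powr (-p) * (1 - x) powr (b * (p - 1))) * \<Phi> x"
            by (simp add: ennreal_mult mult_ac)
          also have "(1 - x) powr (-p) * (1 - x) powr (b * (p - 1)) = (1 - x) powr (b * (p - 1) - p)"
            by (simp add: powr_add[symmetric])
          finally show ?thesis using True by simp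
        qed simp
      qed
      finally have X: "ennreal (r powr p) * mean_pow p r h \<le> ennreal (A powr (p - 1)) * (\<integral>\<^sup>+x. ennreal ((1 - x) powr (b * (p - 1) - p)) * \<Phi> x * indicator {0..r} x \<partial>lborel)"
        by (simp add: mult_left_mono)
      have "mean_pow p r h = ennreal (2 powr p * (1/2) powr p) * mean_pow p r h"
        by (simp add: powr_mult[symmetric])
      also have "\<dots> \<le> ennreal (2 powr p * r powr p) * mean_pow p r h"
        using r p by (intro mult_right_mono ennreal_leI mult_left_mono powr_mono2) auto
      also have "\<dots> = ennreal (2 powr p) * (ennreal (r powr p) * mean_pow p r h)"
        by (simp add: ennreal_mult mult.assoc)
      also have "\<dots> \<le> ennreal (2 powr p) * (ennreal (A powr (p - 1)) * (\<integral>\<^sup>+x. ennreal ((1 - x) powr (b * (p - 1) - p)) * \<Phi> x * indicator {0..r} x \<partial>lborel))"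
        by (intro mult_left_mono X) auto
      finally show ?thesis by (simp add: A_def ennreal_mult mult.assoc)
    qed
    \<comment> \<open>On this range sqrt s >= 1/2, so the factor r that comes with z * h(z) can be
      divided out.\<close>
    define hi where "hi = (\<integral>\<^sup>+s. ennreal ((\<alpha>+1) * (1 - s) powr \<alpha>) * mean_pow p (sqrt s) h * indicator {1/4..<1} s \<partial>lborel)"
    have hi: "hi \<le> ennreal C2 * (\<integral>\<^sup>+x. ennreal ((1 - x) powr \<alpha>) * \<Phi> x * indicator {0..<1} x \<partial>lborel)"
    proof -
      have "hi \<le> (\<integral>\<^sup>+s. ennreal C1 * (\<integral>\<^sup>+x. ennreal ((1 - x) powr (b * (p - 1) - p)) * \<Phi> x * indicator {0..<1} x
          * (ennreal ((1 - s) powr \<gamma>) * indicator {x\<^sup>2..<1} s) \<partial>lborel) \<partial>lborel)"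
        unfolding hi_def
      proof (rule nn_integral_mono)
        fix s
        show "ennreal ((\<alpha>+1) * (1 - s) powr \<alpha>) * mean_pow p (sqrt s) h * indicator {1/4..<1} s
            \<le> ennreal C1 * (\<integral>\<^sup>+x. ennreal ((1 - x) powr (b * (p - 1) - p)) * \<Phi> x * indicator {0..<1} x
          * (ennreal ((1 - s) powr \<gamma>) * indicator {x\<^sup>2..<1} s) \<partial>lborel)"
        proof (cases "s \<in> {1/4..<1}")
          case True
          define r where "r = sqrt s"
          have "sqrt (1/4) \<le> r" using True unfolding r_def by (subst real_sqrt_le_iff) auto
          then have r: "1/2 \<le> r" "r < 1" "s = r\<^sup>2" using True by (auto simp: r_def real_sqrt_divide)
          let ?I = "\<integral>\<^sup>+x. ennreal ((1 - x) powr (b * (p - 1) - p)) * \<Phi> x * indicator {0..r} x \<partial>lborel"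
          have "(1 - r) * (1 + r) \<le> (1 - r) * 2" using r by (intro mult_left_mono) auto
          then have "(1 - s) / 2 \<le> 1 - r" unfolding r(3) power2_eq_square by (simp add: field_simps)
          then have "(1 - r) powr (1 - b) \<le> ((1 - s) / 2) powr (1 - b)"
            using True b by (intro powr_mono2') auto
          also have "\<dots> = (1/2) powr (1 - b) * (1 - s) powr (1 - b)"
            using True by (simp add: powr_divide)
          finally have "((1 - r) powr (1 - b) / (b - 1)) powr (p - 1) \<le> ((1/2) powr (1 - b) / (b - 1) * (1 - s) powr (1 - b)) powr (p - 1)"
            using b p by (intro powr_mono2) (auto intro!: divide_right_mono)
          also have "\<dots> = ((1/2) powr (1 - b) / (b - 1)) powr (p - 1) * (1 - s) powr ((1 - b) * (p - 1))"
            using b by (simp only: powr_mult[of "_ / _"] powr_powr)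
          finally have c: "((1 - r) powr (1 - b) / (b - 1)) powr (p - 1) \<le> ((1/2) powr (1 - b) / (b - 1)) powr (p - 1) * (1 - s) powr ((1 - b) * (p - 1))" .
          have "ennreal ((\<alpha>+1) * (1 - s) powr \<alpha>) * mean_pow p r h
              \<le> ennreal ((\<alpha>+1) * (1 - s) powr \<alpha>) * (ennreal (2 powr p * ((1 - r) powr (1 - b) / (b - 1)) powr (p - 1)) * ?I)"
            by (intro mult_left_mono mh r) auto
          also have "\<dots> = ennreal ((\<alpha>+1) * (1 - s) powr \<alpha> * (2 powr p * ((1 - r) powr (1 - b) / (b - 1)) powr (p - 1))) * ?I"
            using \<alpha> by (simp add: ennreal_mult mult.assoc)
          also have "\<dots> \<le> ennreal ((\<alpha>+1) * (1 - s) powr \<alpha> * (2 powr p * (((1/2) powr (1 - b) / (b - 1)) powr (p - 1) * (1 - s) powr ((1 - b) * (p - 1))))) * ?I"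
            using c \<alpha> by (intro mult_right_mono ennreal_leI mult_left_mono) auto
          also have "(\<alpha>+1) * (1 - s) powr \<alpha> * (2 powr p * (((1/2) powr (1 - b) / (b - 1)) powr (p - 1) * (1 - s) powr ((1 - b) * (p - 1)))) = C1 * (1 - s) powr \<gamma>"
            by (simp add: C1_def \<gamma>_def powr_add mult_ac)
          also have "ennreal (C1 * (1 - s) powr \<gamma>) * ?I = ennreal C1 * (?I * ennreal ((1 - s) powr \<gamma>))"
            using C1 by (simp add: ennreal_mult mult_ac)
          also have "?I * ennreal ((1 - s) powr \<gamma>) = (\<integral>\<^sup>+x. ennreal ((1 - x) powr (b * (p - 1) - p)) * \<Phi> x * indicator {0..r} x * ennreal ((1 - s) powr \<gamma>) \<partial>lborel)"
            by (rule nn_integral_multc[symmetric]) measurable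
          also have "\<dots> \<le> (\<integral>\<^sup>+x. ennreal ((1 - x) powr (b * (p - 1) - p)) * \<Phi> x * indicator {0..<1} x
            * (ennreal ((1 - s) powr \<gamma>) * indicator {x\<^sup>2..<1} s) \<partial>lborel)"
          proof (rule nn_integral_mono)
            fix x
            show "ennreal ((1 - x) powr (b * (p - 1) - p)) * \<Phi> x * indicator {0..r} x * ennreal ((1 - s) powr \<gamma>)
              \<le> ennreal ((1 - x) powr (b * (p - 1) - p)) * \<Phi> x * indicator {0..<1} x * (ennreal ((1 - s) powr \<gamma>) * indicator {x\<^sup>2..<1} s)"
            proof (cases "x \<in> {0..r}")
              case x: True
              then have "x\<^sup>2 \<le> s" unfolding r(3) by (intro power_mono) auto
              then show ?thesis using x r True by auto
            qed simp
          qed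
          finally show ?thesis using True by (simp add: r_def mult_left_mono)
        qed simp
      qed
      also have "\<dots> = ennreal C1 * (\<integral>\<^sup>+s. (\<integral>\<^sup>+x. ennreal ((1 - x) powr (b * (p - 1) - p)) * \<Phi> x * indicator {0..<1} x
          * (ennreal ((1 - s) powr \<gamma>) * indicator {x\<^sup>2..<1} s) \<partial>lborel) \<partial>lborel)"
        by (rule nn_integral_cmult) (unfold indicator_def atLeastLessThan_iff, measurable)
      also have "(\<integral>\<^sup>+s. (\<integral>\<^sup>+x. ennreal ((1 - x) powr (b * (p - 1) - p)) * \<Phi> x * indicator {0..<1} x
          * (ennreal ((1 - s) powr \<gamma>) * indicator {x\<^sup>2..<1} s) \<partial>lborel) \<partial>lborel)
          = (\<integral>\<^sup>+x. (\<integral>\<^sup>+s. ennreal ((1 - x) powr (b * (p - 1) - p)) * \<Phi> x * indicator {0..<1} x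
          * (ennreal ((1 - s) powr \<gamma>) * indicator {x\<^sup>2..<1} s) \<partial>lborel) \<partial>lborel)"
        by (rule lborel_pair.Fubini') (unfold indicator_def atLeastLessThan_iff, measurable)
      also have "\<dots> \<le> (\<integral>\<^sup>+x. ennreal (2 powr (\<gamma>+1) / (\<gamma>+1)) * (ennreal ((1 - x) powr \<alpha>) * \<Phi> x * indicator {0..<1} x) \<partial>lborel)"
      proof (rule nn_integral_mono)
        fix x
        show "(\<integral>\<^sup>+s. ennreal ((1 - x) powr (b * (p - 1) - p)) * \<Phi> x * indicator {0..<1} x * (ennreal ((1 - s) powr \<gamma>) * indicator {x\<^sup>2..<1} s) \<partial>lborel)
          \<le> ennreal (2 powr (\<gamma>+1) / (\<gamma>+1)) * (ennreal ((1 - x) powr \<alpha>) * \<Phi> x * indicator {0..<1} x)"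
        proof (cases "x \<in> {0..<1}")
          case x: True
          have x2: "x\<^sup>2 \<le> 1" using x by (auto simp: abs_square_le_1)
          have "(\<integral>\<^sup>+s. ennreal ((1 - x) powr (b * (p - 1) - p)) * \<Phi> x * (ennreal ((1 - s) powr \<gamma>) * indicator {x\<^sup>2..<1} s) \<partial>lborel)
             = ennreal ((1 - x) powr (b * (p - 1) - p)) * \<Phi> x * (\<integral>\<^sup>+s. ennreal ((1 - s) powr \<gamma>) * indicator {x\<^sup>2..<1} s \<partial>lborel)"
            by (rule nn_integral_cmult) measurable
          also have "\<dots> = ennreal ((1 - x) powr (b * (p - 1) - p)) * \<Phi> x * ennreal ((1 - x\<^sup>2) powr (\<gamma>+1) / (\<gamma>+1))"
            by (simp only: nn_integral_powr_upto_1[OF \<gamma> x2])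
          also have "\<dots> \<le> ennreal ((1 - x) powr (b * (p - 1) - p)) * \<Phi> x * ennreal (2 powr (\<gamma>+1) * (1 - x) powr (\<gamma>+1) / (\<gamma>+1))"
          proof (intro mult_left_mono ennreal_leI divide_right_mono)
            have "1 - x\<^sup>2 = (1 + x) * (1 - x)" by (simp add: power2_eq_square algebra_simps)
            also have "\<dots> \<le> 2 * (1 - x)" using x by (intro mult_right_mono) auto
            finally have "(1 - x\<^sup>2) powr (\<gamma>+1) \<le> (2 * (1 - x)) powr (\<gamma>+1)" using \<gamma> x2 by (intro powr_mono2) auto
            then show "(1 - x\<^sup>2) powr (\<gamma>+1) \<le> 2 powr (\<gamma>+1) * (1 - x) powr (\<gamma>+1)" using x by (simp only: powr_mult)
          qed (use \<gamma> in auto)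
          also have "\<dots> = ennreal (2 powr (\<gamma>+1) / (\<gamma>+1) * ((1 - x) powr (b * (p - 1) - p) * (1 - x) powr (\<gamma>+1))) * \<Phi> x"
            using \<gamma> by (simp add: ennreal_mult[symmetric] mult_ac)
          \<comment> \<open>The auxiliary exponent b cancels and exactly \<alpha> remains.\<close>
          also have "(1 - x) powr (b * (p - 1) - p) * (1 - x) powr (\<gamma>+1) = (1 - x) powr \<alpha>"
            by (simp add: powr_add[symmetric] \<gamma>_def algebra_simps)
          also have "ennreal (2 powr (\<gamma>+1) / (\<gamma>+1) * (1 - x) powr \<alpha>) = ennreal (2 powr (\<gamma>+1) / (\<gamma>+1)) * ennreal ((1 - x) powr \<alpha>)"
            using \<gamma> by (intro ennreal_mult) auto
          finally show ?thesis using x by (simp only: mult.assoc indicator_simps(1) mult_1_right mult_1)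
        qed simp
      qed
      also have "\<dots> = ennreal (2 powr (\<gamma>+1) / (\<gamma>+1)) * (\<integral>\<^sup>+x. ennreal ((1 - x) powr \<alpha>) * \<Phi> x * indicator {0..<1} x \<partial>lborel)"
        by (rule nn_integral_cmult) measurable
      finally have "hi \<le> ennreal C1 * (ennreal (2 powr (\<gamma>+1) / (\<gamma>+1)) * (\<integral>\<^sup>+x. ennreal ((1 - x) powr \<alpha>) * \<Phi> x * indicator {0..<1} x \<partial>lborel))"
        by (simp add: mult_left_mono)
      moreover have "ennreal C2 = ennreal C1 * ennreal (2 powr (\<gamma>+1) / (\<gamma>+1))"
        unfolding C2_def using C1 \<gamma> by (intro ennreal_mult) auto
      ultimately show ?thesis by (simp only: mult.assoc)
    qed
    \<comment> \<open>By monotonicity the part s < 1/4 is at most m and the part s >= 1/4 at least W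
      * m.\<close>
    define m where "m = mean_pow p (1/2) h"
    have lo: "(\<integral>\<^sup>+s. ennreal ((\<alpha>+1) * (1 - s) powr \<alpha>) * mean_pow p (sqrt s) h * indicator {0..<1/4} s \<partial>lborel) \<le> m"
    proof -
      have "(\<integral>\<^sup>+s. ennreal ((\<alpha>+1) * (1 - s) powr \<alpha>) * mean_pow p (sqrt s) h * indicator {0..<1/4} s \<partial>lborel)
          \<le> (\<integral>\<^sup>+s. (ennreal (\<alpha>+1) * m) * (ennreal ((1 - s) powr \<alpha>) * indicator {0..<1} s) \<partial>lborel)"
      proof (rule nn_integral_mono)
        fix s
        show "ennreal ((\<alpha>+1) * (1 - s) powr \<alpha>) * mean_pow p (sqrt s) h * indicator {0..<1/4} s
            \<le> (ennreal (\<alpha>+1) * m) * (ennreal ((1 - s) powr \<alpha>) * indicator {0..<1} s)"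
        proof (cases "s \<in> {0..<1/4}")
          case True
          have "sqrt s \<le> sqrt (1/4)" using True by simp
          then have "sqrt s \<le> 1/2" by (simp add: real_sqrt_divide)
          then have "mean_pow p (sqrt s) h \<le> m" unfolding m_def using True p by (intro mean_pow_mono[OF h]) auto
          then have "(ennreal (\<alpha>+1) * ennreal ((1 - s) powr \<alpha>)) * mean_pow p (sqrt s) h \<le> (ennreal (\<alpha>+1) * ennreal ((1 - s) powr \<alpha>)) * m"
            by (rule mult_left_mono) simp
          then show ?thesis using True \<alpha> by (simp add: ennreal_mult mult_ac)
        qed simp
      qed
      also have "\<dots> = (ennreal (\<alpha>+1) * m) * (\<integral>\<^sup>+s. ennreal ((1 - s) powr \<alpha>) * indicator {0..<1} s \<partial>lborel)"
        by (rule nn_integral_cmult) measurable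
      also have "\<dots> = (ennreal (\<alpha>+1) * ennreal (1 / (\<alpha>+1))) * m"
        using nn_integral_powr_upto_1[OF \<alpha>, of 0] by (simp add: mult_ac)
      also have "ennreal (\<alpha>+1) * ennreal (1 / (\<alpha>+1)) = 1"
        using \<alpha> by (subst ennreal_mult[symmetric]) auto
      finally show ?thesis by simp
    qed
    have mW: "ennreal W * m \<le> hi"
    proof -
      have "ennreal W * m = (ennreal (\<alpha>+1) * m) * (\<integral>\<^sup>+s. ennreal ((1 - s) powr \<alpha>) * indicator {1/4..<1} s \<partial>lborel)"
      proof -
        have "ennreal W = ennreal (\<alpha>+1) * ennreal (W / (\<alpha>+1))" using \<alpha> by (subst ennreal_mult[symmetric]) (auto simp: W_def)
        then show ?thesis using nn_integral_powr_upto_1[OF \<alpha>, of "1/4"] by (simp add: mult_ac W_def)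
      qed
      also have "\<dots> = (\<integral>\<^sup>+s. (ennreal (\<alpha>+1) * m) * (ennreal ((1 - s) powr \<alpha>) * indicator {1/4..<1} s) \<partial>lborel)"
        by (rule nn_integral_cmult[symmetric]) measurable
      also have "\<dots> \<le> hi" unfolding hi_def
      proof (rule nn_integral_mono)
        fix s
        show "(ennreal (\<alpha>+1) * m) * (ennreal ((1 - s) powr \<alpha>) * indicator {1/4..<1} s)
            \<le> ennreal ((\<alpha>+1) * (1 - s) powr \<alpha>) * mean_pow p (sqrt s) h * indicator {1/4..<1} s"
        proof (cases "s \<in> {1/4..<1}")
          case True
          have "sqrt (1/4) \<le> sqrt s" using True by simp
          then have "1/2 \<le> sqrt s" by (simp add: real_sqrt_divide)
          then have "m \<le> mean_pow p (sqrt s) h" unfolding m_def using True p by (intro mean_pow_mono[OF h]) auto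
          then have "(ennreal (\<alpha>+1) * ennreal ((1 - s) powr \<alpha>)) * m \<le> (ennreal (\<alpha>+1) * ennreal ((1 - s) powr \<alpha>)) * mean_pow p (sqrt s) h"
            by (rule mult_left_mono) simp
          then show ?thesis using True \<alpha> by (simp add: ennreal_mult mult_ac)
        qed simp
      qed
      finally show ?thesis .
    qed
    have "m = ennreal (1/W) * (ennreal W * m)"
      using W by (simp add: mult.assoc[symmetric] ennreal_mult[symmetric])
    also have "\<dots> \<le> ennreal (1/W) * hi" by (intro mult_left_mono mW) auto
    finally have mhi: "m \<le> ennreal (1/W) * hi" .
    have "bergman_int p \<alpha> h = bergman_int p \<alpha> (disc_restrict h)" by (simp add: bergman_int_disc_restrict)
    also have "\<dots> = (\<integral>\<^sup>+s. ennreal ((\<alpha>+1) * (1 - s) powr \<alpha>) * mean_pow p (sqrt s) (disc_restrict h) * indicator {0..<1/4} s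
        + ennreal ((\<alpha>+1) * (1 - s) powr \<alpha>) * mean_pow p (sqrt s) (disc_restrict h) * indicator {1/4..<1} s \<partial>lborel)"
      unfolding bergman_int_def by (intro nn_integral_cong) (auto simp: indicator_def)
    also have "\<dots> = (\<integral>\<^sup>+s. ennreal ((\<alpha>+1) * (1 - s) powr \<alpha>) * mean_pow p (sqrt s) (disc_restrict h) * indicator {0..<1/4} s \<partial>lborel)
        + (\<integral>\<^sup>+s. ennreal ((\<alpha>+1) * (1 - s) powr \<alpha>) * mean_pow p (sqrt s) (disc_restrict h) * indicator {1/4..<1} s \<partial>lborel)"
      by (rule nn_integral_add) measurable
    also have "\<dots> = (\<integral>\<^sup>+s. ennreal ((\<alpha>+1) * (1 - s) powr \<alpha>) * mean_pow p (sqrt s) h * indicator {0..<1/4} s \<partial>lborel) + hi"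
      unfolding hi_def by (intro arg_cong2[where f = "(+)"] nn_integral_cong) (auto simp: indicator_def mean_pow_disc_restrict)
    also have "\<dots> \<le> ennreal (1/W) * hi + hi" using lo mhi by (intro add_mono) auto
    also have "\<dots> = ennreal (1 + 1/W) * hi" using W by (simp add: distrib_right add.commute)
    also have "\<dots> \<le> ennreal (1 + 1/W) * (ennreal C2 * (\<integral>\<^sup>+x. ennreal ((1 - x) powr \<alpha>) * \<Phi> x * indicator {0..<1} x \<partial>lborel))"
      by (intro mult_left_mono hi) auto
    also have "\<dots> = ennreal ((1 + 1/W) * C2) * (\<integral>\<^sup>+x. ennreal ((1 - x) powr \<alpha>) * \<Phi> x * indicator {0..<1} x \<partial>lborel)"
    proof -
      have "ennreal ((1 + 1/W) * C2) = ennreal (1 + 1/W) * ennreal C2" using W C2 by (intro ennreal_mult) auto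
      then show ?thesis by (simp only: mult.assoc)
    qed
    finally show ?thesis .
  qed
  show ?thesis by (rule that[of "(1 + 1 / W) * C2"]) (use main W C2 in \<open>auto intro!: mult_pos_pos add_pos_pos\<close>)
qed

section \<open>Boundedness and compactness from the growth of the symbol\<close>

text \<open>Young's convolution inequality combined with Hoelder's inequality for \<open>f(z) / (1 - z)\<close>, in one
  application of Jensen's inequality with weight \<open>|1 - z|\<^bsup>-q\<^esup>\<close>, \<open>q = p / (p - 1)\<close>.\<close>

lemma mean_pow_Rhaly_le:
  assumes p: "p \<ge> (1::real)"
  obtains C where "C > 0" "\<And>\<eta> f r. fps_conv_radius (Abs_fps \<eta>) \<ge> 1 \<Longrightarrow> f holomorphic_on unit_disc \<Longrightarrow> 0 \<le> r \<Longrightarrow> r < 1 \<Longrightarrow>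
    mean_pow p (r\<^sup>2) (binom_deriv (Rhaly \<eta> f) 1)
      \<le> ennreal (C / (1 - r)) * (mean_pow p r (binom_deriv (symbol_fun \<eta>) 1) * mean_pow p r f)"
proof -
  \<comment> \<open>The conjugate exponent; for p = 1 the division by zero gives 0, and that case is
    treated apart.\<close>
  define q where "q = p / (p - 1)"
  define C where "C = (if p = 1 then 1 else kernel_const 0 q powr (p - 1))"
  have q: "q > 1" "(q - 1) * p = q" "(1 - q) * (p - 1) = -1" if "p \<noteq> 1"
    using that p by (auto simp: q_def field_simps)
  have C: "C > 0" using q(1) kernel_const_pos[of 0 q] by (auto simp: C_def)
  have main: "mean_pow p (r\<^sup>2) (binom_deriv (Rhaly \<eta> f) 1)
      \<le> ennreal (C / (1 - r)) * (mean_pow p r (binom_deriv (symbol_fun \<eta>) 1) * mean_pow p r f)"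
    if \<eta>: "fps_conv_radius (Abs_fps \<eta>) \<ge> 1" and f: "f holomorphic_on unit_disc" and r: "0 \<le> r" "r < 1" for \<eta> f r
  proof -
    interpret C: sigma_finite_measure circ by (rule sigma_finite_circ)
    interpret pair_sigma_finite circ circ ..
    define F where "F = (\<lambda>t. binom_deriv (symbol_fun \<eta>) 1 (of_real r * cis t))"
    define G where "G = (\<lambda>t. f (of_real r * cis t))"
    define k where "k = (\<lambda>t. norm (1 - of_real r * cis t))"
    define H where "H = (\<lambda>\<theta>. binom_deriv (Rhaly \<eta> f) 1 (of_real (r\<^sup>2) * cis \<theta>))"
    have F1: "binom_deriv (symbol_fun \<eta>) 1 holomorphic_on unit_disc"
      by (rule holomorphic_binom_deriv[OF symbol_fun_expansion(1)[OF \<eta>]])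
    have [measurable]: "F \<in> borel_measurable borel" unfolding F_def by (rule holomorphic_circle_measurable[OF F1 r])
    have [measurable]: "G \<in> borel_measurable borel" unfolding G_def by (rule holomorphic_circle_measurable[OF f r])
    have [measurable]: "k \<in> borel_measurable borel" unfolding k_def by measurable
    have k: "k t \<ge> 1 - r" for t unfolding k_def by (rule norm_one_minus_cis_ge[OF r(1)])
    then have k0: "k t > 0" for t using r by (metis diff_gt_0_iff_gt less_le_trans)
    have Gper: "G (t + 2*pi) = G t" for t by (simp add: G_def cis_mult[symmetric])
    have H_le: "ennreal (norm (H \<theta>)) \<le> (\<integral>\<^sup>+t. ennreal (norm (F t) * norm (G (\<theta> - t)) * k (\<theta> - t) powr (-1)) \<partial>circ)" for \<theta>
    proof (cases "integrable circ (\<lambda>t. F t * (G (\<theta> - t) / (1 - of_real r * cis (\<theta> - t))))")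
      case True
      have "norm (F t * (G (\<theta> - t) / (1 - of_real r * cis (\<theta> - t)))) = norm (F t) * norm (G (\<theta> - t)) * k (\<theta> - t) powr (-1)" for t
        using k0[of "\<theta> - t"] by (simp add: norm_mult norm_divide norm_inverse k_def powr_minus divide_inverse)
      then show ?thesis
        using integral_norm_bound_ennreal[OF True] binom_deriv_Rhaly_convolution[OF \<eta> f r, of \<theta>]
        by (simp add: H_def F_def G_def del: binom_deriv.simps)
    next
      case False
      \<comment> \<open>The Bochner integral of a non-integrable function is 0 by
        convention.\<close>
      then have "H \<theta> = 0"
        unfolding H_def binom_deriv_Rhaly_convolution[OF \<eta> f r] by (simp add: not_integrable_integral_eq F_def G_def del: binom_deriv.simps)
      then show ?thesis by simp
    qed
    have pt: "ennreal (norm (H \<theta>) powr p) \<le> ennreal (C / (1 - r)) * (\<integral>\<^sup>+t. ennreal (norm (F t) powr p * norm (G (\<theta> - t)) powr p) \<partial>circ)" for \<theta>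
    proof (cases "p = 1")
      case True
      have "ennreal (norm (H \<theta>)) \<le> (\<integral>\<^sup>+t. ennreal (1 / (1 - r)) * ennreal (norm (F t) * norm (G (\<theta> - t))) \<partial>circ)"
      proof (rule order_trans[OF H_le], rule nn_integral_mono)
        fix t
        \<comment> \<open>The endpoint of Hoelder's inequality: the supremum 1/(1 - r) of the kernel
          takes the place of its q-norm.\<close>
        have "k (\<theta> - t) powr (-1) \<le> 1 / (1 - r)"
          using k[of "\<theta> - t"] k0[of "\<theta> - t"] r by (simp add: powr_minus_divide divide_left_mono)
        then have "norm (F t) * norm (G (\<theta> - t)) * k (\<theta> - t) powr (-1) \<le> norm (F t) * norm (G (\<theta> - t)) * (1 / (1 - r))"
          by (rule mult_left_mono) simp
        then show "ennreal (norm (F t) * norm (G (\<theta> - t)) * k (\<theta> - t) powr (-1)) \<le> ennreal (1 / (1 - r)) * ennreal (norm (F t) * norm (G (\<theta> - t)))"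
          using r by (subst ennreal_mult[symmetric]) (auto intro!: ennreal_leI simp: mult_ac)
      qed
      also have "\<dots> = ennreal (1 / (1 - r)) * (\<integral>\<^sup>+t. ennreal (norm (F t) * norm (G (\<theta> - t))) \<partial>circ)"
        by (rule nn_integral_cmult) measurable
      finally show ?thesis using True by (simp add: C_def)
    next
      case False
      note q = q[OF False]
      define A where "A = kernel_const 0 q * (1 - r) powr (1 - q)"
      have kc: "kernel_const 0 q > 0" using q by (intro kernel_const_pos) auto
      have A: "A > 0" unfolding A_def using kc r by simp
      \<comment> \<open>Write k^(-1) = k^(q - 1) * k^(-q). Since (q - 1) p = q, the p-th power of
        the first factor cancels the weight, and only F and G remain.\<close>
      have "ennreal (norm (H \<theta>) powr p) \<le> ennreal (A powr (p - 1)) *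
          (\<integral>\<^sup>+t. ennreal ((norm (F t) * norm (G (\<theta> - t)) * k (\<theta> - t) powr (q - 1)) powr p * k (\<theta> - t) powr (-q)) \<partial>circ)"
      proof (rule nn_integral_weighted_Jensen[OF _ _ _ _ p A])
        have "(\<integral>\<^sup>+t. ennreal (k (\<theta> - t) powr (-q)) \<partial>circ) = (\<integral>\<^sup>+t. ennreal (k t powr (-q)) \<partial>circ)"
          by (rule nn_integral_circ_reflect) (auto simp: k_def cis_mult[symmetric])
        also have "\<dots> \<le> ennreal A" unfolding A_def k_def by (rule nn_integral_circ_kernel[OF q(1) r])
        finally show "(\<integral>\<^sup>+t. ennreal (k (\<theta> - t) powr (-q)) \<partial>circ) \<le> ennreal A" .
        have "k x powr (q - 1) * k x powr (-q) = k x powr (-1)" for x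
          by (simp add: powr_add[symmetric])
        then show "ennreal (norm (H \<theta>)) \<le> (\<integral>\<^sup>+t. ennreal (norm (F t) * norm (G (\<theta> - t)) * k (\<theta> - t) powr (q - 1) * k (\<theta> - t) powr (-q)) \<partial>circ)"
          using H_le[of \<theta>] by (simp only: mult.assoc)
      qed auto
      also have "(\<integral>\<^sup>+t. ennreal ((norm (F t) * norm (G (\<theta> - t)) * k (\<theta> - t) powr (q - 1)) powr p * k (\<theta> - t) powr (-q)) \<partial>circ)
          = (\<integral>\<^sup>+t. ennreal (norm (F t) powr p * norm (G (\<theta> - t)) powr p) \<partial>circ)"
      proof (intro nn_integral_cong arg_cong[where f = ennreal])
        fix t
        have "(k (\<theta> - t) powr (q - 1)) powr p * k (\<theta> - t) powr (-q) = 1"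
          using k0[of "\<theta> - t"] by (simp add: powr_powr q(2) powr_add[symmetric])
        then show "(norm (F t) * norm (G (\<theta> - t)) * k (\<theta> - t) powr (q - 1)) powr p * k (\<theta> - t) powr (-q)
            = norm (F t) powr p * norm (G (\<theta> - t)) powr p"
          by (simp add: powr_mult mult.assoc)
      qed
      \<comment> \<open>A carries the power (1 - r)^(1 - q), and (1 - q)(p - 1) = -1.\<close>
      also have "A powr (p - 1) = C / (1 - r)"
        using False kc r q(3) by (simp add: A_def C_def powr_mult powr_powr powr_minus_divide)
      finally show ?thesis .
    qed
    have "mean_pow p (r\<^sup>2) (binom_deriv (Rhaly \<eta> f) 1)
        \<le> (\<integral>\<^sup>+\<theta>. ennreal (C / (1 - r)) * (\<integral>\<^sup>+t. ennreal (norm (F t) powr p * norm (G (\<theta> - t)) powr p) \<partial>circ) \<partial>circ)"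
      unfolding mean_pow_def by (rule nn_integral_mono) (rule pt[unfolded H_def])
    also have "\<dots> = ennreal (C / (1 - r)) * (\<integral>\<^sup>+\<theta>. (\<integral>\<^sup>+t. ennreal (norm (F t) powr p * norm (G (\<theta> - t)) powr p) \<partial>circ) \<partial>circ)"
      by (rule nn_integral_cmult) measurable
    also have "(\<integral>\<^sup>+\<theta>. (\<integral>\<^sup>+t. ennreal (norm (F t) powr p * norm (G (\<theta> - t)) powr p) \<partial>circ) \<partial>circ)
        = (\<integral>\<^sup>+t. (\<integral>\<^sup>+\<theta>. ennreal (norm (F t) powr p * norm (G (\<theta> - t)) powr p) \<partial>circ) \<partial>circ)"
      by (rule Fubini') measurable
    also have "\<dots> = (\<integral>\<^sup>+t. ennreal (norm (F t) powr p) * mean_pow p r f \<partial>circ)"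
    proof (rule nn_integral_cong)
      fix t
      have "(\<integral>\<^sup>+\<theta>. ennreal (norm (G (- t + \<theta>)) powr p) \<partial>circ) = (\<integral>\<^sup>+\<theta>. ennreal (norm (G \<theta>) powr p) \<partial>circ)"
        by (rule nn_integral_circ_shift) (auto simp: Gper)
      moreover have "(\<integral>\<^sup>+\<theta>. ennreal (norm (F t) powr p * norm (G (\<theta> - t)) powr p) \<partial>circ)
          = ennreal (norm (F t) powr p) * (\<integral>\<^sup>+\<theta>. ennreal (norm (G (- t + \<theta>)) powr p) \<partial>circ)"
        by (simp add: ennreal_mult nn_integral_cmult)
      moreover have "(\<integral>\<^sup>+\<theta>. ennreal (norm (G \<theta>) powr p) \<partial>circ) = mean_pow p r f"
        by (simp add: mean_pow_def G_def)
      ultimately show "(\<integral>\<^sup>+\<theta>. ennreal (norm (F t) powr p * norm (G (\<theta> - t)) powr p) \<partial>circ) = ennreal (norm (F t) powr p) * mean_pow p r f"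
        by (simp only:)
    qed
    also have "\<dots> = mean_pow p r (binom_deriv (symbol_fun \<eta>) 1) * mean_pow p r f"
    proof -
      have "(\<integral>\<^sup>+t. ennreal (norm (F t) powr p) * mean_pow p r f \<partial>circ) = (\<integral>\<^sup>+t. ennreal (norm (F t) powr p) \<partial>circ) * mean_pow p r f"
        by (rule nn_integral_multc) measurable
      then show ?thesis by (simp only: mean_pow_def[of p r "binom_deriv (symbol_fun \<eta>) 1"] F_def)
    qed
    finally show ?thesis .
  qed
  show ?thesis by (rule that[OF C main])
qed

text \<open>The growth condition \<open>M\<^sub>p(r, (zF)') \<le> \<epsilon> (1-r)\<^bsup>1/p-1\<^esup> + K\<close>: the big-\<open>O\<close> condition says that it holds for
  some \<open>\<epsilon>\<close> and \<open>K\<close>, the little-\<open>o\<close> condition that for every \<open>\<epsilon>\<close> there is such a \<open>K\<close>.\<close>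

definition mean_growth :: "real \<Rightarrow> real \<Rightarrow> real \<Rightarrow> real \<Rightarrow> (complex \<Rightarrow> complex) \<Rightarrow> bool" where
  "mean_growth p \<beta> \<epsilon> K f \<longleftrightarrow> (\<forall>r. 0 \<le> r \<and> r < 1 \<longrightarrow> mean_pow p r f \<le> ennreal ((\<epsilon> * (1 - r) powr (-\<beta>) + K) powr p))"

text \<open>The loss 1/(1 - r) from the convolution and the growth (1 - r)^(-(p - 1)) of the symbol
  multiply to (1 - r)^(-p), just what \<open>bergman_int_le_derivative\<close> admits. The factor (1
  - sqrt x)^(1 - 1/p) is kept beside K because, for p > 1, its decay at the circle gives
  compactness.\<close>

lemma bergman_int_Rhaly_le:
  assumes p: "p \<ge> 1" and \<alpha>: "\<alpha> > -1"
  obtains C where "C > 0" "\<And>\<eta> f \<epsilon> K. fps_conv_radius (Abs_fps \<eta>) \<ge> 1 \<Longrightarrow> f holomorphic_on unit_disc \<Longrightarrow> \<epsilon> \<ge> 0 \<Longrightarrow> K \<ge> 0 \<Longrightarrow>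
    mean_growth p (1 - 1/p) \<epsilon> K (binom_deriv (symbol_fun \<eta>) 1) \<Longrightarrow>
    bergman_int p \<alpha> (Rhaly \<eta> f) \<le> ennreal C *
      (\<integral>\<^sup>+x. ennreal ((1 - x) powr \<alpha> * (\<epsilon> + K * (1 - sqrt x) powr (1 - 1/p)) powr p) * mean_pow p (sqrt x) f * indicator {0..<1} x \<partial>lborel)"
proof -
  obtain C1 where C1: "C1 > 0" "\<And>\<eta> f r. fps_conv_radius (Abs_fps \<eta>) \<ge> 1 \<Longrightarrow> f holomorphic_on unit_disc \<Longrightarrow> 0 \<le> r \<Longrightarrow> r < 1 \<Longrightarrow>
    mean_pow p (r\<^sup>2) (binom_deriv (Rhaly \<eta> f) 1)
      \<le> ennreal (C1 / (1 - r)) * (mean_pow p r (binom_deriv (symbol_fun \<eta>) 1) * mean_pow p r f)"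
    using mean_pow_Rhaly_le[OF p] by blast
  obtain C2 where C2: "C2 > 0" "\<And>h \<Phi>. h holomorphic_on unit_disc \<Longrightarrow> \<Phi> \<in> borel_measurable borel \<Longrightarrow>
      (\<And>x. 0 \<le> x \<Longrightarrow> x < 1 \<Longrightarrow> mean_pow p x (binom_deriv h 1) \<le> ennreal ((1 - x) powr (-p)) * \<Phi> x) \<Longrightarrow>
      bergman_int p \<alpha> h \<le> ennreal C2 * (\<integral>\<^sup>+x. ennreal ((1 - x) powr \<alpha>) * \<Phi> x * indicator {0..<1} x \<partial>lborel)"
    using bergman_int_le_derivative[OF p \<alpha>] by blast
  define \<beta> where "\<beta> = 1 - 1/p"
  have \<beta>: "0 \<le> \<beta>" "\<beta> * p = p - 1" using p by (auto simp: \<beta>_def field_simps)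
  define C where "C = C2 * (2 powr p * C1)"
  have C: "C > 0" using C1 C2 by (simp add: C_def)
  have "bergman_int p \<alpha> (Rhaly \<eta> f) \<le> ennreal C *
      (\<integral>\<^sup>+x. ennreal ((1 - x) powr \<alpha> * (\<epsilon> + K * (1 - sqrt x) powr \<beta>) powr p) * mean_pow p (sqrt x) f * indicator {0..<1} x \<partial>lborel)"
    if \<eta>: "fps_conv_radius (Abs_fps \<eta>) \<ge> 1" and f: "f holomorphic_on unit_disc" and \<epsilon>: "\<epsilon> \<ge> 0" and K: "K \<ge> 0"
      and gr: "mean_growth p \<beta> \<epsilon> K (binom_deriv (symbol_fun \<eta>) 1)" for \<eta> f \<epsilon> K
  proof -
    note [measurable] = disc_restrict_measurable[OF f]
    let ?\<Phi> = "\<lambda>x. ennreal (2 powr p * C1) * (ennreal ((\<epsilon> + K * (1 - sqrt x) powr \<beta>) powr p) * mean_pow p (sqrt x) (disc_restrict f))"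
    have "bergman_int p \<alpha> (Rhaly \<eta> f) \<le> ennreal C2 * (\<integral>\<^sup>+x. ennreal ((1 - x) powr \<alpha>) * ?\<Phi> x * indicator {0..<1} x \<partial>lborel)"
    proof (rule C2(2)[OF holomorphic_Rhaly[OF \<eta> f]])
      show "?\<Phi> \<in> borel_measurable borel" by measurable
      fix x :: real assume x: "0 \<le> x" "x < 1"
      define r where "r = sqrt x"
      have r: "0 \<le> r" "r < 1" "x = r\<^sup>2" using x by (auto simp: r_def)
      define E where "E = \<epsilon> + K * (1 - r) powr \<beta>"
      have E: "E \<ge> 0" using \<epsilon> K by (simp add: E_def)
      have "\<epsilon> * (1 - r) powr (-\<beta>) + K = (1 - r) powr (-\<beta>) * E"
        using r by (simp add: E_def distrib_left powr_minus field_simps)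
      then have "(\<epsilon> * (1 - r) powr (-\<beta>) + K) powr p = (1 - r) powr (- (p - 1)) * E powr p"
        using E by (simp add: powr_mult powr_powr \<beta>(2))
      then have g: "mean_pow p r (binom_deriv (symbol_fun \<eta>) 1) \<le> ennreal ((1 - r) powr (- (p - 1)) * E powr p)"
        using gr r unfolding mean_growth_def by metis
      have "mean_pow p x (binom_deriv (Rhaly \<eta> f) 1) \<le> ennreal (C1 / (1 - r)) * (mean_pow p r (binom_deriv (symbol_fun \<eta>) 1) * mean_pow p r f)"
        unfolding r(3) by (rule C1(2)[OF \<eta> f r(1,2)])
      also have "\<dots> \<le> ennreal (C1 / (1 - r)) * (ennreal ((1 - r) powr (- (p - 1)) * E powr p) * mean_pow p r f)"
        by (intro mult_left_mono mult_right_mono g) auto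
      also have "\<dots> = ennreal (C1 / (1 - r) * ((1 - r) powr (- (p - 1)) * E powr p)) * mean_pow p r f"
        using C1(1) r by (subst ennreal_mult) (auto simp: mult.assoc)
      also have "\<dots> \<le> ennreal ((1 - x) powr (-p) * ((2 powr p * C1) * E powr p)) * mean_pow p r f"
      proof (intro mult_right_mono ennreal_leI)
        have "(1 - r) * (1 + r) \<le> (1 - r) * 2" using r by (intro mult_left_mono) auto
        then have "(1 - x) / 2 \<le> 1 - r" unfolding r(3) power2_eq_square by (simp add: field_simps)
        then have "(1 - r) powr (-p) \<le> ((1 - x) / 2) powr (-p)" using x p by (intro powr_mono2') auto
        also have "\<dots> = 2 powr p * (1 - x) powr (-p)" using x by (simp add: powr_divide powr_minus field_simps)
        finally have le: "(1 - r) powr (-p) \<le> 2 powr p * (1 - x) powr (-p)" .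
        have "C1 / (1 - r) * ((1 - r) powr (- (p - 1)) * E powr p) = (1 - r) powr (-p) * (C1 * E powr p)"
          using r by (simp add: powr_diff powr_minus field_simps)
        also have "\<dots> \<le> 2 powr p * (1 - x) powr (-p) * (C1 * E powr p)"
          using C1(1) by (intro mult_right_mono le) auto
        finally show "C1 / (1 - r) * ((1 - r) powr (- (p - 1)) * E powr p) \<le> (1 - x) powr (-p) * ((2 powr p * C1) * E powr p)"
          by (simp add: mult_ac)
      qed auto
      also have "\<dots> = ennreal ((1 - x) powr (-p)) * ?\<Phi> x"
        using C1(1) r unfolding E_def r_def[symmetric] mean_pow_disc_restrict[OF r(1,2)]
        by (simp add: ennreal_mult mult.assoc)
      finally show "mean_pow p x (binom_deriv (Rhaly \<eta> f) 1) \<le> ennreal ((1 - x) powr (-p)) * ?\<Phi> x" .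
    qed
    also have "(\<integral>\<^sup>+x. ennreal ((1 - x) powr \<alpha>) * ?\<Phi> x * indicator {0..<1} x \<partial>lborel)
        = (\<integral>\<^sup>+x. ennreal (2 powr p * C1) * (ennreal ((1 - x) powr \<alpha> * (\<epsilon> + K * (1 - sqrt x) powr \<beta>) powr p) * mean_pow p (sqrt x) (disc_restrict f) * indicator {0..<1} x) \<partial>lborel)"
      by (intro nn_integral_cong) (simp add: ennreal_mult mult_ac)
    also have "\<dots> = ennreal (2 powr p * C1) * (\<integral>\<^sup>+x. ennreal ((1 - x) powr \<alpha> * (\<epsilon> + K * (1 - sqrt x) powr \<beta>) powr p) * mean_pow p (sqrt x) (disc_restrict f) * indicator {0..<1} x \<partial>lborel)"
      by (rule nn_integral_cmult) measurable
    also have "(\<integral>\<^sup>+x. ennreal ((1 - x) powr \<alpha> * (\<epsilon> + K * (1 - sqrt x) powr \<beta>) powr p) * mean_pow p (sqrt x) (disc_restrict f) * indicator {0..<1} x \<partial>lborel)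
        = (\<integral>\<^sup>+x. ennreal ((1 - x) powr \<alpha> * (\<epsilon> + K * (1 - sqrt x) powr \<beta>) powr p) * mean_pow p (sqrt x) f * indicator {0..<1} x \<partial>lborel)"
      by (intro nn_integral_cong) (auto simp: indicator_def mean_pow_disc_restrict)
    finally have X: "bergman_int p \<alpha> (Rhaly \<eta> f) \<le> ennreal C2 * (ennreal (2 powr p * C1) *
       (\<integral>\<^sup>+x. ennreal ((1 - x) powr \<alpha> * (\<epsilon> + K * (1 - sqrt x) powr \<beta>) powr p) * mean_pow p (sqrt x) f * indicator {0..<1} x \<partial>lborel))" .
    have "ennreal C = ennreal C2 * ennreal (2 powr p * C1)" unfolding C_def using C1 C2 by (intro ennreal_mult) auto
    then show ?thesis using X by (simp only: mult.assoc)
  qed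
  then show ?thesis by (intro that[OF C]) (simp add: \<beta>_def)
qed

text \<open>The decaying factor beside K is at most 1, so the integrand is a constant multiple of
  the Bergman weight at most.\<close>

lemma Rhaly_in_Bergman_bound:
  assumes p: "p \<ge> 1" and \<alpha>: "\<alpha> > -1" and \<eta>: "fps_conv_radius (Abs_fps \<eta>) \<ge> 1"
    and gr: "mean_growth p (1 - 1/p) \<epsilon> K (binom_deriv (symbol_fun \<eta>) 1)" "\<epsilon> \<ge> 0" "K \<ge> 0"
  obtains C where "C \<ge> 0" "\<And>f. f holomorphic_on unit_disc \<Longrightarrow> bergman_int p \<alpha> (Rhaly \<eta> f) \<le> ennreal C * bergman_int p \<alpha> f"
proof -
  obtain C where C: "C > 0" "\<And>\<eta> f \<epsilon> K. fps_conv_radius (Abs_fps \<eta>) \<ge> 1 \<Longrightarrow> f holomorphic_on unit_disc \<Longrightarrow> \<epsilon> \<ge> 0 \<Longrightarrow> K \<ge> 0 \<Longrightarrow>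
    mean_growth p (1 - 1/p) \<epsilon> K (binom_deriv (symbol_fun \<eta>) 1) \<Longrightarrow>
    bergman_int p \<alpha> (Rhaly \<eta> f) \<le> ennreal C *
      (\<integral>\<^sup>+x. ennreal ((1 - x) powr \<alpha> * (\<epsilon> + K * (1 - sqrt x) powr (1 - 1/p)) powr p) * mean_pow p (sqrt x) f * indicator {0..<1} x \<partial>lborel)"
    using bergman_int_Rhaly_le[OF p \<alpha>] by blast
  define D where "D = (\<epsilon> + K) powr p / (\<alpha> + 1)"
  have D: "D \<ge> 0" using \<alpha> by (simp add: D_def)
  show ?thesis
  proof (rule that[of "C * D"])
    show "C * D \<ge> 0" using C D by simp
    fix f assume f: "f holomorphic_on unit_disc"
    note [measurable] = disc_restrict_measurable[OF f]
    have "(\<integral>\<^sup>+x. ennreal ((1 - x) powr \<alpha> * (\<epsilon> + K * (1 - sqrt x) powr (1 - 1/p)) powr p) * mean_pow p (sqrt x) f * indicator {0..<1} x \<partial>lborel)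
        \<le> (\<integral>\<^sup>+x. ennreal D * (ennreal ((\<alpha>+1) * (1 - x) powr \<alpha>) * mean_pow p (sqrt x) (disc_restrict f) * indicator {0..<1} x) \<partial>lborel)"
    proof (rule nn_integral_mono)
      fix x
      show "ennreal ((1 - x) powr \<alpha> * (\<epsilon> + K * (1 - sqrt x) powr (1 - 1/p)) powr p) * mean_pow p (sqrt x) f * indicator {0..<1} x
        \<le> ennreal D * (ennreal ((\<alpha>+1) * (1 - x) powr \<alpha>) * mean_pow p (sqrt x) (disc_restrict f) * indicator {0..<1} x)"
      proof (cases "x \<in> {0..<1}")
        case True
        have "(1 - sqrt x) powr (1 - 1/p) \<le> 1" using True p by (intro powr_le1) auto
        then have "\<epsilon> + K * (1 - sqrt x) powr (1 - 1/p) \<le> \<epsilon> + K" using gr(3) by (simp add: mult_left_le)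
        then have "(\<epsilon> + K * (1 - sqrt x) powr (1 - 1/p)) powr p \<le> (\<epsilon> + K) powr p" using gr p by (intro powr_mono2) auto
        then have "(1 - x) powr \<alpha> * (\<epsilon> + K * (1 - sqrt x) powr (1 - 1/p)) powr p \<le> D * ((\<alpha>+1) * (1 - x) powr \<alpha>)"
          using \<alpha> by (simp add: D_def mult_left_mono mult.commute)
        then have "ennreal ((1 - x) powr \<alpha> * (\<epsilon> + K * (1 - sqrt x) powr (1 - 1/p)) powr p) \<le> ennreal D * ennreal ((\<alpha>+1) * (1 - x) powr \<alpha>)"
          using D by (simp add: ennreal_mult'[symmetric] ennreal_leI)
        then show ?thesis using True by (simp add: mean_pow_disc_restrict mult_right_mono mult.assoc[symmetric])
      qed simp
    qed
    also have "\<dots> = ennreal D * bergman_int p \<alpha> (disc_restrict f)"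
      unfolding bergman_int_def by (rule nn_integral_cmult) measurable
    finally have X: "(\<integral>\<^sup>+x. ennreal ((1 - x) powr \<alpha> * (\<epsilon> + K * (1 - sqrt x) powr (1 - 1/p)) powr p) * mean_pow p (sqrt x) f * indicator {0..<1} x \<partial>lborel)
        \<le> ennreal D * bergman_int p \<alpha> f"
      by (simp add: bergman_int_disc_restrict)
    have "bergman_int p \<alpha> (Rhaly \<eta> f) \<le> ennreal C * (ennreal D * bergman_int p \<alpha> f)"
      by (rule order_trans[OF C(2)[OF \<eta> f gr(2,3,1)]]) (intro mult_left_mono X, simp)
    then show "bergman_int p \<alpha> (Rhaly \<eta> f) \<le> ennreal (C * D) * bergman_int p \<alpha> f"
      using C D by (simp add: ennreal_mult mult.assoc)
  qed
qed

theorem Rhaly_bounded_of_growth: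
  assumes p: "p \<ge> 1" and \<alpha>: "\<alpha> > -1" and \<eta>: "fps_conv_radius (Abs_fps \<eta>) \<ge> 1"
    and gr: "mean_growth p (1 - 1/p) \<epsilon> K (binom_deriv (symbol_fun \<eta>) 1)" "\<epsilon> \<ge> 0" "K \<ge> 0"
  shows "Rhaly_bounded_Bergman \<eta> p \<alpha>"
proof -
  obtain C where C: "C \<ge> 0" "\<And>f. f holomorphic_on unit_disc \<Longrightarrow> bergman_int p \<alpha> (Rhaly \<eta> f) \<le> ennreal C * bergman_int p \<alpha> f"
    using Rhaly_in_Bergman_bound[OF assms] by blast
  have hol: "f holomorphic_on unit_disc" if "f \<in> Bergman p \<alpha>" for f
    using that Bergman_iff[OF \<alpha>] by blast
  have mem: "Rhaly \<eta> f \<in> Bergman p \<alpha>" if f: "f \<in> Bergman p \<alpha>" for f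
    using f C(2)[OF hol[OF f]] holomorphic_Rhaly[OF \<eta> hol[OF f]] unfolding Bergman_iff[OF \<alpha>]
    by (auto intro: le_less_trans simp: ennreal_mult_less_top)
  have "Bergman_norm p \<alpha> (Rhaly \<eta> f) \<le> C powr (1/p) * Bergman_norm p \<alpha> f" if f: "f \<in> Bergman p \<alpha>" for f
  proof -
    have "ennreal (Bergman_norm p \<alpha> (Rhaly \<eta> f) powr p) \<le> ennreal C * ennreal (Bergman_norm p \<alpha> f powr p)"
      using C(2)[OF hol[OF f]] bergman_int_eq_norm[OF \<alpha> f] bergman_int_eq_norm[OF \<alpha> mem[OF f]] p by simp
    then have "Bergman_norm p \<alpha> (Rhaly \<eta> f) powr p \<le> C * Bergman_norm p \<alpha> f powr p"
      using C(1) by (simp add: ennreal_mult[symmetric])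
    then have "(Bergman_norm p \<alpha> (Rhaly \<eta> f) powr p) powr (1/p) \<le> (C * Bergman_norm p \<alpha> f powr p) powr (1/p)"
      using p by (intro powr_mono2) auto
    then show ?thesis
      using p C(1) by (simp add: powr_mult powr_powr Bergman_norm_nonneg)
  qed
  then show ?thesis
    unfolding Rhaly_bounded_Bergman_def Rhaly_well_defined_on_def bounded_operator_on_def linear_operator_on_def
    using fps_conv_radius_Rhaly[OF \<eta> hol] mem Rhaly_linear[OF \<eta> hol hol] by auto
qed

section \<open>Differences, limits and point evaluations in Bergman spaces\<close>

lemma bergman_int_diff_le:
  assumes f: "f holomorphic_on unit_disc" and g: "g holomorphic_on unit_disc" and p: "p \<ge> 1"
    and B: "bergman_int p \<alpha> f \<le> B" "bergman_int p \<alpha> g \<le> B"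
  shows "bergman_int p \<alpha> (\<lambda>w. 1 * f w + (- 1) * g w) \<le> ennreal (2 powr p) * (B + B)"
proof -
  note [measurable] = disc_restrict_measurable[OF f] disc_restrict_measurable[OF g]
  have mp: "mean_pow p r (\<lambda>w. 1 * f w + (- 1) * g w) \<le> ennreal (2 powr p) * (mean_pow p r f + mean_pow p r g)"
    if r: "0 \<le> r" "r < 1" for r
  proof -
    have [measurable]: "(\<lambda>t. f (of_real r * cis t)) \<in> borel_measurable borel" "(\<lambda>t. g (of_real r * cis t)) \<in> borel_measurable borel"
      by (rule holomorphic_circle_measurable[OF f r] holomorphic_circle_measurable[OF g r])+
    have "norm (a - b) powr p \<le> 2 powr p * (norm a powr p + norm b powr p)" for a b :: complex
    proof -
      have "norm (a - b) \<le> 2 * max (norm a) (norm b)" using norm_triangle_ineq4[of a b] by linarith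
      then have "norm (a - b) powr p \<le> (2 * max (norm a) (norm b)) powr p" using p by (intro powr_mono2) auto
      also have "\<dots> = 2 powr p * max (norm a) (norm b) powr p" by (simp add: powr_mult)
      also have "\<dots> \<le> 2 powr p * (norm a powr p + norm b powr p)" by (auto simp: max_def)
      finally show ?thesis .
    qed
    then have "mean_pow p r (\<lambda>w. 1 * f w + (- 1) * g w) \<le> (\<integral>\<^sup>+t. ennreal (2 powr p) * (ennreal (norm (f (of_real r * cis t)) powr p) + ennreal (norm (g (of_real r * cis t)) powr p)) \<partial>circ)"
      unfolding mean_pow_def by (intro nn_integral_mono) (simp add: ennreal_mult[symmetric] ennreal_plus[symmetric] ennreal_leI del: ennreal_plus)
    also have "\<dots> = ennreal (2 powr p) * (mean_pow p r f + mean_pow p r g)"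
      unfolding mean_pow_def by (simp add: nn_integral_cmult nn_integral_add)
    finally show ?thesis .
  qed
  have "bergman_int p \<alpha> (\<lambda>w. 1 * f w + (- 1) * g w) \<le> (\<integral>\<^sup>+s. ennreal (2 powr p) * (ennreal ((\<alpha>+1) * (1 - s) powr \<alpha>) * mean_pow p (sqrt s) (disc_restrict f) * indicator {0..<1} s
      + ennreal ((\<alpha>+1) * (1 - s) powr \<alpha>) * mean_pow p (sqrt s) (disc_restrict g) * indicator {0..<1} s) \<partial>lborel)"
    unfolding bergman_int_def
  proof (rule nn_integral_mono)
    fix s
    show "ennreal ((\<alpha>+1) * (1 - s) powr \<alpha>) * mean_pow p (sqrt s) (\<lambda>w. 1 * f w + (- 1) * g w) * indicator {0..<1} s
      \<le> ennreal (2 powr p) * (ennreal ((\<alpha>+1) * (1 - s) powr \<alpha>) * mean_pow p (sqrt s) (disc_restrict f) * indicator {0..<1} s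
      + ennreal ((\<alpha>+1) * (1 - s) powr \<alpha>) * mean_pow p (sqrt s) (disc_restrict g) * indicator {0..<1} s)"
    proof (cases "s \<in> {0..<1}")
      case True
      then have "ennreal ((\<alpha>+1) * (1 - s) powr \<alpha>) * mean_pow p (sqrt s) (\<lambda>w. 1 * f w + (- 1) * g w)
          \<le> ennreal ((\<alpha>+1) * (1 - s) powr \<alpha>) * (ennreal (2 powr p) * (mean_pow p (sqrt s) f + mean_pow p (sqrt s) g))"
        by (intro mult_left_mono mp) auto
      also have "\<dots> = ennreal (2 powr p) * (ennreal ((\<alpha>+1) * (1 - s) powr \<alpha>) * mean_pow p (sqrt s) f + ennreal ((\<alpha>+1) * (1 - s) powr \<alpha>) * mean_pow p (sqrt s) g)"
        by (simp only: mult.left_commute distrib_left)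
      finally show ?thesis using True by (simp add: mean_pow_disc_restrict)
    qed simp
  qed
  also have "\<dots> = ennreal (2 powr p) * (bergman_int p \<alpha> (disc_restrict f) + bergman_int p \<alpha> (disc_restrict g))"
    unfolding bergman_int_def by (simp add: nn_integral_cmult nn_integral_add)
  also have "\<dots> \<le> ennreal (2 powr p) * (B + B)"
    unfolding bergman_int_disc_restrict by (intro mult_left_mono add_mono B) auto
  finally show ?thesis .
qed

lemma mean_pow_liminf_le:
  assumes f: "\<And>n. f n holomorphic_on unit_disc" and r: "0 \<le> r" "r < 1" and p: "p > 0"
    and lim: "\<And>z. norm z < 1 \<Longrightarrow> (\<lambda>n. f n z) \<longlonglongrightarrow> g z"
  shows "mean_pow p r g \<le> liminf (\<lambda>n. mean_pow p r (f n))"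
proof -
  have [measurable]: "(\<lambda>t. f n (of_real r * cis t)) \<in> borel_measurable borel" for n
    by (rule holomorphic_circle_measurable[OF f r])
  have "(\<lambda>n. ennreal (norm (f n (of_real r * cis t)) powr p)) \<longlonglongrightarrow> ennreal (norm (g (of_real r * cis t)) powr p)" for t
    using r p by (intro tendsto_ennrealI tendsto_powr2 tendsto_norm tendsto_const lim) (auto simp: norm_mult)
  then have "mean_pow p r g = (\<integral>\<^sup>+t. liminf (\<lambda>n. ennreal (norm (f n (of_real r * cis t)) powr p)) \<partial>circ)"
    unfolding mean_pow_def by (intro nn_integral_cong) (metis lim_imp_Liminf trivial_limit_sequentially)
  also have "\<dots> \<le> liminf (\<lambda>n. mean_pow p r (f n))"
    unfolding mean_pow_def by (rule nn_integral_liminf) measurable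
  finally show ?thesis .
qed

text \<open>Fatou's lemma on each circle and once more over the radii. It keeps limits obtained from
  Montel's theorem inside the space.\<close>

lemma bergman_int_limit_le:
  assumes f: "\<And>n. f n holomorphic_on unit_disc" and g: "g holomorphic_on unit_disc" and p: "p \<ge> 1"
    and lim: "\<And>z. norm z < 1 \<Longrightarrow> (\<lambda>n. f n z) \<longlonglongrightarrow> g z" and B: "\<And>n. bergman_int p \<alpha> (f n) \<le> B"
  shows "bergman_int p \<alpha> g \<le> B"
proof -
  note [measurable] = disc_restrict_measurable[OF f] disc_restrict_measurable[OF g]
  have "bergman_int p \<alpha> g \<le> (\<integral>\<^sup>+s. liminf (\<lambda>n. ennreal ((\<alpha>+1) * (1 - s) powr \<alpha>) * mean_pow p (sqrt s) (disc_restrict (f n)) * indicator {0..<1} s) \<partial>lborel)"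
    unfolding bergman_int_def
  proof (rule nn_integral_mono)
    fix s
    show "ennreal ((\<alpha>+1) * (1 - s) powr \<alpha>) * mean_pow p (sqrt s) g * indicator {0..<1} s
        \<le> liminf (\<lambda>n. ennreal ((\<alpha>+1) * (1 - s) powr \<alpha>) * mean_pow p (sqrt s) (disc_restrict (f n)) * indicator {0..<1} s)"
    proof (cases "s \<in> {0..<1}")
      case True
      then have s: "0 \<le> sqrt s" "sqrt s < 1" by auto
      have "mean_pow p (sqrt s) g \<le> liminf (\<lambda>n. mean_pow p (sqrt s) (f n))"
        by (rule mean_pow_liminf_le[OF f s _ lim]) (use p in auto)
      then have "ennreal ((\<alpha>+1) * (1 - s) powr \<alpha>) * mean_pow p (sqrt s) g \<le> ennreal ((\<alpha>+1) * (1 - s) powr \<alpha>) * liminf (\<lambda>n. mean_pow p (sqrt s) (f n))"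
        by (rule mult_left_mono) simp
      also have "\<dots> \<le> liminf (\<lambda>n. ennreal ((\<alpha>+1) * (1 - s) powr \<alpha>) * mean_pow p (sqrt s) (f n))"
      proof -
        let ?c = "\<lambda>x. ennreal ((\<alpha>+1) * (1 - s) powr \<alpha>) * x"
        have "liminf (\<lambda>n. ?c (mean_pow p (sqrt s) (f n))) = ?c (liminf (\<lambda>n. mean_pow p (sqrt s) (f n)))"
        proof (rule Liminf_compose_continuous_mono)
          show "continuous_on UNIV ?c" by (intro ennreal_continuous_on_cmult continuous_on_id) simp
          show "mono ?c" by (intro monoI mult_left_mono) simp_all
        qed simp
        then show ?thesis by simp
      qed
      finally show ?thesis using True by (simp add: mean_pow_disc_restrict[OF s])
    qed simp
  qed
  also have "\<dots> \<le> liminf (\<lambda>n. \<integral>\<^sup>+s. ennreal ((\<alpha>+1) * (1 - s) powr \<alpha>) * mean_pow p (sqrt s) (disc_restrict (f n)) * indicator {0..<1} s \<partial>lborel)"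
    by (rule nn_integral_liminf) measurable
  also have "\<dots> = liminf (\<lambda>n. bergman_int p \<alpha> (f n))"
    by (simp add: bergman_int_def[symmetric] bergman_int_disc_restrict)
  also have "\<dots> \<le> liminf (\<lambda>n. B)" by (intro Liminf_mono always_eventually allI B)
  also have "\<dots> = B" by (simp add: Liminf_const)
  finally show ?thesis .
qed

text \<open>The Poisson estimate on a circle between \<rho> and 1, whose mean is controlled by the
  Bergman integral. This is the local boundedness that Montel's theorem asks for, and it turns
  convergence in norm into pointwise convergence.\<close>

lemma bergman_int_pointwise:
  assumes \<alpha>: "\<alpha> > -1" and p: "p \<ge> 1" and \<rho>: "0 \<le> \<rho>" "\<rho> < 1"
  obtains C where "C > 0" "\<And>f z. f holomorphic_on unit_disc \<Longrightarrow> norm z \<le> \<rho> \<Longrightarrow> ennreal (norm (f z) powr p) \<le> ennreal C * bergman_int p \<alpha> f"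
proof -
  define \<rho>' where "\<rho>' = (1 + \<rho>) / 2"
  have \<rho>': "\<rho> < \<rho>'" "\<rho>' < 1" "0 < \<rho>'" using \<rho> by (auto simp: \<rho>'_def)
  define W where "W = (1 - \<rho>'\<^sup>2) powr (\<alpha>+1)"
  have "\<rho>'\<^sup>2 < 1" using \<rho>' by (auto simp: abs_square_less_1)
  then have W: "W > 0" by (simp add: W_def)
  define c where "c = 2 / (1 - \<rho>/\<rho>')"
  have c: "c > 0" using \<rho>' by (simp add: c_def)
  have "ennreal (norm (f z) powr p) \<le> ennreal (c / W) * bergman_int p \<alpha> f"
    if f: "f holomorphic_on unit_disc" and z: "norm z \<le> \<rho>" for f z
  proof -
    have "ennreal (norm (f z) powr p) \<le> ennreal c * mean_pow p \<rho>' f"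
      unfolding c_def by (rule norm_powr_le_mean_pow[OF f z \<rho>'(1,2) p])
    also have "ennreal c = ennreal (c / W) * ennreal W" using c W by (simp add: ennreal_mult[symmetric])
    also have "ennreal (c / W) * ennreal W * mean_pow p \<rho>' f = ennreal (c / W) * (ennreal W * mean_pow p \<rho>' f)"
      by (rule mult.assoc)
    also have "\<dots> \<le> ennreal (c / W) * bergman_int p \<alpha> f"
      unfolding W_def using \<rho>' by (intro mult_left_mono mean_pow_le_bergman_int[OF f \<alpha> p]) auto
    finally show ?thesis .
  qed
  then show ?thesis using c W by (intro that[of "c / W"]) auto
qed

text \<open>Montel's theorem extracts a locally uniform limit g, which stays in the space; the
  differences \<open>d n\<close> are then bounded in norm and tend to 0 on compact sets. In the
  bound for \<open>Rhaly \<eta> (d n)\<close> the factor is small on an outer annulus by the growth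
  condition, and on the inner disc the values of \<open>d n\<close> are small.\<close>

theorem Rhaly_compact_of_growth:
  assumes p: "p > 1" and \<alpha>: "\<alpha> > -1" and \<eta>: "fps_conv_radius (Abs_fps \<eta>) \<ge> 1"
    and gr: "\<And>\<epsilon>. \<epsilon> > 0 \<Longrightarrow> \<exists>K\<ge>0. mean_growth p (1 - 1/p) \<epsilon> K (binom_deriv (symbol_fun \<eta>) 1)"
  shows "Rhaly_compact_Bergman \<eta> p \<alpha>"
proof -
  have p1: "p \<ge> 1" and p0: "p > 0" using p by auto
  define \<beta> where "\<beta> = 1 - 1/p"
  have \<beta>: "\<beta> > 0" using p by (simp add: \<beta>_def)
  obtain K1 where "K1 \<ge> 0" "mean_growth p (1 - 1/p) 1 K1 (binom_deriv (symbol_fun \<eta>) 1)"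
    using gr[of 1] by auto
  then have bdd: "Rhaly_bounded_Bergman \<eta> p \<alpha>"
    by (intro Rhaly_bounded_of_growth[OF p1 \<alpha> \<eta>, of 1 K1]) auto
  obtain C where C: "C > 0" "\<And>\<eta> f \<epsilon> K. fps_conv_radius (Abs_fps \<eta>) \<ge> 1 \<Longrightarrow> f holomorphic_on unit_disc \<Longrightarrow> \<epsilon> \<ge> 0 \<Longrightarrow> K \<ge> 0 \<Longrightarrow>
    mean_growth p (1 - 1/p) \<epsilon> K (binom_deriv (symbol_fun \<eta>) 1) \<Longrightarrow>
    bergman_int p \<alpha> (Rhaly \<eta> f) \<le> ennreal C *
      (\<integral>\<^sup>+x. ennreal ((1 - x) powr \<alpha> * (\<epsilon> + K * (1 - sqrt x) powr (1 - 1/p)) powr p) * mean_pow p (sqrt x) f * indicator {0..<1} x \<partial>lborel)"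
    using bergman_int_Rhaly_le[OF p1 \<alpha>] by blast
  have "\<exists>s g. strict_mono s \<and> g \<in> Bergman p \<alpha> \<and> (\<lambda>n. Bergman_norm p \<alpha> (\<lambda>z. Rhaly \<eta> (f (s n)) z - g z)) \<longlonglongrightarrow> 0"
    if f: "\<And>n. f n \<in> Bergman p \<alpha>" and bd: "bdd_above (range (\<lambda>n. Bergman_norm p \<alpha> (f n)))" for f :: "nat \<Rightarrow> complex \<Rightarrow> complex"
  proof -
    obtain M where M: "\<And>n. Bergman_norm p \<alpha> (f n) \<le> M" using bd by (auto simp: bdd_above_def)
    have M0: "M \<ge> 0" using M[of 0] Bergman_norm_nonneg order_trans by blast
    have fh: "f n holomorphic_on unit_disc" for n using f[of n] Bergman_iff[OF \<alpha>] by blast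
    have fB: "bergman_int p \<alpha> (f n) \<le> ennreal (M powr p)" for n
      unfolding bergman_int_eq_norm[OF \<alpha> f p0] using M[of n] p0 by (intro ennreal_leI powr_mono2) (auto simp: Bergman_norm_nonneg)
    define \<H> where "\<H> = {h. h holomorphic_on unit_disc \<and> bergman_int p \<alpha> h \<le> ennreal (M powr p)}"
    obtain g s where g: "g holomorphic_on unit_disc" and s: "strict_mono s"
      and ptw: "\<And>x. x \<in> unit_disc \<Longrightarrow> ((\<lambda>n. f (s n) x) \<longlongrightarrow> g x) sequentially"
      and unif: "\<And>K. \<lbrakk>compact K; K \<subseteq> unit_disc\<rbrakk> \<Longrightarrow> uniform_limit K (f \<circ> s) g sequentially"
    proof (rule Montel[of unit_disc \<H> f])
      fix K :: "complex set" assume K: "compact K" "K \<subseteq> unit_disc"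
      obtain \<rho> where \<rho>: "0 \<le> \<rho>" "\<rho> < 1" "\<And>z. z \<in> K \<Longrightarrow> norm z \<le> \<rho>"
      proof (cases "K = {}")
        case False
        obtain z0 where "z0 \<in> K" "\<And>z. z \<in> K \<Longrightarrow> norm z \<le> norm z0"
          using continuous_attains_sup[OF K(1) False, of norm] by (auto intro: continuous_intros)
        then show ?thesis using K by (intro that[of "norm z0"]) auto
      qed (use that[of 0] in auto)
      obtain C' where C': "C' > 0" "\<And>f z. f holomorphic_on unit_disc \<Longrightarrow> norm z \<le> \<rho> \<Longrightarrow> ennreal (norm (f z) powr p) \<le> ennreal C' * bergman_int p \<alpha> f"
        using bergman_int_pointwise[OF \<alpha> p1 \<rho>(1,2)] by blast
      have "norm (h z) \<le> (C' * M powr p) powr (1/p)" if "h \<in> \<H>" "z \<in> K" for h z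
      proof -
        have "ennreal (norm (h z) powr p) \<le> ennreal C' * bergman_int p \<alpha> h"
          using that \<rho> by (intro C') (auto simp: \<H>_def)
        also have "\<dots> \<le> ennreal C' * ennreal (M powr p)" using that by (intro mult_left_mono) (auto simp: \<H>_def)
        finally have "norm (h z) powr p \<le> C' * M powr p" using C'(1) by (simp add: ennreal_mult[symmetric])
        then have "(norm (h z) powr p) powr (1/p) \<le> (C' * M powr p) powr (1/p)" using p0 by (intro powr_mono2) auto
        then show ?thesis using p0 by (simp add: powr_powr)
      qed
      then show "\<exists>B. \<forall>h\<in>\<H>. \<forall>z\<in>K. norm (h z) \<le> B" by blast
    qed (use fh fB that in \<open>auto simp: \<H>_def\<close>)
    have gB: "bergman_int p \<alpha> g \<le> ennreal (M powr p)"
      by (rule bergman_int_limit_le[of "\<lambda>n. f (s n)", OF fh g p1 _ fB]) (use ptw in auto)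
    then have gm: "g \<in> Bergman p \<alpha>" using g unfolding Bergman_iff[OF \<alpha>] by (auto intro: le_less_trans)
    \<comment> \<open>Written as a linear combination to match the form of
      \<open>Rhaly_linear\<close> and \<open>bergman_int_diff_le\<close>.\<close>
    define d where "d = (\<lambda>n w. 1 * f (s n) w + (- 1) * g w)"
    have dh: "d n holomorphic_on unit_disc" for n unfolding d_def by (intro holomorphic_intros fh g)
    define D where "D = 2 powr p * (M powr p + M powr p)"
    have D: "D \<ge> 0" by (simp add: D_def)
    have dB: "bergman_int p \<alpha> (d n) \<le> ennreal D" for n
    proof -
      have "bergman_int p \<alpha> (d n) \<le> ennreal (2 powr p) * (ennreal (M powr p) + ennreal (M powr p))"
        unfolding d_def by (rule bergman_int_diff_le[OF fh g p1 fB gB])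
      also have "\<dots> = ennreal D" by (simp only: D_def ennreal_mult ennreal_plus powr_ge_zero add_nonneg_nonneg)
      finally show ?thesis .
    qed
    have small: "eventually (\<lambda>n. bergman_int p \<alpha> (Rhaly \<eta> (d n)) \<le> ennreal \<delta>) sequentially" if \<delta>: "\<delta> > 0" for \<delta>
    proof -
      \<comment> \<open>Chosen so that the annulus, where the factor is at most 2 * \<epsilon>,
        contributes at most \<delta>/2; D + 1 keeps the denominator positive.\<close>
      define \<epsilon> where "\<epsilon> = (\<delta> / 2 * (\<alpha>+1) / (C * (D + 1))) powr (1/p) / 2"
      have \<epsilon>: "\<epsilon> > 0" using \<delta> \<alpha> C(1) D by (simp add: \<epsilon>_def)
      have "(2 * \<epsilon>) powr p = \<delta> / 2 * (\<alpha>+1) / (C * (D + 1))"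
        using \<delta> \<alpha> C(1) D p0 by (simp add: \<epsilon>_def powr_powr)
      then have "C * ((2 * \<epsilon>) powr p / (\<alpha>+1) * D) = \<delta> / 2 * (D / (D + 1))"
        using \<alpha> C(1) D by simp
      also have "\<dots> \<le> \<delta> / 2 * 1" using \<delta> D by (intro mult_left_mono) auto
      finally have e1: "C * ((2 * \<epsilon>) powr p / (\<alpha>+1) * D) \<le> \<delta> / 2" by simp
      obtain K where K: "K \<ge> 0" "mean_growth p (1 - 1/p) \<epsilon> K (binom_deriv (symbol_fun \<eta>) 1)" using gr[OF \<epsilon>] by blast
      \<comment> \<open>The width of the annulus, on which K * (1 - sqrt x)^\<beta> is at most
        \<epsilon>; \<beta> > 0 makes such a width exist.\<close>
      define y where "y = min (1/2) ((\<epsilon> / (K + 1)) powr (1/\<beta>))"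
      have y: "0 < y" "y \<le> 1/2" using \<epsilon> K by (auto simp: y_def)
      have "y powr \<beta> \<le> ((\<epsilon> / (K + 1)) powr (1/\<beta>)) powr \<beta>" using y \<beta> by (intro powr_mono2) (auto simp: y_def)
      also have "\<dots> = \<epsilon> / (K + 1)" using \<beta> \<epsilon> K by (simp add: powr_powr)
      finally have "K * y powr \<beta> \<le> K * (\<epsilon> / (K + 1))" using K by (intro mult_left_mono) auto
      also have "\<dots> \<le> \<epsilon>" using \<epsilon> K by (simp add: field_simps)
      finally have yK: "K * y powr \<beta> \<le> \<epsilon>" .
      \<comment> \<open>The uniform bound for \<open>d n\<close> that makes the inner disc
        contribute \<delta>/2.\<close>
      define \<tau> where "\<tau> = (\<delta> / 2 * (\<alpha>+1) / (C * (\<epsilon> + K) powr p)) powr (1/p)"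
      have eK: "\<epsilon> + K > 0" using \<epsilon> K by simp
      have \<tau>: "\<tau> > 0" using \<delta> \<alpha> C(1) eK by (simp add: \<tau>_def)
      have "\<tau> powr p = \<delta> / 2 * (\<alpha>+1) / (C * (\<epsilon> + K) powr p)"
        using \<delta> \<alpha> C(1) p0 eK by (simp add: \<tau>_def powr_powr)
      then have e2: "C * ((\<epsilon> + K) powr p * \<tau> powr p * (1 / (\<alpha>+1))) = \<delta> / 2"
        using \<alpha> C(1) eK by (simp add: field_simps)
      have "uniform_limit (cball 0 (1 - y)) (f \<circ> s) g sequentially" by (rule unif) (use y in auto)
      then have "eventually (\<lambda>n. \<forall>z\<in>cball 0 (1 - y). dist ((f \<circ> s) n z) (g z) < \<tau>) sequentially"
        using \<tau> by (auto simp: uniform_limit_iff)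
      then show ?thesis
      proof eventually_elim
        case (elim n)
        have dz: "norm (d n z) \<le> \<tau>" if "norm z \<le> 1 - y" for z
        proof -
          have "dist (f (s n) z) (g z) < \<tau>" using elim that by auto
          then show ?thesis by (simp add: d_def dist_norm)
        qed
        note [measurable] = disc_restrict_measurable[OF dh[of n]]
        have "(\<integral>\<^sup>+x. ennreal ((1 - x) powr \<alpha> * (\<epsilon> + K * (1 - sqrt x) powr (1 - 1/p)) powr p) * mean_pow p (sqrt x) (d n) * indicator {0..<1} x \<partial>lborel)
          \<le> (\<integral>\<^sup>+x. ennreal ((2 * \<epsilon>) powr p / (\<alpha>+1)) * (ennreal ((\<alpha>+1) * (1 - x) powr \<alpha>) * mean_pow p (sqrt x) (disc_restrict (d n)) * indicator {0..<1} x)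
            + ennreal ((\<epsilon> + K) powr p * \<tau> powr p) * (ennreal ((1 - x) powr \<alpha>) * indicator {0..<1} x) \<partial>lborel)"
        proof (rule nn_integral_mono)
          fix x
          show "ennreal ((1 - x) powr \<alpha> * (\<epsilon> + K * (1 - sqrt x) powr (1 - 1/p)) powr p) * mean_pow p (sqrt x) (d n) * indicator {0..<1} x
            \<le> ennreal ((2 * \<epsilon>) powr p / (\<alpha>+1)) * (ennreal ((\<alpha>+1) * (1 - x) powr \<alpha>) * mean_pow p (sqrt x) (disc_restrict (d n)) * indicator {0..<1} x)
            + ennreal ((\<epsilon> + K) powr p * \<tau> powr p) * (ennreal ((1 - x) powr \<alpha>) * indicator {0..<1} x)"
          proof (cases "x \<in> {0..<1}")
            case x: True
            have r: "0 \<le> sqrt x" "sqrt x < 1" using x by auto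
            define E where "E = \<epsilon> + K * (1 - sqrt x) powr \<beta>"
            have E0: "E \<ge> 0" using \<epsilon> K by (simp add: E_def)
            show ?thesis
            proof (cases "1 - y \<le> sqrt x")
              case True
              have "K * (1 - sqrt x) powr \<beta> \<le> K * y powr \<beta>" using True r K \<beta> by (intro mult_left_mono powr_mono2) auto
              then have "E \<le> 2 * \<epsilon>" using yK by (simp add: E_def)
              then have "(1 - x) powr \<alpha> * E powr p \<le> (1 - x) powr \<alpha> * (2 * \<epsilon>) powr p" using E0 p0 by (intro mult_left_mono powr_mono2) auto
              also have "\<dots> = (2 * \<epsilon>) powr p / (\<alpha>+1) * ((\<alpha>+1) * (1 - x) powr \<alpha>)" using \<alpha> by simp
              finally have "ennreal ((1 - x) powr \<alpha> * E powr p) * mean_pow p (sqrt x) (d n) \<le> ennreal ((2 * \<epsilon>) powr p / (\<alpha>+1) * ((\<alpha>+1) * (1 - x) powr \<alpha>)) * mean_pow p (sqrt x) (d n)"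
                by (intro mult_right_mono ennreal_leI) auto
              also have "\<dots> = ennreal ((2 * \<epsilon>) powr p / (\<alpha>+1)) * (ennreal ((\<alpha>+1) * (1 - x) powr \<alpha>) * mean_pow p (sqrt x) (disc_restrict (d n)))"
                using \<alpha> by (subst ennreal_mult) (auto simp: mult.assoc mean_pow_disc_restrict[OF r])
              finally show ?thesis using x by (simp add: E_def \<beta>_def add_increasing2)
            next
              case False
              have "(1 - sqrt x) powr \<beta> \<le> 1" using r \<beta> by (intro powr_le1) auto
              then have "E \<le> \<epsilon> + K" using K by (simp add: E_def mult_left_le)
              then have w: "(1 - x) powr \<alpha> * E powr p \<le> (1 - x) powr \<alpha> * (\<epsilon> + K) powr p" using E0 p0 by (intro mult_left_mono powr_mono2) auto
              have m: "mean_pow p (sqrt x) (d n) \<le> ennreal (\<tau> powr p)"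
              proof -
                have "mean_pow p (sqrt x) (d n) \<le> (\<integral>\<^sup>+t. ennreal (\<tau> powr p) \<partial>circ)"
                  unfolding mean_pow_def using False r p0 by (intro nn_integral_mono ennreal_leI powr_mono2 dz) (auto simp: norm_mult)
                then show ?thesis by simp
              qed
              have "ennreal ((1 - x) powr \<alpha> * E powr p) * mean_pow p (sqrt x) (d n) \<le> ennreal ((1 - x) powr \<alpha> * (\<epsilon> + K) powr p) * ennreal (\<tau> powr p)"
                by (rule mult_mono[OF ennreal_leI[OF w] m]) simp_all
              also have "\<dots> = ennreal ((\<epsilon> + K) powr p * \<tau> powr p) * ennreal ((1 - x) powr \<alpha>)"
                by (simp add: ennreal_mult[symmetric] mult_ac)
              finally show ?thesis using x by (simp add: E_def \<beta>_def add_increasing)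
            qed
          qed simp
        qed
        also have "\<dots> = ennreal ((2 * \<epsilon>) powr p / (\<alpha>+1)) * bergman_int p \<alpha> (disc_restrict (d n))
            + ennreal ((\<epsilon> + K) powr p * \<tau> powr p) * (\<integral>\<^sup>+x. ennreal ((1 - x) powr \<alpha>) * indicator {0..<1} x \<partial>lborel)"
          unfolding bergman_int_def by (simp add: nn_integral_add nn_integral_cmult)
        also have "\<dots> \<le> ennreal ((2 * \<epsilon>) powr p / (\<alpha>+1)) * ennreal D + ennreal ((\<epsilon> + K) powr p * \<tau> powr p) * ennreal (1 / (\<alpha>+1))"
          using dB[of n] nn_integral_powr_upto_1[OF \<alpha>, of 0] by (intro add_mono mult_left_mono) (auto simp: bergman_int_disc_restrict)
        also have "\<dots> = ennreal ((2 * \<epsilon>) powr p / (\<alpha>+1) * D + (\<epsilon> + K) powr p * \<tau> powr p * (1 / (\<alpha>+1)))"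
          using \<alpha> D by (simp add: ennreal_mult[symmetric] ennreal_plus[symmetric] del: ennreal_plus)
        finally have I: "(\<integral>\<^sup>+x. ennreal ((1 - x) powr \<alpha> * (\<epsilon> + K * (1 - sqrt x) powr (1 - 1/p)) powr p) * mean_pow p (sqrt x) (d n) * indicator {0..<1} x \<partial>lborel)
           \<le> ennreal ((2 * \<epsilon>) powr p / (\<alpha>+1) * D + (\<epsilon> + K) powr p * \<tau> powr p * (1 / (\<alpha>+1)))" .
        have "bergman_int p \<alpha> (Rhaly \<eta> (d n)) \<le> ennreal C * ennreal ((2 * \<epsilon>) powr p / (\<alpha>+1) * D + (\<epsilon> + K) powr p * \<tau> powr p * (1 / (\<alpha>+1)))"
          by (rule order_trans[OF C(2)[OF \<eta> dh less_imp_le[OF \<epsilon>] K]]) (intro mult_left_mono I, simp)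
        also have "\<dots> = ennreal (C * ((2 * \<epsilon>) powr p / (\<alpha>+1) * D + (\<epsilon> + K) powr p * \<tau> powr p * (1 / (\<alpha>+1))))"
          using C(1) \<alpha> D by (intro ennreal_mult[symmetric]) auto
        also have "\<dots> \<le> ennreal \<delta>"
        proof (rule ennreal_leI)
          have "C * ((2 * \<epsilon>) powr p / (\<alpha>+1) * D + (\<epsilon> + K) powr p * \<tau> powr p * (1 / (\<alpha>+1)))
              = C * ((2 * \<epsilon>) powr p / (\<alpha>+1) * D) + C * ((\<epsilon> + K) powr p * \<tau> powr p * (1 / (\<alpha>+1)))"
            by (rule distrib_left)
          also have "\<dots> \<le> \<delta> / 2 + \<delta> / 2" using e1 e2 by linarith
          finally show "C * ((2 * \<epsilon>) powr p / (\<alpha>+1) * D + (\<epsilon> + K) powr p * \<tau> powr p * (1 / (\<alpha>+1))) \<le> \<delta>" by simp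
        qed
        finally show ?case .
      qed
    qed
    have Rh: "Rhaly \<eta> (f (s n)) holomorphic_on unit_disc" "Rhaly \<eta> g holomorphic_on unit_disc" for n
      using holomorphic_Rhaly[OF \<eta>] fh g by auto
    have norm_eq: "Bergman_norm p \<alpha> (\<lambda>z. Rhaly \<eta> (f (s n)) z - Rhaly \<eta> g z) = enn2real (bergman_int p \<alpha> (Rhaly \<eta> (d n))) powr (1/p)" for n
    proof -
      have "bergman_int p \<alpha> (\<lambda>z. Rhaly \<eta> (f (s n)) z - Rhaly \<eta> g z) = bergman_int p \<alpha> (Rhaly \<eta> (d n))"
        by (rule bergman_int_cong) (use Rhaly_linear[OF \<eta> fh g, of _ 1 "s _" "-1"] in \<open>simp add: d_def\<close>)
      then show ?thesis
        by (subst Bergman_norm_eq[OF \<alpha>]) (auto intro!: holomorphic_intros Rh)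
    qed
    have "(\<lambda>n. enn2real (bergman_int p \<alpha> (Rhaly \<eta> (d n)))) \<longlonglongrightarrow> 0"
    proof (rule order_tendstoI)
      fix a :: real assume "a > 0"
      then have "a / 2 > 0" by simp
      from small[OF this] show "eventually (\<lambda>n. enn2real (bergman_int p \<alpha> (Rhaly \<eta> (d n))) < a) sequentially"
      proof eventually_elim
        case (elim n)
        then have "enn2real (bergman_int p \<alpha> (Rhaly \<eta> (d n))) \<le> a / 2" using \<open>a > 0\<close> by (intro enn2real_leI) auto
        then show ?case using \<open>a > 0\<close> by simp
      qed
    next
      fix a :: real assume "a < 0"
      then show "eventually (\<lambda>n. a < enn2real (bergman_int p \<alpha> (Rhaly \<eta> (d n)))) sequentially"
        by (intro always_eventually allI less_le_trans[OF _ enn2real_nonneg])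
    qed
    then have "(\<lambda>n. enn2real (bergman_int p \<alpha> (Rhaly \<eta> (d n))) powr (1/p)) \<longlonglongrightarrow> 0 powr (1/p)"
      using p0 by (intro tendsto_powr2 tendsto_const) auto
    then have "(\<lambda>n. Bergman_norm p \<alpha> (\<lambda>z. Rhaly \<eta> (f (s n)) z - Rhaly \<eta> g z)) \<longlonglongrightarrow> 0"
      using p0 by (simp add: norm_eq)
    moreover have "Rhaly \<eta> g \<in> Bergman p \<alpha>"
      using bdd gm unfolding Rhaly_bounded_Bergman_def bounded_operator_on_def linear_operator_on_def by blast
    ultimately show ?thesis using s by blast
  qed
  then show ?thesis
    using bdd unfolding Rhaly_compact_Bergman_def Rhaly_bounded_Bergman_def compact_operator_on_def bounded_operator_on_def
    by blast
qed

section \<open>Boundary values and moduli of continuity\<close>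

definition rad :: "nat \<Rightarrow> real" where "rad n = 1 - 1 / real (n + 2)"

lemma rad_bounds: "0 < rad n" "rad n < 1" "rad n \<ge> 0"
  by (auto simp: rad_def field_simps)

lemma rad_tendsto: "rad \<longlonglongrightarrow> 1"
  unfolding rad_def by real_asymp

lemma filterlim_rad: "filterlim rad (at_left 1) sequentially"
  unfolding filterlim_at using rad_tendsto rad_bounds by (auto simp: less_imp_neq)

text \<open>Taking the limit along a sequence makes the boundary function Borel measurable.\<close>

definition bdry :: "(complex \<Rightarrow> complex) \<Rightarrow> real \<Rightarrow> complex" where
  "bdry F \<theta> = lim (\<lambda>n. F (of_real (rad n) * cis \<theta>))"

lemma bdry_measurable:
  assumes F: "F holomorphic_on unit_disc"
  shows "bdry F \<in> borel_measurable borel"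
proof -
  have [measurable]: "(\<lambda>t. F (of_real (rad n) * cis t)) \<in> borel_measurable borel" for n
    by (rule holomorphic_circle_measurable[OF F]) (use rad_bounds[of n] in auto)
  show ?thesis unfolding bdry_def by measurable
qed

lemma bdry_periodic: "bdry F (\<theta> + 2*pi) = bdry F \<theta>"
  by (simp add: bdry_def cis_mult[symmetric])

lemma has_radial_limit_bdry:
  assumes "has_radial_limit F (cis \<theta>)"
  shows "((\<lambda>r. F (of_real r * cis \<theta>)) \<longlongrightarrow> bdry F \<theta>) (at_left 1)" "boundary_value F (cis \<theta>) = bdry F \<theta>"
    "(\<lambda>n. F (of_real (rad n) * cis \<theta>)) \<longlonglongrightarrow> bdry F \<theta>"
proof -
  obtain l where l: "((\<lambda>r. F (of_real r * cis \<theta>)) \<longlongrightarrow> l) (at_left 1)"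
    using assms by (auto simp: has_radial_limit_def)
  have "(\<lambda>n. F (of_real (rad n) * cis \<theta>)) \<longlonglongrightarrow> l"
    by (rule filterlim_compose[OF l filterlim_rad])
  then have b: "bdry F \<theta> = l" unfolding bdry_def by (rule limI)
  show "((\<lambda>r. F (of_real r * cis \<theta>)) \<longlongrightarrow> bdry F \<theta>) (at_left 1)" using l b by simp
  show "boundary_value F (cis \<theta>) = bdry F \<theta>"
    unfolding boundary_value_def b by (rule tendsto_Lim[OF _ l]) simp
  show "(\<lambda>n. F (of_real (rad n) * cis \<theta>)) \<longlonglongrightarrow> bdry F \<theta>"
    using \<open>(\<lambda>n. F (of_real (rad n) * cis \<theta>)) \<longlonglongrightarrow> l\<close> b by simp
qed

lemma AE_lborel_shift:
  fixes P :: "real \<Rightarrow> bool"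
  assumes "AE x in lborel. P x"
  shows "AE x in lborel. P (c + x)"
proof (rule AE_distrD[where M' = borel and f = "(+) c" and P = P])
  show "(+) c \<in> measurable lborel borel" by measurable
  show "AE x in distr lborel borel ((+) c). P x" unfolding lborel_distr_plus by (rule assms)
qed

lemma AE_circI: "AE x in lborel. P x \<Longrightarrow> AE x in circ. P x"
  unfolding circ_def by (subst AE_density) auto

text \<open>Countably many translates of one period cover the line, and a countable union of null
  sets is null. Tonelli on \<open>circ\<close> yields statements about one period, whereas the
  definitions quantify over almost every real angle.\<close>

lemma AE_lborel_of_circ:
  assumes P: "AE x in circ. P x" and per: "\<And>x. P (x + 2*pi) = P x"
  shows "AE x in lborel. P x"
proof -
  have "AE x in lborel. x \<in> {0..<2*pi} \<longrightarrow> P x"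
    using P unfolding circ_def by (subst (asm) AE_density) (auto simp: indicator_def elim!: eventually_mono split: if_splits)
  then have "AE x in lborel. 2*pi * of_int k + x \<in> {0..<2*pi} \<longrightarrow> P (2*pi * of_int k + x)" for k :: int
    by (rule AE_lborel_shift)
  then have "AE x in lborel. \<forall>k::int. 2*pi * of_int k + x \<in> {0..<2*pi} \<longrightarrow> P (2*pi * of_int k + x)"
    by (simp only: AE_all_countable) simp
  then show ?thesis
  proof eventually_elim
    case (elim x)
    define k where "k = - \<lfloor>x / (2*pi)\<rfloor>"
    have "of_int (- k) \<le> x / (2*pi)" "x / (2*pi) < of_int (- k) + 1" unfolding k_def by linarith+
    then have "2*pi * of_int k + x \<in> {0..<2*pi}" by (auto simp: field_simps)
    then have "P (2*pi * of_int k + x)" using elim by blast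
    then show "P x" using periodic_int[of P x k, OF per] by (simp add: add.commute)
  qed
qed

definition modulus_int :: "real \<Rightarrow> real \<Rightarrow> (complex \<Rightarrow> complex) \<Rightarrow> ennreal" where
  "modulus_int p t F = (\<integral>\<^sup>+\<theta>. ennreal (norm (bdry F (\<theta> + t) - bdry F \<theta>) powr p) \<partial>circ)"

lemma modulus_int_minus:
  assumes F: "F holomorphic_on unit_disc"
  shows "modulus_int p (- t) F = modulus_int p t F"
proof -
  note [measurable] = bdry_measurable[OF F]
  have "modulus_int p t F = (\<integral>\<^sup>+\<theta>. ennreal (norm (bdry F ((- t + \<theta>) + t) - bdry F (- t + \<theta>)) powr p) \<partial>circ)"
    unfolding modulus_int_def
  proof (rule nn_integral_circ_shift[symmetric])
    show "ennreal (norm (bdry F (\<theta> + 2*pi + t) - bdry F (\<theta> + 2*pi)) powr p) = ennreal (norm (bdry F (\<theta> + t) - bdry F \<theta>) powr p)" for \<theta>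
      using bdry_periodic[of F "\<theta> + t"] bdry_periodic[of F \<theta>] by (simp add: add_ac)
  qed measurable
  then show ?thesis by (simp add: modulus_int_def norm_minus_commute)
qed

text \<open>\<open>boundary_value\<close> is a limit over a continuous parameter, while
  \<open>bdry\<close> is a limit of a sequence and hence Borel. They agree for almost every angle,
  and by shift invariance of null sets also at \<theta> + t.\<close>

lemma modulus_integral_eq:
  assumes F: "F holomorphic_on unit_disc" and lim: "AE \<theta> in lebesgue. has_radial_limit F (cis \<theta>)"
  shows "1 / (2 * pi) * (LINT \<theta>:{-pi..pi}|lebesgue. norm (boundary_value F (cis (\<theta> + t)) - boundary_value F (cis \<theta>)) powr p)
    = enn2real (modulus_int p t F)"
proof -
  note [measurable] = bdry_measurable[OF F]
  let ?g = "\<lambda>\<theta>. norm (bdry F (\<theta> + t) - bdry F \<theta>) powr p"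
  let ?h = "\<lambda>\<theta>. norm (boundary_value F (cis (\<theta> + t)) - boundary_value F (cis \<theta>)) powr p"
  have lb: "AE \<theta> in lborel. has_radial_limit F (cis \<theta>)" using lim by (simp add: AE_completion_iff)
  have "AE \<theta> in lborel. has_radial_limit F (cis (t + \<theta>))" by (rule AE_lborel_shift[OF lb])
  then have ae: "AE \<theta> in lebesgue. ?g \<theta> = ?h \<theta>"
    unfolding AE_completion_iff using lb
    by eventually_elim (simp add: has_radial_limit_bdry(2) add.commute)
  have g: "?g \<in> borel_measurable lebesgue"
    by (rule measurable_completion) measurable
  then have h: "?h \<in> borel_measurable lebesgue"
    by (rule borel_measurable_AE[OF _ ae])
  have "(LINT \<theta>:{-pi..pi}|lebesgue. ?h \<theta>) = (LINT \<theta>:{-pi..pi}|lebesgue. ?g \<theta>)"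
    unfolding set_lebesgue_integral_def
  proof (rule integral_cong_AE)
    show "AE \<theta> in lebesgue. indicator {-pi..pi} \<theta> *\<^sub>R ?h \<theta> = indicator {-pi..pi} \<theta> *\<^sub>R ?g \<theta>"
      using ae by eventually_elim simp
  qed (use g h in \<open>auto intro!: borel_measurable_times borel_measurable_indicator\<close>)
  moreover have "1 / (2*pi) * (LINT \<theta>:{-pi..-pi+2*pi}|lebesgue. ?g \<theta>) = enn2real (\<integral>\<^sup>+\<theta>. ennreal (?g \<theta>) \<partial>circ)"
  proof (rule set_integral_circ)
    show "?g (\<theta> + 2*pi) = ?g \<theta>" for \<theta>
      using bdry_periodic[of F "\<theta> + t"] bdry_periodic[of F \<theta>] by (simp add: add_ac)
  qed auto
  ultimately show ?thesis by (simp add: modulus_int_def)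
qed

lemma mean_modulus_eq:
  assumes F: "F holomorphic_on unit_disc" and lim: "AE \<theta> in lebesgue. has_radial_limit F (cis \<theta>)"
  shows "mean_modulus p \<delta> F = (SUP t\<in>{t. 0 < \<bar>t\<bar> \<and> \<bar>t\<bar> \<le> \<delta>}. enn2real (modulus_int p t F) powr (1/p))"
  unfolding mean_modulus_def modulus_integral_eq[OF assms] ..

text \<open>Fatou's lemma bounds the p-norm of the boundary function by the means. The bound,
  uniform in t, matters because the supremum in \<open>mean_modulus\<close> is taken in the reals
  and is an upper bound only of a bounded family.\<close>

lemma modulus_int_le:
  assumes F: "F holomorphic_on unit_disc" and lim: "AE \<theta> in lebesgue. has_radial_limit F (cis \<theta>)"
    and B: "\<And>r. 0 < r \<Longrightarrow> r < 1 \<Longrightarrow> mean_pow p r F \<le> ennreal (B powr p)" "B \<ge> 0" and p: "p \<ge> 1"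
  shows "modulus_int p t F \<le> ennreal ((4 * (B + B)) powr p)"
proof -
  note [measurable] = bdry_measurable[OF F]
  have [measurable]: "(\<lambda>t. F (of_real (rad n) * cis t)) \<in> borel_measurable borel" for n
    by (rule holomorphic_circle_measurable[OF F]) (use rad_bounds[of n] in auto)
  have ae: "AE \<theta> in circ. has_radial_limit F (cis \<theta>)" using lim by (intro AE_circI) (simp add: AE_completion_iff)
  have b: "(\<integral>\<^sup>+\<theta>. ennreal (norm (bdry F \<theta>) powr p) \<partial>circ) \<le> ennreal (B powr p)"
  proof -
    have "(\<integral>\<^sup>+\<theta>. ennreal (norm (bdry F \<theta>) powr p) \<partial>circ) \<le> (\<integral>\<^sup>+\<theta>. liminf (\<lambda>n. ennreal (norm (F (of_real (rad n) * cis \<theta>)) powr p)) \<partial>circ)"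
    proof (rule nn_integral_mono_AE)
      show "AE \<theta> in circ. ennreal (norm (bdry F \<theta>) powr p) \<le> liminf (\<lambda>n. ennreal (norm (F (of_real (rad n) * cis \<theta>)) powr p))"
        using ae
      proof eventually_elim
        case (elim \<theta>)
        have "(\<lambda>n. ennreal (norm (F (of_real (rad n) * cis \<theta>)) powr p)) \<longlonglongrightarrow> ennreal (norm (bdry F \<theta>) powr p)"
          using p by (intro tendsto_ennrealI tendsto_powr2 tendsto_norm tendsto_const has_radial_limit_bdry(3)[OF elim]) auto
        from lim_imp_Liminf[OF _ this] show ?case by simp
      qed
    qed
    also have "\<dots> \<le> liminf (\<lambda>n. mean_pow p (rad n) F)"
      unfolding mean_pow_def by (rule nn_integral_liminf) measurable
    also have "\<dots> \<le> liminf (\<lambda>n. ennreal (B powr p))"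
      by (intro Liminf_mono always_eventually allI B(1) rad_bounds)
    also have "\<dots> = ennreal (B powr p)" by (simp add: Liminf_const)
    finally show ?thesis .
  qed
  have b': "(\<integral>\<^sup>+\<theta>. ennreal (norm (bdry F (\<theta> + t)) powr p) \<partial>circ) \<le> ennreal (B powr p)"
  proof -
    have "(\<integral>\<^sup>+\<theta>. ennreal (norm (bdry F (t + \<theta>)) powr p) \<partial>circ) = (\<integral>\<^sup>+\<theta>. ennreal (norm (bdry F \<theta>) powr p) \<partial>circ)"
      by (rule nn_integral_circ_shift) (auto simp: bdry_periodic)
    then show ?thesis using b by (simp add: add.commute)
  qed
  show ?thesis unfolding modulus_int_def
    by (rule nn_integral_powr_triangle[where u = "\<lambda>\<theta>. norm (bdry F (\<theta> + t))" and v = "\<lambda>\<theta>. norm (bdry F \<theta>)"])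
       (use p B b b' norm_triangle_ineq4 in auto)
qed

section \<open>Rotation differences inside the disc\<close>

lemma mean_pow_rotate:
  assumes F: "F holomorphic_on unit_disc" and r: "0 \<le> r" "r < 1"
  shows "mean_pow p r (\<lambda>z. F (cis t * z)) = mean_pow p r F"
proof -
  have [measurable]: "(\<lambda>t. F (of_real r * cis t)) \<in> borel_measurable borel"
    by (rule holomorphic_circle_measurable[OF F r])
  have "(\<integral>\<^sup>+\<theta>. ennreal (norm (F (of_real r * cis (t + \<theta>))) powr p) \<partial>circ) = mean_pow p r F"
    unfolding mean_pow_def by (rule nn_integral_circ_shift) (auto simp: cis_mult[symmetric])
  then show ?thesis by (simp add: mean_pow_def cis_mult[symmetric] mult_ac)
qed

definition rot_diff :: "real \<Rightarrow> (complex \<Rightarrow> complex) \<Rightarrow> complex \<Rightarrow> complex" where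
  "rot_diff t F = (\<lambda>z. F (cis t * z) - F z)"

lemma holomorphic_rot_diff:
  assumes F: "F holomorphic_on unit_disc"
  shows "rot_diff t F holomorphic_on unit_disc"
proof -
  have "(\<lambda>z. F (cis t * z)) holomorphic_on unit_disc"
    by (intro holomorphic_on_compose_gen[OF _ F, unfolded o_def] holomorphic_intros) (auto simp: norm_mult)
  then show ?thesis unfolding rot_diff_def by (intro holomorphic_intros F)
qed

lemma mean_pow_rot_diff_le:
  assumes F: "F holomorphic_on unit_disc" and r: "0 \<le> r" "r < 1" and p: "p \<ge> 1"
    and B: "mean_pow p r F \<le> ennreal (B powr p)" "B \<ge> 0"
  shows "mean_pow p r (rot_diff t F) \<le> ennreal ((4 * (B + B)) powr p)"
proof -
  have Ft: "(\<lambda>z. F (cis t * z)) holomorphic_on unit_disc"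
    by (intro holomorphic_on_compose_gen[OF _ F, unfolded o_def] holomorphic_intros) (auto simp: norm_mult)
  have [measurable]: "(\<lambda>t. F (of_real r * cis t)) \<in> borel_measurable borel" "(\<lambda>\<theta>. F (cis t * (of_real r * cis \<theta>))) \<in> borel_measurable borel"
    using holomorphic_circle_measurable[OF F r] holomorphic_circle_measurable[OF Ft r] by auto
  show ?thesis unfolding mean_pow_def rot_diff_def
  proof (rule nn_integral_powr_triangle[where u = "\<lambda>\<theta>. norm (F (cis t * (of_real r * cis \<theta>)))" and v = "\<lambda>\<theta>. norm (F (of_real r * cis \<theta>))"])
    show "(\<integral>\<^sup>+\<theta>. ennreal (norm (F (cis t * (of_real r * cis \<theta>))) powr p) \<partial>circ) \<le> ennreal (B powr p)"
      using B mean_pow_rotate[OF F r, of p t] by (simp add: mean_pow_def)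
    show "(\<integral>\<^sup>+\<theta>. ennreal (norm (F (of_real r * cis \<theta>)) powr p) \<partial>circ) \<le> ennreal (B powr p)"
      using B by (simp add: mean_pow_def)
  qed (use p B norm_triangle_ineq4 in auto)
qed

text \<open>\<open>rot_diff t F\<close> is itself holomorphic with bounded means, and its radial
  limits are the differences of those of F, so \<open>mean_pow_le_boundary\<close> applies to
  it.\<close>

lemma mean_pow_rot_diff_le_modulus:
  assumes F: "F holomorphic_on unit_disc" and lim: "AE \<theta> in lebesgue. has_radial_limit F (cis \<theta>)"
    and B: "\<And>r. 0 < r \<Longrightarrow> r < 1 \<Longrightarrow> mean_pow p r F \<le> ennreal (B powr p)" "B \<ge> 0" and p: "p \<ge> 1" and r: "0 \<le> r" "r < 1"
  shows "mean_pow p r (rot_diff t F) \<le> modulus_int p t F"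
  unfolding modulus_int_def
proof (rule mean_pow_le_boundary[OF holomorphic_rot_diff[OF F] p _ _ rad_bounds(1,2) rad_tendsto _ _ _ r])
  note [measurable] = bdry_measurable[OF F]
  show "mean_pow p r (rot_diff t F) \<le> ennreal ((4 * (B + B)) powr p)" if "0 < r" "r < 1" for r
    using that by (intro mean_pow_rot_diff_le[OF F _ _ p] B) auto
  show "(\<lambda>\<theta>. norm (bdry F (\<theta> + t) - bdry F \<theta>)) \<in> borel_measurable borel" by measurable
  have lb: "AE \<theta> in lborel. has_radial_limit F (cis \<theta>)" using lim by (simp add: AE_completion_iff)
  have "AE \<theta> in lborel. has_radial_limit F (cis (t + \<theta>))" by (rule AE_lborel_shift[OF lb])
  with lb have "AE \<theta> in lborel. (\<lambda>n. norm (rot_diff t F (of_real (rad n) * cis \<theta>))) \<longlonglongrightarrow> norm (bdry F (\<theta> + t) - bdry F \<theta>)"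
  proof eventually_elim
    case (elim \<theta>)
    have e: "cis t * (of_real x * cis \<theta>) = of_real x * cis (t + \<theta>)" for x by (simp add: cis_mult[symmetric])
    show ?case unfolding rot_diff_def e
      using has_radial_limit_bdry(3)[OF elim(1)] has_radial_limit_bdry(3)[OF elim(2)]
      by (intro tendsto_norm tendsto_diff) (simp_all add: add.commute)
  qed
  then show "AE \<theta> in circ. (\<lambda>n. norm (rot_diff t F (of_real (rad n) * cis \<theta>))) \<longlonglongrightarrow> norm (bdry F (\<theta> + t) - bdry F \<theta>)"
    by (rule AE_circI)
qed auto

lemma Hardy_mean_pow:
  assumes F: "F \<in> Hardy p" and p: "p \<ge> 1"
  obtains B where "B \<ge> 0" "\<And>r. 0 \<le> r \<Longrightarrow> r < 1 \<Longrightarrow> mean_pow p r F \<le> ennreal (B powr p)"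
proof -
  have h: "F holomorphic_on unit_disc" using F by (simp add: Hardy_def)
  obtain B where "\<forall>r\<in>{0<..<1}. integral_mean p r F \<le> B"
    using F by (auto simp: Hardy_def bdd_above_def)
  then have B: "\<And>r. 0 < r \<Longrightarrow> r < 1 \<Longrightarrow> integral_mean p r F \<le> B" by auto
  have B0: "B \<ge> 0" using B[of "1/2"] integral_mean_nonneg[of p "1/2" F] by linarith
  have *: "mean_pow p r F \<le> ennreal (B powr p)" if "0 < r" "r < 1" for r
    using that B[of r] B0 p integral_mean_le_iff[OF h, of r p B] by auto
  show ?thesis
  proof (rule that[OF B0])
    fix r :: real assume r: "0 \<le> r" "r < 1"
    show "mean_pow p r F \<le> ennreal (B powr p)"
      by (rule order_trans[OF mean_pow_mono[OF h r(1) _ _ p, of "(1 + r)/2"] *]) (use r in auto)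
  qed
qed

text \<open>The modulus of continuity controls small t only; for larger t the trivial bound by the
  means of F is absorbed in K * t^2. The square matches the kernel |1 - q e^(it)|^(-2), against
  which it contributes a mere constant. The second bound, restricted to small t and free of K,
  serves p = 1.\<close>

lemma rot_diff_bound_of_modulus:
  assumes F: "F \<in> Hardy p" and lim: "AE \<theta> in lebesgue. has_radial_limit F (cis \<theta>)" and p: "p \<ge> 1"
    and \<epsilon>: "\<epsilon> > 0" "\<delta>0 > 0" "\<And>\<delta>. 0 < \<delta> \<Longrightarrow> \<delta> < \<delta>0 \<Longrightarrow> mean_modulus p \<delta> F \<le> \<epsilon> * \<delta> powr (1/p)"
  obtains K where "K \<ge> 0" "\<And>t r. 0 \<le> r \<Longrightarrow> r < 1 \<Longrightarrow> mean_pow p r (rot_diff t F) \<le> ennreal ((\<epsilon> * \<bar>t\<bar> powr (1/p) + K * t\<^sup>2) powr p)"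
    "\<And>t r. 0 \<le> r \<Longrightarrow> r < 1 \<Longrightarrow> \<bar>t\<bar> < \<delta>0 \<Longrightarrow> mean_pow p r (rot_diff t F) \<le> ennreal ((\<epsilon> * \<bar>t\<bar> powr (1/p)) powr p)"
proof -
  have h: "F holomorphic_on unit_disc" using F by (simp add: Hardy_def)
  obtain B where B: "B \<ge> 0" "\<And>r. 0 \<le> r \<Longrightarrow> r < 1 \<Longrightarrow> mean_pow p r F \<le> ennreal (B powr p)"
    using Hardy_mean_pow[OF F p] by blast
  define B' where "B' = 4 * (B + B)"
  have B': "B' \<ge> 0" using B by (simp add: B'_def)
  have mi: "modulus_int p t F \<le> ennreal (B' powr p)" for t
    unfolding B'_def by (rule modulus_int_le[OF h lim _ B(1) p]) (use B in auto)
  have small: "mean_pow p r (rot_diff t F) \<le> ennreal ((\<epsilon> * \<bar>t\<bar> powr (1/p)) powr p)"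
    if r: "0 \<le> r" "r < 1" and t: "\<bar>t\<bar> < \<delta>0" for t r
  proof (cases "t = 0")
    case True
    then show ?thesis using p by (simp add: mean_pow_def rot_diff_def)
  next
    case False
    have bd: "bdd_above ((\<lambda>t. enn2real (modulus_int p t F) powr (1/p)) ` {s. 0 < \<bar>s\<bar> \<and> \<bar>s\<bar> \<le> \<bar>t\<bar>})"
    proof (rule bdd_aboveI2)
      show "enn2real (modulus_int p t F) powr (1/p) \<le> (B' powr p) powr (1/p)" for t
        using mi[of t] p by (intro powr_mono2 enn2real_leI) auto
    qed
    have "enn2real (modulus_int p t F) powr (1/p) \<le> mean_modulus p \<bar>t\<bar> F"
      unfolding mean_modulus_eq[OF h lim] by (rule cSUP_upper[OF _ bd]) (use False in auto)
    also have "\<dots> \<le> \<epsilon> * \<bar>t\<bar> powr (1/p)" using \<epsilon>(3)[of "\<bar>t\<bar>"] False t by auto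
    finally have "(enn2real (modulus_int p t F) powr (1/p)) powr p \<le> (\<epsilon> * \<bar>t\<bar> powr (1/p)) powr p"
      using p by (intro powr_mono2) auto
    then have "enn2real (modulus_int p t F) \<le> (\<epsilon> * \<bar>t\<bar> powr (1/p)) powr p"
      using p by (simp add: powr_powr)
    moreover have "modulus_int p t F < top" using mi[of t] by (auto intro: le_less_trans)
    ultimately have "modulus_int p t F \<le> ennreal ((\<epsilon> * \<bar>t\<bar> powr (1/p)) powr p)"
      by (metis ennreal_enn2real ennreal_leI)
    moreover have "mean_pow p r (rot_diff t F) \<le> modulus_int p t F"
      by (rule mean_pow_rot_diff_le_modulus[OF h lim _ B(1) p r]) (use B in auto)
    ultimately show ?thesis by (rule order_trans[rotated])
  qed
  \<comment> \<open>Where it is needed, t^2 >= \<delta>0^2, so K * t^2 exceeds the trivial bound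
    B'.\<close>
  define K where "K = B' / \<delta>0\<^sup>2"
  have K: "K \<ge> 0" using B' by (simp add: K_def)
  show ?thesis
  proof (rule that[OF K])
    fix t r :: real assume r: "0 \<le> r" "r < 1"
    show "mean_pow p r (rot_diff t F) \<le> ennreal ((\<epsilon> * \<bar>t\<bar> powr (1/p) + K * t\<^sup>2) powr p)"
    proof (cases "\<bar>t\<bar> < \<delta>0")
      case True
      show ?thesis by (rule order_trans[OF small[OF r True]]) (use \<epsilon> K p in \<open>auto intro!: ennreal_leI powr_mono2\<close>)
    next
      case False
      have "\<delta>0\<^sup>2 \<le> \<bar>t\<bar>\<^sup>2" using False \<epsilon> by (intro power_mono) auto
      then have "B' \<le> K * t\<^sup>2" using B' \<epsilon>(2) by (simp add: K_def field_simps mult_left_mono)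
      then have "B' \<le> \<epsilon> * \<bar>t\<bar> powr (1/p) + K * t\<^sup>2" using \<epsilon> by (simp add: add_increasing)
      then have "ennreal (B' powr p) \<le> ennreal ((\<epsilon> * \<bar>t\<bar> powr (1/p) + K * t\<^sup>2) powr p)" using B' p by (intro ennreal_leI powr_mono2) auto
      moreover have "mean_pow p r (rot_diff t F) \<le> ennreal (B' powr p)"
        unfolding B'_def by (rule mean_pow_rot_diff_le[OF h r p B(2)[OF r] B(1)])
      ultimately show ?thesis by (rule order_trans[rotated])
    qed
  qed (use small in auto)
qed

section \<open>From moduli of continuity to the growth of the derivative\<close>

text \<open>The series sums to w/(1 - w)^2 with w = q e^(it). Convolution with it is the operator z
  d/dz.\<close>

lemma fourier_derivative_kernel:
  assumes q: "0 \<le> q" "q < 1"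
  shows "norm (fourier (\<lambda>n. of_nat n * of_real q ^ n) t) \<le> norm (1 - of_real q * cis t) powr (-2)"
    and "summable (\<lambda>n. norm (of_nat n * of_real q ^ n :: complex))"
proof -
  define w where "w = of_real q * cis t"
  have w: "norm w < 1" using q by (simp add: w_def norm_mult)
  then have ne: "w \<noteq> 1" by auto
  have s: "(\<lambda>n. of_nat n * w ^ n) sums (w / (1 - w)\<^sup>2)"
  proof -
    have "(\<lambda>n. of_nat (Suc n) * w ^ n) sums (1 / (1 - w)\<^sup>2)" by (rule geometric_deriv_sums[OF w])
    then have "(\<lambda>n. w * (of_nat (Suc n) * w ^ n)) sums (w * (1 / (1 - w)\<^sup>2))" by (rule sums_mult)
    then have "(\<lambda>n. of_nat (Suc n) * w ^ Suc n) sums (w / (1 - w)\<^sup>2)" by (simp add: mult_ac del: of_nat_Suc)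
    then show ?thesis by (subst (asm) sums_Suc_iff) simp
  qed
  have "fourier (\<lambda>n. of_nat n * of_real q ^ n) t = w / (1 - w)\<^sup>2"
    using s unfolding fourier_def w_def by (simp only: power_mult_distrib Complex.DeMoivre mult.assoc sums_iff)
  then have "norm (fourier (\<lambda>n. of_nat n * of_real q ^ n) t) \<le> 1 / (norm (1 - w))\<^sup>2"
    using w by (simp add: norm_divide norm_power divide_right_mono)
  also have "\<dots> = norm (1 - w) powr (-2)"
    using ne by (simp add: powr_minus_divide)
  finally show "norm (fourier (\<lambda>n. of_nat n * of_real q ^ n) t) \<le> norm (1 - of_real q * cis t) powr (-2)"
    by (simp add: w_def)
  have "summable (\<lambda>n. of_nat (Suc n) * q ^ n)" using geometric_deriv_sums[of q] q by (auto simp: sums_iff)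
  then have "summable (\<lambda>n. q * (of_nat (Suc n) * q ^ n))" by (rule summable_mult)
  then have "summable (\<lambda>n. of_nat (Suc n) * q ^ Suc n)" by (simp add: mult_ac del: of_nat_Suc)
  then have "summable (\<lambda>n. of_nat n * q ^ n)" by (subst (asm) summable_Suc_iff)
  then show "summable (\<lambda>n. norm (of_nat n * of_real q ^ n :: complex))"
    using q by (simp add: norm_mult norm_power)
qed

lemma fps_nth_z_deriv:
  assumes F: "F holomorphic_on unit_disc"
  shows "fps_nth (fps_expansion (\<lambda>z. z * deriv F z) 0) n = of_nat n * fps_nth (fps_expansion F 0) n"
proof -
  have "(\<lambda>z. z * deriv F z) has_fps_expansion (fps_X * fps_deriv (fps_expansion F 0))"
    by (intro fps_expansion_intros fps_expansion_disc[OF F])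
  then have "fps_expansion (\<lambda>z. z * deriv F z) 0 = fps_X * fps_deriv (fps_expansion F 0)" by (rule fps_expansion_eqI)
  then show ?thesis by (cases n) (simp_all del: of_nat_Suc)
qed

lemma holomorphic_z_deriv: "F holomorphic_on unit_disc \<Longrightarrow> (\<lambda>z. z * deriv F z) holomorphic_on unit_disc"
  by (intro holomorphic_intros) auto

text \<open>The kernel of \<open>z F'(z)\<close> has mean zero, so \<open>F\<close> may be replaced by its differences.\<close>

lemma norm_z_deriv_le_rot_diff:
  assumes F: "F holomorphic_on unit_disc" and q: "0 \<le> q" "q < 1"
  shows "ennreal (norm ((of_real (q\<^sup>2) * cis \<theta>) * deriv F (of_real (q\<^sup>2) * cis \<theta>)))
    \<le> (\<integral>\<^sup>+t. ennreal (norm (fourier (\<lambda>n. of_nat n * of_real q ^ n) t) * norm (rot_diff (- t) F (of_real q * cis \<theta>))) \<partial>circ)"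
proof -
  define a where "a = (\<lambda>n. of_nat n * of_real q ^ n :: complex)"
  define b where "b = (\<lambda>n. fps_nth (fps_expansion F 0) n * of_real q ^ n)"
  \<comment> \<open>The coefficients of the function that is constant in the angle, with the value
    to be subtracted; a_0 = 0 makes its convolution with the kernel vanish.\<close>
  define e where "e = (\<lambda>n::nat. if n = 0 then F (of_real q * cis \<theta>) else 0 :: complex)"
  have q2: "0 \<le> q\<^sup>2" "q\<^sup>2 < 1" using q by (auto simp: abs_square_less_1)
  have a: "summable (\<lambda>n. norm (a n))" unfolding a_def by (rule fourier_derivative_kernel(2)[OF q])
  have F': "F holomorphic_on ball 0 1" using F .
  have b: "summable (\<lambda>n. norm (b n))" unfolding b_def by (rule holomorphic_power_series_fourier(2)[OF F' q])
  have e: "summable (\<lambda>n. norm (e n))" unfolding e_def by (rule summable_finite[of "{0}"]) auto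
  have fe: "fourier e x = F (of_real q * cis \<theta>)" for x
    unfolding fourier_def e_def using suminf_finite[of "{0}" "\<lambda>n. (if n = 0 then F (of_real q * cis \<theta>) else 0) * cis (real n * x)"] by simp
  have fb: "fourier b x = F (of_real q * cis x)" for x
    unfolding b_def by (rule holomorphic_power_series_fourier(1)[OF F' q, symmetric])
  have "(of_real (q\<^sup>2) * cis \<theta>) * deriv F (of_real (q\<^sup>2) * cis \<theta>) = fourier (\<lambda>n. a n * b n) \<theta>"
    using holomorphic_power_series_fourier(1)[OF holomorphic_z_deriv[OF F] q2, of \<theta>]
    unfolding fps_nth_z_deriv[OF F] by (simp add: a_def b_def power2_eq_square power_mult_distrib mult_ac)
  also have "\<dots> = fourier (\<lambda>n. a n * b n) \<theta> - fourier (\<lambda>n. a n * e n) \<theta>"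
  proof -
    have "(\<lambda>n. a n * e n) = (\<lambda>n. 0)" by (auto simp: a_def e_def)
    then show ?thesis by (simp add: fourier_def)
  qed
  also have "\<dots> = (LINT t|circ. fourier a t * fourier b (\<theta> - t)) - (LINT t|circ. fourier a t * fourier e (\<theta> - t))"
    by (simp only: integral_fourier_convolution[OF a b] integral_fourier_convolution[OF a e])
  also have "\<dots> = (LINT t|circ. fourier a t * fourier b (\<theta> - t) - fourier a t * fourier e (\<theta> - t))"
  proof (rule Bochner_Integration.integral_diff[symmetric])
    show "integrable circ (\<lambda>t. fourier a t * fourier b (\<theta> - t))"
      by (rule integrable_circ_bounded[where K = "(\<Sum>n. norm (a n)) * (\<Sum>n. norm (b n))"])
         (auto simp: norm_mult intro!: mult_mono norm_fourier_le[OF a] norm_fourier_le[OF b] suminf_nonneg a)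
    show "integrable circ (\<lambda>t. fourier a t * fourier e (\<theta> - t))"
      by (rule integrable_circ_bounded[where K = "(\<Sum>n. norm (a n)) * (\<Sum>n. norm (e n))"])
         (auto simp: norm_mult intro!: mult_mono norm_fourier_le[OF a] norm_fourier_le[OF e] suminf_nonneg a)
  qed
  finally have eq: "(of_real (q\<^sup>2) * cis \<theta>) * deriv F (of_real (q\<^sup>2) * cis \<theta>) = (LINT t|circ. fourier a t * rot_diff (- t) F (of_real q * cis \<theta>))"
    by (simp add: fb fe rot_diff_def right_diff_distrib cis_mult mult.left_commute[of "cis _"])
  have "norm (LINT t|circ. fourier a t * rot_diff (- t) F (of_real q * cis \<theta>)) \<le> (\<integral>\<^sup>+t. ennreal (norm (fourier a t * rot_diff (- t) F (of_real q * cis \<theta>))) \<partial>circ)"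
    by (cases "integrable circ (\<lambda>t. fourier a t * rot_diff (- t) F (of_real q * cis \<theta>))")
       (auto intro: integral_norm_bound_ennreal simp: not_integrable_integral_eq)
  then show ?thesis unfolding eq by (simp add: a_def norm_mult)
qed

text \<open>Minkowski's inequality in t. Against |1 - q e^(it)|^(-2) the term |t|^(1/p) integrates
  to a multiple of (1 - q)^(1/p - 1), and t^2 to a constant.\<close>

lemma mean_growth_z_deriv:
  assumes p: "p > 1" and F: "F holomorphic_on unit_disc" and \<epsilon>: "\<epsilon> > 0" and K: "K \<ge> 0"
    and rd: "\<And>t r. 0 \<le> r \<Longrightarrow> r < 1 \<Longrightarrow> mean_pow p r (rot_diff t F) \<le> ennreal ((\<epsilon> * \<bar>t\<bar> powr (1/p) + K * t\<^sup>2) powr p)"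
  shows "mean_growth p (1 - 1/p) (2 * kernel_const (1/p) 2 * \<epsilon>) (25 * K) (\<lambda>z. z * deriv F z)"
  unfolding mean_growth_def
proof (intro allI impI)
  fix r :: real assume "0 \<le> r \<and> r < 1"
  define q where "q = sqrt r"
  have q: "0 \<le> q" "q < 1" "r = q\<^sup>2" using \<open>0 \<le> r \<and> r < 1\<close> by (auto simp: q_def)
  have a0: "1/p > 0" "1/p < 1" using p by simp_all
  \<comment> \<open>The kernel estimate with exponents 1/p and 2 asks for 2 > 1/p + 1, that is p >
    1.\<close>
  then have a: "1/p > -1" "2 > 1/p + 1" "1/p > 0" by linarith+
  define k where "k = (\<lambda>t. norm (fourier (\<lambda>n. of_nat n * of_real q ^ n) t))"
  have [measurable]: "k \<in> borel_measurable borel" unfolding k_def by measurable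
  have k0: "k t \<ge> 0" for t by (simp add: k_def)
  have kle: "k t \<le> norm (1 - of_real q * cis t) powr (-2)" for t unfolding k_def by (rule fourier_derivative_kernel(1)[OF q(1,2)])
  have kper: "k (t + 2*pi) = k t" for t
    unfolding k_def fourier_def by (simp add: distrib_left cis_mult[symmetric] cis_multiple_2pi mult.commute[of _ "2*pi"])
  define G where "G = (\<lambda>\<theta> t. norm (rot_diff (- t) F (of_real q * cis \<theta>)))"
  have Gm[measurable]: "(\<lambda>(\<theta>, t). G \<theta> t) \<in> borel_measurable (borel \<Otimes>\<^sub>M borel)"
  proof -
    have [measurable]: "(\<lambda>t. F (of_real q * cis t)) \<in> borel_measurable borel"
      by (rule holomorphic_circle_measurable[OF F q(1,2)])
    have "G \<theta> t = norm (F (of_real q * cis (\<theta> - t)) - F (of_real q * cis \<theta>))" for \<theta> t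
      by (simp add: G_def rot_diff_def cis_mult mult.left_commute[of "cis _"])
    then show ?thesis by simp
  qed
  define m where "m = (\<lambda>t. (1 / (2*pi)) * (k t * (\<epsilon> * \<bar>t\<bar> powr (1/p) + K * t\<^sup>2)) * indicator {-pi..<pi} t)"
  \<comment> \<open>The 25 is the square of the 5 in \<open>norm_one_minus_cis_lower\<close>: it
    bounds t^2 times the kernel.\<close>
  define I where "I = \<epsilon> * kernel_const (1/p) 2 * (1 - q) powr (1/p - 1) + 25 * K"
  have kc: "kernel_const (1/p) 2 > 0" by (rule kernel_const_pos[OF a(1,2)])
  have "(\<integral>\<^sup>+\<theta>. ennreal (norm ((of_real (q\<^sup>2) * cis \<theta>) * deriv F (of_real (q\<^sup>2) * cis \<theta>)) powr p) \<partial>circ) \<le> ennreal (I powr p)"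
  proof (rule Minkowski_integral_inequality[where N = lborel and \<phi> = "\<lambda>\<theta> t. (1 / (2*pi)) * (k t * G \<theta> t) * indicator {-pi..<pi} t" and m = m])
    show "sigma_finite_measure circ" by (rule sigma_finite_circ)
    show "sigma_finite_measure (lborel :: real measure)" by (rule sigma_finite_lborel)
    show "(\<lambda>(\<theta>, t). (1 / (2*pi)) * (k t * G \<theta> t) * indicator {-pi..<pi} t) \<in> borel_measurable (circ \<Otimes>\<^sub>M lborel)"
      by measurable
    show "m \<in> borel_measurable lborel" unfolding m_def by measurable
    show "(1 / (2*pi)) * (k t * G \<theta> t) * indicator {-pi..<pi} t \<ge> 0" for \<theta> t using k0 by (simp add: G_def)
    show "m t \<ge> 0" for t using k0 \<epsilon> K by (simp add: m_def)
    show "p \<ge> 1" using p by simp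
    show "I \<ge> 0" using \<epsilon> K kc by (simp add: I_def)
    show "(1 / (2*pi)) * (k t * G \<theta> t) * indicator {-pi..<pi} t = 0" if "m t = 0" for \<theta> t
    proof (cases "t = 0")
      case True
      then show ?thesis by (simp add: G_def rot_diff_def)
    next
      case False
      then have "\<epsilon> * \<bar>t\<bar> powr (1/p) + K * t\<^sup>2 > 0" using \<epsilon> K by (intro add_pos_nonneg) auto
      then show ?thesis using that by (auto simp: m_def)
    qed
    show "(\<integral>\<^sup>+t. ennreal (m t) \<partial>lborel) \<le> ennreal I"
    proof -
      have "(\<integral>\<^sup>+t. ennreal (m t) \<partial>lborel)
          \<le> (\<integral>\<^sup>+t. ennreal \<epsilon> * (ennreal (\<bar>t\<bar> powr (1/p) * norm (1 - of_real q * cis t) powr (-2)) * indicator {-pi..<pi} t)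
            + ennreal (25 * K / (2*pi)) * indicator {-pi..<pi} t \<partial>lborel)"
      proof (rule nn_integral_mono)
        fix t
        show "ennreal (m t) \<le> ennreal \<epsilon> * (ennreal (\<bar>t\<bar> powr (1/p) * norm (1 - of_real q * cis t) powr (-2)) * indicator {-pi..<pi} t)
            + ennreal (25 * K / (2*pi)) * indicator {-pi..<pi} t"
        proof (cases "t \<in> {-pi..<pi}")
          case True
          define N where "N = norm (1 - of_real q * cis t)"
          have N: "N \<ge> 1 - q" unfolding N_def by (rule norm_one_minus_cis_ge[OF q(1)])
          have N0: "N > 0" using N q by linarith
          have "\<bar>t\<bar> / 5 \<le> max (1 - q) \<bar>t\<bar> / 5" by (intro divide_right_mono) auto
          also have "\<dots> \<le> N" unfolding N_def by (rule norm_one_minus_cis_lower[OF q(1,2)]) (use True in auto)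
          finally have "\<bar>t\<bar> / 5 \<le> N" .
          then have "(\<bar>t\<bar> / 5)\<^sup>2 \<le> N\<^sup>2" by (intro power_mono) auto
          then have t2: "t\<^sup>2 * N powr (-2) \<le> 25" using N0 by (simp add: powr_minus_divide field_simps power_divide)
          have "k t * (\<epsilon> * \<bar>t\<bar> powr (1/p) + K * t\<^sup>2) \<le> N powr (-2) * (\<epsilon> * \<bar>t\<bar> powr (1/p) + K * t\<^sup>2)"
            using \<epsilon> K kle[of t] by (intro mult_right_mono) (auto simp: N_def)
          also have "\<dots> = \<epsilon> * (\<bar>t\<bar> powr (1/p) * N powr (-2)) + K * (t\<^sup>2 * N powr (-2))" by (simp add: algebra_simps)
          also have "\<dots> \<le> \<epsilon> * (\<bar>t\<bar> powr (1/p) * N powr (-2)) + K * 25" using K t2 by (intro add_left_mono mult_left_mono)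
          finally have "(1 / (2*pi)) * (k t * (\<epsilon> * \<bar>t\<bar> powr (1/p) + K * t\<^sup>2)) \<le> (1 / (2*pi)) * (\<epsilon> * (\<bar>t\<bar> powr (1/p) * N powr (-2)) + K * 25)"
            by (rule mult_left_mono) simp
          also have "\<dots> = (1 / (2*pi)) * (\<epsilon> * (\<bar>t\<bar> powr (1/p) * N powr (-2))) + 25 * K / (2*pi)"
            by (simp add: algebra_simps add_divide_distrib)
          also have "(1 / (2*pi)) * (\<epsilon> * (\<bar>t\<bar> powr (1/p) * N powr (-2))) \<le> 1 * (\<epsilon> * (\<bar>t\<bar> powr (1/p) * N powr (-2)))"
            using \<epsilon> pi_gt3 by (intro mult_right_mono) (auto simp: field_simps)
          finally have "m t \<le> \<epsilon> * (\<bar>t\<bar> powr (1/p) * N powr (-2)) + 25 * K / (2*pi)" using True by (simp add: m_def)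
          then have "ennreal (m t) \<le> ennreal (\<epsilon> * (\<bar>t\<bar> powr (1/p) * N powr (-2)) + 25 * K / (2*pi))" by (rule ennreal_leI)
          also have "\<dots> = ennreal \<epsilon> * ennreal (\<bar>t\<bar> powr (1/p) * N powr (-2)) + ennreal (25 * K / (2*pi))"
            using \<epsilon> K by (subst ennreal_plus) (auto simp: ennreal_mult)
          finally show ?thesis using True by (simp add: N_def)
        qed (simp add: m_def)
      qed
      also have "\<dots> = ennreal \<epsilon> * (\<integral>\<^sup>+t. ennreal (\<bar>t\<bar> powr (1/p) * norm (1 - of_real q * cis t) powr (-2)) * indicator {-pi..<pi} t \<partial>lborel)
          + ennreal (25 * K / (2*pi)) * ennreal (2*pi)"
        by (simp add: nn_integral_add nn_integral_cmult)
      also have "\<dots> \<le> ennreal \<epsilon> * ennreal (kernel_const (1/p) 2 * (1 - q) powr (1/p+1-2)) + ennreal (25 * K / (2*pi)) * ennreal (2*pi)"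
        by (intro add_right_mono mult_left_mono nn_integral_kernel a q) auto
      also have "\<dots> = ennreal I"
        using \<epsilon> K kc by (simp add: I_def ennreal_mult[symmetric] ennreal_plus[symmetric] mult.assoc del: ennreal_plus)
      finally show ?thesis .
    qed
    show "(\<integral>\<^sup>+\<theta>. ennreal (((1 / (2*pi)) * (k t * G \<theta> t) * indicator {-pi..<pi} t) powr p) \<partial>circ) \<le> ennreal (m t powr p)" for t
    proof (cases "t \<in> {-pi..<pi}")
      case True
      have [measurable]: "(\<lambda>\<theta>. rot_diff (- t) F (of_real q * cis \<theta>)) \<in> borel_measurable borel"
        by (rule holomorphic_circle_measurable[OF holomorphic_rot_diff[OF F] q(1,2)])
      have "(\<integral>\<^sup>+\<theta>. ennreal (((1 / (2*pi)) * (k t * G \<theta> t) * indicator {-pi..<pi} t) powr p) \<partial>circ)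
          = (\<integral>\<^sup>+\<theta>. ennreal ((1 / (2*pi) * k t) powr p) * ennreal (norm (rot_diff (- t) F (of_real q * cis \<theta>)) powr p) \<partial>circ)"
        using True k0[of t] by (intro nn_integral_cong) (simp add: G_def ennreal_mult[symmetric] powr_mult powr_divide)
      also have "\<dots> = ennreal ((1 / (2*pi) * k t) powr p) * mean_pow p q (rot_diff (- t) F)"
        unfolding mean_pow_def by (rule nn_integral_cmult) measurable
      also have "\<dots> \<le> ennreal ((1 / (2*pi) * k t) powr p) * ennreal ((\<epsilon> * \<bar>- t\<bar> powr (1/p) + K * (- t)\<^sup>2) powr p)"
        by (intro mult_left_mono rd q) auto
      also have "\<dots> = ennreal (((1 / (2*pi) * k t) * (\<epsilon> * \<bar>t\<bar> powr (1/p) + K * t\<^sup>2)) powr p)"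
        using \<epsilon> K k0[of t] by (simp add: ennreal_mult[symmetric] powr_mult powr_divide)
      also have "\<dots> = ennreal (m t powr p)" using True by (simp add: m_def mult.assoc)
      finally show ?thesis .
    qed simp
    show "AE \<theta> in circ. ennreal (norm ((of_real (q\<^sup>2) * cis \<theta>) * deriv F (of_real (q\<^sup>2) * cis \<theta>)))
        \<le> (\<integral>\<^sup>+t. ennreal ((1 / (2*pi)) * (k t * G \<theta> t) * indicator {-pi..<pi} t) \<partial>lborel)"
    proof (rule AE_I2)
      fix \<theta>
      have [measurable]: "(\<lambda>t. G \<theta> t) \<in> borel_measurable borel" using measurable_Pair2[OF Gm, of \<theta>] by simp
      have Gper: "G \<theta> (t + 2*pi) = G \<theta> t" for t
      proof -
        have "cis (- (t + 2*pi)) = cis (- t)"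
          by (metis cis_2pi cis_cnj cis_mult complex_cnj_one complex_cnj_mult mult_1_right)
        then show ?thesis by (simp add: G_def rot_diff_def)
      qed
      have "ennreal (norm ((of_real (q\<^sup>2) * cis \<theta>) * deriv F (of_real (q\<^sup>2) * cis \<theta>))) \<le> (\<integral>\<^sup>+t. ennreal (k t * G \<theta> t) \<partial>circ)"
        using norm_z_deriv_le_rot_diff[OF F q(1,2), of \<theta>] by (simp add: k_def G_def)
      also have "\<dots> = ennreal (1 / (2*pi)) * (\<integral>\<^sup>+t. ennreal (k t * G \<theta> t) * indicator {-pi..<-pi+2*pi} t \<partial>lborel)"
        by (rule nn_integral_circ_interval) (auto simp: kper Gper)
      also have "\<dots> = (\<integral>\<^sup>+t. ennreal (1 / (2*pi)) * (ennreal (k t * G \<theta> t) * indicator {-pi..<-pi+2*pi} t) \<partial>lborel)"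
        by (rule nn_integral_cmult[symmetric]) measurable
      also have "\<dots> = (\<integral>\<^sup>+t. ennreal ((1 / (2*pi)) * (k t * G \<theta> t) * indicator {-pi..<pi} t) \<partial>lborel)"
        using k0 by (intro nn_integral_cong) (auto simp: indicator_def ennreal_mult[symmetric] G_def)
      finally show "ennreal (norm ((of_real (q\<^sup>2) * cis \<theta>) * deriv F (of_real (q\<^sup>2) * cis \<theta>)))
        \<le> (\<integral>\<^sup>+t. ennreal ((1 / (2*pi)) * (k t * G \<theta> t) * indicator {-pi..<pi} t) \<partial>lborel)" .
    qed
  qed simp
  then have "mean_pow p r (\<lambda>z. z * deriv F z) \<le> ennreal (I powr p)" by (simp add: mean_pow_def q(3))
  also have "\<dots> \<le> ennreal ((2 * kernel_const (1/p) 2 * \<epsilon> * (1 - r) powr (- (1 - 1/p)) + 25 * K) powr p)"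
  proof (intro ennreal_leI powr_mono2)
    have "(1 - q) * (1 + q) \<le> (1 - q) * 2" using q by (intro mult_left_mono) auto
    then have "(1 - r) / 2 \<le> 1 - q" unfolding q(3) power2_eq_square by (simp add: field_simps)
    then have "(1 - q) powr (1/p - 1) \<le> ((1 - r) / 2) powr (1/p - 1)"
      using \<open>0 \<le> r \<and> r < 1\<close> a p by (intro powr_mono2') auto
    also have "\<dots> = 2 powr (1 - 1/p) * (1 - r) powr (1/p - 1)"
    proof -
      have "((1 - r) / 2) powr (1/p - 1) = (1 - r) powr (1/p - 1) / 2 powr (1/p - 1)"
        by (rule powr_divide)
      also have "\<dots> = 2 powr (1 - 1/p) * (1 - r) powr (1/p - 1)"
        using powr_minus_divide[of 2 "1/p - 1"] by simp
      finally show ?thesis .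
    qed
    also have "\<dots> \<le> 2 powr 1 * (1 - r) powr (1/p - 1)"
      using a by (intro mult_right_mono powr_mono) auto
    finally have "\<epsilon> * kernel_const (1/p) 2 * (1 - q) powr (1/p - 1) \<le> \<epsilon> * kernel_const (1/p) 2 * (2 * (1 - r) powr (1/p - 1))"
      using \<epsilon> kc by (intro mult_left_mono) auto
    then show "I \<le> 2 * kernel_const (1/p) 2 * \<epsilon> * (1 - r) powr (- (1 - 1/p)) + 25 * K"
      by (simp add: I_def mult_ac)
    show "0 \<le> I" using \<epsilon> K kc by (simp add: I_def)
  qed (use p in auto)
  finally show "mean_pow p r (\<lambda>z. z * deriv F z) \<le> ennreal ((2 * kernel_const (1/p) 2 * \<epsilon> * (1 - r) powr (- (1 - 1/p)) + 25 * K) powr p)" .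
qed

text \<open>For p = 1 the integral of |t| against the kernel grows logarithmically as q tends to 1.
  Instead, (F(e^(it) z) - F(z))/t tends to i z F'(z) as t tends to 0, these quotients have means at
  most \<epsilon>, and Fatou's lemma passes to the limit.\<close>

lemma mean_growth_z_deriv_1:
  assumes F: "F holomorphic_on unit_disc" and \<epsilon>: "\<epsilon> > 0" "\<delta>0 > 0"
    and rd: "\<And>t r. 0 \<le> r \<Longrightarrow> r < 1 \<Longrightarrow> \<bar>t\<bar> < \<delta>0 \<Longrightarrow> mean_pow 1 r (rot_diff t F) \<le> ennreal (\<epsilon> * \<bar>t\<bar>)"
  shows "mean_growth 1 0 \<epsilon> 0 (\<lambda>z. z * deriv F z)"
  unfolding mean_growth_def
proof (intro allI impI)
  fix r :: real assume "0 \<le> r \<and> r < 1"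
  then have r: "0 \<le> r" "r < 1" by auto
  define t where "t = (\<lambda>n. \<delta>0 / real (n + 2))"
  have t: "0 < t n" "t n < \<delta>0" for n using \<epsilon> by (auto simp: t_def field_simps add_pos_nonneg)
  have t0: "t \<longlonglongrightarrow> 0" unfolding t_def by real_asymp
  have "mean_pow 1 r (\<lambda>z. \<i> * z * deriv F z) \<le> liminf (\<lambda>n. mean_pow 1 r (\<lambda>z. rot_diff (t n) F z / of_real (t n)))"
  proof (rule mean_pow_liminf_le[OF _ r])
    show "(\<lambda>z. rot_diff (t n) F z / of_real (t n)) holomorphic_on unit_disc" for n
      using t[of n] by (intro holomorphic_intros holomorphic_rot_diff[OF F]) auto
    fix z :: complex assume z: "norm z < 1"
    have "((\<lambda>s. F (exp (\<i> * s) * z)) has_field_derivative deriv F (exp (\<i> * 0) * z) * (\<i> * exp (\<i> * 0) * z)) (at 0)"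
    proof (rule DERIV_chain2[where f = F and g = "\<lambda>s. exp (\<i> * s) * z"])
      show "(F has_field_derivative deriv F (exp (\<i> * 0) * z)) (at (exp (\<i> * 0) * z))"
        using z by (intro holomorphic_derivI[OF F]) auto
      show "((\<lambda>s. exp (\<i> * s) * z) has_field_derivative \<i> * exp (\<i> * 0) * z) (at 0)"
        by (auto intro!: derivative_eq_intros)
    qed
    then have "((\<lambda>s. (F (exp (\<i> * s) * z) - F z) / s) \<longlongrightarrow> \<i> * z * deriv F z) (at 0)"
      by (simp add: has_field_derivative_iff mult_ac)
    moreover have "filterlim (\<lambda>n. complex_of_real (t n)) (at 0) sequentially"
      unfolding filterlim_at using t by (auto intro!: tendsto_eq_intros t0 simp: less_imp_neq[symmetric])
    ultimately have "(\<lambda>n. (F (exp (\<i> * of_real (t n)) * z) - F z) / of_real (t n)) \<longlonglongrightarrow> \<i> * z * deriv F z"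
      by (rule filterlim_compose)
    then show "(\<lambda>n. rot_diff (t n) F z / of_real (t n)) \<longlonglongrightarrow> \<i> * z * deriv F z"
      by (simp add: rot_diff_def cis_conv_exp)
  qed simp
  also have "\<dots> \<le> liminf (\<lambda>n. ennreal \<epsilon>)"
  proof (intro Liminf_mono always_eventually allI)
    fix n
    have [measurable]: "(\<lambda>\<theta>. rot_diff (t n) F (of_real r * cis \<theta>)) \<in> borel_measurable borel"
      by (rule holomorphic_circle_measurable[OF holomorphic_rot_diff[OF F] r])
    have "mean_pow 1 r (\<lambda>z. rot_diff (t n) F z / of_real (t n)) = ennreal (1 / t n) * mean_pow 1 r (rot_diff (t n) F)"
      unfolding mean_pow_def using t[of n]
      by (subst nn_integral_cmult[symmetric]) (auto simp: ennreal_mult[symmetric] norm_divide)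
    also have "\<dots> \<le> ennreal (1 / t n) * ennreal (\<epsilon> * \<bar>t n\<bar>)"
      using t[of n] by (intro mult_left_mono rd r) auto
    also have "\<dots> = ennreal \<epsilon>" using t[of n] \<epsilon> by (simp add: ennreal_mult[symmetric])
    finally show "mean_pow 1 r (\<lambda>z. rot_diff (t n) F z / of_real (t n)) \<le> ennreal \<epsilon>" .
  qed
  also have "\<dots> = ennreal \<epsilon>" by (simp add: Liminf_const)
  finally have "mean_pow 1 r (\<lambda>z. \<i> * z * deriv F z) \<le> ennreal \<epsilon>" .
  then show "mean_pow 1 r (\<lambda>z. z * deriv F z) \<le> ennreal ((\<epsilon> * (1 - r) powr - 0 + 0) powr 1)"
    using \<epsilon> r by (simp add: mean_pow_def norm_mult)
qed

lemma mean_growth_binom_deriv_1: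
  assumes F: "F holomorphic_on unit_disc" and p: "p \<ge> 1" and B: "B \<ge> 0" and \<epsilon>: "\<epsilon> \<ge> 0" "K \<ge> 0"
    and mB: "\<And>r. 0 \<le> r \<Longrightarrow> r < 1 \<Longrightarrow> mean_pow p r F \<le> ennreal (B powr p)"
    and gr: "mean_growth p \<beta> \<epsilon> K (\<lambda>z. z * deriv F z)"
  shows "mean_growth p \<beta> (4 * \<epsilon>) (4 * (K + B)) (binom_deriv F 1)"
  unfolding mean_growth_def
proof (intro allI impI)
  fix r :: real assume "0 \<le> r \<and> r < 1"
  then have r: "0 \<le> r" "r < 1" by auto
  have [measurable]: "(\<lambda>t. F (of_real r * cis t)) \<in> borel_measurable borel"
    by (rule holomorphic_circle_measurable[OF F r])
  have [measurable]: "(\<lambda>t. (of_real r * cis t) * deriv F (of_real r * cis t)) \<in> borel_measurable borel"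
    by (rule holomorphic_circle_measurable[OF holomorphic_z_deriv[OF F] r])
  have "mean_pow p r (binom_deriv F 1) \<le> ennreal ((4 * (B + (\<epsilon> * (1 - r) powr (-\<beta>) + K))) powr p)"
    unfolding mean_pow_def
  proof (rule nn_integral_powr_triangle[where u = "\<lambda>t. norm (F (of_real r * cis t))" and v = "\<lambda>t. norm ((of_real r * cis t) * deriv F (of_real r * cis t))"])
    show "(\<integral>\<^sup>+t. ennreal (norm (F (of_real r * cis t)) powr p) \<partial>circ) \<le> ennreal (B powr p)"
      using mB[OF r] by (simp add: mean_pow_def)
    show "(\<integral>\<^sup>+t. ennreal (norm ((of_real r * cis t) * deriv F (of_real r * cis t)) powr p) \<partial>circ) \<le> ennreal ((\<epsilon> * (1 - r) powr (-\<beta>) + K) powr p)"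
      using gr r by (simp add: mean_growth_def mean_pow_def)
    show "norm (binom_deriv F 1 (of_real r * cis t)) \<le> norm (F (of_real r * cis t)) + norm ((of_real r * cis t) * deriv F (of_real r * cis t))" for t
      using norm_triangle_ineq[of "F (of_real r * cis t)" "(of_real r * cis t) * deriv F (of_real r * cis t)"] by simp
  qed (use p B \<epsilon> in auto)
  also have "4 * (B + (\<epsilon> * (1 - r) powr (-\<beta>) + K)) = 4 * \<epsilon> * (1 - r) powr (-\<beta>) + 4 * (K + B)"
    by (simp add: algebra_simps)
  finally show "mean_pow p r (binom_deriv F 1) \<le> ennreal ((4 * \<epsilon> * (1 - r) powr (-\<beta>) + 4 * (K + B)) powr p)" .
qed

text \<open>The constant in front of \<open>\<epsilon>\<close> does not depend on \<open>\<epsilon>\<close>; this serves both the big-\<open>O\<close> and the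
  little-\<open>o\<close> case.\<close>

theorem mean_growth_of_modulus:
  assumes p: "p > 1"
  obtains C where "C > 0" "\<And>F \<epsilon> \<delta>0. F \<in> Hardy p \<Longrightarrow> (AE \<theta> in lebesgue. has_radial_limit F (cis \<theta>)) \<Longrightarrow> \<epsilon> > 0 \<Longrightarrow> \<delta>0 > 0 \<Longrightarrow>
    (\<And>\<delta>. 0 < \<delta> \<Longrightarrow> \<delta> < \<delta>0 \<Longrightarrow> mean_modulus p \<delta> F \<le> \<epsilon> * \<delta> powr (1/p)) \<Longrightarrow>
    \<exists>K\<ge>0. mean_growth p (1 - 1/p) (C * \<epsilon>) K (binom_deriv F 1)"
proof -
  have p1: "p \<ge> 1" using p by simp
  have a0: "1/p > 0" "1/p < 1" using p by simp_all
  then have kc: "kernel_const (1/p) 2 > 0" by (intro kernel_const_pos) linarith+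
  show ?thesis
  proof (rule that[of "4 * (2 * kernel_const (1/p) 2)"])
    show "4 * (2 * kernel_const (1/p) 2) > 0" using kc by simp
    fix F \<epsilon> \<delta>0
    assume F: "F \<in> Hardy p" and lim: "AE \<theta> in lebesgue. has_radial_limit F (cis \<theta>)" and \<epsilon>: "\<epsilon> > 0" "\<delta>0 > 0"
      and m: "\<And>\<delta>. 0 < \<delta> \<Longrightarrow> \<delta> < \<delta>0 \<Longrightarrow> mean_modulus p \<delta> F \<le> \<epsilon> * \<delta> powr (1/p)"
    have h: "F holomorphic_on unit_disc" using F by (simp add: Hardy_def)
    obtain B where B: "B \<ge> 0" "\<And>r. 0 \<le> r \<Longrightarrow> r < 1 \<Longrightarrow> mean_pow p r F \<le> ennreal (B powr p)"
      using Hardy_mean_pow[OF F p1] by blast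
    obtain K where K: "K \<ge> 0" "\<And>t r. 0 \<le> r \<Longrightarrow> r < 1 \<Longrightarrow> mean_pow p r (rot_diff t F) \<le> ennreal ((\<epsilon> * \<bar>t\<bar> powr (1/p) + K * t\<^sup>2) powr p)"
    proof (rule rot_diff_bound_of_modulus[OF F lim p1 \<epsilon>])
      fix \<delta> assume "0 < \<delta>" "\<delta> < \<delta>0"
      then show "mean_modulus p \<delta> F \<le> \<epsilon> * \<delta> powr (1/p)" by (rule m)
    next
      fix K assume "0 \<le> K" "\<And>t r. 0 \<le> r \<Longrightarrow> r < 1 \<Longrightarrow> mean_pow p r (rot_diff t F) \<le> ennreal ((\<epsilon> * \<bar>t\<bar> powr (1/p) + K * t\<^sup>2) powr p)"
      then show thesis by (rule that)
    qed
    have "mean_growth p (1 - 1/p) (4 * (2 * kernel_const (1/p) 2 * \<epsilon>)) (4 * (25 * K + B)) (binom_deriv F 1)"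
      by (rule mean_growth_binom_deriv_1[OF h p1 B(1) _ _ B(2) mean_growth_z_deriv[OF p h \<epsilon>(1) K]]) (use kc \<epsilon> K in auto)
    then show "\<exists>K\<ge>0. mean_growth p (1 - 1/p) (4 * (2 * kernel_const (1/p) 2) * \<epsilon>) K (binom_deriv F 1)"
      using B(1) K(1) by (intro exI[of _ "4 * (25 * K + B)"]) (simp add: mult.assoc del: binom_deriv.simps)
  qed
qed

theorem mean_growth_of_modulus_1:
  assumes F: "F \<in> Hardy 1" and lim: "AE \<theta> in lebesgue. has_radial_limit F (cis \<theta>)" and \<epsilon>: "\<epsilon> > 0" "\<delta>0 > 0"
    and m: "\<And>\<delta>. 0 < \<delta> \<Longrightarrow> \<delta> < \<delta>0 \<Longrightarrow> mean_modulus 1 \<delta> F \<le> \<epsilon> * \<delta> powr (1/1)"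
  shows "\<exists>K\<ge>0. mean_growth 1 0 (4 * \<epsilon>) K (binom_deriv F 1)"
proof -
  have h: "F holomorphic_on unit_disc" using F by (simp add: Hardy_def)
  obtain B where B: "B \<ge> 0" "\<And>r. 0 \<le> r \<Longrightarrow> r < 1 \<Longrightarrow> mean_pow 1 r F \<le> ennreal (B powr 1)"
    using Hardy_mean_pow[OF F] by auto
  have one: "(1::real) \<ge> 1" by simp
  obtain K :: real where K: "K \<ge> 0" "\<And>t r. 0 \<le> r \<Longrightarrow> r < 1 \<Longrightarrow> \<bar>t\<bar> < \<delta>0 \<Longrightarrow> mean_pow 1 r (rot_diff t F) \<le> ennreal ((\<epsilon> * \<bar>t\<bar> powr (1/1)) powr 1)"
  proof (rule rot_diff_bound_of_modulus[OF F lim one \<epsilon>])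
    fix \<delta> assume "0 < \<delta>" "\<delta> < \<delta>0"
    then show "mean_modulus 1 \<delta> F \<le> \<epsilon> * \<delta> powr (1/1)" by (rule m)
  next
    fix K :: real assume "0 \<le> K" "\<And>t r. 0 \<le> r \<Longrightarrow> r < 1 \<Longrightarrow> \<bar>t\<bar> < \<delta>0 \<Longrightarrow> mean_pow 1 r (rot_diff t F) \<le> ennreal ((\<epsilon> * \<bar>t\<bar> powr (1/1)) powr 1)"
    then show thesis by (rule that)
  qed
  have "mean_growth 1 0 \<epsilon> 0 (\<lambda>z. z * deriv F z)"
    by (rule mean_growth_z_deriv_1[OF h \<epsilon>]) (use K(2) \<epsilon> in simp)
  from mean_growth_binom_deriv_1[OF h _ B(1) _ _ B(2) this] \<epsilon> B(1) show ?thesis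
    by (intro exI[of _ "4 * (0 + B)"]) (simp del: binom_deriv.simps)
qed

section \<open>From the growth of the derivative to moduli of continuity\<close>

lemma mean_growthD:
  "mean_growth p \<beta> \<epsilon> K f \<Longrightarrow> 0 \<le> r \<Longrightarrow> r < 1 \<Longrightarrow> mean_pow p r f \<le> ennreal ((\<epsilon> * (1 - r) powr (-\<beta>) + K) powr p)"
  by (simp add: mean_growth_def)

lemma disc_restrict_radial_measurable:
  assumes "f holomorphic_on unit_disc"
  shows "(\<lambda>(\<theta>, s). disc_restrict f (of_real s * cis \<theta>)) \<in> borel_measurable (borel \<Otimes>\<^sub>M borel)"
  using disc_restrict_measurable[OF assms] by measurable

text \<open>Minkowski's inequality over the radius. S and c vary between the uses: the whole radius
  for the boundedness of the means, the end piece for the distance to the boundary function, an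
  initial piece for lowering the order of \<open>binom_deriv\<close>.\<close>

lemma nn_integral_radial_le:
  assumes f: "f holomorphic_on unit_disc" and gr: "mean_growth p \<beta> \<epsilon> K f" and p: "p \<ge> 1"
    and \<epsilon>: "\<epsilon> > 0" "K \<ge> 0" and c: "c \<ge> 0" and S: "S \<in> sets borel" "S \<subseteq> {0..<1}"
    and I: "(\<integral>\<^sup>+s. ennreal (c * (\<epsilon> * (1 - s) powr (-\<beta>) + K)) * indicator S s \<partial>lborel) \<le> ennreal I" "I \<ge> 0"
    and h: "\<And>\<theta>. h \<theta> \<ge> 0"
    and hle: "AE \<theta> in circ. ennreal (h \<theta>) \<le> (\<integral>\<^sup>+s. ennreal (c * norm (f (of_real s * cis \<theta>))) * indicator S s \<partial>lborel)"
  shows "(\<integral>\<^sup>+\<theta>. ennreal (h \<theta> powr p) \<partial>circ) \<le> ennreal (I powr p)"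
proof -
  note [measurable] = disc_restrict_radial_measurable[OF f] S(1)
  have eq: "c * norm (disc_restrict f (of_real s * cis \<theta>)) * indicator S s = c * norm (f (of_real s * cis \<theta>)) * indicator S s" for s \<theta>
    using S(2) by (cases "s \<in> S") (auto simp: disc_restrict_eq norm_mult subset_iff)
  show ?thesis
  proof (rule Minkowski_integral_inequality[where N = lborel and \<phi> = "\<lambda>\<theta> s. c * norm (disc_restrict f (of_real s * cis \<theta>)) * indicator S s"
        and m = "\<lambda>s. c * (\<epsilon> * (1 - s) powr (-\<beta>) + K) * indicator S s"])
    show "sigma_finite_measure circ" by (rule sigma_finite_circ)
    show "sigma_finite_measure (lborel :: real measure)" by (rule sigma_finite_lborel)
    show "(\<lambda>(\<theta>, s). c * norm (disc_restrict f (of_real s * cis \<theta>)) * indicator S s) \<in> borel_measurable (circ \<Otimes>\<^sub>M lborel)"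
      by measurable
    show "(\<lambda>s. c * (\<epsilon> * (1 - s) powr (-\<beta>) + K) * indicator S s) \<in> borel_measurable lborel" by measurable
    show "c * norm (disc_restrict f (of_real s * cis \<theta>)) * indicator S s = 0" if "c * (\<epsilon> * (1 - s) powr (-\<beta>) + K) * indicator S s = 0" for \<theta> s
    proof (cases "s \<in> S")
      case True
      then have "s < 1" using S by auto
      then have "\<epsilon> * (1 - s) powr (-\<beta>) + K > 0" using \<epsilon> by (intro add_pos_nonneg mult_pos_pos) auto
      then show ?thesis using that True by auto
    qed simp
    show "(\<integral>\<^sup>+s. ennreal (c * (\<epsilon> * (1 - s) powr (-\<beta>) + K) * indicator S s) \<partial>lborel) \<le> ennreal I"
    proof -
      have "(\<integral>\<^sup>+s. ennreal (c * (\<epsilon> * (1 - s) powr (-\<beta>) + K) * indicator S s) \<partial>lborel) = (\<integral>\<^sup>+s. ennreal (c * (\<epsilon> * (1 - s) powr (-\<beta>) + K)) * indicator S s \<partial>lborel)"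
        by (intro nn_integral_cong) (auto simp: indicator_def)
      then show ?thesis using I by simp
    qed
    show "(\<integral>\<^sup>+\<theta>. ennreal ((c * norm (disc_restrict f (of_real s * cis \<theta>)) * indicator S s) powr p) \<partial>circ)
        \<le> ennreal ((c * (\<epsilon> * (1 - s) powr (-\<beta>) + K) * indicator S s) powr p)" for s
    proof (cases "s \<in> S")
      case True
      then have s: "0 \<le> s" "s < 1" using S by auto
      have [measurable]: "(\<lambda>\<theta>. f (of_real s * cis \<theta>)) \<in> borel_measurable borel" by (rule holomorphic_circle_measurable[OF f s])
      have "(\<integral>\<^sup>+\<theta>. ennreal ((c * norm (disc_restrict f (of_real s * cis \<theta>)) * indicator S s) powr p) \<partial>circ)
          = (\<integral>\<^sup>+\<theta>. ennreal (c powr p) * ennreal (norm (f (of_real s * cis \<theta>)) powr p) \<partial>circ)"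
        unfolding eq using True c by (intro nn_integral_cong) (simp add: powr_mult ennreal_mult)
      also have "\<dots> = ennreal (c powr p) * mean_pow p s f"
        unfolding mean_pow_def by (rule nn_integral_cmult) measurable
      also have "\<dots> \<le> ennreal (c powr p) * ennreal ((\<epsilon> * (1 - s) powr (-\<beta>) + K) powr p)"
        by (intro mult_left_mono mean_growthD[OF gr s]) auto
      also have "\<dots> = ennreal ((c * (\<epsilon> * (1 - s) powr (-\<beta>) + K) * indicator S s) powr p)"
        using True c \<epsilon> by (simp add: ennreal_mult[symmetric] powr_mult)
      finally show ?thesis .
    qed simp
    show "AE \<theta> in circ. ennreal (h \<theta>) \<le> (\<integral>\<^sup>+s. ennreal (c * norm (disc_restrict f (of_real s * cis \<theta>)) * indicator S s) \<partial>lborel)"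
      using hle
    proof eventually_elim
      case (elim \<theta>)
      also have "(\<integral>\<^sup>+s. ennreal (c * norm (f (of_real s * cis \<theta>))) * indicator S s \<partial>lborel) = (\<integral>\<^sup>+s. ennreal (c * norm (disc_restrict f (of_real s * cis \<theta>)) * indicator S s) \<partial>lborel)"
        unfolding eq by (intro nn_integral_cong) (auto simp: indicator_def)
      finally show ?case .
    qed
  qed (use p I h c \<epsilon> in auto)
qed

lemma nn_integral_growth_tail:
  assumes \<beta>: "\<beta> < 1" and \<epsilon>: "\<epsilon> \<ge> 0" "K \<ge> 0" and y: "y \<le> 1"
  shows "(\<integral>\<^sup>+s. ennreal (\<epsilon> * (1 - s) powr (-\<beta>) + K) * indicator {y..<1} s \<partial>lborel) = ennreal (\<epsilon> * ((1 - y) powr (1 - \<beta>) / (1 - \<beta>)) + K * (1 - y))"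
proof -
  have "(\<integral>\<^sup>+s. ennreal (\<epsilon> * (1 - s) powr (-\<beta>) + K) * indicator {y..<1} s \<partial>lborel)
      = (\<integral>\<^sup>+s. ennreal \<epsilon> * (ennreal ((1 - s) powr (-\<beta>)) * indicator {y..<1} s) + ennreal K * indicator {y..<1} s \<partial>lborel)"
    using \<epsilon> by (intro nn_integral_cong) (auto simp: indicator_def ennreal_mult)
  also have "\<dots> = ennreal \<epsilon> * ennreal ((1 - y) powr (-\<beta>+1) / (-\<beta>+1)) + ennreal K * ennreal (1 - y)"
    using nn_integral_powr_upto_1[of "-\<beta>" y] \<beta> y by (simp add: nn_integral_add nn_integral_cmult)
  also have "\<dots> = ennreal (\<epsilon> * ((1 - y) powr (1 - \<beta>) / (1 - \<beta>)) + K * (1 - y))"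
    using \<epsilon> \<beta> y by (simp add: ennreal_mult[symmetric] ennreal_plus[symmetric] add.commute del: ennreal_plus)
  finally show ?thesis .
qed

lemma mean_pow_const: "mean_pow p r (\<lambda>_. c) = ennreal (norm c powr p)"
  by (simp add: mean_pow_def)

lemma mean_pow_of_deriv_growth:
  assumes F: "F holomorphic_on unit_disc" and p: "p \<ge> 1" and \<beta>: "\<beta> < 1" and \<epsilon>: "\<epsilon> > 0" "K \<ge> 0"
    and gr: "mean_growth p \<beta> \<epsilon> K (deriv F)" and r: "0 \<le> r" "r < 1"
  shows "mean_pow p r F \<le> ennreal ((4 * ((\<epsilon> / (1 - \<beta>) + K) + norm (F 0))) powr p)"
proof -
  have dF: "deriv F holomorphic_on unit_disc" by (rule holomorphic_deriv[OF F]) simp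
  have [measurable]: "(\<lambda>t. F (of_real r * cis t)) \<in> borel_measurable borel" by (rule holomorphic_circle_measurable[OF F r])
  have d: "(\<integral>\<^sup>+\<theta>. ennreal (norm (F (of_real r * cis \<theta>) - F 0) powr p) \<partial>circ) \<le> ennreal ((\<epsilon> / (1 - \<beta>) + K) powr p)"
  proof (rule nn_integral_radial_le[OF dF gr p \<epsilon>, where c = 1 and S = "{0..<1}"])
    show "(\<integral>\<^sup>+s. ennreal (1 * (\<epsilon> * (1 - s) powr (-\<beta>) + K)) * indicator {0..<1} s \<partial>lborel) \<le> ennreal (\<epsilon> / (1 - \<beta>) + K)"
      using nn_integral_growth_tail[OF \<beta> less_imp_le[OF \<epsilon>(1)] \<epsilon>(2), of 0] by simp
    show "AE \<theta> in circ. ennreal (norm (F (of_real r * cis \<theta>) - F 0)) \<le> (\<integral>\<^sup>+s. ennreal (1 * norm (deriv F (of_real s * cis \<theta>))) * indicator {0..<1} s \<partial>lborel)"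
    proof (rule AE_I2)
      fix \<theta>
      have "ennreal (norm (F (of_real r * cis \<theta>) - F (of_real 0 * cis \<theta>))) \<le> (\<integral>\<^sup>+s. ennreal (norm (deriv F (of_real s * cis \<theta>)) * indicator {0..r} s) \<partial>lborel)"
        by (rule norm_radial_diff_le[OF F _ r]) simp
      also have "\<dots> \<le> (\<integral>\<^sup>+s. ennreal (1 * norm (deriv F (of_real s * cis \<theta>))) * indicator {0..<1} s \<partial>lborel)"
        using r by (intro nn_integral_mono) (auto simp: indicator_def)
      finally show "ennreal (norm (F (of_real r * cis \<theta>) - F 0)) \<le> (\<integral>\<^sup>+s. ennreal (1 * norm (deriv F (of_real s * cis \<theta>))) * indicator {0..<1} s \<partial>lborel)" by simp
    qed
  qed (use \<epsilon> \<beta> in auto)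
  show ?thesis unfolding mean_pow_def
  proof (rule nn_integral_powr_triangle[where u = "\<lambda>t. norm (F (of_real r * cis t) - F 0)" and v = "\<lambda>t. norm (F 0)"])
    show "norm (F (of_real r * cis t)) \<le> norm (F (of_real r * cis t) - F 0) + norm (F 0)" for t
      using norm_triangle_ineq[of "F (of_real r * cis t) - F 0" "F 0"] by simp
  qed (use p \<epsilon> \<beta> d in auto)
qed

lemma Hardy_of_mean_pow:
  assumes F: "F holomorphic_on unit_disc" and p: "p \<ge> 1" and B: "B \<ge> 0"
    and le: "\<And>r. 0 \<le> r \<Longrightarrow> r < 1 \<Longrightarrow> mean_pow p r F \<le> ennreal (B powr p)"
  shows "F \<in> Hardy p"
proof -
  have "integral_mean p r F \<le> B" if "r \<in> {0<..<1}" for r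
    using that le[of r] p B integral_mean_le_iff[OF F, of r p B] by auto
  then have "bdd_above ((\<lambda>r. integral_mean p r F) ` {0<..<1})" by (rule bdd_aboveI2)
  then show ?thesis using F by (simp add: Hardy_def)
qed

text \<open>The image of the radius has finite length, so F along it is an integral of an integrable
  function, and dominated convergence gives the limit.\<close>

lemma has_radial_limit_of_finite_length:
  assumes F: "F holomorphic_on unit_disc"
    and fin: "(\<integral>\<^sup>+s. ennreal (norm (deriv F (of_real s * cis \<theta>))) * indicator {0..<1} s \<partial>lborel) < \<infinity>"
  shows "has_radial_limit F (cis \<theta>)"
proof -
  \<comment> \<open>Extended by 0 beyond the radius, so that one integrable function serves all
    r.\<close>
  define \<phi>' where "\<phi>' = (\<lambda>s. indicator {0..<1} s *\<^sub>R (cis \<theta> * disc_restrict (deriv F) (of_real s * cis \<theta>)))"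
  have dF: "deriv F holomorphic_on unit_disc" by (rule holomorphic_deriv[OF F]) simp
  note [measurable] = disc_restrict_measurable[OF dF]
  have [measurable]: "\<phi>' \<in> borel_measurable borel" unfolding \<phi>'_def by measurable
  have int: "integrable lborel \<phi>'"
  proof (rule integrableI_bounded)
    have "(\<integral>\<^sup>+s. ennreal (norm (\<phi>' s)) \<partial>lborel) = (\<integral>\<^sup>+s. ennreal (norm (deriv F (of_real s * cis \<theta>))) * indicator {0..<1} s \<partial>lborel)"
      by (intro nn_integral_cong) (auto simp: \<phi>'_def indicator_def norm_mult disc_restrict_eq)
    then show "(\<integral>\<^sup>+s. ennreal (norm (\<phi>' s)) \<partial>lborel) < \<infinity>" using fin by simp
  qed measurable
  have rep: "F (of_real r * cis \<theta>) = F 0 + (LINT s|lborel. indicator {0..r} s *\<^sub>R \<phi>' s)" if r: "0 \<le> r" "r < 1" for r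
  proof -
    have "continuous_on unit_disc (deriv F)" using dF by (rule holomorphic_on_imp_continuous_on)
    then have "continuous_on {0..r} (\<lambda>s. deriv F (of_real s * cis \<theta>))"
      by (rule continuous_on_compose2) (use r in \<open>auto intro!: continuous_intros simp: norm_mult\<close>)
    then have "continuous_on {0..r} (\<lambda>s. cis \<theta> * deriv F (of_real s * cis \<theta>))" by (intro continuous_intros)
    then have "(LINT s|lborel. indicator {0..r} s *\<^sub>R (cis \<theta> * deriv F (of_real s * cis \<theta>))) = F (of_real r * cis \<theta>) - F (of_real 0 * cis \<theta>)"
      using r by (intro integral_FTC_Icc[where F = "\<lambda>s. F (of_real s * cis \<theta>)"] radial_has_vector_derivative[OF F]) auto
    moreover have "(LINT s|lborel. indicator {0..r} s *\<^sub>R (cis \<theta> * deriv F (of_real s * cis \<theta>))) = (LINT s|lborel. indicator {0..r} s *\<^sub>R \<phi>' s)"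
      using r by (intro Bochner_Integration.integral_cong) (auto simp: \<phi>'_def indicator_def disc_restrict_eq norm_mult)
    ultimately show ?thesis by simp
  qed
  have "((\<lambda>r. F (of_real r * cis \<theta>)) \<longlongrightarrow> F 0 + (LINT s|lborel. \<phi>' s)) (at_left 1)"
  proof (rule tendsto_at_left_sequentially[of 0])
    fix S :: "nat \<Rightarrow> real" assume S: "\<And>n. S n < 1" "\<And>n. 0 < S n" "incseq S" "S \<longlonglongrightarrow> 1"
    have "(\<lambda>n. LINT s|lborel. indicator {0..S n} s *\<^sub>R \<phi>' s) \<longlonglongrightarrow> (LINT s|lborel. \<phi>' s)"
    proof (rule integral_dominated_convergence[where w = "\<lambda>s. norm (\<phi>' s)"])
      show "AE s in lborel. (\<lambda>n. indicator {0..S n} s *\<^sub>R \<phi>' s) \<longlonglongrightarrow> \<phi>' s"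
      proof (rule AE_I2)
        fix s
        show "(\<lambda>n. indicator {0..S n} s *\<^sub>R \<phi>' s) \<longlonglongrightarrow> \<phi>' s"
        proof (cases "s \<in> {0..<1}")
          case True
          then have "eventually (\<lambda>n. s < S n) sequentially" using S(4) by (intro order_tendstoD(1)) auto
          then have "eventually (\<lambda>n. indicator {0..S n} s *\<^sub>R \<phi>' s = \<phi>' s) sequentially"
            by eventually_elim (use True in auto)
          then show ?thesis by (rule tendsto_eventually)
        qed (simp add: \<phi>'_def)
      qed
    qed (use int in \<open>auto simp: indicator_def\<close>)
    then have "(\<lambda>n. F 0 + (LINT s|lborel. indicator {0..S n} s *\<^sub>R \<phi>' s)) \<longlonglongrightarrow> F 0 + (LINT s|lborel. \<phi>' s)"
      by (intro tendsto_intros)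
    then show "(\<lambda>n. F (of_real (S n) * cis \<theta>)) \<longlonglongrightarrow> F 0 + (LINT s|lborel. \<phi>' s)"
      using rep[of "S _"] S(1,2) by (simp add: less_imp_le)
  qed simp
  then show ?thesis unfolding has_radial_limit_def by blast
qed

text \<open>Since \<beta> < 1, the lengths of the images of radii have finite average over the
  circle; hence almost every radius has an image of finite length.\<close>

lemma AE_has_radial_limit:
  assumes F: "F holomorphic_on unit_disc" and p: "p \<ge> 1" and \<beta>: "\<beta> < 1" and \<epsilon>: "\<epsilon> > 0" "K \<ge> 0"
    and gr: "mean_growth p \<beta> \<epsilon> K (deriv F)"
  shows "AE \<theta> in lebesgue. has_radial_limit F (cis \<theta>)"
proof -
  interpret C: sigma_finite_measure circ by (rule sigma_finite_circ)
  interpret pair_sigma_finite circ lborel ..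
  have dF: "deriv F holomorphic_on unit_disc" by (rule holomorphic_deriv[OF F]) simp
  note [measurable] = disc_restrict_measurable[OF dF]
  define m where "m = (\<lambda>s. \<epsilon> * (1 - s) powr (-\<beta>) + K)"
  let ?L = "\<lambda>\<theta>. \<integral>\<^sup>+s. ennreal (norm (disc_restrict (deriv F) (of_real s * cis \<theta>))) * indicator {0..<1} s \<partial>lborel"
  have "(\<integral>\<^sup>+\<theta>. ?L \<theta> \<partial>circ) = (\<integral>\<^sup>+s. \<integral>\<^sup>+\<theta>. ennreal (norm (disc_restrict (deriv F) (of_real s * cis \<theta>))) * indicator {0..<1} s \<partial>circ \<partial>lborel)"
    by (rule Fubini'[symmetric]) measurable
  also have "\<dots> \<le> (\<integral>\<^sup>+s. ennreal 2 * (ennreal (m s) * indicator {0..<1} s) \<partial>lborel)"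
  proof (rule nn_integral_mono)
    fix s
    show "(\<integral>\<^sup>+\<theta>. ennreal (norm (disc_restrict (deriv F) (of_real s * cis \<theta>))) * indicator {0..<1} s \<partial>circ) \<le> ennreal 2 * (ennreal (m s) * indicator {0..<1} s)"
    proof (cases "s \<in> {0..<1}")
      case True
      then have s: "0 \<le> s" "s < 1" by auto
      have [measurable]: "(\<lambda>\<theta>. deriv F (of_real s * cis \<theta>)) \<in> borel_measurable borel" by (rule holomorphic_circle_measurable[OF dF s])
      have m: "m s > 0" unfolding m_def using \<epsilon> s by (intro add_pos_nonneg mult_pos_pos) auto
      \<comment> \<open>If x > m s, then x = x^(1 - p) * x^p is at most (m s)^(1 - p) * x^p. As m s
        bounds the p-mean, each summand has average at most m s, whence the factor 2.\<close>
      have le: "x \<le> m s + m s powr (1 - p) * x powr p" if x: "x \<ge> 0" for x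
      proof (cases "x \<le> m s")
        case True
        then show ?thesis by (simp add: add_increasing2)
      next
        case False
        have "m s powr (p - 1) \<le> x powr (p - 1)" using False m p by (intro powr_mono2) auto
        then have "m s powr (1 - p) * m s powr (p - 1) * x \<le> m s powr (1 - p) * x powr (p - 1) * x"
          using x by (intro mult_right_mono mult_left_mono) auto
        moreover have "m s powr (1 - p) * m s powr (p - 1) = 1" using m by (simp add: powr_add[symmetric])
        moreover have "x powr (p - 1) * x = x powr p" using False m x by (simp add: powr_diff)
        ultimately show ?thesis using m by (simp add: mult.assoc)
      qed
      have "(\<integral>\<^sup>+\<theta>. ennreal (norm (disc_restrict (deriv F) (of_real s * cis \<theta>))) * indicator {0..<1} s \<partial>circ)
          \<le> (\<integral>\<^sup>+\<theta>. ennreal (m s) + ennreal (m s powr (1 - p)) * ennreal (norm (deriv F (of_real s * cis \<theta>)) powr p) \<partial>circ)"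
      proof (rule nn_integral_mono)
        fix \<theta>
        have "ennreal (norm (deriv F (of_real s * cis \<theta>))) \<le> ennreal (m s + m s powr (1 - p) * norm (deriv F (of_real s * cis \<theta>)) powr p)"
          by (intro ennreal_leI le) simp
        also have "\<dots> = ennreal (m s) + ennreal (m s powr (1 - p)) * ennreal (norm (deriv F (of_real s * cis \<theta>)) powr p)"
          using m by (simp add: ennreal_mult)
        finally show "ennreal (norm (disc_restrict (deriv F) (of_real s * cis \<theta>))) * indicator {0..<1} s
          \<le> ennreal (m s) + ennreal (m s powr (1 - p)) * ennreal (norm (deriv F (of_real s * cis \<theta>)) powr p)"
          using s by (simp add: disc_restrict_eq norm_mult)
      qed
      also have "\<dots> = ennreal (m s) + ennreal (m s powr (1 - p)) * mean_pow p s (deriv F)"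
        unfolding mean_pow_def by (subst nn_integral_add) (auto simp: nn_integral_cmult)
      also have "\<dots> \<le> ennreal (m s) + ennreal (m s powr (1 - p)) * ennreal (m s powr p)"
        unfolding m_def by (intro add_left_mono mult_left_mono mean_growthD[OF gr s]) auto
      also have "ennreal (m s powr (1 - p)) * ennreal (m s powr p) = ennreal (m s)"
        using m by (simp add: ennreal_mult[symmetric] powr_add[symmetric])
      also have "ennreal (m s) + ennreal (m s) = ennreal 2 * ennreal (m s)"
        by (simp add: mult_2)
      finally show ?thesis using True by simp
    qed simp
  qed
  also have "\<dots> = ennreal 2 * (\<integral>\<^sup>+s. ennreal (m s) * indicator {0..<1} s \<partial>lborel)"
    unfolding m_def by (rule nn_integral_cmult) measurable
  also have "\<dots> < \<infinity>"
    unfolding m_def using nn_integral_growth_tail[OF \<beta> less_imp_le[OF \<epsilon>(1)] \<epsilon>(2), of 0] by (simp add: ennreal_mult_less_top)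
  finally have "(\<integral>\<^sup>+\<theta>. ?L \<theta> \<partial>circ) \<noteq> \<infinity>" by simp
  then have "AE \<theta> in circ. ?L \<theta> \<noteq> \<infinity>"
    by (intro nn_integral_noteq_infinite) measurable
  then have "AE \<theta> in circ. has_radial_limit F (cis \<theta>)"
  proof eventually_elim
    case (elim \<theta>)
    have "?L \<theta> = (\<integral>\<^sup>+s. ennreal (norm (deriv F (of_real s * cis \<theta>))) * indicator {0..<1} s \<partial>lborel)"
      by (intro nn_integral_cong) (auto simp: indicator_def disc_restrict_eq norm_mult)
    then show ?case using elim by (intro has_radial_limit_of_finite_length[OF F]) (simp add: less_top)
  qed
  then have "AE \<theta> in lborel. has_radial_limit F (cis \<theta>)"
    by (rule AE_lborel_of_circ) (simp add: cis_mult[symmetric])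
  then show ?thesis by (simp add: AE_completion_iff)
qed

text \<open>The path of Hardy and Littlewood: from one boundary point radially inwards to radius 1 -
  \<delta>, along the arc, and radially outwards to the other. Each piece has p-norm at most
  J.\<close>

lemma modulus_int_of_deriv_growth:
  assumes F: "F holomorphic_on unit_disc" and p: "p \<ge> 1" and \<beta>: "0 \<le> \<beta>" "\<beta> < 1" and \<epsilon>: "\<epsilon> > 0" "K \<ge> 0"
    and gr: "mean_growth p \<beta> \<epsilon> K (deriv F)" and lim: "AE \<theta> in lebesgue. has_radial_limit F (cis \<theta>)"
    and t: "0 < t" "t \<le> \<delta>" "\<delta> \<le> 1"
  shows "modulus_int p t F \<le> ennreal ((48 * (\<epsilon> * \<delta> powr (1 - \<beta>) / (1 - \<beta>) + K * \<delta>)) powr p)"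
proof -
  \<comment> \<open>Depth \<delta> balances the pieces: the radial tails and the arc both scale like
    \<delta>^(1 - \<beta>).\<close>
  define r where "r = 1 - \<delta>"
  have r: "0 \<le> r" "r < 1" using t by (auto simp: r_def)
  have \<delta>: "\<delta> > 0" using t by simp
  have dF: "deriv F holomorphic_on unit_disc" by (rule holomorphic_deriv[OF F]) simp
  define J where "J = \<epsilon> * \<delta> powr (1 - \<beta>) / (1 - \<beta>) + K * \<delta>"
  have J: "J \<ge> 0" using \<epsilon> \<beta> \<delta> by (simp add: J_def)
  note [measurable] = bdry_measurable[OF F]
  have [measurable]: "(\<lambda>t. F (of_real r * cis t)) \<in> borel_measurable borel" by (rule holomorphic_circle_measurable[OF F r])
  have [measurable]: "(\<lambda>\<theta>. F (of_real r * cis (\<theta> + t))) \<in> borel_measurable borel"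
    using measurable_compose[of "\<lambda>\<theta>. \<theta> + t" borel borel "\<lambda>t. F (of_real r * cis t)"] by measurable
  have ae: "AE \<theta> in circ. has_radial_limit F (cis \<theta>)" using lim by (intro AE_circI) (simp add: AE_completion_iff)
  have u1: "(\<integral>\<^sup>+\<theta>. ennreal (norm (bdry F \<theta> - F (of_real r * cis \<theta>)) powr p) \<partial>circ) \<le> ennreal (J powr p)"
  proof (rule nn_integral_radial_le[OF dF gr p \<epsilon>, where c = 1 and S = "{r..<1}"])
    show "(\<integral>\<^sup>+s. ennreal (1 * (\<epsilon> * (1 - s) powr (-\<beta>) + K)) * indicator {r..<1} s \<partial>lborel) \<le> ennreal J"
      using nn_integral_growth_tail[OF \<beta>(2) less_imp_le[OF \<epsilon>(1)] \<epsilon>(2), of r] \<delta> by (simp add: J_def r_def)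
    show "AE \<theta> in circ. ennreal (norm (bdry F \<theta> - F (of_real r * cis \<theta>)))
        \<le> (\<integral>\<^sup>+s. ennreal (1 * norm (deriv F (of_real s * cis \<theta>))) * indicator {r..<1} s \<partial>lborel)"
      using ae
    proof eventually_elim
      case (elim \<theta>)
      have "((\<lambda>x. ennreal (norm (F (of_real x * cis \<theta>) - F (of_real r * cis \<theta>)))) \<longlongrightarrow> ennreal (norm (bdry F \<theta> - F (of_real r * cis \<theta>)))) (at_left 1)"
        by (intro tendsto_ennrealI tendsto_norm tendsto_diff tendsto_const has_radial_limit_bdry(1)[OF elim])
      then show ?case
      proof (rule tendsto_upperbound)
        have "eventually (\<lambda>x::real. r < x \<and> x < 1) (at_left 1)"
          using eventually_at_left_real[OF r(2)] by eventually_elim auto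
        then show "eventually (\<lambda>x. ennreal (norm (F (of_real x * cis \<theta>) - F (of_real r * cis \<theta>)))
            \<le> (\<integral>\<^sup>+s. ennreal (1 * norm (deriv F (of_real s * cis \<theta>))) * indicator {r..<1} s \<partial>lborel)) (at_left 1)"
        proof eventually_elim
          case (elim x)
          have "ennreal (norm (F (of_real x * cis \<theta>) - F (of_real r * cis \<theta>))) \<le> (\<integral>\<^sup>+s. ennreal (norm (deriv F (of_real s * cis \<theta>)) * indicator {r..x} s) \<partial>lborel)"
            using elim by (intro norm_radial_diff_le[OF F r(1)]) auto
          also have "\<dots> \<le> (\<integral>\<^sup>+s. ennreal (1 * norm (deriv F (of_real s * cis \<theta>))) * indicator {r..<1} s \<partial>lborel)"
            using elim by (intro nn_integral_mono) (auto simp: indicator_def)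
          finally show ?case .
        qed
      qed simp
    qed
  qed (use \<epsilon> J r in auto)
  have u2: "(\<integral>\<^sup>+\<theta>. ennreal (norm (bdry F (\<theta> + t) - F (of_real r * cis (\<theta> + t))) powr p) \<partial>circ) \<le> ennreal (J powr p)"
  proof -
    have "(\<integral>\<^sup>+\<theta>. ennreal (norm (bdry F (t + \<theta>) - F (of_real r * cis (t + \<theta>))) powr p) \<partial>circ)
        = (\<integral>\<^sup>+\<theta>. ennreal (norm (bdry F \<theta> - F (of_real r * cis \<theta>)) powr p) \<partial>circ)"
      by (rule nn_integral_circ_shift) (auto simp: bdry_periodic cis_mult[symmetric])
    then show ?thesis using u1 by (simp add: add.commute)
  qed
  have u3: "(\<integral>\<^sup>+\<theta>. ennreal (norm (F (of_real r * cis (\<theta> + t)) - F (of_real r * cis \<theta>)) powr p) \<partial>circ) \<le> ennreal (J powr p)"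
  proof -
    \<comment> \<open>The growth bound on the circle of radius 1 - \<delta>; multiplied by the
      length t <= \<delta> of the arc it is again at most J.\<close>
    define M where "M = \<epsilon> * \<delta> powr (-\<beta>) + K"
    have M: "M > 0" unfolding M_def using \<epsilon> \<delta> by (intro add_pos_nonneg mult_pos_pos) auto
    have [measurable]: "(\<lambda>t. deriv F (of_real r * cis t)) \<in> borel_measurable borel" by (rule holomorphic_circle_measurable[OF dF r])
    have "(\<integral>\<^sup>+\<theta>. ennreal (norm (F (of_real r * cis (\<theta> + t)) - F (of_real r * cis \<theta>)) powr p) \<partial>circ) \<le> ennreal ((M * t) powr p)"
    proof (rule Minkowski_integral_inequality[where N = lborel and \<phi> = "\<lambda>\<theta> s. norm (deriv F (of_real r * cis (\<theta> + s))) * indicator {0..t} s" and m = "\<lambda>s. M * indicator {0..t} s"])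
      show "sigma_finite_measure circ" by (rule sigma_finite_circ)
      show "sigma_finite_measure (lborel :: real measure)" by (rule sigma_finite_lborel)
      show "(\<lambda>(\<theta>, s). norm (deriv F (of_real r * cis (\<theta> + s))) * indicator {0..t} s) \<in> borel_measurable (circ \<Otimes>\<^sub>M lborel)"
        using measurable_compose[of "\<lambda>(\<theta>, s). \<theta> + s" "circ \<Otimes>\<^sub>M lborel" borel "\<lambda>t. deriv F (of_real r * cis t)"] by (simp add: split_beta') measurable
      show "(\<integral>\<^sup>+s. ennreal (M * indicator {0..t} s) \<partial>lborel) \<le> ennreal (M * t)"
      proof -
        have "(\<integral>\<^sup>+s. ennreal (M * indicator {0..t} s) \<partial>lborel) = (\<integral>\<^sup>+s. ennreal M * indicator {0..t} s \<partial>lborel)"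
          by (intro nn_integral_cong) (auto simp: indicator_def)
        then show ?thesis using M t by (simp add: nn_integral_cmult ennreal_mult)
      qed
      show "(\<integral>\<^sup>+\<theta>. ennreal ((norm (deriv F (of_real r * cis (\<theta> + s))) * indicator {0..t} s) powr p) \<partial>circ) \<le> ennreal ((M * indicator {0..t} s) powr p)" for s
      proof (cases "s \<in> {0..t}")
        case True
        have "(\<integral>\<^sup>+\<theta>. ennreal (norm (deriv F (of_real r * cis (s + \<theta>))) powr p) \<partial>circ) = mean_pow p r (deriv F)"
          unfolding mean_pow_def by (rule nn_integral_circ_shift) (auto simp: cis_mult[symmetric])
        then show ?thesis using True mean_growthD[OF gr r] by (simp add: M_def r_def add.commute)
      qed simp
      show "AE \<theta> in circ. ennreal (norm (F (of_real r * cis (\<theta> + t)) - F (of_real r * cis \<theta>)))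
          \<le> (\<integral>\<^sup>+s. ennreal (norm (deriv F (of_real r * cis (\<theta> + s))) * indicator {0..t} s) \<partial>lborel)"
      proof (rule AE_I2)
        fix \<theta>
        have "ennreal (norm (F (of_real r * cis (\<theta> + t)) - F (of_real r * cis \<theta>)))
            \<le> (\<integral>\<^sup>+s. ennreal (norm (deriv F (of_real r * cis s)) * indicator {\<theta>..\<theta>+t} s) \<partial>lborel)"
          using t by (intro norm_angular_diff_le[OF F r]) auto
        also have "\<dots> = (\<integral>\<^sup>+s. ennreal (norm (deriv F (of_real r * cis (\<theta> + s))) * indicator {\<theta>..\<theta>+t} (\<theta> + s)) \<partial>lborel)"
          by (rule nn_integral_lborel_shift[symmetric]) measurable
        also have "\<dots> = (\<integral>\<^sup>+s. ennreal (norm (deriv F (of_real r * cis (\<theta> + s))) * indicator {0..t} s) \<partial>lborel)"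
          by (intro nn_integral_cong) (auto simp: indicator_def)
        finally show "ennreal (norm (F (of_real r * cis (\<theta> + t)) - F (of_real r * cis \<theta>)))
          \<le> (\<integral>\<^sup>+s. ennreal (norm (deriv F (of_real r * cis (\<theta> + s))) * indicator {0..t} s) \<partial>lborel)" .
      qed
    qed (use p M t in \<open>auto simp: indicator_def split: if_splits\<close>)
    also have "\<dots> \<le> ennreal (J powr p)"
    proof (intro ennreal_leI powr_mono2)
      have "M * t \<le> M * \<delta>" using M t by (intro mult_left_mono) auto
      also have "\<dots> = \<epsilon> * \<delta> powr (1 - \<beta>) + K * \<delta>" using \<delta> by (simp add: M_def algebra_simps powr_diff powr_minus divide_inverse)
      also have "\<dots> \<le> J"
      proof -
        have "\<epsilon> * \<delta> powr (1 - \<beta>) * (1 - \<beta>) \<le> \<epsilon> * \<delta> powr (1 - \<beta>) * 1" using \<epsilon> \<beta> by (intro mult_left_mono) auto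
        then show ?thesis using \<beta> by (simp add: J_def field_simps)
      qed
      finally show "M * t \<le> J" .
    qed (use p M t in auto)
    finally show ?thesis .
  qed
  have v: "(\<integral>\<^sup>+\<theta>. ennreal ((norm (bdry F (\<theta> + t) - F (of_real r * cis (\<theta> + t))) + norm (bdry F \<theta> - F (of_real r * cis \<theta>))) powr p) \<partial>circ) \<le> ennreal ((4 * (J + J)) powr p)"
    by (rule nn_integral_powr_triangle[OF _ _ _ _ _ p _ J J u2 u1]) auto
  \<comment> \<open>Two uses of the triangle inequality with constant 4 give 4 (4 * 2 + 1) J = 36 J;
    the 48 leaves slack.\<close>
  have "modulus_int p t F \<le> ennreal ((4 * (4 * (J + J) + J)) powr p)"
    unfolding modulus_int_def
  proof (rule nn_integral_powr_triangle[OF _ _ _ _ _ p _ _ J v u3])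
    show "norm (bdry F (\<theta> + t) - bdry F \<theta>) \<le> (norm (bdry F (\<theta> + t) - F (of_real r * cis (\<theta> + t))) + norm (bdry F \<theta> - F (of_real r * cis \<theta>)))
        + norm (F (of_real r * cis (\<theta> + t)) - F (of_real r * cis \<theta>))" for \<theta>
      by norm
  qed (use J in auto)
  also have "\<dots> \<le> ennreal ((48 * J) powr p)" using J p by (intro ennreal_leI powr_mono2) auto
  finally show ?thesis by (simp add: J_def)
qed

theorem mean_modulus_of_deriv_growth:
  assumes F: "F holomorphic_on unit_disc" and p: "p > 1" and \<epsilon>: "\<epsilon> > 0" "K \<ge> 0"
    and gr: "mean_growth p (1 - 1/p) \<epsilon> K (deriv F)"
  shows "F \<in> Hardy p" "AE \<theta> in lebesgue. has_radial_limit F (cis \<theta>)"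
    "\<And>\<delta>. 0 < \<delta> \<Longrightarrow> \<delta> \<le> 1 \<Longrightarrow> \<bar>mean_modulus p \<delta> F\<bar> \<le> 48 * (\<epsilon> * \<delta> powr (1/p) * p + K * \<delta>)"
proof -
  have p1: "p \<ge> 1" using p by simp
  have \<beta>: "0 \<le> 1 - 1/p" "1 - 1/p < 1" using p by auto
  show H: "F \<in> Hardy p"
    by (rule Hardy_of_mean_pow[OF F p1 _ mean_pow_of_deriv_growth[OF F p1 \<beta>(2) \<epsilon> gr]]) (use p \<epsilon> in auto)
  show lim: "AE \<theta> in lebesgue. has_radial_limit F (cis \<theta>)"
    by (rule AE_has_radial_limit[OF F p1 \<beta>(2) \<epsilon> gr])
  fix \<delta> :: real assume \<delta>: "0 < \<delta>" "\<delta> \<le> 1"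
  define R where "R = 48 * (\<epsilon> * \<delta> powr (1/p) * p + K * \<delta>)"
  have R: "R \<ge> 0" using \<epsilon> p \<delta> by (simp add: R_def)
  have le: "enn2real (modulus_int p t F) powr (1/p) \<le> R" if "t \<in> {t. 0 < \<bar>t\<bar> \<and> \<bar>t\<bar> \<le> \<delta>}" for t
  proof -
    have "modulus_int p \<bar>t\<bar> F \<le> ennreal (R powr p)"
      using modulus_int_of_deriv_growth[OF F p1 \<beta> \<epsilon> gr lim, of "\<bar>t\<bar>" \<delta>] that \<delta> by (simp add: R_def)
    moreover have "modulus_int p \<bar>t\<bar> F = modulus_int p t F"
      using modulus_int_minus[OF F, of p t] by (cases "t \<ge> 0") auto
    ultimately have "enn2real (modulus_int p t F) \<le> R powr p" by (intro enn2real_leI) auto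
    then have "enn2real (modulus_int p t F) powr (1/p) \<le> (R powr p) powr (1/p)" using p by (intro powr_mono2) auto
    then show ?thesis using p R by (simp add: powr_powr)
  qed
  have ne: "{t. 0 < \<bar>t\<bar> \<and> \<bar>t\<bar> \<le> \<delta>} \<noteq> {}" using \<delta> by (auto intro!: exI[of _ \<delta>])
  have "mean_modulus p \<delta> F \<le> R"
    unfolding mean_modulus_eq[OF F lim] by (rule cSUP_least[OF ne le])
  moreover have "mean_modulus p \<delta> F \<ge> 0"
  proof -
    have "bdd_above ((\<lambda>t. enn2real (modulus_int p t F) powr (1/p)) ` {t. 0 < \<bar>t\<bar> \<and> \<bar>t\<bar> \<le> \<delta>})"
      by (rule bdd_aboveI2[OF le])
    then have "enn2real (modulus_int p \<delta> F) powr (1/p) \<le> mean_modulus p \<delta> F"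
      unfolding mean_modulus_eq[OF F lim] using \<delta> by (intro cSUP_upper) auto
    then show ?thesis using order_trans[OF powr_ge_zero] by blast
  qed
  ultimately show "\<bar>mean_modulus p \<delta> F\<bar> \<le> 48 * (\<epsilon> * \<delta> powr (1/p) * p + K * \<delta>)" by (simp add: R_def)
qed

section \<open>Test functions\<close>

text \<open>The numerator cancels against the factor 1/(1 - z) inside the operator; what remains is
  \<open>binom_deriv\<close> of the geometric series, with coefficients a^n times (n + j choose
  j).\<close>

definition test_fun :: "real \<Rightarrow> nat \<Rightarrow> complex \<Rightarrow> complex" where
  "test_fun a j = (\<lambda>z. (1 - z) / (1 - of_real a * z) ^ Suc j)"

lemma one_minus_mult_nz:
  fixes z :: complex
  assumes "0 \<le> a" "a < 1" "norm z < 1"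
  shows "1 - of_real a * z \<noteq> 0"
proof
  assume "1 - of_real a * z = 0"
  then have "of_real a * z = 1" by simp
  then have "norm (of_real a * z) = 1" by simp
  moreover have "a * norm z \<le> a * 1" using assms by (intro mult_left_mono) auto
  ultimately show False using assms by (simp add: norm_mult)
qed

lemma holomorphic_test_fun:
  assumes "0 \<le> a" "a < 1"
  shows "test_fun a j holomorphic_on unit_disc"
  unfolding test_fun_def using one_minus_mult_nz[OF assms] by (intro holomorphic_intros) auto

lemma holomorphic_inverse_power:
  assumes "0 \<le> a" "a < 1"
  shows "(\<lambda>z. 1 / (1 - of_real a * z) ^ j) holomorphic_on unit_disc"
  using one_minus_mult_nz[OF assms] by (intro holomorphic_intros) auto

lemma binom_deriv_geometric:
  assumes a: "0 \<le> a" "a < 1" and z: "norm z < 1"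
  shows "binom_deriv (\<lambda>z. 1 / (1 - of_real a * z)) j z = 1 / (1 - of_real a * z) ^ Suc j"
  using z
proof (induction j arbitrary: z)
  case (Suc j)
  let ?f = "binom_deriv (\<lambda>z. 1 / (1 - of_real a * z)) j"
  define w where "w = 1 - of_real a * z"
  have w: "w \<noteq> 0" unfolding w_def using one_minus_mult_nz[OF a Suc.prems] .
  have "((\<lambda>z. 1 / (1 - of_real a * z) ^ Suc j) has_field_derivative (of_nat (Suc j) * of_real a / w ^ Suc (Suc j))) (at z)"
  proof -
    have "((\<lambda>z. inverse ((1 - of_real a * z) ^ Suc j)) has_field_derivative
        - (inverse (w ^ Suc j) * (of_nat (Suc j) * w ^ j * (- of_real a)) * inverse (w ^ Suc j))) (at z)"
    proof (rule DERIV_inverse'[where f = "\<lambda>z. (1 - of_real a * z) ^ Suc j" and x = z, folded w_def])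
      show "((\<lambda>z. (1 - of_real a * z) ^ Suc j) has_field_derivative of_nat (Suc j) * w ^ j * (- of_real a)) (at z)"
        by (auto intro!: derivative_eq_intros simp: w_def simp del: of_nat_Suc power_Suc)
      show "w ^ Suc j \<noteq> 0" using w by simp
    qed
    moreover have "- (inverse (w ^ Suc j) * (of_nat (Suc j) * w ^ j * (- of_real a)) * inverse (w ^ Suc j)) = of_nat (Suc j) * of_real a / w ^ Suc (Suc j)"
      using w by (simp add: field_simps del: of_nat_Suc)
    ultimately show ?thesis by (simp add: inverse_eq_divide)
  qed
  then have "(?f has_field_derivative (of_nat (Suc j) * of_real a / w ^ Suc (Suc j))) (at z)"
    by (rule has_field_derivative_transform_within_open[where S = unit_disc]) (use Suc in auto)
  then have d: "deriv ?f z = of_nat (Suc j) * of_real a / w ^ Suc (Suc j)" by (rule DERIV_imp_deriv)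
  have "binom_deriv (\<lambda>z. 1 / (1 - of_real a * z)) (Suc j) z = 1 / w ^ Suc j + z * (of_nat (Suc j) * of_real a / w ^ Suc (Suc j)) / of_nat (Suc j)"
    using Suc.IH[OF Suc.prems] d by (simp add: w_def del: of_nat_Suc)
  also have "\<dots> = 1 / w ^ Suc j + z * of_real a / w ^ Suc (Suc j)"
    by (simp del: of_nat_Suc)
  also have "\<dots> = (w + of_real a * z) / w ^ Suc (Suc j)"
    using w by (simp add: add_divide_distrib)
  also have "w + of_real a * z = 1" by (simp add: w_def)
  finally show ?case by (simp add: w_def)
qed simp

lemma fps_nth_geometric:
  assumes a: "0 \<le> a" "a < 1"
  shows "fps_nth (fps_expansion (\<lambda>z. 1 / (1 - of_real a * z)) 0) n = of_real a ^ n"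
proof -
  define G where "G = fps_expansion (\<lambda>z. 1 / (1 - of_real a * z :: complex)) 0"
  have h: "(\<lambda>z. 1 / (1 - of_real a * z)) holomorphic_on unit_disc"
    using holomorphic_inverse_power[OF a, of 1] by simp
  have "(\<lambda>z. (1 - of_real a * z) * (1 / (1 - of_real a * z))) has_fps_expansion ((1 - fps_const (of_real a) * fps_X) * G)"
    unfolding G_def by (intro fps_expansion_intros fps_expansion_disc h)
  moreover have "eventually (\<lambda>z. z \<in> unit_disc) (nhds (0::complex))"
    by (intro eventually_nhds_in_open) auto
  then have "eventually (\<lambda>z. (1 - of_real a * z) * (1 / (1 - of_real a * z)) = 1) (nhds (0::complex))"
    by eventually_elim (use one_minus_mult_nz[OF a] in auto)
  ultimately have "(\<lambda>z. 1) has_fps_expansion ((1 - fps_const (of_real a) * fps_X) * G)"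
    by (subst (asm) has_fps_expansion_cong[OF _ refl])
  then have "(1 - fps_const (of_real a) * fps_X) * G = 1"
    using fps_expansion_unique_complex has_fps_expansion_1 by blast
  then have G: "G = 1 + fps_const (of_real a) * (fps_X * G)" by (simp add: algebra_simps)
  have "fps_nth G n = of_real a ^ n"
  proof (induction n)
    case 0
    show ?case by (subst G) simp
  next
    case (Suc n)
    show ?case by (subst G) (use Suc in simp)
  qed
  then show ?thesis by (simp add: G_def)
qed

text \<open>After division by 1 - z the coefficients are a^n (n + j choose j); multiplied by
  \<eta>_n they are those of \<open>binom_deriv\<close> of the symbol, with a^n turning z into a *
  z.\<close>

lemma Rhaly_test_fun:
  assumes \<eta>: "fps_conv_radius (Abs_fps \<eta>) \<ge> 1" and a: "0 \<le> a" "a < 1" and z: "norm z < 1"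
  shows "Rhaly \<eta> (test_fun a j) z = binom_deriv (symbol_fun \<eta>) j (of_real a * z)"
proof -
  let ?g = "\<lambda>z. 1 / (1 - of_real a * z :: complex)" and ?F = "symbol_fun \<eta>"
  have h: "?g holomorphic_on unit_disc" using holomorphic_inverse_power[OF a, of 1] by simp
  have F: "?F holomorphic_on unit_disc" by (rule symbol_fun_expansion(1)[OF \<eta>])
  have "eventually (\<lambda>z. z \<in> unit_disc) (nhds (0::complex))" by (intro eventually_nhds_in_open) auto
  then have "eventually (\<lambda>z. test_fun a j z / (1 - z) = binom_deriv ?g j z) (nhds 0)"
    by eventually_elim (auto simp: test_fun_def binom_deriv_geometric[OF a])
  then have e: "fps_expansion (\<lambda>z. test_fun a j z / (1 - z)) 0 = fps_expansion (binom_deriv ?g j) 0"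
    by (rule fps_expansion_cong)
  have "fps_nth (Rhaly_fps \<eta> (test_fun a j)) n * z ^ n = fps_nth (fps_expansion (binom_deriv ?F j) 0) n * (of_real a * z) ^ n" for n
    unfolding fps_nth_binom_deriv[OF F] symbol_fun_expansion(2)[OF \<eta>]
    by (simp add: Rhaly_fps_def partial_sum_fps_nth[OF holomorphic_test_fun[OF a]] e fps_nth_binom_deriv[OF h] fps_nth_geometric[OF a] power_mult_distrib)
  then have "Rhaly \<eta> (test_fun a j) z = eval_fps (fps_expansion (binom_deriv ?F j) 0) (of_real a * z)"
    unfolding Rhaly_def eval_fps_def by simp
  also have "\<dots> = binom_deriv ?F j (of_real a * z)"
  proof (rule eval_fps_expansion_disc[OF holomorphic_binom_deriv[OF F]])
    have "a * norm z \<le> 1 * norm z" using a by (intro mult_right_mono) auto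
    then show "norm (of_real a * z) < 1" using z a by (simp add: norm_mult)
  qed
  finally show ?thesis .
qed

text \<open>|1 - z| <= |1 - a z| + (1 - a)|z| <= 2 |1 - a z|, so the numerator takes away one power
  of the denominator.\<close>

lemma norm_test_fun_le:
  assumes a: "0 \<le> a" "a < 1" and z: "norm z < 1"
  shows "norm (test_fun a j z) \<le> 2 * norm (1 - of_real a * z) powr (- real j)"
proof -
  define N where "N = norm (1 - of_real a * z)"
  have "a * norm z \<le> a * 1" using a z by (intro mult_left_mono) auto
  moreover have "1 - norm (of_real a * z) \<le> N" unfolding N_def using norm_triangle_ineq2[of 1 "of_real a * z"] by simp
  ultimately have Na: "1 - a \<le> N" using a by (simp add: norm_mult)
  then have N: "N > 0" using a by linarith
  have "norm (1 - z) = norm ((1 - of_real a * z) - of_real (1 - a) * z)" by (simp add: algebra_simps)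
  also have "\<dots> \<le> N + norm (of_real (1 - a) * z)" unfolding N_def by (rule norm_triangle_ineq4)
  also have "norm (of_real (1 - a) * z) \<le> (1 - a) * 1"
    unfolding norm_mult norm_of_real using a z by (intro mult_mono) auto
  finally have "norm (1 - z) \<le> 2 * N" using Na by simp
  then have "norm (test_fun a j z) \<le> 2 * N / N ^ Suc j"
    unfolding test_fun_def norm_divide norm_power N_def[symmetric] using N by (intro divide_right_mono) auto
  also have "\<dots> = 2 * N powr (- real j)"
    using N by (simp add: powr_minus powr_realpow field_simps)
  finally show ?thesis by (simp add: N_def)
qed

text \<open>The means are bounded by multiples of (1 - a r)^(1 - j p). For j p > \<alpha> + 2 this
  singularity outweighs the weight, so that the integral is a pure power of 1 - a without a
  logarithm.\<close>

lemma bergman_int_test_fun: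
  assumes p: "p \<ge> 1" and \<alpha>: "\<alpha> > -1" and j: "real j * p > \<alpha> + 2"
  obtains C where "C > 0" "\<And>a. 0 \<le> a \<Longrightarrow> a < 1 \<Longrightarrow> bergman_int p \<alpha> (test_fun a j) \<le> ennreal (C * (1 - a) powr (\<alpha> + 2 - real j * p))"
proof -
  define b where "b = real j * p"
  have b: "b > 1" "b - 1 > \<alpha> + 1" using j \<alpha> by (auto simp: b_def)
  have kc: "kernel_const 0 b > 0" using b by (intro kernel_const_pos) auto
  define C1 where "C1 = (\<alpha>+1) * (2 powr p * kernel_const 0 b * 2 powr (b - 1))"
  have C1: "C1 > 0" using kc \<alpha> by (simp add: C1_def)
  define C2 where "C2 = 1 / (\<alpha>+1) + 1 / ((b - 1) - \<alpha> - 1)"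
  have C2: "C2 > 0" unfolding C2_def using \<alpha> b by (simp add: add_pos_pos)
  show ?thesis
  proof (rule that[of "C1 * C2"])
    show "C1 * C2 > 0" using C1 C2 by simp
    fix a :: real assume a: "0 \<le> a" "a < 1"
    have mp: "mean_pow p r (test_fun a j) \<le> ennreal (2 powr p * kernel_const 0 b * (1 - a * r) powr (1 - b))"
      if r: "0 \<le> r" "r < 1" for r
    proof -
      have ar: "0 \<le> a * r" "a * r < 1" using a r mult_left_mono[of r 1 a] by auto
      have "mean_pow p r (test_fun a j) \<le> (\<integral>\<^sup>+t. ennreal (2 powr p) * ennreal (norm (1 - of_real (a * r) * cis t) powr (-b)) \<partial>circ)"
        unfolding mean_pow_def
      proof (rule nn_integral_mono)
        fix t
        have "norm (test_fun a j (of_real r * cis t)) \<le> 2 * norm (1 - of_real (a * r) * cis t) powr (- real j)"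
          using norm_test_fun_le[OF a, of "of_real r * cis t" j] r by (simp add: norm_mult mult.assoc)
        then have "norm (test_fun a j (of_real r * cis t)) powr p \<le> (2 * norm (1 - of_real (a * r) * cis t) powr (- real j)) powr p"
          using p by (intro powr_mono2) auto
        also have "\<dots> = 2 powr p * norm (1 - of_real (a * r) * cis t) powr (-b)"
          by (simp add: powr_mult powr_powr b_def)
        finally show "ennreal (norm (test_fun a j (of_real r * cis t)) powr p) \<le> ennreal (2 powr p) * ennreal (norm (1 - of_real (a * r) * cis t) powr (-b))"
          by (subst ennreal_mult[symmetric]) (auto intro: ennreal_leI)
      qed
      also have "\<dots> = ennreal (2 powr p) * (\<integral>\<^sup>+t. ennreal (norm (1 - of_real (a * r) * cis t) powr (-b)) \<partial>circ)"
        by (rule nn_integral_cmult) measurable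
      also have "\<dots> \<le> ennreal (2 powr p) * ennreal (kernel_const 0 b * (1 - a * r) powr (1 - b))"
        by (intro mult_left_mono nn_integral_circ_kernel b ar) auto
      also have "\<dots> = ennreal (2 powr p * kernel_const 0 b * (1 - a * r) powr (1 - b))"
        using kc by (simp add: ennreal_mult[symmetric] mult.assoc)
      finally show ?thesis .
    qed
    have "bergman_int p \<alpha> (test_fun a j) \<le> (\<integral>\<^sup>+s. ennreal C1 * (ennreal ((1 - s) powr \<alpha> * max (1 - a) (1 - s) powr (-(b - 1))) * indicator {0..} (1 - s)) \<partial>lborel)"
      unfolding bergman_int_def
    proof (rule nn_integral_mono)
      fix s
      show "ennreal ((\<alpha>+1) * (1 - s) powr \<alpha>) * mean_pow p (sqrt s) (test_fun a j) * indicator {0..<1} s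
        \<le> ennreal C1 * (ennreal ((1 - s) powr \<alpha> * max (1 - a) (1 - s) powr (-(b - 1))) * indicator {0..} (1 - s))"
      proof (cases "s \<in> {0..<1}")
        case True
        define r where "r = sqrt s"
        have r: "0 \<le> r" "r < 1" "s = r\<^sup>2" using True by (auto simp: r_def)
        have "(1 - r) * (1 + r) \<le> (1 - r) * 2" using r by (intro mult_left_mono) auto
        then have "(1 - s) / 2 \<le> 1 - r" unfolding r(3) power2_eq_square by (simp add: field_simps)
        moreover have "a * r \<le> 1 * r" "a * r \<le> a * 1" using mult_right_mono[of a 1 r] mult_left_mono[of r 1 a] a r by auto
        \<comment> \<open>1 - a r is at least 1 - a, and also at least 1 - r >= (1 - s)/2.\<close>
        ultimately have "max (1 - a) (1 - s) / 2 \<le> 1 - a * r" using a by (auto simp: max_def)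
        then have "(1 - a * r) powr (1 - b) \<le> (max (1 - a) (1 - s) / 2) powr (1 - b)"
          using a b by (intro powr_mono2') auto
        also have "\<dots> = 2 powr (b - 1) * max (1 - a) (1 - s) powr (-(b - 1))"
        proof -
          have "(max (1 - a) (1 - s) / 2) powr (1 - b) = max (1 - a) (1 - s) powr (1 - b) / 2 powr (1 - b)" by (rule powr_divide)
          then show ?thesis using powr_minus_divide[of 2 "1 - b"] by simp
        qed
        finally have le: "(1 - a * r) powr (1 - b) \<le> 2 powr (b - 1) * max (1 - a) (1 - s) powr (-(b - 1))" .
        have "mean_pow p r (test_fun a j) \<le> ennreal (2 powr p * kernel_const 0 b * (1 - a * r) powr (1 - b))" by (rule mp[OF r(1,2)])
        also have "\<dots> \<le> ennreal (2 powr p * kernel_const 0 b * (2 powr (b - 1) * max (1 - a) (1 - s) powr (-(b - 1))))"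
          using kc by (intro ennreal_leI mult_left_mono le) auto
        finally have "ennreal ((\<alpha>+1) * (1 - s) powr \<alpha>) * mean_pow p r (test_fun a j)
            \<le> ennreal ((\<alpha>+1) * (1 - s) powr \<alpha>) * ennreal (2 powr p * kernel_const 0 b * (2 powr (b - 1) * max (1 - a) (1 - s) powr (-(b - 1))))"
          by (rule mult_left_mono) simp
        also have "\<dots> = ennreal C1 * ennreal ((1 - s) powr \<alpha> * max (1 - a) (1 - s) powr (-(b - 1)))"
          using \<alpha> kc by (simp add: C1_def ennreal_mult[symmetric] mult_ac)
        finally show ?thesis using True by (simp add: r_def)
      qed simp
    qed
    also have "\<dots> = ennreal C1 * (\<integral>\<^sup>+s. ennreal ((1 - s) powr \<alpha> * max (1 - a) (1 - s) powr (-(b - 1))) * indicator {0..} (1 - s) \<partial>lborel)"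
      by (rule nn_integral_cmult) measurable
    also have "(\<integral>\<^sup>+s. ennreal ((1 - s) powr \<alpha> * max (1 - a) (1 - s) powr (-(b - 1))) * indicator {0..} (1 - s) \<partial>lborel)
        = (\<integral>\<^sup>+y. ennreal (y powr \<alpha> * max (1 - a) y powr (-(b - 1))) * indicator {0..} y \<partial>lborel)"
      by (subst nn_integral_real_affine[where c = "-1" and t = 1]) auto
    also have "ennreal C1 * \<dots> \<le> ennreal C1 * ennreal (C2 * (1 - a) powr (\<alpha>+1-(b-1)))"
      unfolding C2_def using a b \<alpha> by (intro mult_left_mono nn_integral_max_powr) auto
    also have "\<dots> = ennreal (C1 * C2 * (1 - a) powr (\<alpha> + 2 - real j * p))"
      using C1 C2 by (simp add: ennreal_mult[symmetric] b_def mult.assoc algebra_simps)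
    finally show "bergman_int p \<alpha> (test_fun a j) \<le> ennreal (C1 * C2 * (1 - a) powr (\<alpha> + 2 - real j * p))" .
  qed
qed

section \<open>Normalised test functions and their images\<close>

lemma bergman_int_cmult:
  assumes f: "f holomorphic_on unit_disc" and p: "p > 0"
  shows "bergman_int p \<alpha> (\<lambda>z. c * f z) = ennreal (norm c powr p) * bergman_int p \<alpha> f"
proof -
  note [measurable] = disc_restrict_measurable[OF f]
  have "bergman_int p \<alpha> (\<lambda>z. c * f z) = (\<integral>\<^sup>+s. ennreal (norm c powr p) * (ennreal ((\<alpha>+1) * (1 - s) powr \<alpha>) * mean_pow p (sqrt s) (disc_restrict f) * indicator {0..<1} s) \<partial>lborel)"
    unfolding bergman_int_def
  proof (rule nn_integral_cong)
    fix s
    show "ennreal ((\<alpha>+1) * (1 - s) powr \<alpha>) * mean_pow p (sqrt s) (\<lambda>z. c * f z) * indicator {0..<1} s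
      = ennreal (norm c powr p) * (ennreal ((\<alpha>+1) * (1 - s) powr \<alpha>) * mean_pow p (sqrt s) (disc_restrict f) * indicator {0..<1} s)"
    proof (cases "s \<in> {0..<1}")
      case True
      then have r: "0 \<le> sqrt s" "sqrt s < 1" by auto
      have [measurable]: "(\<lambda>t. f (of_real (sqrt s) * cis t)) \<in> borel_measurable borel" by (rule holomorphic_circle_measurable[OF f r])
      have "mean_pow p (sqrt s) (\<lambda>z. c * f z) = ennreal (norm c powr p) * mean_pow p (sqrt s) f"
        unfolding mean_pow_def by (subst nn_integral_cmult[symmetric]) (auto simp: norm_mult powr_mult ennreal_mult)
      then show ?thesis using True by (simp add: mean_pow_disc_restrict[OF r] mult_ac)
    qed simp
  qed
  also have "\<dots> = ennreal (norm c powr p) * bergman_int p \<alpha> (disc_restrict f)"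
    unfolding bergman_int_def by (rule nn_integral_cmult) measurable
  finally show ?thesis by (simp add: bergman_int_disc_restrict)
qed

text \<open>The constant 1 lies in the space, and all partial sums of its coefficients are 1, so the
  operator maps it to the symbol.\<close>

lemma symbol_conv_radius:
  assumes wd: "Rhaly_well_defined_on \<eta> (Bergman p \<alpha>)" and \<alpha>: "\<alpha> > -1" and p: "p \<ge> 1"
  shows "fps_conv_radius (Abs_fps \<eta>) \<ge> 1"
proof -
  have "bergman_int p \<alpha> (\<lambda>_. 1) = (\<integral>\<^sup>+s. ennreal (\<alpha>+1) * (ennreal ((1 - s) powr \<alpha>) * indicator {0..<1} s) \<partial>lborel)"
    unfolding bergman_int_def using \<alpha> by (intro nn_integral_cong) (simp add: mean_pow_const ennreal_mult mult.assoc)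
  also have "\<dots> = ennreal (\<alpha>+1) * ennreal (1 / (\<alpha>+1))"
    using nn_integral_powr_upto_1[OF \<alpha>, of 0] by (simp add: nn_integral_cmult)
  finally have "(\<lambda>_. 1) \<in> Bergman p \<alpha>"
    unfolding Bergman_iff[OF \<alpha>] by (simp add: ennreal_mult_less_top)
  then have "fps_conv_radius (Rhaly_fps \<eta> (\<lambda>_. 1)) \<ge> 1" using wd by (simp add: Rhaly_well_defined_on_def)
  moreover have "fps_expansion (\<lambda>_. 1) 0 = (1 :: complex fps)" by (rule fps_expansion_eqI) simp
  then have "Rhaly_fps \<eta> (\<lambda>_. 1) = Abs_fps \<eta>"
    unfolding Rhaly_fps_def by (intro fps_ext) simp
  ultimately show ?thesis by simp
qed

text \<open>The exponent of 1 - a undoes the growth in \<open>bergman_int_test_fun\<close>, so the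
  family is bounded in norm as a varies.\<close>

definition scaled_test_fun :: "real \<Rightarrow> real \<Rightarrow> nat \<Rightarrow> real \<Rightarrow> complex \<Rightarrow> complex" where
  "scaled_test_fun p \<alpha> j a = (\<lambda>z. of_real ((1 - a) powr (real j - (\<alpha> + 2) / p)) * test_fun a j z)"

lemma holomorphic_scaled_test_fun:
  "0 \<le> a \<Longrightarrow> a < 1 \<Longrightarrow> scaled_test_fun p \<alpha> j a holomorphic_on unit_disc"
  unfolding scaled_test_fun_def by (intro holomorphic_intros holomorphic_test_fun)

lemma scaled_test_fun_Bergman:
  assumes p: "p \<ge> 1" and \<alpha>: "\<alpha> > -1" and j: "real j * p > \<alpha> + 2"
  obtains C where "\<And>a. 0 \<le> a \<Longrightarrow> a < 1 \<Longrightarrow> scaled_test_fun p \<alpha> j a \<in> Bergman p \<alpha>"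
    "\<And>a. 0 \<le> a \<Longrightarrow> a < 1 \<Longrightarrow> Bergman_norm p \<alpha> (scaled_test_fun p \<alpha> j a) \<le> C"
proof -
  obtain C where C: "C > 0" "\<And>a. 0 \<le> a \<Longrightarrow> a < 1 \<Longrightarrow> bergman_int p \<alpha> (test_fun a j) \<le> ennreal (C * (1 - a) powr (\<alpha> + 2 - real j * p))"
    using bergman_int_test_fun[OF assms] by blast
  have le: "bergman_int p \<alpha> (scaled_test_fun p \<alpha> j a) \<le> ennreal C" if a: "0 \<le> a" "a < 1" for a
  proof -
    have e: "(real j - (\<alpha> + 2) / p) * p = real j * p - (\<alpha> + 2)" using p by (simp add: field_simps)
    have "bergman_int p \<alpha> (scaled_test_fun p \<alpha> j a) = ennreal ((1 - a) powr (real j * p - (\<alpha> + 2))) * bergman_int p \<alpha> (test_fun a j)"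
      unfolding scaled_test_fun_def using p by (subst bergman_int_cmult[OF holomorphic_test_fun[OF a]]) (auto simp: powr_powr e)
    also have "\<dots> \<le> ennreal ((1 - a) powr (real j * p - (\<alpha> + 2))) * ennreal (C * (1 - a) powr (\<alpha> + 2 - real j * p))"
      by (intro mult_left_mono C a) auto
    also have "\<dots> = ennreal (C * ((1 - a) powr (real j * p - (\<alpha> + 2)) * (1 - a) powr (\<alpha> + 2 - real j * p)))"
      using C(1) by (simp add: ennreal_mult[symmetric] mult_ac)
    also have "(1 - a) powr (real j * p - (\<alpha> + 2)) * (1 - a) powr (\<alpha> + 2 - real j * p) = 1"
      using a by (simp add: powr_add[symmetric])
    finally show ?thesis by simp
  qed
  show ?thesis
  proof (rule that[of "C powr (1/p)"])
    fix a :: real assume a: "0 \<le> a" "a < 1"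
    show "scaled_test_fun p \<alpha> j a \<in> Bergman p \<alpha>"
      unfolding Bergman_iff[OF \<alpha>] using holomorphic_scaled_test_fun[OF a] le[OF a] by (auto intro: le_less_trans)
    show "Bergman_norm p \<alpha> (scaled_test_fun p \<alpha> j a) \<le> C powr (1/p)"
      unfolding Bergman_norm_eq[OF \<alpha> holomorphic_scaled_test_fun[OF a]]
      using le[OF a] C(1) p by (intro powr_mono2 enn2real_leI) auto
  qed
qed

lemma Rhaly_scaled_test_fun:
  assumes \<eta>: "fps_conv_radius (Abs_fps \<eta>) \<ge> 1" and a: "0 \<le> a" "a < 1" and z: "norm z < 1"
  shows "Rhaly \<eta> (scaled_test_fun p \<alpha> j a) z = of_real ((1 - a) powr (real j - (\<alpha> + 2) / p)) * binom_deriv (symbol_fun \<eta>) j (of_real a * z)"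
  using Rhaly_linear[OF \<eta> holomorphic_test_fun[OF a] holomorphic_test_fun[OF a] z, of "of_real ((1 - a) powr (real j - (\<alpha> + 2) / p))" j 0 j]
  by (simp add: scaled_test_fun_def Rhaly_test_fun[OF \<eta> a z])

text \<open>With a = sqrt r the image at radius a shows \<open>binom_deriv\<close> of the symbol at
  radius a^2 = r. The norm controls the mean at a up to (1 - r)^(-(\<alpha> + 1)/p), and undoing the
  normalisation costs (1 - a)^((\<alpha> + 2)/p - j). The exponents add up to 1/p - j, free of
  \<alpha>.\<close>

lemma mean_pow_binom_deriv_le:
  assumes p: "p \<ge> 1" and \<alpha>: "\<alpha> > -1" and \<eta>: "fps_conv_radius (Abs_fps \<eta>) \<ge> 1" and j: "real j * p > \<alpha> + 2"
    and r: "0 \<le> r" "r < 1" and R: "Rhaly \<eta> (scaled_test_fun p \<alpha> j (sqrt r)) \<in> Bergman p \<alpha>"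
    and T: "Bergman_norm p \<alpha> (Rhaly \<eta> (scaled_test_fun p \<alpha> j (sqrt r))) \<le> T"
  shows "mean_pow p r (binom_deriv (symbol_fun \<eta>) j) \<le> ennreal ((2 powr (real j - (\<alpha> + 2) / p) * T * (1 - r) powr (- (real j - 1/p))) powr p)"
proof -
  define a where "a = sqrt r"
  have a: "0 \<le> a" "a < 1" "r = a\<^sup>2" using r by (auto simp: a_def)
  define e where "e = real j - (\<alpha> + 2) / p"
  have ep: "e * p = real j * p - (\<alpha> + 2)" using p by (simp add: e_def field_simps)
  let ?F = "binom_deriv (symbol_fun \<eta>) j"
  let ?h = "Rhaly \<eta> (scaled_test_fun p \<alpha> j a)"
  have T0: "T \<ge> 0" using T Bergman_norm_nonneg order_trans by blast
  have F: "?F holomorphic_on unit_disc" by (rule holomorphic_binom_deriv[OF symbol_fun_expansion(1)[OF \<eta>]])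
  have [measurable]: "(\<lambda>t. ?F (of_real r * cis t)) \<in> borel_measurable borel" by (rule holomorphic_circle_measurable[OF F r])
  have h: "?h holomorphic_on unit_disc" by (rule holomorphic_Rhaly[OF \<eta> holomorphic_scaled_test_fun[OF a(1,2)]])
  have m: "mean_pow p a ?h = ennreal ((1 - a) powr (e * p)) * mean_pow p r ?F"
  proof -
    have "?h (of_real a * cis t) = of_real ((1 - a) powr e) * ?F (of_real r * cis t)" for t
      using Rhaly_scaled_test_fun[OF \<eta> a(1,2), of "of_real a * cis t" p \<alpha> j] a
      by (simp add: norm_mult e_def power2_eq_square mult.assoc)
    then have "mean_pow p a ?h = (\<integral>\<^sup>+t. ennreal ((1 - a) powr (e * p)) * ennreal (norm (?F (of_real r * cis t)) powr p) \<partial>circ)"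
      unfolding mean_pow_def by (intro nn_integral_cong) (simp add: norm_mult powr_mult powr_powr ennreal_mult)
    also have "\<dots> = ennreal ((1 - a) powr (e * p)) * mean_pow p r ?F"
      unfolding mean_pow_def by (rule nn_integral_cmult) measurable
    finally show ?thesis .
  qed
  have "ennreal ((1 - a\<^sup>2) powr (\<alpha>+1)) * mean_pow p a ?h \<le> bergman_int p \<alpha> ?h"
    by (rule mean_pow_le_bergman_int[OF h \<alpha> p a(1,2)])
  also have "\<dots> = ennreal (Bergman_norm p \<alpha> ?h powr p)"
    by (rule bergman_int_eq_norm[OF \<alpha>]) (use R p in \<open>auto simp: a_def\<close>)
  also have "\<dots> \<le> ennreal (T powr p)"
    using T p by (intro ennreal_leI powr_mono2) (auto simp: a_def Bergman_norm_nonneg)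
  finally have 1: "ennreal ((1 - r) powr (\<alpha>+1)) * (ennreal ((1 - a) powr (e * p)) * mean_pow p r ?F) \<le> ennreal (T powr p)"
    unfolding m a(3) .
  define W where "W = (1 - r) powr (\<alpha>+1) * (1 - a) powr (e * p)"
  have W: "W > 0" using a r by (simp add: W_def)
  have "mean_pow p r ?F = ennreal (1 / W) * (ennreal W * mean_pow p r ?F)"
    using W by (simp add: mult.assoc[symmetric] ennreal_mult[symmetric])
  also have "ennreal W * mean_pow p r ?F \<le> ennreal (T powr p)"
    using 1 by (simp add: W_def ennreal_mult mult.assoc)
  finally have "mean_pow p r ?F \<le> ennreal (1 / W) * ennreal (T powr p)" by (simp add: mult_left_mono)
  also have "\<dots> = ennreal (1 / W * T powr p)" using W by (simp add: ennreal_mult[symmetric])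
  also have "\<dots> \<le> ennreal ((2 powr e * T * (1 - r) powr (- (real j - 1/p))) powr p)"
  proof (rule ennreal_leI)
    have "(1 - a) * (1 + a) \<le> (1 - a) * 2" using a by (intro mult_left_mono) auto
    then have "(1 - r) / 2 \<le> 1 - a" unfolding a(3) power2_eq_square by (simp add: field_simps)
    then have "((1 - r) / 2) powr (e * p) \<le> (1 - a) powr (e * p)" using r j ep by (intro powr_mono2) auto
    moreover have "((1 - r) / 2) powr (e * p) = (1 - r) powr (e * p) / 2 powr (e * p)" by (rule powr_divide)
    ultimately have "(1 - r) powr (\<alpha>+1) * ((1 - r) powr (e * p) / 2 powr (e * p)) \<le> W"
      unfolding W_def by (intro mult_left_mono) auto
    moreover have "(1 - r) powr (\<alpha>+1) * ((1 - r) powr (e * p) / 2 powr (e * p)) = (1 - r) powr (real j * p - 1) / 2 powr (e * p)"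
      unfolding ep by (simp add: powr_add[symmetric])
    ultimately have "1 / W \<le> 1 / ((1 - r) powr (real j * p - 1) / 2 powr (e * p))"
      using r W by (intro divide_left_mono) auto
    also have "\<dots> = 2 powr (e * p) * (1 - r) powr (- (real j * p - 1))"
      unfolding powr_minus by (simp add: divide_inverse)
    finally have "1 / W * T powr p \<le> 2 powr (e * p) * (1 - r) powr (- (real j * p - 1)) * T powr p"
      by (intro mult_right_mono) auto
    also have "\<dots> = (2 powr e * T * (1 - r) powr (- (real j - 1/p))) powr p"
    proof -
      have "- (real j - 1/p) * p = - (real j * p - 1)" using p by (simp add: field_simps)
      then show ?thesis using T0 by (simp add: powr_mult powr_powr mult_ac)
    qed
    finally show "1 / W * T powr p \<le> (2 powr e * T * (1 - r) powr (- (real j - 1/p))) powr p" .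
  qed
  finally show ?thesis by (simp add: e_def)
qed

text \<open>Integrates the derivative of z^(i + 1) * \<open>binom_deriv F i\<close> along radii, and
  then divides by r^(i + 1), which for r >= 1/2 costs at most 2^(i + 1).\<close>

lemma mean_pow_binom_deriv_step:
  assumes F: "F holomorphic_on unit_disc" and gr: "mean_growth p \<gamma> \<epsilon> K (binom_deriv F (Suc i))" and p: "p \<ge> 1" and \<epsilon>: "\<epsilon> > 0" "K \<ge> 0"
    and r: "1/2 \<le> r" "r < 1"
    and I: "(\<integral>\<^sup>+s. ennreal (\<epsilon> * (1 - s) powr (-\<gamma>) + K) * indicator {0..r} s \<partial>lborel) \<le> ennreal I" "I \<ge> 0"
  shows "mean_pow p r (binom_deriv F i) \<le> ennreal ((2 ^ Suc i * (real (Suc i) * I)) powr p)"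
proof -
  let ?f = "binom_deriv F (Suc i)" and ?g = "binom_deriv F i"
  have f: "?f holomorphic_on unit_disc" and g: "?g holomorphic_on unit_disc" by (rule holomorphic_binom_deriv[OF F])+
  have [measurable]: "(\<lambda>t. ?g (of_real r * cis t)) \<in> borel_measurable borel" by (rule holomorphic_circle_measurable[OF g]) (use r in auto)
  have "(\<integral>\<^sup>+\<theta>. ennreal ((r ^ Suc i * norm (?g (of_real r * cis \<theta>))) powr p) \<partial>circ) \<le> ennreal ((real (Suc i) * I) powr p)"
  proof (rule nn_integral_radial_le[OF f gr p \<epsilon>, where c = "real (Suc i)" and S = "{0..r}"])
    have "(\<integral>\<^sup>+s. ennreal (real (Suc i) * (\<epsilon> * (1 - s) powr (-\<gamma>) + K)) * indicator {0..r} s \<partial>lborel)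
        = (\<integral>\<^sup>+s. ennreal (real (Suc i)) * (ennreal (\<epsilon> * (1 - s) powr (-\<gamma>) + K) * indicator {0..r} s) \<partial>lborel)"
      using \<epsilon> by (intro nn_integral_cong) (simp add: ennreal_mult mult.assoc del: of_nat_Suc)
    also have "\<dots> = ennreal (real (Suc i)) * (\<integral>\<^sup>+s. ennreal (\<epsilon> * (1 - s) powr (-\<gamma>) + K) * indicator {0..r} s \<partial>lborel)"
      by (rule nn_integral_cmult) measurable
    also have "\<dots> \<le> ennreal (real (Suc i)) * ennreal I" by (intro mult_left_mono I) auto
    also have "\<dots> = ennreal (real (Suc i) * I)" using I by (intro ennreal_mult[symmetric]) auto
    finally show "(\<integral>\<^sup>+s. ennreal (real (Suc i) * (\<epsilon> * (1 - s) powr (-\<gamma>) + K)) * indicator {0..r} s \<partial>lborel) \<le> ennreal (real (Suc i) * I)" .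
    show "AE \<theta> in circ. ennreal (r ^ Suc i * norm (?g (of_real r * cis \<theta>))) \<le> (\<integral>\<^sup>+s. ennreal (real (Suc i) * norm (?f (of_real s * cis \<theta>))) * indicator {0..r} s \<partial>lborel)"
    proof (rule AE_I2)
      fix \<theta>
      let ?G = "\<lambda>z. z ^ Suc i * ?g z"
      have G: "?G holomorphic_on unit_disc" by (intro holomorphic_intros g)
      have dG: "deriv ?G z = of_nat (Suc i) * z ^ i * ?f z" if "norm z < 1" for z
        by (rule DERIV_imp_deriv[OF binom_deriv_has_derivative[OF F that]])
      have "ennreal (norm (?G (of_real r * cis \<theta>) - ?G (of_real 0 * cis \<theta>))) \<le> (\<integral>\<^sup>+s. ennreal (norm (deriv ?G (of_real s * cis \<theta>)) * indicator {0..r} s) \<partial>lborel)"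
        by (rule norm_radial_diff_le[OF G]) (use r in auto)
      also have "\<dots> \<le> (\<integral>\<^sup>+s. ennreal (real (Suc i) * norm (?f (of_real s * cis \<theta>))) * indicator {0..r} s \<partial>lborel)"
      proof (rule nn_integral_mono)
        fix s
        show "ennreal (norm (deriv ?G (of_real s * cis \<theta>)) * indicator {0..r} s) \<le> ennreal (real (Suc i) * norm (?f (of_real s * cis \<theta>))) * indicator {0..r} s"
        proof (cases "s \<in> {0..r}")
          case True
          then have s: "0 \<le> s" "s < 1" using r by auto
          have "norm (deriv ?G (of_real s * cis \<theta>)) = real (Suc i) * s ^ i * norm (?f (of_real s * cis \<theta>))"
            using s by (subst dG) (simp_all add: norm_mult norm_power del: of_nat_Suc binom_deriv.simps)
          also have "\<dots> \<le> real (Suc i) * 1 * norm (?f (of_real s * cis \<theta>))"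
            using s by (intro mult_right_mono mult_left_mono power_le_one) auto
          finally have "ennreal (norm (deriv ?G (of_real s * cis \<theta>))) \<le> ennreal (real (Suc i) * norm (?f (of_real s * cis \<theta>)))" by (intro ennreal_leI) simp
          then show ?thesis using True by simp
        qed simp
      qed
      finally show "ennreal (r ^ Suc i * norm (?g (of_real r * cis \<theta>))) \<le> (\<integral>\<^sup>+s. ennreal (real (Suc i) * norm (?f (of_real s * cis \<theta>))) * indicator {0..r} s \<partial>lborel)"
        using r by (simp add: norm_mult norm_power del: of_nat_Suc binom_deriv.simps)
    qed
  qed (use r I in auto)
  also have "(\<integral>\<^sup>+\<theta>. ennreal ((r ^ Suc i * norm (?g (of_real r * cis \<theta>))) powr p) \<partial>circ) = ennreal ((r ^ Suc i) powr p) * mean_pow p r ?g"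
    unfolding mean_pow_def using r by (subst nn_integral_cmult[symmetric]) (auto simp: powr_mult ennreal_mult simp del: power_Suc)
  finally have 1: "ennreal ((r ^ Suc i) powr p) * mean_pow p r ?g \<le> ennreal ((real (Suc i) * I) powr p)" .
  have "mean_pow p r ?g = ennreal ((2 ^ Suc i) powr p * ((1/2) ^ Suc i) powr p) * mean_pow p r ?g"
    by (simp add: powr_mult[symmetric] power_mult_distrib[symmetric] del: power_Suc)
  also have "\<dots> \<le> ennreal ((2 ^ Suc i) powr p * (r ^ Suc i) powr p) * mean_pow p r ?g"
    using r p by (intro mult_right_mono ennreal_leI mult_left_mono powr_mono2 power_mono) auto
  also have "\<dots> = ennreal ((2 ^ Suc i) powr p) * (ennreal ((r ^ Suc i) powr p) * mean_pow p r ?g)"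
    by (simp add: ennreal_mult mult.assoc)
  also have "\<dots> \<le> ennreal ((2 ^ Suc i) powr p) * ennreal ((real (Suc i) * I) powr p)" by (intro mult_left_mono 1) auto
  also have "\<dots> = ennreal ((2 ^ Suc i * (real (Suc i) * I)) powr p)"
    using I by (simp add: ennreal_mult[symmetric] powr_mult del: power_Suc of_nat_Suc)
  finally show ?thesis .
qed

text \<open>For \<gamma> > 1 the integral of (1 - s)^(-\<gamma>) up to r is at most (1 - r)^(1 -
  \<gamma>)/(\<gamma> - 1): one order is traded for one power of 1 - r. C must not depend on
  \<epsilon>, since the little-o case applies it with \<epsilon> tending to 0.\<close>

lemma mean_growth_binom_deriv_descend:
  assumes p: "p \<ge> 1" and \<gamma>: "\<gamma> > 1"
  obtains C where "C > 0" "\<And>F \<epsilon> K. F holomorphic_on unit_disc \<Longrightarrow> \<epsilon> > 0 \<Longrightarrow> K \<ge> 0 \<Longrightarrow> mean_growth p \<gamma> \<epsilon> K (binom_deriv F (Suc i)) \<Longrightarrow>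
    \<exists>K'\<ge>0. mean_growth p (\<gamma> - 1) (C * \<epsilon>) K' (binom_deriv F i)"
proof -
  define D where "D = 2 ^ Suc i * real (Suc i)"
  have D: "D > 0" by (simp add: D_def del: power_Suc of_nat_Suc)
  show ?thesis
  proof (rule that[of "D / (\<gamma> - 1)"])
    show "D / (\<gamma> - 1) > 0" using D \<gamma> by simp
    fix F \<epsilon> K assume F: "F holomorphic_on unit_disc" and \<epsilon>: "\<epsilon> > 0" "K \<ge> 0" and gr: "mean_growth p \<gamma> \<epsilon> K (binom_deriv F (Suc i))"
    have g: "binom_deriv F i holomorphic_on unit_disc" by (rule holomorphic_binom_deriv[OF F])
    have step: "mean_pow p r (binom_deriv F i) \<le> ennreal ((D * (\<epsilon> * ((1 - r) powr (1 - \<gamma>) / (\<gamma> - 1)) + K)) powr p)" if r: "1/2 \<le> r" "r < 1" for r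
      unfolding D_def mult.assoc
    proof (rule mean_pow_binom_deriv_step[OF F gr p \<epsilon> r])
      have "(\<integral>\<^sup>+s. ennreal (\<epsilon> * (1 - s) powr (-\<gamma>) + K) * indicator {0..r} s \<partial>lborel)
          = (\<integral>\<^sup>+s. ennreal \<epsilon> * ennreal ((1 - s) powr (-\<gamma>) * indicator {0..r} s) + ennreal K * indicator {0..r} s \<partial>lborel)"
        using \<epsilon> by (intro nn_integral_cong) (auto simp: indicator_def ennreal_mult)
      also have "\<dots> = ennreal \<epsilon> * (\<integral>\<^sup>+s. ennreal ((1 - s) powr (-\<gamma>) * indicator {0..r} s) \<partial>lborel) + ennreal K * ennreal r"
        using r by (simp add: nn_integral_add nn_integral_cmult)
      also have "\<dots> \<le> ennreal \<epsilon> * ennreal ((1 - r) powr (1 - \<gamma>) / (\<gamma> - 1)) + ennreal K * ennreal 1"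
        using r \<gamma> by (intro add_mono mult_left_mono nn_integral_powr_below ennreal_leI) auto
      also have "\<dots> = ennreal (\<epsilon> * ((1 - r) powr (1 - \<gamma>) / (\<gamma> - 1)) + K)"
        using \<epsilon> \<gamma> by (simp add: ennreal_mult[symmetric] ennreal_plus[symmetric] del: ennreal_plus)
      finally show "(\<integral>\<^sup>+s. ennreal (\<epsilon> * (1 - s) powr (-\<gamma>) + K) * indicator {0..r} s \<partial>lborel) \<le> ennreal (\<epsilon> * ((1 - r) powr (1 - \<gamma>) / (\<gamma> - 1)) + K)" .
    qed (use \<epsilon> \<gamma> in auto)
    \<comment> \<open>The estimate at r = 1/2, which by monotonicity of the means also covers
      smaller r.\<close>
    define K' where "K' = D * (\<epsilon> * ((1/2) powr (1 - \<gamma>) / (\<gamma> - 1)) + K)"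
    have K': "K' \<ge> D * K" "K' \<ge> 0" using D \<epsilon> \<gamma> by (auto simp: K'_def mult_left_mono)
    have "mean_growth p (\<gamma> - 1) (D / (\<gamma> - 1) * \<epsilon>) K' (binom_deriv F i)"
      unfolding mean_growth_def
    proof (intro allI impI)
      fix r :: real assume "0 \<le> r \<and> r < 1"
      then have r: "0 \<le> r" "r < 1" by auto
      show "mean_pow p r (binom_deriv F i) \<le> ennreal ((D / (\<gamma> - 1) * \<epsilon> * (1 - r) powr - (\<gamma> - 1) + K') powr p)"
      proof (cases "1/2 \<le> r")
        case True
        show ?thesis
        proof (rule order_trans[OF step[OF True r(2)]], intro ennreal_leI powr_mono2)
          have "D * (\<epsilon> * ((1 - r) powr (1 - \<gamma>) / (\<gamma> - 1)) + K) = D / (\<gamma> - 1) * \<epsilon> * (1 - r) powr - (\<gamma> - 1) + D * K"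
            by (simp add: algebra_simps)
          then show "D * (\<epsilon> * ((1 - r) powr (1 - \<gamma>) / (\<gamma> - 1)) + K) \<le> D / (\<gamma> - 1) * \<epsilon> * (1 - r) powr - (\<gamma> - 1) + K'" using K' by simp
        qed (use p D \<epsilon> \<gamma> in auto)
      next
        case False
        have "mean_pow p r (binom_deriv F i) \<le> mean_pow p (1/2) (binom_deriv F i)"
          using False r p by (intro mean_pow_mono[OF g]) auto
        also have "\<dots> \<le> ennreal (K' powr p)" using step[of "1/2"] by (simp add: K'_def)
        also have "\<dots> \<le> ennreal ((D / (\<gamma> - 1) * \<epsilon> * (1 - r) powr - (\<gamma> - 1) + K') powr p)"
          using K' D \<gamma> \<epsilon> p by (intro ennreal_leI powr_mono2) auto
        finally show ?thesis .
      qed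
    qed
    then show "\<exists>K'\<ge>0. mean_growth p (\<gamma> - 1) (D / (\<gamma> - 1) * \<epsilon>) K' (binom_deriv F i)" using K' by blast
  qed
qed

text \<open>Each descent starts from an exponent j + 2 - 1/p > 1 and so stays clear of the critical
  exponent 1, at which a logarithm would arise; it stops at order 1.\<close>

lemma mean_growth_binom_deriv_descend_1:
  assumes p: "p > 1"
  shows "\<exists>C>0. \<forall>F \<epsilon> K. F holomorphic_on unit_disc \<longrightarrow> \<epsilon> > 0 \<longrightarrow> K \<ge> 0 \<longrightarrow> mean_growth p (real (Suc j) - 1/p) \<epsilon> K (binom_deriv F (Suc j)) \<longrightarrow>
    (\<exists>K'\<ge>0. mean_growth p (1 - 1/p) (C * \<epsilon>) K' (binom_deriv F (Suc 0)))"
proof (induction j)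
  case 0
  show ?case by (intro exI[of _ 1]) (auto simp del: binom_deriv.simps)
next
  case (Suc j)
  then obtain C1 where C1: "C1 > 0" "\<And>F \<epsilon> K. F holomorphic_on unit_disc \<Longrightarrow> \<epsilon> > 0 \<Longrightarrow> K \<ge> 0 \<Longrightarrow> mean_growth p (real (Suc j) - 1/p) \<epsilon> K (binom_deriv F (Suc j)) \<Longrightarrow>
    (\<exists>K'\<ge>0. mean_growth p (1 - 1/p) (C1 * \<epsilon>) K' (binom_deriv F (Suc 0)))" by blast
  have p1: "p \<ge> 1" using p by simp
  have "1/p < 1" using p by simp
  then have \<gamma>: "real (Suc (Suc j)) - 1/p > 1" by simp
  obtain C2 where C2: "C2 > 0" "\<And>F \<epsilon> K. F holomorphic_on unit_disc \<Longrightarrow> \<epsilon> > 0 \<Longrightarrow> K \<ge> 0 \<Longrightarrow> mean_growth p (real (Suc (Suc j)) - 1/p) \<epsilon> K (binom_deriv F (Suc (Suc j))) \<Longrightarrow>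
    \<exists>K'\<ge>0. mean_growth p (real (Suc (Suc j)) - 1/p - 1) (C2 * \<epsilon>) K' (binom_deriv F (Suc j))"
    using mean_growth_binom_deriv_descend[OF p1 \<gamma>, of "Suc j"] by blast
  have e: "real (Suc (Suc j)) - 1/p - 1 = real (Suc j) - 1/p" by simp
  show ?case
  proof (rule exI[of _ "C1 * C2"], intro conjI allI impI)
    show "C1 * C2 > 0" using C1 C2 by simp
    fix F :: "complex \<Rightarrow> complex" and \<epsilon> K :: real
    assume F: "F holomorphic_on unit_disc" and \<epsilon>: "\<epsilon> > 0" "K \<ge> 0" "mean_growth p (real (Suc (Suc j)) - 1/p) \<epsilon> K (binom_deriv F (Suc (Suc j)))"
    obtain K1 where "K1 \<ge> 0" "mean_growth p (real (Suc j) - 1/p) (C2 * \<epsilon>) K1 (binom_deriv F (Suc j))"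
      using C2(2)[OF F \<epsilon>] unfolding e by blast
    from C1(2)[OF F _ this] C2(1) \<epsilon>(1) show "\<exists>K'\<ge>0. mean_growth p (1 - 1/p) (C1 * C2 * \<epsilon>) K' (binom_deriv F (Suc 0))"
      by (simp add: mult.assoc del: binom_deriv.simps)
  qed
qed

text \<open>z F' is \<open>binom_deriv\<close> of order 1 minus F, and the means of F are bounded
  because 1 - 1/p < 1 makes the growth integrable. Division by |z| >= 1/2, and monotonicity of the
  means for smaller radii, give F'.\<close>

lemma mean_growth_deriv:
  assumes p: "p > 1" and F: "F holomorphic_on unit_disc" and \<epsilon>: "\<epsilon> > 0" "K \<ge> 0"
    and gr: "mean_growth p (1 - 1/p) \<epsilon> K (binom_deriv F (Suc 0))"
  obtains K' where "K' \<ge> 0" "mean_growth p (1 - 1/p) (8 * \<epsilon>) K' (deriv F)"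
proof -
  define \<beta> where "\<beta> = 1 - 1/p"
  have \<beta>: "0 < \<beta>" "\<beta> < 1" using p by (auto simp: \<beta>_def)
  have p1: "p \<ge> 1" using p by simp
  have gr': "mean_growth p \<beta> \<epsilon> K (binom_deriv F (Suc 0))" using gr by (simp add: \<beta>_def del: binom_deriv.simps)
  define B where "B = 2 * (\<epsilon> / (1 - \<beta>) + K)"
  have B: "B \<ge> 0" using \<epsilon> \<beta> by (simp add: B_def)
  have mF: "mean_pow p r F \<le> ennreal (B powr p)" if r: "1/2 \<le> r" "r < 1" for r
  proof -
    have "mean_pow p r (binom_deriv F 0) \<le> ennreal ((2 ^ Suc 0 * (real (Suc 0) * (\<epsilon> / (1 - \<beta>) + K))) powr p)"
    proof (rule mean_pow_binom_deriv_step[OF F gr' p1 \<epsilon> r])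
      have "(\<integral>\<^sup>+s. ennreal (\<epsilon> * (1 - s) powr (-\<beta>) + K) * indicator {0..r} s \<partial>lborel) \<le> (\<integral>\<^sup>+s. ennreal (\<epsilon> * (1 - s) powr (-\<beta>) + K) * indicator {0..<1} s \<partial>lborel)"
        using r by (intro nn_integral_mono) (auto simp: indicator_def)
      also have "\<dots> = ennreal (\<epsilon> / (1 - \<beta>) + K)"
        using nn_integral_growth_tail[OF \<beta>(2) less_imp_le[OF \<epsilon>(1)] \<epsilon>(2), of 0] by simp
      finally show "(\<integral>\<^sup>+s. ennreal (\<epsilon> * (1 - s) powr (-\<beta>) + K) * indicator {0..r} s \<partial>lborel) \<le> ennreal (\<epsilon> / (1 - \<beta>) + K)" .
    qed (use \<epsilon> \<beta> in auto)
    then show ?thesis by (simp add: B_def)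
  qed
  have dF: "deriv F holomorphic_on unit_disc" by (rule holomorphic_deriv[OF F]) simp
  have F1: "binom_deriv F (Suc 0) holomorphic_on unit_disc" by (rule holomorphic_binom_deriv[OF F])
  have big: "mean_pow p r (deriv F) \<le> ennreal ((4 * (2 * (\<epsilon> * (1 - r) powr (-\<beta>) + K) + 2 * B)) powr p)" if r: "1/2 \<le> r" "r < 1" for r
  proof -
    have r0: "0 \<le> r" using r by simp
    have [measurable]: "(\<lambda>t. F (of_real r * cis t)) \<in> borel_measurable borel" by (rule holomorphic_circle_measurable[OF F r0 r(2)])
    have [measurable]: "(\<lambda>t. binom_deriv F (Suc 0) (of_real r * cis t)) \<in> borel_measurable borel" by (rule holomorphic_circle_measurable[OF F1 r0 r(2)])
    have sc: "(\<integral>\<^sup>+t. ennreal ((2 * norm (f (of_real r * cis t))) powr p) \<partial>circ) \<le> ennreal ((2 * A) powr p)"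
      if [measurable]: "(\<lambda>t. f (of_real r * cis t)) \<in> borel_measurable borel" and A: "A \<ge> 0" "mean_pow p r f \<le> ennreal (A powr p)" for f :: "complex \<Rightarrow> complex" and A
    proof -
      have "(\<integral>\<^sup>+t. ennreal ((2 * norm (f (of_real r * cis t))) powr p) \<partial>circ) = ennreal (2 powr p) * mean_pow p r f"
        unfolding mean_pow_def by (subst nn_integral_cmult[symmetric]) (auto simp: powr_mult ennreal_mult)
      also have "\<dots> \<le> ennreal (2 powr p) * ennreal (A powr p)" by (intro mult_left_mono A) auto
      also have "\<dots> = ennreal ((2 * A) powr p)" using A by (simp add: ennreal_mult[symmetric] powr_mult)
      finally show ?thesis .
    qed
    show ?thesis unfolding mean_pow_def
    proof (rule nn_integral_powr_triangle[where u = "\<lambda>t. 2 * norm (binom_deriv F (Suc 0) (of_real r * cis t))" and v = "\<lambda>t. 2 * norm (F (of_real r * cis t))"])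
      show "(\<integral>\<^sup>+t. ennreal ((2 * norm (binom_deriv F (Suc 0) (of_real r * cis t))) powr p) \<partial>circ) \<le> ennreal ((2 * (\<epsilon> * (1 - r) powr (-\<beta>) + K)) powr p)"
        by (rule sc) (use \<epsilon> mean_growthD[OF gr' r0 r(2)] in \<open>simp_all add: \<beta>_def del: binom_deriv.simps\<close>)
      show "(\<integral>\<^sup>+t. ennreal ((2 * norm (F (of_real r * cis t))) powr p) \<partial>circ) \<le> ennreal ((2 * B) powr p)"
        by (rule sc) (use B mF[OF r] in simp_all)
      fix t
      define z where "z = of_real r * cis t"
      have "z * deriv F z = binom_deriv F (Suc 0) z - F z" by simp
      then have "norm (z * deriv F z) \<le> norm (binom_deriv F (Suc 0) z) + norm (F z)" by (metis norm_triangle_ineq4)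
      moreover have "1/2 * norm (deriv F z) \<le> norm (z * deriv F z)" using r unfolding norm_mult by (intro mult_right_mono) (auto simp: z_def norm_mult)
      ultimately show "norm (deriv F (of_real r * cis t)) \<le> 2 * norm (binom_deriv F (Suc 0) (of_real r * cis t)) + 2 * norm (F (of_real r * cis t))"
        unfolding z_def by linarith
    qed (use p1 \<epsilon> B in \<open>auto simp del: binom_deriv.simps\<close>)
  qed
  define K' where "K' = 8 * (\<epsilon> * (1/2) powr (-\<beta>) + K + B)"
  have K': "K' \<ge> 0" "K' \<ge> 8 * K + 8 * B" using \<epsilon> B by (auto simp: K'_def)
  have "mean_growth p \<beta> (8 * \<epsilon>) K' (deriv F)"
    unfolding mean_growth_def
  proof (intro allI impI)
    fix r :: real assume "0 \<le> r \<and> r < 1"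
    then have r: "0 \<le> r" "r < 1" by auto
    show "mean_pow p r (deriv F) \<le> ennreal ((8 * \<epsilon> * (1 - r) powr - \<beta> + K') powr p)"
    proof (cases "1/2 \<le> r")
      case True
      show ?thesis by (rule order_trans[OF big[OF True r(2)]], intro ennreal_leI powr_mono2) (use p1 \<epsilon> B K' in auto)
    next
      case False
      have "mean_pow p r (deriv F) \<le> mean_pow p (1/2) (deriv F)"
        using False r p1 by (intro mean_pow_mono[OF dF]) auto
      also have "\<dots> \<le> ennreal (K' powr p)" using big[of "1/2"] by (simp add: K'_def algebra_simps)
      also have "\<dots> \<le> ennreal ((8 * \<epsilon> * (1 - r) powr - \<beta> + K') powr p)"
        using K' \<epsilon> p by (intro ennreal_leI powr_mono2) auto
      finally show ?thesis .
    qed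
  qed
  then show ?thesis using that[OF K'(1)] by (simp add: \<beta>_def)
qed

text \<open>Any \<open>j\<close> with \<open>j p > \<alpha> + 2\<close> serves: the growth of \<open>binom_deriv F j\<close> is read off from the test
  functions and then integrated down to \<open>F'\<close>.\<close>

lemma mean_growth_deriv_of_binom_deriv:
  assumes p: "p > 1"
  obtains C where "C > 0" "\<And>F \<epsilon> K. F holomorphic_on unit_disc \<Longrightarrow> \<epsilon> > 0 \<Longrightarrow> K \<ge> 0 \<Longrightarrow> mean_growth p (real (Suc j) - 1/p) \<epsilon> K (binom_deriv F (Suc j)) \<Longrightarrow>
    \<exists>K'\<ge>0. mean_growth p (1 - 1/p) (C * \<epsilon>) K' (deriv F)"
proof -
  obtain C where C: "C > 0" "\<And>F \<epsilon> K. F holomorphic_on unit_disc \<Longrightarrow> \<epsilon> > 0 \<Longrightarrow> K \<ge> 0 \<Longrightarrow> mean_growth p (real (Suc j) - 1/p) \<epsilon> K (binom_deriv F (Suc j)) \<Longrightarrow>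
    (\<exists>K'\<ge>0. mean_growth p (1 - 1/p) (C * \<epsilon>) K' (binom_deriv F (Suc 0)))"
    using mean_growth_binom_deriv_descend_1[OF p, of j] by blast
  show ?thesis
  proof (rule that[of "8 * C"])
    show "8 * C > 0" using C by simp
    fix F \<epsilon> K assume a: "F holomorphic_on unit_disc" "\<epsilon> > 0" "K \<ge> 0" "mean_growth p (real (Suc j) - 1/p) \<epsilon> K (binom_deriv F (Suc j))"
    obtain K1 where K1: "K1 \<ge> 0" "mean_growth p (1 - 1/p) (C * \<epsilon>) K1 (binom_deriv F (Suc 0))" using C(2)[OF a] unfolding One_nat_def by blast
    have "C * \<epsilon> > 0" using C(1) a(2) by simp
    from mean_growth_deriv[OF p a(1) this K1] show "\<exists>K'\<ge>0. mean_growth p (1 - 1/p) (8 * C * \<epsilon>) K' (deriv F)"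
      by (metis mult.assoc)
  qed
qed

lemma exists_test_order:
  assumes "p > (0::real)"
  obtains j where "real (Suc j) * p > \<alpha> + 2"
proof -
  obtain n :: nat where "(\<alpha> + 2) / p < real n" using reals_Archimedean2 by blast
  then have "\<alpha> + 2 < real n * p" using assms by (simp add: field_simps)
  also have "\<dots> \<le> real (Suc n) * p" using assms by (intro mult_right_mono) auto
  finally show ?thesis by (rule that)
qed

theorem growth_of_Rhaly_bounded:
  assumes p: "p > 1" and \<alpha>: "\<alpha> > -1" and bd: "Rhaly_bounded_Bergman \<eta> p \<alpha>"
  shows "fps_conv_radius (Abs_fps \<eta>) \<ge> 1" "\<exists>\<epsilon>>0. \<exists>K\<ge>0. mean_growth p (1 - 1/p) \<epsilon> K (deriv (symbol_fun \<eta>))"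
proof -
  have p1: "p \<ge> 1" and p0: "p > 0" using p by auto
  show \<eta>: "fps_conv_radius (Abs_fps \<eta>) \<ge> 1"
    by (rule symbol_conv_radius[OF _ \<alpha> p1]) (use bd in \<open>simp add: Rhaly_bounded_Bergman_def\<close>)
  obtain j where j: "real (Suc j) * p > \<alpha> + 2" using exists_test_order[OF p0] by blast
  obtain A where A: "\<And>f. f \<in> Bergman p \<alpha> \<Longrightarrow> Bergman_norm p \<alpha> (Rhaly \<eta> f) \<le> A * Bergman_norm p \<alpha> f"
    using bd unfolding Rhaly_bounded_Bergman_def bounded_operator_on_def by blast
  have mem: "Rhaly \<eta> f \<in> Bergman p \<alpha>" if "f \<in> Bergman p \<alpha>" for f
    using bd that by (auto simp: Rhaly_bounded_Bergman_def bounded_operator_on_def linear_operator_on_def)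
  obtain C0 where C0: "\<And>a. 0 \<le> a \<Longrightarrow> a < 1 \<Longrightarrow> scaled_test_fun p \<alpha> (Suc j) a \<in> Bergman p \<alpha>"
    "\<And>a. 0 \<le> a \<Longrightarrow> a < 1 \<Longrightarrow> Bergman_norm p \<alpha> (scaled_test_fun p \<alpha> (Suc j) a) \<le> C0"
    using scaled_test_fun_Bergman[OF p1 \<alpha> j] by blast
  \<comment> \<open>A might be negative, hence the absolute value; the summand 1 makes T
    positive.\<close>
  define T where "T = \<bar>A\<bar> * C0 + 1"
  have C00: "C0 \<ge> 0" using C0(2)[of 0] Bergman_norm_nonneg[of p \<alpha> "scaled_test_fun p \<alpha> (Suc j) 0"] by linarith
  have T: "T > 0" using C00 by (simp add: T_def add_nonneg_pos)
  have TB: "Bergman_norm p \<alpha> (Rhaly \<eta> (scaled_test_fun p \<alpha> (Suc j) a)) \<le> T" if a: "0 \<le> a" "a < 1" for a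
  proof -
    have "Bergman_norm p \<alpha> (Rhaly \<eta> (scaled_test_fun p \<alpha> (Suc j) a)) \<le> A * Bergman_norm p \<alpha> (scaled_test_fun p \<alpha> (Suc j) a)" by (rule A[OF C0(1)[OF a]])
    also have "\<dots> \<le> \<bar>A\<bar> * C0" using C0(2)[OF a] by (intro mult_mono) (auto simp: Bergman_norm_nonneg)
    finally show ?thesis by (simp add: T_def)
  qed
  define \<epsilon> where "\<epsilon> = 2 powr (real (Suc j) - (\<alpha> + 2) / p) * T"
  have \<epsilon>: "\<epsilon> > 0" using T by (simp add: \<epsilon>_def)
  have "mean_growth p (real (Suc j) - 1/p) \<epsilon> 0 (binom_deriv (symbol_fun \<eta>) (Suc j))"
    unfolding mean_growth_def
  proof (intro allI impI)
    fix r :: real assume "0 \<le> r \<and> r < 1"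
    then have r: "0 \<le> r" "r < 1" "0 \<le> sqrt r" "sqrt r < 1" by auto
    show "mean_pow p r (binom_deriv (symbol_fun \<eta>) (Suc j)) \<le> ennreal ((\<epsilon> * (1 - r) powr - (real (Suc j) - 1/p) + 0) powr p)"
      using mean_pow_binom_deriv_le[OF p1 \<alpha> \<eta> j r(1,2) mem[OF C0(1)[OF r(3,4)]] TB[OF r(3,4)]] by (simp add: \<epsilon>_def del: of_nat_Suc binom_deriv.simps)
  qed
  moreover obtain C where C: "C > 0" "\<And>F \<epsilon> K. F holomorphic_on unit_disc \<Longrightarrow> \<epsilon> > 0 \<Longrightarrow> K \<ge> 0 \<Longrightarrow> mean_growth p (real (Suc j) - 1/p) \<epsilon> K (binom_deriv F (Suc j)) \<Longrightarrow>
    \<exists>K'\<ge>0. mean_growth p (1 - 1/p) (C * \<epsilon>) K' (deriv F)"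
    using mean_growth_deriv_of_binom_deriv[OF p, of j] by blast
  ultimately have "\<exists>K'\<ge>0. mean_growth p (1 - 1/p) (C * \<epsilon>) K' (deriv (symbol_fun \<eta>))"
    using symbol_fun_expansion(1)[OF \<eta>] \<epsilon> by (metis order_refl)
  moreover have "C * \<epsilon> > 0" using C(1) \<epsilon> by simp
  ultimately show "\<exists>\<epsilon>>0. \<exists>K\<ge>0. mean_growth p (1 - 1/p) \<epsilon> K (deriv (symbol_fun \<eta>))" by blast
qed

text \<open>The scaled test functions are bounded in norm while their images tend to zero pointwise.\<close>

lemma Rhaly_scaled_test_fun_tendsto:
  assumes p: "p > 1" and \<alpha>: "\<alpha> > -1" and j: "real j * p > \<alpha> + 2" and cp: "Rhaly_compact_Bergman \<eta> p \<alpha>" and \<epsilon>: "\<epsilon> > 0"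
  shows "\<exists>a0<1. 0 \<le> a0 \<and> (\<forall>a. a0 \<le> a \<and> a < 1 \<longrightarrow> Bergman_norm p \<alpha> (Rhaly \<eta> (scaled_test_fun p \<alpha> j a)) \<le> \<epsilon>)"
proof (rule ccontr)
  assume neg: "\<not> ?thesis"
  have p1: "p \<ge> 1" and p0: "p > 0" using p by auto
  have \<eta>: "fps_conv_radius (Abs_fps \<eta>) \<ge> 1"
    by (rule symbol_conv_radius[OF _ \<alpha> p1]) (use cp in \<open>simp add: Rhaly_compact_Bergman_def\<close>)
  let ?\<phi> = "scaled_test_fun p \<alpha> j"
  \<comment> \<open>A failure at every \<open>rad n\<close> yields parameters tending to 1 whose
    images have norm above \<epsilon>. Compactness provides a norm limit g of a subsequence, and g =
    0 is the contradiction.\<close>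
  have "\<exists>a. rad n \<le> a \<and> a < 1 \<and> Bergman_norm p \<alpha> (Rhaly \<eta> (?\<phi> a)) > \<epsilon>" for n
  proof -
    have "\<not> (\<forall>a. rad n \<le> a \<and> a < 1 \<longrightarrow> Bergman_norm p \<alpha> (Rhaly \<eta> (?\<phi> a)) \<le> \<epsilon>)"
      using neg rad_bounds[of n] by blast
    then show ?thesis by (auto simp: not_le)
  qed
  then obtain a where a: "\<And>n. rad n \<le> a n" "\<And>n. a n < 1" "\<And>n. Bergman_norm p \<alpha> (Rhaly \<eta> (?\<phi> (a n))) > \<epsilon>" by metis
  have a0: "0 \<le> a n" for n using a(1)[of n] rad_bounds(1)[of n] by linarith
  have alim: "a \<longlonglongrightarrow> 1"
    by (rule tendsto_sandwich[OF _ _ rad_tendsto tendsto_const]) (use a in \<open>auto simp: less_imp_le\<close>)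
  obtain C0 where C0: "\<And>a. 0 \<le> a \<Longrightarrow> a < 1 \<Longrightarrow> ?\<phi> a \<in> Bergman p \<alpha>" "\<And>a. 0 \<le> a \<Longrightarrow> a < 1 \<Longrightarrow> Bergman_norm p \<alpha> (?\<phi> a) \<le> C0"
    using scaled_test_fun_Bergman[OF p1 \<alpha> j] by blast
  have "(\<forall>n. ?\<phi> (a n) \<in> Bergman p \<alpha>) \<and> bdd_above (range (\<lambda>n. Bergman_norm p \<alpha> (?\<phi> (a n))))"
    using C0 a0 a(2) by (auto intro!: bdd_aboveI2)
  then obtain s g where s: "strict_mono s" and g: "g \<in> Bergman p \<alpha>" and
    conv: "(\<lambda>n. Bergman_norm p \<alpha> (\<lambda>z. Rhaly \<eta> (?\<phi> (a (s n))) z - g z)) \<longlonglongrightarrow> 0"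
    using cp unfolding Rhaly_compact_Bergman_def compact_operator_on_def by meson
  have mem: "Rhaly \<eta> f \<in> Bergman p \<alpha>" if "f \<in> Bergman p \<alpha>" for f
    using cp that by (auto simp: Rhaly_compact_Bergman_def compact_operator_on_def linear_operator_on_def)
  have gh: "g holomorphic_on unit_disc" using g Bergman_iff[OF \<alpha>] by blast
  have Rh: "Rhaly \<eta> (?\<phi> (a n)) holomorphic_on unit_disc" for n
    using holomorphic_Rhaly[OF \<eta> holomorphic_scaled_test_fun[OF a0 a(2)]] .
  have e: "real j - (\<alpha> + 2) / p > 0" using j p0 by (simp add: field_simps)
  \<comment> \<open>Norm convergence forces pointwise convergence to g by
    \<open>bergman_int_pointwise\<close>, while the positive power of 1 - a in the scaling sends the
    images to 0 at each point.\<close>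
  have g0: "g z = 0" if z: "norm z < 1" for z
  proof -
    have F: "binom_deriv (symbol_fun \<eta>) j holomorphic_on unit_disc" by (rule holomorphic_binom_deriv[OF symbol_fun_expansion(1)[OF \<eta>]])
    obtain M where M: "M \<ge> 0" "\<And>w. norm w \<le> norm z \<Longrightarrow> norm (binom_deriv (symbol_fun \<eta>) j w) \<le> M"
      using holomorphic_circle_bounded[OF F z] by blast
    have "(\<lambda>n. Rhaly \<eta> (?\<phi> (a (s n))) z) \<longlonglongrightarrow> 0"
    proof (rule Lim_null_comparison)
      have "norm (Rhaly \<eta> (?\<phi> (a (s n))) z) \<le> (1 - a (s n)) powr (real j - (\<alpha> + 2) / p) * M" for n
      proof -
        have "norm (of_real (a (s n)) * z) \<le> 1 * norm z" unfolding norm_mult using a0[of "s n"] a(2)[of "s n"] by (intro mult_right_mono) auto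
        then have "norm (binom_deriv (symbol_fun \<eta>) j (of_real (a (s n)) * z)) \<le> M" by (intro M(2)) simp
        then show ?thesis
          unfolding Rhaly_scaled_test_fun[OF \<eta> a0 a(2) z] norm_mult by (simp add: mult_left_mono)
      qed
      then show "eventually (\<lambda>n. norm (Rhaly \<eta> (?\<phi> (a (s n))) z) \<le> (1 - a (s n)) powr (real j - (\<alpha> + 2) / p) * M) sequentially" by simp
      have "(\<lambda>n. 1 - a (s n)) \<longlonglongrightarrow> 1 - 1"
        using LIMSEQ_subseq_LIMSEQ[OF alim s] by (intro tendsto_intros) (simp add: o_def)
      then have "(\<lambda>n. (1 - a (s n)) powr (real j - (\<alpha> + 2) / p) * M) \<longlonglongrightarrow> 0 powr (real j - (\<alpha> + 2) / p) * M"
        using a(2) e by (intro tendsto_mult tendsto_powr2 tendsto_const) (auto simp: less_imp_le)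
      then show "(\<lambda>n. (1 - a (s n)) powr (real j - (\<alpha> + 2) / p) * M) \<longlonglongrightarrow> 0" using e by simp
    qed
    moreover have "(\<lambda>n. Rhaly \<eta> (?\<phi> (a (s n))) z - g z) \<longlonglongrightarrow> 0"
    proof -
      obtain C where C: "C > 0" "\<And>f z'. f holomorphic_on unit_disc \<Longrightarrow> norm z' \<le> norm z \<Longrightarrow> ennreal (norm (f z') powr p) \<le> ennreal C * bergman_int p \<alpha> f"
        using bergman_int_pointwise[OF \<alpha> p1 norm_ge_zero z] by blast
      let ?d = "\<lambda>n z. Rhaly \<eta> (?\<phi> (a (s n))) z - g z"
      have dh: "?d n holomorphic_on unit_disc" for n by (intro holomorphic_intros Rh gh)
      have dB: "?d n \<in> Bergman p \<alpha>" for n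
      proof -
        have f: "Rhaly \<eta> (?\<phi> (a (s n))) \<in> Bergman p \<alpha>" by (rule mem[OF C0(1)[OF a0 a(2)]])
        have "bergman_int p \<alpha> (\<lambda>w. 1 * Rhaly \<eta> (?\<phi> (a (s n))) w + (-1) * g w) \<le> ennreal (2 powr p) * ((bergman_int p \<alpha> (Rhaly \<eta> (?\<phi> (a (s n)))) + bergman_int p \<alpha> g) + (bergman_int p \<alpha> (Rhaly \<eta> (?\<phi> (a (s n)))) + bergman_int p \<alpha> g))"
          by (rule bergman_int_diff_le[OF Rh gh p1]) (auto simp: add_increasing add_increasing2)
        also have "\<dots> < \<infinity>" using f g unfolding Bergman_iff[OF \<alpha>] by (simp add: ennreal_mult_less_top)
        finally show ?thesis unfolding Bergman_iff[OF \<alpha>] using dh by simp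
      qed
      have le: "norm (?d n z) \<le> C powr (1/p) * Bergman_norm p \<alpha> (?d n)" for n
      proof -
        have "ennreal (norm (?d n z) powr p) \<le> ennreal C * ennreal (Bergman_norm p \<alpha> (?d n) powr p)"
          using C(2)[OF dh order_refl] unfolding bergman_int_eq_norm[OF \<alpha> dB p0] .
        then have "norm (?d n z) powr p \<le> C * Bergman_norm p \<alpha> (?d n) powr p" using C(1) by (simp add: ennreal_mult[symmetric])
        then have "(norm (?d n z) powr p) powr (1/p) \<le> (C * Bergman_norm p \<alpha> (?d n) powr p) powr (1/p)" using p0 by (intro powr_mono2) auto
        then show ?thesis using p0 C(1) by (simp add: powr_mult powr_powr Bergman_norm_nonneg)
      qed
      show ?thesis
        by (rule Lim_null_comparison[OF always_eventually tendsto_mult_right_zero[OF conv]]) (use le in blast)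
    qed
    ultimately have "(\<lambda>n. Rhaly \<eta> (?\<phi> (a (s n))) z - (Rhaly \<eta> (?\<phi> (a (s n))) z - g z)) \<longlonglongrightarrow> 0 - 0"
      by (rule tendsto_diff)
    then show ?thesis by (simp add: LIMSEQ_const_iff)
  qed
  have "Bergman_norm p \<alpha> (\<lambda>z. Rhaly \<eta> (?\<phi> (a (s n))) z - g z) = Bergman_norm p \<alpha> (Rhaly \<eta> (?\<phi> (a (s n))))" for n
  proof -
    have "bergman_int p \<alpha> (\<lambda>z. Rhaly \<eta> (?\<phi> (a (s n))) z - g z) = bergman_int p \<alpha> (Rhaly \<eta> (?\<phi> (a (s n))))"
      by (rule bergman_int_cong) (simp add: g0)
    moreover have "(\<lambda>z. Rhaly \<eta> (?\<phi> (a (s n))) z - g z) holomorphic_on unit_disc" by (intro holomorphic_intros Rh gh)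
    ultimately show ?thesis using Rh by (simp add: Bergman_norm_eq[OF \<alpha>])
  qed
  then have "(\<lambda>n. Bergman_norm p \<alpha> (Rhaly \<eta> (?\<phi> (a (s n))))) \<longlonglongrightarrow> 0" using conv by simp
  then have "\<epsilon> \<le> 0"
    by (rule tendsto_lowerbound) (use a(3) in \<open>auto simp: less_imp_le\<close>)
  then show False using \<epsilon> by simp
qed

text \<open>Smallness of the images for a >= a0 is the growth bound with a small constant for r >=
  a0^2; smaller r are absorbed in K by monotonicity of the means.\<close>

theorem growth_of_Rhaly_compact:
  assumes p: "p > 1" and \<alpha>: "\<alpha> > -1" and cp: "Rhaly_compact_Bergman \<eta> p \<alpha>"
  shows "fps_conv_radius (Abs_fps \<eta>) \<ge> 1" "\<epsilon> > 0 \<Longrightarrow> \<exists>K\<ge>0. mean_growth p (1 - 1/p) \<epsilon> K (deriv (symbol_fun \<eta>))"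
proof -
  have p1: "p \<ge> 1" and p0: "p > 0" using p by auto
  show \<eta>: "fps_conv_radius (Abs_fps \<eta>) \<ge> 1"
    by (rule symbol_conv_radius[OF _ \<alpha> p1]) (use cp in \<open>simp add: Rhaly_compact_Bergman_def\<close>)
  assume \<epsilon>: "\<epsilon> > 0"
  have F: "symbol_fun \<eta> holomorphic_on unit_disc" by (rule symbol_fun_expansion(1)[OF \<eta>])
  obtain j where j: "real (Suc j) * p > \<alpha> + 2" using exists_test_order[OF p0] by blast
  obtain C where C: "C > 0" "\<And>F \<epsilon> K. F holomorphic_on unit_disc \<Longrightarrow> \<epsilon> > 0 \<Longrightarrow> K \<ge> 0 \<Longrightarrow> mean_growth p (real (Suc j) - 1/p) \<epsilon> K (binom_deriv F (Suc j)) \<Longrightarrow>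
    \<exists>K'\<ge>0. mean_growth p (1 - 1/p) (C * \<epsilon>) K' (deriv F)"
    using mean_growth_deriv_of_binom_deriv[OF p, of j] by blast
  let ?e = "real (Suc j) - (\<alpha> + 2) / p"
  \<comment> \<open>Compensates the power of 2 in \<open>mean_pow_binom_deriv_le\<close> and the
    constant C of the descent.\<close>
  define \<tau> where "\<tau> = \<epsilon> / C / 2 powr ?e"
  have \<tau>: "\<tau> > 0" using \<epsilon> C by (simp add: \<tau>_def)
  have e\<tau>: "2 powr ?e * \<tau> = \<epsilon> / C" by (simp add: \<tau>_def del: of_nat_Suc)
  obtain a0 where a0: "0 \<le> a0" "a0 < 1" "\<And>a. a0 \<le> a \<Longrightarrow> a < 1 \<Longrightarrow> Bergman_norm p \<alpha> (Rhaly \<eta> (scaled_test_fun p \<alpha> (Suc j) a)) \<le> \<tau>"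
    using Rhaly_scaled_test_fun_tendsto[OF p \<alpha> j cp \<tau>] by blast
  obtain C0 where C0: "\<And>a. 0 \<le> a \<Longrightarrow> a < 1 \<Longrightarrow> scaled_test_fun p \<alpha> (Suc j) a \<in> Bergman p \<alpha>"
    using scaled_test_fun_Bergman[OF p1 \<alpha> j] by blast
  have mem: "Rhaly \<eta> f \<in> Bergman p \<alpha>" if "f \<in> Bergman p \<alpha>" for f
    using cp that by (auto simp: Rhaly_compact_Bergman_def compact_operator_on_def linear_operator_on_def)
  let ?F = "binom_deriv (symbol_fun \<eta>) (Suc j)"
  have Fj: "?F holomorphic_on unit_disc" by (rule holomorphic_binom_deriv[OF F])
  have big: "mean_pow p r ?F \<le> ennreal ((\<epsilon> / C * (1 - r) powr - (real (Suc j) - 1/p)) powr p)" if r: "a0\<^sup>2 \<le> r" "r < 1" for r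
  proof -
    have r': "0 \<le> r" "0 \<le> sqrt r" "sqrt r < 1" "a0 \<le> sqrt r" using r a0 order_trans[OF zero_le_power2 r(1)] by (auto simp: real_le_rsqrt)
    show ?thesis
      using mean_pow_binom_deriv_le[OF p1 \<alpha> \<eta> j r'(1) r(2) mem[OF C0[OF r'(2,3)]] a0(3)[OF r'(4,3)]] unfolding e\<tau> .
  qed
  define K where "K = \<epsilon> / C * (1 - a0\<^sup>2) powr - (real (Suc j) - 1/p)"
  have K: "K \<ge> 0" using \<epsilon> C by (simp add: K_def)
  have a02: "a0\<^sup>2 < 1" using a0 by (auto simp: abs_square_less_1)
  have "mean_growth p (real (Suc j) - 1/p) (\<epsilon> / C) K ?F"
    unfolding mean_growth_def
  proof (intro allI impI)
    fix r :: real assume "0 \<le> r \<and> r < 1"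
    then have r: "0 \<le> r" "r < 1" by auto
    show "mean_pow p r ?F \<le> ennreal ((\<epsilon> / C * (1 - r) powr - (real (Suc j) - 1/p) + K) powr p)"
    proof (cases "a0\<^sup>2 \<le> r")
      case True
      show ?thesis by (rule order_trans[OF big[OF True r(2)]], intro ennreal_leI powr_mono2) (use p0 \<epsilon> C K in auto)
    next
      case False
      have "mean_pow p r ?F \<le> mean_pow p (a0\<^sup>2) ?F" using False r a02 p1 by (intro mean_pow_mono[OF Fj]) auto
      also have "\<dots> \<le> ennreal (K powr p)" unfolding K_def by (rule big[OF order_refl a02])
      also have "\<dots> \<le> ennreal ((\<epsilon> / C * (1 - r) powr - (real (Suc j) - 1/p) + K) powr p)"
        using p0 \<epsilon> C K by (intro ennreal_leI powr_mono2) auto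
      finally show ?thesis .
    qed
  qed
  from C(2)[OF F _ K this] \<epsilon> C(1) show "\<exists>K\<ge>0. mean_growth p (1 - 1/p) \<epsilon> K (deriv (symbol_fun \<eta>))" by simp
qed

section \<open>Mean Lipschitz symbols\<close>

lemma mean_LipschitzD:
  assumes "F \<in> mean_Lipschitz p \<alpha>"
  obtains c \<delta>0 where "c > 0" "\<delta>0 > 0" "\<And>\<delta>. 0 < \<delta> \<Longrightarrow> \<delta> < \<delta>0 \<Longrightarrow> mean_modulus p \<delta> F \<le> c * \<delta> powr \<alpha>"
proof -
  have "(\<lambda>\<delta>. mean_modulus p \<delta> F) \<in> O[at_right 0](\<lambda>\<delta>. \<delta> powr \<alpha>)" using assms by (simp add: mean_Lipschitz_def)
  then obtain c where c: "c > 0" "eventually (\<lambda>\<delta>. norm (mean_modulus p \<delta> F) \<le> c * norm (\<delta> powr \<alpha>)) (at_right 0)"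
    by (elim landau_o.bigE)
  then obtain \<delta>0 where "\<delta>0 > 0" "\<And>\<delta>. 0 < \<delta> \<Longrightarrow> \<delta> < \<delta>0 \<Longrightarrow> norm (mean_modulus p \<delta> F) \<le> c * norm (\<delta> powr \<alpha>)"
    unfolding eventually_at_right_field by auto
  then show ?thesis using c(1) by (intro that[of c \<delta>0]) (auto simp: abs_le_iff)
qed

lemma little_mean_LipschitzD:
  assumes "F \<in> little_mean_Lipschitz p \<alpha>" "c > 0"
  obtains \<delta>0 where "\<delta>0 > 0" "\<And>\<delta>. 0 < \<delta> \<Longrightarrow> \<delta> < \<delta>0 \<Longrightarrow> mean_modulus p \<delta> F \<le> c * \<delta> powr \<alpha>"
proof -
  have "(\<lambda>\<delta>. mean_modulus p \<delta> F) \<in> o[at_right 0](\<lambda>\<delta>. \<delta> powr \<alpha>)" using assms by (simp add: little_mean_Lipschitz_def)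
  then have "eventually (\<lambda>\<delta>. norm (mean_modulus p \<delta> F) \<le> c * norm (\<delta> powr \<alpha>)) (at_right 0)"
    using assms(2) by (rule landau_o.smallD)
  then obtain \<delta>0 where "\<delta>0 > 0" "\<And>\<delta>. 0 < \<delta> \<Longrightarrow> \<delta> < \<delta>0 \<Longrightarrow> norm (mean_modulus p \<delta> F) \<le> c * norm (\<delta> powr \<alpha>)"
    unfolding eventually_at_right_field by auto
  then show ?thesis by (intro that[of \<delta>0]) (auto simp: abs_le_iff)
qed

lemma Rhaly_bounded_of_Lipschitz:
  assumes \<alpha>: "\<alpha> > -1" and p: "1 \<le> p" and s: "symbol_in \<eta> (mean_Lipschitz p (1/p))"
  shows "Rhaly_bounded_Bergman \<eta> p \<alpha>"
proof -
  let ?F = "symbol_fun \<eta>"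
  have \<eta>: "fps_conv_radius (Abs_fps \<eta>) \<ge> 1" and F: "?F \<in> mean_Lipschitz p (1/p)" using s by (auto simp: symbol_in_def)
  have H: "?F \<in> Hardy p" and lim: "AE \<theta> in lebesgue. has_radial_limit ?F (cis \<theta>)" using F by (auto simp: mean_Lipschitz_def)
  obtain c \<delta>0 where c: "c > 0" "\<delta>0 > 0" "\<And>\<delta>. 0 < \<delta> \<Longrightarrow> \<delta> < \<delta>0 \<Longrightarrow> mean_modulus p \<delta> ?F \<le> c * \<delta> powr (1/p)"
    using mean_LipschitzD[OF F] by blast
  have "\<exists>\<epsilon>\<ge>0. \<exists>K\<ge>0. mean_growth p (1 - 1/p) \<epsilon> K (binom_deriv ?F 1)"
  proof (cases "p = 1")
    case True
    have "\<exists>K\<ge>0. mean_growth 1 0 (4 * c) K (binom_deriv ?F 1)"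
      by (rule mean_growth_of_modulus_1[of ?F c \<delta>0]) (use H lim c True in auto)
    then show ?thesis using True c(1) by (intro exI[of _ "4 * c"]) simp
  next
    case False
    then have "p > 1" using p by simp
    then obtain C where "C > 0" "\<And>F \<epsilon> \<delta>0. F \<in> Hardy p \<Longrightarrow> (AE \<theta> in lebesgue. has_radial_limit F (cis \<theta>)) \<Longrightarrow> \<epsilon> > 0 \<Longrightarrow> \<delta>0 > 0 \<Longrightarrow>
      (\<And>\<delta>. 0 < \<delta> \<Longrightarrow> \<delta> < \<delta>0 \<Longrightarrow> mean_modulus p \<delta> F \<le> \<epsilon> * \<delta> powr (1/p)) \<Longrightarrow> \<exists>K\<ge>0. mean_growth p (1 - 1/p) (C * \<epsilon>) K (binom_deriv F 1)"
      using mean_growth_of_modulus by blast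
    from this(1) this(2)[OF H lim c] show ?thesis using c(1) by (intro exI[of _ "C * c"]) simp
  qed
  then show ?thesis using Rhaly_bounded_of_growth[OF p \<alpha> \<eta>] by blast
qed

lemma Rhaly_compact_of_little_Lipschitz:
  assumes \<alpha>: "\<alpha> > -1" and p: "1 < p" and s: "symbol_in \<eta> (little_mean_Lipschitz p (1/p))"
  shows "Rhaly_compact_Bergman \<eta> p \<alpha>"
proof -
  let ?F = "symbol_fun \<eta>"
  have \<eta>: "fps_conv_radius (Abs_fps \<eta>) \<ge> 1" and F: "?F \<in> little_mean_Lipschitz p (1/p)" using s by (auto simp: symbol_in_def)
  have H: "?F \<in> Hardy p" and lim: "AE \<theta> in lebesgue. has_radial_limit ?F (cis \<theta>)" using F by (auto simp: little_mean_Lipschitz_def)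
  obtain C where C: "C > 0" "\<And>F \<epsilon> \<delta>0. F \<in> Hardy p \<Longrightarrow> (AE \<theta> in lebesgue. has_radial_limit F (cis \<theta>)) \<Longrightarrow> \<epsilon> > 0 \<Longrightarrow> \<delta>0 > 0 \<Longrightarrow>
      (\<And>\<delta>. 0 < \<delta> \<Longrightarrow> \<delta> < \<delta>0 \<Longrightarrow> mean_modulus p \<delta> F \<le> \<epsilon> * \<delta> powr (1/p)) \<Longrightarrow> \<exists>K\<ge>0. mean_growth p (1 - 1/p) (C * \<epsilon>) K (binom_deriv F 1)"
    using mean_growth_of_modulus[OF p] by blast
  show ?thesis
  proof (rule Rhaly_compact_of_growth[OF p \<alpha> \<eta>])
    fix \<epsilon> :: real assume \<epsilon>: "\<epsilon> > 0"
    then have e: "\<epsilon> / C > 0" using C by simp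
    obtain \<delta>0 where "\<delta>0 > 0" "\<And>\<delta>. 0 < \<delta> \<Longrightarrow> \<delta> < \<delta>0 \<Longrightarrow> mean_modulus p \<delta> ?F \<le> \<epsilon> / C * \<delta> powr (1/p)"
      using little_mean_LipschitzD[OF F e] by blast
    from C(2)[OF H lim e this] show "\<exists>K\<ge>0. mean_growth p (1 - 1/p) \<epsilon> K (binom_deriv ?F 1)" using C(1) by simp
  qed
qed

lemma mean_growth_integral_mean:
  assumes "f holomorphic_on unit_disc" "p > 0" "\<epsilon> > 0" "K \<ge> 0" "mean_growth p \<beta> \<epsilon> K f" "0 \<le> r" "r < 1"
  shows "integral_mean p r f \<le> \<epsilon> * (1 - r) powr (-\<beta>) + K"
  using assms mean_growthD[OF assms(5-7)] by (subst integral_mean_le_iff) auto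

text \<open>No logarithm is actually lost, so that the bounds with the logarithm hold even with little \<open>o\<close>.\<close>

lemma integral_mean_deriv_smallo:
  assumes f: "f holomorphic_on unit_disc" and p: "p > 1" and \<epsilon>: "\<epsilon> > 0" "K \<ge> 0" and gr: "mean_growth p (1 - 1/p) \<epsilon> K f"
  shows "(\<lambda>r. integral_mean p r f) \<in> o[at_left 1](\<lambda>r. ln (1 / (1 - r)) / (1 - r) powr (1 - 1/p))"
proof (rule landau_o.smallI)
  fix c :: real assume c: "c > 0"
  have "filterlim (\<lambda>r::real. ln (1 / (1 - r))) at_top (at_left 1)" by real_asymp
  then have "eventually (\<lambda>r::real. ln (1 / (1 - r)) \<ge> (\<epsilon> + K) / c) (at_left 1)" by (simp add: filterlim_at_top)
  moreover have "eventually (\<lambda>r::real. 0 < r \<and> r < 1) (at_left 1)"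
    using eventually_at_left_real[of 0 "1::real"] by (auto elim: eventually_mono)
  ultimately show "eventually (\<lambda>r. norm (integral_mean p r f) \<le> c * norm (ln (1 / (1 - r)) / (1 - r) powr (1 - 1/p))) (at_left 1)"
  proof eventually_elim
    case (elim r)
    have "0 \<le> (\<epsilon> + K) / c" using \<epsilon> c by simp
    then have l0: "ln (1 / (1 - r)) \<ge> 0" using elim by linarith
    have "(1 - r) powr (1 - 1/p) \<le> 1" using elim p by (intro powr_le1) auto
    then have "1 \<le> (1 - r) powr (-(1 - 1/p))" unfolding powr_minus using elim by (intro one_le_inverse) auto
    then have "K * 1 \<le> K * (1 - r) powr (-(1 - 1/p))" using \<epsilon> by (intro mult_left_mono)
    moreover have "integral_mean p r f \<le> \<epsilon> * (1 - r) powr (-(1 - 1/p)) + K"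
      using elim p by (intro mean_growth_integral_mean[OF f _ \<epsilon> gr]) auto
    ultimately have "integral_mean p r f \<le> (\<epsilon> + K) * (1 - r) powr (-(1 - 1/p))" by (simp add: distrib_right)
    also have "\<dots> \<le> (c * ln (1 / (1 - r))) * (1 - r) powr (-(1 - 1/p))"
      using elim c by (intro mult_right_mono) (auto simp: field_simps)
    also have "\<dots> = c * (ln (1 / (1 - r)) / (1 - r) powr (1 - 1/p))" unfolding powr_minus by (simp add: divide_inverse)
    finally show ?case using l0 c integral_mean_nonneg[of p r f] by simp
  qed
qed

lemma holomorphic_deriv_symbol:
  "fps_conv_radius (Abs_fps \<eta>) \<ge> 1 \<Longrightarrow> deriv (symbol_fun \<eta>) holomorphic_on unit_disc"
  by (intro holomorphic_deriv symbol_fun_expansion) auto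

lemma symbol_in_Lipschitz_of_bounded:
  assumes \<alpha>: "\<alpha> > -1" and p: "1 < p" and bd: "Rhaly_bounded_Bergman \<eta> p \<alpha>"
  shows "symbol_in \<eta> (mean_Lipschitz p (1/p))"
proof -
  let ?F = "symbol_fun \<eta>"
  note \<eta> = growth_of_Rhaly_bounded(1)[OF p \<alpha> bd]
  have F: "?F holomorphic_on unit_disc" by (rule symbol_fun_expansion(1)[OF \<eta>])
  obtain \<epsilon> K where \<epsilon>: "\<epsilon> > 0" "K \<ge> 0" "mean_growth p (1 - 1/p) \<epsilon> K (deriv ?F)"
    using growth_of_Rhaly_bounded(2)[OF p \<alpha> bd] by blast
  note M = mean_modulus_of_deriv_growth[OF F p \<epsilon>]
  have "(\<lambda>\<delta>. mean_modulus p \<delta> ?F) \<in> O[at_right 0](\<lambda>\<delta>. \<delta> powr (1/p))"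
  proof (rule bigoI[where c = "48 * (\<epsilon> * p + K)"])
    have "eventually (\<lambda>\<delta>::real. 0 < \<delta> \<and> \<delta> < 1) (at_right 0)"
      using eventually_at_right_real[of 0 "1::real"] by (auto elim: eventually_mono)
    then show "eventually (\<lambda>\<delta>. norm (mean_modulus p \<delta> ?F) \<le> 48 * (\<epsilon> * p + K) * norm (\<delta> powr (1/p))) (at_right 0)"
    proof eventually_elim
      case (elim \<delta>)
      \<comment> \<open>The K term is of lower order, since \<delta> <= \<delta>^(1/p) for \<delta>
        < 1.\<close>
      have "\<delta> powr 1 \<le> \<delta> powr (1/p)" using elim p by (intro powr_mono') auto
      then have "K * \<delta> \<le> K * \<delta> powr (1/p)" using elim \<epsilon> by (intro mult_left_mono) auto
      then show ?case using M(3)[of \<delta>] elim by (simp add: algebra_simps)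
    qed
  qed
  then show ?thesis using \<eta> M(1,2) by (simp add: symbol_in_def mean_Lipschitz_def)
qed

lemma symbol_in_little_Lipschitz_of_compact:
  assumes \<alpha>: "\<alpha> > -1" and p: "1 < p" and cp: "Rhaly_compact_Bergman \<eta> p \<alpha>"
  shows "symbol_in \<eta> (little_mean_Lipschitz p (1/p))"
proof -
  let ?F = "symbol_fun \<eta>"
  note \<eta> = growth_of_Rhaly_compact(1)[OF p \<alpha> cp]
  have F: "?F holomorphic_on unit_disc" by (rule symbol_fun_expansion(1)[OF \<eta>])
  obtain K1 where "K1 \<ge> 0" "mean_growth p (1 - 1/p) 1 K1 (deriv ?F)"
    using growth_of_Rhaly_compact(2)[OF p \<alpha> cp, of 1] by auto
  note M1 = mean_modulus_of_deriv_growth(1,2)[OF F p zero_less_one this]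
  have "(\<lambda>\<delta>. mean_modulus p \<delta> ?F) \<in> o[at_right 0](\<lambda>\<delta>. \<delta> powr (1/p))"
  proof (rule landau_o.smallI)
    fix c :: real assume c: "c > 0"
    \<comment> \<open>Makes 48 * \<epsilon> * p equal to c/2; the other half of c is reserved for
      the K term.\<close>
    define \<epsilon> where "\<epsilon> = c / (96 * p)"
    have \<epsilon>: "\<epsilon> > 0" using c p by (simp add: \<epsilon>_def)
    obtain K where K: "K \<ge> 0" "mean_growth p (1 - 1/p) \<epsilon> K (deriv ?F)"
      using growth_of_Rhaly_compact(2)[OF p \<alpha> cp \<epsilon>] by blast
    \<comment> \<open>The K term is \<delta>^(1/p) times \<delta>^(1 - 1/p), and the second factor
      tends to 0 because p > 1.\<close>
    have "((\<lambda>\<delta>::real. 48 * K * \<delta> powr (1 - 1/p)) \<longlongrightarrow> 48 * K * 0 powr (1 - 1/p)) (at_right 0)"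
      using p by (intro tendsto_mult tendsto_const tendsto_powr2 tendsto_ident_at) (auto simp: eventually_at_right_less eventually_at intro!: exI[of _ 1])
    then have "((\<lambda>\<delta>::real. 48 * K * \<delta> powr (1 - 1/p)) \<longlongrightarrow> 0) (at_right 0)" using p by simp
    then have "eventually (\<lambda>\<delta>::real. 48 * K * \<delta> powr (1 - 1/p) < c / 2) (at_right 0)"
      using c by (intro order_tendstoD(2)) auto
    moreover have "eventually (\<lambda>\<delta>::real. 0 < \<delta> \<and> \<delta> < 1) (at_right 0)"
      using eventually_at_right_real[of 0 "1::real"] by (auto elim: eventually_mono)
    ultimately show "eventually (\<lambda>\<delta>. norm (mean_modulus p \<delta> ?F) \<le> c * norm (\<delta> powr (1/p))) (at_right 0)"
    proof eventually_elim
      case (elim \<delta>)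
      have "\<delta> = \<delta> powr (1 - 1/p) * \<delta> powr (1/p)" using elim by (simp add: powr_add[symmetric])
      then have "48 * K * \<delta> = (48 * K * \<delta> powr (1 - 1/p)) * \<delta> powr (1/p)" by (metis mult.assoc)
      also have "\<dots> \<le> c / 2 * \<delta> powr (1/p)" using elim by (intro mult_right_mono) auto
      finally have "48 * K * \<delta> \<le> c / 2 * \<delta> powr (1/p)" .
      moreover have "48 * (\<epsilon> * \<delta> powr (1/p) * p) = c / 2 * \<delta> powr (1/p)" using p by (simp add: \<epsilon>_def)
      moreover have "\<bar>mean_modulus p \<delta> ?F\<bar> \<le> 48 * (\<epsilon> * \<delta> powr (1/p) * p + K * \<delta>)"
        using elim by (intro mean_modulus_of_deriv_growth(3)[OF F p \<epsilon> K]) auto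
      ultimately have "\<bar>mean_modulus p \<delta> ?F\<bar> \<le> c * \<delta> powr (1/p)" unfolding distrib_left by linarith
      then show ?case by simp
    qed
  qed
  then show ?thesis using \<eta> M1 by (simp add: symbol_in_def little_mean_Lipschitz_def)
qed

theorem theorem3:
  fixes \<eta> :: "nat \<Rightarrow> complex"
  shows
    "(\<forall>\<alpha> p. \<alpha> > -1 \<and> 1 \<le> p \<and> symbol_in \<eta> (mean_Lipschitz p (1 / p))
        \<longrightarrow> Rhaly_bounded_Bergman \<eta> p \<alpha>) \<and>
     (\<forall>\<alpha> p. \<alpha> > -1 \<and> 1 < p \<and> symbol_in \<eta> (little_mean_Lipschitz p (1 / p))
        \<longrightarrow> Rhaly_compact_Bergman \<eta> p \<alpha>) \<and>
     (\<forall>\<alpha> p. 1 < p \<and> -1 < \<alpha> \<and> \<alpha> < 2 * p - 2 \<and> Rhaly_bounded_Bergman \<eta> p \<alpha>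
        \<longrightarrow> (\<lambda>r. integral_mean p r (deriv (symbol_fun \<eta>)))
              \<in> O[at_left 1](\<lambda>r. ln (1 / (1 - r)) / (1 - r) powr (1 - 1 / p))) \<and>
     (\<forall>\<alpha> p. 1 < p \<and> -1 < \<alpha> \<and> \<alpha> < 2 * p - 2 \<and> Rhaly_compact_Bergman \<eta> p \<alpha>
        \<longrightarrow> (\<lambda>r. integral_mean p r (deriv (symbol_fun \<eta>)))
              \<in> o[at_left 1](\<lambda>r. ln (1 / (1 - r)) / (1 - r) powr (1 - 1 / p))) \<and>
     (\<forall>\<alpha>. \<alpha> > -1 \<longrightarrow>
        (Rhaly_bounded_Bergman \<eta> 2 \<alpha> \<longleftrightarrow> symbol_in \<eta> (mean_Lipschitz 2 (1 / 2)))) \<and>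
     (\<forall>\<alpha>. \<alpha> > -1 \<longrightarrow>
        (Rhaly_compact_Bergman \<eta> 2 \<alpha> \<longleftrightarrow> symbol_in \<eta> (little_mean_Lipschitz 2 (1 / 2))))"
proof (intro conjI allI impI)
  fix \<alpha> p :: real
  assume "\<alpha> > -1 \<and> 1 \<le> p \<and> symbol_in \<eta> (mean_Lipschitz p (1 / p))"
  then show "Rhaly_bounded_Bergman \<eta> p \<alpha>" using Rhaly_bounded_of_Lipschitz by blast
next
  fix \<alpha> p :: real
  assume "\<alpha> > -1 \<and> 1 < p \<and> symbol_in \<eta> (little_mean_Lipschitz p (1 / p))"
  then show "Rhaly_compact_Bergman \<eta> p \<alpha>" using Rhaly_compact_of_little_Lipschitz by blast
next
  fix \<alpha> p :: real
  assume "1 < p \<and> -1 < \<alpha> \<and> \<alpha> < 2 * p - 2 \<and> Rhaly_bounded_Bergman \<eta> p \<alpha>"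
  then have a: "p > 1" "\<alpha> > -1" "Rhaly_bounded_Bergman \<eta> p \<alpha>" by auto
  obtain \<epsilon> K where "\<epsilon> > 0" "K \<ge> 0" "mean_growth p (1 - 1/p) \<epsilon> K (deriv (symbol_fun \<eta>))"
    using growth_of_Rhaly_bounded(2)[OF a] by blast
  from integral_mean_deriv_smallo[OF holomorphic_deriv_symbol[OF growth_of_Rhaly_bounded(1)[OF a]] a(1) this]
  show "(\<lambda>r. integral_mean p r (deriv (symbol_fun \<eta>))) \<in> O[at_left 1](\<lambda>r. ln (1 / (1 - r)) / (1 - r) powr (1 - 1 / p))"
    by (rule landau_o.small_imp_big)
next
  fix \<alpha> p :: real
  assume "1 < p \<and> -1 < \<alpha> \<and> \<alpha> < 2 * p - 2 \<and> Rhaly_compact_Bergman \<eta> p \<alpha>"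
  then have a: "p > 1" "\<alpha> > -1" "Rhaly_compact_Bergman \<eta> p \<alpha>" by auto
  obtain K where K: "K \<ge> 0" "mean_growth p (1 - 1/p) 1 K (deriv (symbol_fun \<eta>))"
    using growth_of_Rhaly_compact(2)[OF a zero_less_one] by blast
  show "(\<lambda>r. integral_mean p r (deriv (symbol_fun \<eta>))) \<in> o[at_left 1](\<lambda>r. ln (1 / (1 - r)) / (1 - r) powr (1 - 1 / p))"
    by (rule integral_mean_deriv_smallo[OF holomorphic_deriv_symbol[OF growth_of_Rhaly_compact(1)[OF a]] a(1) zero_less_one K])
next
  fix \<alpha> :: real
  assume \<alpha>: "\<alpha> > -1"
  show "Rhaly_bounded_Bergman \<eta> 2 \<alpha> \<longleftrightarrow> symbol_in \<eta> (mean_Lipschitz 2 (1 / 2))"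
    using Rhaly_bounded_of_Lipschitz[OF \<alpha>, of 2 \<eta>] symbol_in_Lipschitz_of_bounded[OF \<alpha>, of 2 \<eta>] by auto
next
  fix \<alpha> :: real
  assume \<alpha>: "\<alpha> > -1"
  show "Rhaly_compact_Bergman \<eta> 2 \<alpha> \<longleftrightarrow> symbol_in \<eta> (little_mean_Lipschitz 2 (1 / 2))"
    using Rhaly_compact_of_little_Lipschitz[OF \<alpha>, of 2 \<eta>] symbol_in_little_Lipschitz_of_compact[OF \<alpha>, of 2 \<eta>] by auto
qed

end
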